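(* Let $Z,X\in\mathbb{D}^{1,2}$ have mean $0$. Suppose $Z$ has support $(l,u)$, $-\infty\le l<0<u\le\infty$, with a density $\rho_*$ that is continuous on $(l,u)$, and that either $\|g_*\|_\infty<\infty$ or $X$ has a density. Suppose that for some positive $\tilde g\in\mathcal{C}^1(l,u)$ we have $0<\varliminf g_*(x)/\tilde g(x)\le\varlimsup g_*(x)/\tilde g(x)<\infty$ both as $x\to u$ and as $x\to l$, and the limits $\tilde g'(l^+)$ and $\tilde g'(u^-)$ exist in $[-\infty,\infty]$; that if $u=\infty$ then $\varliminf_{x\to u}g_*(x)>0$; and that if $l=-\infty$ then $\varliminf_{x\to l}g_*(x)>0$. Let $G_*$ be an antiderivative of $g_*$. Then $X$ and $Z$ have the same law if and only if all of the following are satisfied: 1. $\mathbb{E}[g_*(X)^2]=\mathbb{E}[g_*(Z)^2]$; 2. $\mathbb{E}[XG_*(X)]=\mathbb{E}[ZG_*(Z)]$; 3. $\mathbb{E}[g_X^2]=\mathbb{E}[g_Z^2]$.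
   Context: Let $\mathfrak{H}$ be a real separable Hilbert space and $W$ an isonormal Gaussian process over $\mathfrak{H}$ on a probability space $(\Omega,\mathcal{F},\mathbb{P})$, with $\mathcal{F}$ generated by $W$. $D$ is the Malliavin derivative, with domain $\mathbb{D}^{1,2}\subset L^2(\Omega)$; if $F=\sum_{q\ge0}I_q(f_q)$ is the Wiener chaos decomposition, $L^{-1}F=-\sum_{q\ge1}\frac1qI_q(f_q)$. For a mean-zero $F\in\mathbb{D}^{1,2}$, $g_F:=\mathbb{E}[\langle DF,-DL^{-1}F\rangle_{\mathfrak{H}}\mid F]$. The function $g_*$ attached to $Z$ is $g_*(z)=\mathbb{E}[\langle DZ,-DL^{-1}Z\rangle_{\mathfrak{H}}\mid Z=z]$, taken in the version $g_*(z)=\frac{1}{\rho_*(z)}\int_z^u y\rho_*(y)\,dy>0$ for $z\in(l,u)$, and $g_*(z)=0$ outside $(l,u)$; thus $g_Z=g_*(Z)$ a.s. The expectations in 1–3 are understood to exist and be finite. *)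

theory Defs
  imports "HOL-Probability.Probability"
begin

section \<open>Square-integrable random elements\<close>

definition square_integrable :: "'a measure \<Rightarrow> ('a \<Rightarrow> 'b::real_normed_vector) \<Rightarrow> bool" where
  "square_integrable M F \<longleftrightarrow>
     F \<in> borel_measurable M \<and> integrable M (\<lambda>\<omega>. (norm (F \<omega>))\<^sup>2)"

definition L2_converges ::
  "'a measure \<Rightarrow> (nat \<Rightarrow> 'a \<Rightarrow> 'b::real_normed_vector) \<Rightarrow> ('a \<Rightarrow> 'b) \<Rightarrow> bool" where
  "L2_converges M Fs F \<longleftrightarrow>
     (\<forall>n. square_integrable M (Fs n)) \<and> square_integrable M F \<and>
     (\<lambda>n. \<integral>\<omega>. (norm (Fs n \<omega> - F \<omega>))\<^sup>2 \<partial>M) \<longlonglongrightarrow> 0"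

section \<open>Isonormal Gaussian processes\<close>

text \<open>The degenerate law (point mass at 0) counts as Gaussian.\<close>

definition centered_gaussian :: "'a measure \<Rightarrow> ('a \<Rightarrow> real) \<Rightarrow> bool" where
  "centered_gaussian M X \<longleftrightarrow> X \<in> borel_measurable M \<and>
     (\<exists>\<sigma>\<ge>0. distr M borel X =
        (if \<sigma> = 0 then return borel 0 else density lborel (\<lambda>x. ennreal (normal_density 0 \<sigma> x))))"

locale isonormal_gaussian_process = prob_space M
  for M :: "'a measure" +
  fixes W :: "'h::{real_inner, banach, second_countable_topology} \<Rightarrow> 'a \<Rightarrow> real"
  assumes jointly_gaussian:
      "\<And>(N::nat) a h. centered_gaussian M (\<lambda>\<omega>. \<Sum>i<N. a i * W (h i) \<omega>)"
    and covariance: "\<And>h k. expectation (\<lambda>\<omega>. W h \<omega> * W k \<omega>) = inner h k"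
    and generated:
      "sets M = sigma_sets (space M) {W h -` A \<inter> space M | h A. A \<in> sets borel}"

section \<open>Malliavin derivative\<close>

text \<open>A function on \<open>\<real>\<^sup>n\<close> is represented by a function of a sequence \<open>x :: nat \<Rightarrow> real\<close> that
  depends only on \<open>x 0, \<dots>, x (n - 1)\<close>. For such functions continuity in the product topology
  is continuity on \<open>\<real>\<^sup>n\<close>.\<close>

definition partial_deriv :: "nat \<Rightarrow> ((nat \<Rightarrow> real) \<Rightarrow> real) \<Rightarrow> (nat \<Rightarrow> real) \<Rightarrow> real" where
  "partial_deriv i f x = deriv (\<lambda>t. f (x(i := t))) (x i)"

definition iterated_partial :: "nat list \<Rightarrow> ((nat \<Rightarrow> real) \<Rightarrow> real) \<Rightarrow> (nat \<Rightarrow> real) \<Rightarrow> real" where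
  "iterated_partial js f = foldr partial_deriv js f"

text \<open>The class of \<open>C\<^sup>\<infinity>\<close> functions on \<open>\<real>\<^sup>n\<close> which, together with all their partial derivatives,
  have at most polynomial growth.\<close>

definition smooth_poly_growth :: "nat \<Rightarrow> ((nat \<Rightarrow> real) \<Rightarrow> real) \<Rightarrow> bool" where
  "smooth_poly_growth n f \<longleftrightarrow>
     (\<forall>x y. (\<forall>i<n. x i = y i) \<longrightarrow> f x = f y) \<and>
     (\<forall>js. set js \<subseteq> {..<n} \<longrightarrow>
        continuous_on UNIV (iterated_partial js f) \<and>
        (\<forall>i<n. \<forall>x. (\<lambda>t. iterated_partial js f (x(i := t))) differentiable (at (x i))) \<and>
        (\<exists>C k. \<forall>x. \<bar>iterated_partial js f x\<bar> \<le> C * (1 + (\<Sum>i<n. \<bar>x i\<bar>)) ^ k))"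

text \<open>\<open>F = f (W(h\<^sub>0), \<dots>, W(h\<^bsub>n-1\<^esub>))\<close> and \<open>G = \<Sum>\<^sub>i \<partial>\<^sub>i f (W(h\<^sub>0), \<dots>, W(h\<^bsub>n-1\<^esub>)) h\<^sub>i\<close>.\<close>

definition smooth_cylindrical ::
  "('h::real_inner \<Rightarrow> 'a \<Rightarrow> real) \<Rightarrow> ('a \<Rightarrow> real) \<Rightarrow> ('a \<Rightarrow> 'h) \<Rightarrow> bool" where
  "smooth_cylindrical W F G \<longleftrightarrow>
     (\<exists>n f h. smooth_poly_growth n f \<and>
        F = (\<lambda>\<omega>. f (\<lambda>i. W (h i) \<omega>)) \<and>
        G = (\<lambda>\<omega>. \<Sum>i<n. partial_deriv i f (\<lambda>i. W (h i) \<omega>) *\<^sub>R h i))"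

text \<open>The closure of the derivative on smooth cylindrical random variables, as an operator from
  \<open>L\<^sup>2(\<Omega>)\<close> to \<open>L\<^sup>2(\<Omega>; H)\<close>. Since that operator is closable, \<open>G\<close> is determined by \<open>F\<close> up to
  almost sure equality, and \<open>malliavin_D\<close> selects a version.\<close>

definition is_malliavin_deriv ::
  "'a measure \<Rightarrow> ('h::real_inner \<Rightarrow> 'a \<Rightarrow> real) \<Rightarrow> ('a \<Rightarrow> real) \<Rightarrow> ('a \<Rightarrow> 'h) \<Rightarrow> bool" where
  "is_malliavin_deriv M W F G \<longleftrightarrow>
     (\<exists>Fs Gs. (\<forall>n. smooth_cylindrical W (Fs n) (Gs n)) \<and>
        L2_converges M Fs F \<and> L2_converges M Gs G)"

definition D12 :: "'a measure \<Rightarrow> ('h::real_inner \<Rightarrow> 'a \<Rightarrow> real) \<Rightarrow> ('a \<Rightarrow> real) set" where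
  "D12 M W = {F. \<exists>G. is_malliavin_deriv M W F G}"

definition malliavin_D ::
  "'a measure \<Rightarrow> ('h::real_inner \<Rightarrow> 'a \<Rightarrow> real) \<Rightarrow> ('a \<Rightarrow> real) \<Rightarrow> 'a \<Rightarrow> 'h" where
  "malliavin_D M W F = (SOME G. is_malliavin_deriv M W F G)"

section \<open>Wiener chaos and the pseudo-inverse of the Ornstein-Uhlenbeck generator\<close>

fun hermite :: "nat \<Rightarrow> real \<Rightarrow> real" where
  "hermite 0 x = 1"
| "hermite (Suc 0) x = x"
| "hermite (Suc (Suc n)) x = x * hermite (Suc n) x - real (Suc n) * hermite n x"

text \<open>The \<open>q\<close>-th Wiener chaos, i.e. the range of the multiple integral \<open>I\<^sub>q\<close>: the closed linear
  span in \<open>L\<^sup>2(\<Omega>)\<close> of the variables \<open>H\<^sub>q(W(h))\<close> with \<open>h\<close> of norm 1. Order 0 is separate only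
  so that the constants are obtained also when the Hilbert space is trivial.\<close>

definition wiener_chaos ::
  "'a measure \<Rightarrow> ('h::real_inner \<Rightarrow> 'a \<Rightarrow> real) \<Rightarrow> nat \<Rightarrow> ('a \<Rightarrow> real) set" where
  "wiener_chaos M W q =
     (if q = 0 then {Y. Y \<in> borel_measurable M \<and> (\<exists>c. AE \<omega> in M. Y \<omega> = c)}
      else {Y. \<exists>Ys. L2_converges M Ys Y \<and>
             (\<forall>n. \<exists>(N::nat) a h. (\<forall>i<N. norm (h i) = 1) \<and>
                 Ys n = (\<lambda>\<omega>. \<Sum>i<N. a i * hermite q (W (h i) \<omega>)))})"

text \<open>\<open>J q\<close> plays the role of \<open>I\<^sub>q(f\<^sub>q)\<close>.\<close>

definition chaos_decomposition ::
  "'a measure \<Rightarrow> ('h::real_inner \<Rightarrow> 'a \<Rightarrow> real) \<Rightarrow> ('a \<Rightarrow> real) \<Rightarrow> (nat \<Rightarrow> 'a \<Rightarrow> real) \<Rightarrow> bool" where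
  "chaos_decomposition M W F J \<longleftrightarrow>
     (\<forall>q. J q \<in> wiener_chaos M W q) \<and> L2_converges M (\<lambda>n \<omega>. \<Sum>q\<le>n. J q \<omega>) F"

definition is_L_inverse ::
  "'a measure \<Rightarrow> ('h::real_inner \<Rightarrow> 'a \<Rightarrow> real) \<Rightarrow> ('a \<Rightarrow> real) \<Rightarrow> ('a \<Rightarrow> real) \<Rightarrow> bool" where
  "is_L_inverse M W F G \<longleftrightarrow>
     (\<exists>J. chaos_decomposition M W F J \<and>
        L2_converges M (\<lambda>n \<omega>. - (\<Sum>q=1..n. J q \<omega> / real q)) G)"

text \<open>Again determined up to almost sure equality.\<close>

definition L_inverse ::
  "'a measure \<Rightarrow> ('h::real_inner \<Rightarrow> 'a \<Rightarrow> real) \<Rightarrow> ('a \<Rightarrow> real) \<Rightarrow> 'a \<Rightarrow> real" where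
  "L_inverse M W F = (SOME G. is_L_inverse M W F G)"

section \<open>The random variable \<open>g\<^sub>F\<close> and the function \<open>g\<^sub>*\<close>\<close>

definition g_rv ::
  "'a measure \<Rightarrow> ('h::real_inner \<Rightarrow> 'a \<Rightarrow> real) \<Rightarrow> ('a \<Rightarrow> real) \<Rightarrow> 'a \<Rightarrow> real" where
  "g_rv M W F =
     real_cond_exp M (vimage_algebra (space M) F borel)
       (\<lambda>\<omega>. inner (malliavin_D M W F \<omega>) (- malliavin_D M W (L_inverse M W F) \<omega>))"

text \<open>If \<open>\<rho>\<close> is the density of a centered \<open>Z \<in> D12 M W\<close> with support \<open>(l, u)\<close>, this is the version of
  \<open>E[\<langle>DZ, -DL\<^sup>-\<^sup>1Z\<rangle> | Z = z]\<close> for which \<open>g_rv M W Z = g_star l u \<rho> \<circ> Z\<close> almost surely.\<close>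

definition g_star :: "ereal \<Rightarrow> ereal \<Rightarrow> (real \<Rightarrow> real) \<Rightarrow> real \<Rightarrow> real" where
  "g_star l u \<rho> z =
     (if z \<in> einterval l u then 1 / \<rho> z * (LBINT y=ereal z..u. y * \<rho> y) else 0)"

text \<open>The topological support. It is always closed, so "support \<open>(l, u)\<close>" for the law of a random
  variable means that it equals the closure of \<open>(l, u)\<close>.\<close>

definition measure_support :: "real measure \<Rightarrow> real set" where
  "measure_support N = {x. \<forall>U. open U \<longrightarrow> x \<in> U \<longrightarrow> 0 < emeasure N U}"

end

theory Submission imports Defs "HOL-Real_Asymp.Real_Asymp" begin

text \<open>Let \<open>F\<close> have mean zero. Malliavin calculus gives \<open>E [F \<phi>(F)] = E [\<phi>'(F) g\<^sub>F]\<close>, while Fubini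
  gives \<open>E [F \<phi>(F)] = \<integral> \<phi>'(z) R\<^sub>F(z) dz\<close> with \<open>R\<^sub>F(z) = E [F; F > z]\<close>. Hence \<open>g\<^sub>F\<close> is the density
  of the measure \<open>R\<^sub>F(z) dz\<close> with respect to the law of \<open>F\<close> (\<open>g_rv_tail_mean\<close>), and almost surely
  the only function of \<open>F\<close> with this property (\<open>g_rv_eqI\<close>). For the variable \<open>Z\<close> the definition
  of \<open>g\<^sub>*\<close> says \<open>R\<^sub>Z = \<rho> g\<^sub>*\<close> (\<open>g_star_facts\<close>), so \<open>g\<^sub>Z = g\<^sub>*(Z)\<close>. If \<open>X\<close> has the law of \<open>Z\<close>, then
  \<open>R\<^sub>X = R\<^sub>Z\<close>, so \<open>g\<^sub>X = g\<^sub>*(X)\<close>, and each of the three expectations depends on the law alone.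

  Conversely, the test function \<open>\<phi> = G\<close> gives \<open>E [g\<^sub>X g\<^sub>*(X)] = E [X G(X)]\<close>, and likewise for \<open>Z\<close>,
  where the left-hand side is \<open>E [g\<^sub>*(Z)\<^sup>2]\<close>. The three conditions therefore say that
  \<open>E [g\<^sub>*(X)\<^sup>2]\<close>, \<open>E [g\<^sub>X g\<^sub>*(X)]\<close> and \<open>E [g\<^sub>X\<^sup>2]\<close> all equal \<open>E [g\<^sub>*(Z)\<^sup>2]\<close>, whence
  \<open>E [(g\<^sub>X - g\<^sub>*(X))\<^sup>2] = 0\<close>. So the law of \<open>X\<close> has the Stein kernel \<open>g\<^sub>*\<close>, that is, \<open>R\<^sub>X(z) dz\<close> is
  \<open>g\<^sub>*\<close> times the law of \<open>X\<close>. On \<open>(l, u)\<close> both \<open>R\<^sub>X\<close> and \<open>R\<^sub>Z\<close> then solve the linear equation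
  \<open>R' = - z R / g\<^sub>*\<close> and are proportional; letting \<open>z\<close> tend to the endpoints shows that \<open>X\<close> does
  not leave \<open>(l, u)\<close>, so the laws are proportional and equal (\<open>law_unique_of_kernel\<close>).

  The identity \<open>E [F \<phi>(F)] = E [\<phi>'(F) g\<^sub>F]\<close> is proved in \<open>malliavin_integration_by_parts\<close>. Its
  source is the product formula \<open>E [G \<langle>DF, e\<rangle>] + E [F \<langle>DG, e\<rangle>] = E [F G W(e)]\<close> for cylindrical
  variables (\<open>gaussian_integration_by_parts\<close>), which is Stein's identity for the normal law
  after conditioning on the directions orthogonal to \<open>e\<close>. Applied to \<open>F = H\<^sub>q(W h)\<close> it says
  \<open>E \<langle>DF, DG\<rangle> = q E [F G]\<close>; this yields the orthogonality of the chaoses, energy bounds for \<open>D\<close>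
  and, since the Hermite polynomials are total (\<open>hermite_total\<close>), the chaos decomposition and
  the existence of \<open>L\<^sup>-\<^sup>1 F\<close> and of its derivative. For smooth \<open>Y\<close> the map
  \<open>V \<mapsto> E [\<phi>'(Y) \<langle>DY, DV\<rangle>]\<close> is given by integration against an \<open>L\<^sup>2\<close> variable, the divergence of
  \<open>\<phi>'(Y) DY\<close>. Its value is \<open>q E [\<phi>(Y) V]\<close> when \<open>V\<close> has order \<open>q\<close>, which cancels the factor \<open>1/q\<close>
  in \<open>L\<^sup>-\<^sup>1\<close>.\<close>

section \<open>Square-integrable random elements\<close>

lemma square_integrableD:
  assumes "square_integrable M F"
  shows "F \<in> borel_measurable M" "integrable M (\<lambda>\<omega>. (norm (F \<omega>))\<^sup>2)"
  using assms by (auto simp: square_integrable_def)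

lemma norm_mult_le_squares: "norm a * norm b \<le> (norm a)\<^sup>2 + (norm b)\<^sup>2"
proof -
  have "0 \<le> (norm a - norm b)\<^sup>2" by simp
  then have "2 * (norm a * norm b) \<le> (norm a)\<^sup>2 + (norm b)\<^sup>2"
    by (simp add: power2_eq_square algebra_simps)
  moreover have "0 \<le> norm a * norm b" by simp
  ultimately show ?thesis by linarith
qed

lemma norm_add_square_le: "(norm (a + b))\<^sup>2 \<le> 2 * (norm a)\<^sup>2 + 2 * (norm b)\<^sup>2"
proof -
  have "(norm (a + b))\<^sup>2 \<le> (norm a + norm b)\<^sup>2"
    by (intro power_mono norm_triangle_ineq) auto
  also have "\<dots> = 2 * (norm a)\<^sup>2 + 2 * (norm b)\<^sup>2 - (norm a - norm b)\<^sup>2"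
    by (simp add: power2_eq_square algebra_simps)
  finally show ?thesis by (smt (verit) zero_le_power2)
qed

lemma square_integrable_bound:
  fixes F :: "'a \<Rightarrow> 'b::real_normed_vector" and G :: "'a \<Rightarrow> 'c::real_normed_vector"
  assumes "square_integrable M F" "G \<in> borel_measurable M" "\<And>\<omega>. norm (G \<omega>) \<le> norm (F \<omega>)"
  shows "square_integrable M G"
  unfolding square_integrable_def
proof (intro conjI Bochner_Integration.integrable_bound[OF square_integrableD(2)[OF assms(1)]] AE_I2)
  show "(\<lambda>\<omega>. (norm (G \<omega>))\<^sup>2) \<in> borel_measurable M" using assms(2) by measurable
  show "norm ((norm (G \<omega>))\<^sup>2) \<le> norm ((norm (F \<omega>))\<^sup>2)" for \<omega>
    using assms(3)[of \<omega>] by (simp add: power_mono)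
qed (use assms in auto)

lemma square_integrable_scaleR:
  assumes "square_integrable M F"
  shows "square_integrable M (\<lambda>\<omega>. c *\<^sub>R F \<omega>)"
  using assms unfolding square_integrable_def by (auto simp: power_mult_distrib)

lemma square_integrable_cmult:
  assumes "square_integrable M (F :: 'a \<Rightarrow> real)"
  shows "square_integrable M (\<lambda>\<omega>. c * F \<omega>)"
  using square_integrable_scaleR[OF assms, of c] by simp

lemma square_integrable_add:
  fixes F G :: "'a \<Rightarrow> 'b::{second_countable_topology, real_normed_vector}"
  assumes "square_integrable M F" "square_integrable M G"
  shows "square_integrable M (\<lambda>\<omega>. F \<omega> + G \<omega>)"
proof -
  note [measurable] = square_integrableD(1)[OF assms(1)] square_integrableD(1)[OF assms(2)]
  have "integrable M (\<lambda>\<omega>. 2 * (norm (F \<omega>))\<^sup>2 + 2 * (norm (G \<omega>))\<^sup>2)"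
    using square_integrableD(2)[OF assms(1)] square_integrableD(2)[OF assms(2)] by auto
  then have "integrable M (\<lambda>\<omega>. (norm (F \<omega> + G \<omega>))\<^sup>2)"
    by (rule Bochner_Integration.integrable_bound) (auto simp: norm_add_square_le intro!: AE_I2)
  then show ?thesis by (simp add: square_integrable_def)
qed

lemma square_integrable_minus:
  assumes "square_integrable M F"
  shows "square_integrable M (\<lambda>\<omega>. - F \<omega>)"
  using square_integrable_scaleR[OF assms, of "-1"] by simp

lemma square_integrable_diff:
  fixes F G :: "'a \<Rightarrow> 'b::{second_countable_topology, real_normed_vector}"
  assumes "square_integrable M F" "square_integrable M G"
  shows "square_integrable M (\<lambda>\<omega>. F \<omega> - G \<omega>)"
  using square_integrable_add[OF assms(1) square_integrable_minus[OF assms(2)]] by simp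

lemma square_integrable_sum:
  fixes F :: "'i \<Rightarrow> 'a \<Rightarrow> 'b::{second_countable_topology, real_normed_vector}"
  assumes "\<And>i. i \<in> I \<Longrightarrow> square_integrable M (F i)"
  shows "square_integrable M (\<lambda>\<omega>. \<Sum>i\<in>I. F i \<omega>)"
proof (cases "finite I")
  case True
  then show ?thesis using assms
    by (induction I) (auto intro!: square_integrable_add, auto simp: square_integrable_def)
qed (auto simp: square_integrable_def)

lemma square_integrable_norm:
  assumes "square_integrable M F"
  shows "square_integrable M (\<lambda>\<omega>. norm (F \<omega>))"
  using assms by (auto simp: square_integrable_def)

lemma integrable_norm_mult:
  assumes "square_integrable M F" "square_integrable M G"
  shows "integrable M (\<lambda>\<omega>. norm (F \<omega>) * norm (G \<omega>))"
proof -
  note [measurable] = square_integrableD(1)[OF assms(1)] square_integrableD(1)[OF assms(2)]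
  have "integrable M (\<lambda>\<omega>. (norm (F \<omega>))\<^sup>2 + (norm (G \<omega>))\<^sup>2)"
    using square_integrableD(2)[OF assms(1)] square_integrableD(2)[OF assms(2)] by auto
  then show ?thesis
    by (rule Bochner_Integration.integrable_bound)
       (auto intro!: AE_I2 order_trans[OF norm_mult_le_squares])
qed

lemma integrable_inner_L2:
  fixes F G :: "'a \<Rightarrow> 'b::{second_countable_topology, real_inner}"
  assumes "square_integrable M F" "square_integrable M G"
  shows "integrable M (\<lambda>\<omega>. inner (F \<omega>) (G \<omega>))"
proof -
  note [measurable] = square_integrableD(1)[OF assms(1)] square_integrableD(1)[OF assms(2)]
  show ?thesis
    by (rule Bochner_Integration.integrable_bound[OF integrable_norm_mult[OF assms]])
       (auto intro!: AE_I2 simp: Cauchy_Schwarz_ineq2)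
qed

lemma integrable_mult_L2:
  fixes F G :: "'a \<Rightarrow> real"
  assumes "square_integrable M F" "square_integrable M G"
  shows "integrable M (\<lambda>\<omega>. F \<omega> * G \<omega>)"
  using integrable_inner_L2[OF assms] by simp

text \<open>The discriminant of the nonnegative quadratic polynomial
  \<open>t \<mapsto> \<integral> (\<bar>F\<bar> + t \<bar>G\<bar>)\<^sup>2\<close> is not positive.\<close>

lemma Cauchy_Schwarz_integral:
  assumes "square_integrable M F" "square_integrable M G"
  shows "(\<integral>\<omega>. norm (F \<omega>) * norm (G \<omega>) \<partial>M)\<^sup>2
    \<le> (\<integral>\<omega>. (norm (F \<omega>))\<^sup>2 \<partial>M) * (\<integral>\<omega>. (norm (G \<omega>))\<^sup>2 \<partial>M)"
proof -
  let ?a = "\<integral>\<omega>. (norm (F \<omega>))\<^sup>2 \<partial>M" and ?b = "\<integral>\<omega>. norm (F \<omega>) * norm (G \<omega>) \<partial>M"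
  let ?c = "\<integral>\<omega>. (norm (G \<omega>))\<^sup>2 \<partial>M"
  note i = square_integrableD(2)[OF assms(1)] square_integrableD(2)[OF assms(2)]
    integrable_norm_mult[OF assms]
  have q: "0 \<le> s\<^sup>2 * ?a - 2 * s * t * ?b + t\<^sup>2 * ?c" for s t
  proof -
    have "0 \<le> (\<integral>\<omega>. (s * norm (F \<omega>) - t * norm (G \<omega>))\<^sup>2 \<partial>M)" by simp
    also have "\<dots> = (\<integral>\<omega>. s\<^sup>2 * (norm (F \<omega>))\<^sup>2 - 2 * s * t * (norm (F \<omega>) * norm (G \<omega>)) + t\<^sup>2 * (norm (G \<omega>))\<^sup>2 \<partial>M)"
      by (simp add: power2_eq_square algebra_simps)
    also have "\<dots> = s\<^sup>2 * ?a - 2 * s * t * ?b + t\<^sup>2 * ?c"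
      using i by simp
    finally show ?thesis .
  qed
  have a: "?a \<ge> 0" and c: "?c \<ge> 0" by simp_all
  show ?thesis
  proof (cases "?a = 0")
    case True
    have "?b \<le> 0"
    proof (rule ccontr)
      assume "\<not> ?b \<le> 0"
      then show False using q[of "(?c + 1) / (2 * ?b)" 1] True by auto
    qed
    moreover have "?b \<ge> 0" by simp
    ultimately have "?b = 0" by linarith
    then show ?thesis by (simp only: True) simp
  next
    case False
    then have "?a > 0" using a by linarith
    have "0 \<le> ?b\<^sup>2 * ?a - 2 * ?b * ?a * ?b + ?a\<^sup>2 * ?c" using q[of ?b ?a] .
    also have "\<dots> = ?a * (?a * ?c - ?b\<^sup>2)" by (simp add: power2_eq_square algebra_simps)
    finally show ?thesis using \<open>?a > 0\<close> by (simp add: zero_le_mult_iff)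
  qed
qed

lemma integral_inner_abs_le:
  fixes F G :: "'a \<Rightarrow> 'b::{second_countable_topology, real_inner}"
  assumes "square_integrable M F" "square_integrable M G"
  shows "\<bar>\<integral>\<omega>. inner (F \<omega>) (G \<omega>) \<partial>M\<bar>
    \<le> sqrt (\<integral>\<omega>. (norm (F \<omega>))\<^sup>2 \<partial>M) * sqrt (\<integral>\<omega>. (norm (G \<omega>))\<^sup>2 \<partial>M)"
proof -
  have "\<bar>\<integral>\<omega>. inner (F \<omega>) (G \<omega>) \<partial>M\<bar> \<le> (\<integral>\<omega>. \<bar>inner (F \<omega>) (G \<omega>)\<bar> \<partial>M)"
    using integral_abs_bound by blast
  also have "\<dots> \<le> (\<integral>\<omega>. norm (F \<omega>) * norm (G \<omega>) \<partial>M)"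
    using integrable_inner_L2[OF assms] integrable_norm_mult[OF assms]
    by (intro integral_mono) (auto simp: Cauchy_Schwarz_ineq2)
  also have "\<dots> \<le> sqrt ((\<integral>\<omega>. (norm (F \<omega>))\<^sup>2 \<partial>M) * (\<integral>\<omega>. (norm (G \<omega>))\<^sup>2 \<partial>M))"
    using Cauchy_Schwarz_integral[OF assms] by (rule real_le_rsqrt)
  finally show ?thesis by (simp add: real_sqrt_mult)
qed

subsection \<open>Convergence in mean square\<close>

lemma L2_convergesD:
  assumes "L2_converges M Fs F"
  shows "\<And>n. square_integrable M (Fs n)" "square_integrable M F"
    "(\<lambda>n. \<integral>\<omega>. (norm (Fs n \<omega> - F \<omega>))\<^sup>2 \<partial>M) \<longlonglongrightarrow> 0"
  using assms by (auto simp: L2_converges_def)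

lemma L2_converges_subseq:
  assumes "L2_converges M Fs F" "strict_mono r"
  shows "L2_converges M (\<lambda>n. Fs (r n)) F"
  using L2_convergesD[OF assms(1)] LIMSEQ_subseq_LIMSEQ[OF L2_convergesD(3)[OF assms(1)] assms(2)]
  by (auto simp: L2_converges_def o_def)

lemma L2_converges_bound:
  fixes F :: "'a \<Rightarrow> 'b::{second_countable_topology, real_normed_vector}"
  assumes "\<And>n. square_integrable M (Fs n)" "square_integrable M F"
    and "\<And>n. (\<integral>\<omega>. (norm (Fs n \<omega> - F \<omega>))\<^sup>2 \<partial>M) \<le> e n" "e \<longlonglongrightarrow> 0"
  shows "L2_converges M Fs F"
  unfolding L2_converges_def using assms(1,2)
  by (auto intro!: tendsto_sandwich[OF _ _ tendsto_const assms(4)] always_eventually assms(3))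

lemma L2_converges_add:
  fixes F :: "'a \<Rightarrow> 'b::{second_countable_topology, real_normed_vector}"
  assumes "L2_converges M Fs F" "L2_converges M Gs G"
  shows "L2_converges M (\<lambda>n \<omega>. Fs n \<omega> + Gs n \<omega>) (\<lambda>\<omega>. F \<omega> + G \<omega>)"
proof (rule L2_converges_bound)
  note a = L2_convergesD[OF assms(1)] and b = L2_convergesD[OF assms(2)]
  show "square_integrable M (\<lambda>\<omega>. Fs n \<omega> + Gs n \<omega>)" for n by (intro square_integrable_add a b)
  show "square_integrable M (\<lambda>\<omega>. F \<omega> + G \<omega>)" by (intro square_integrable_add a b)
  show "(\<integral>\<omega>. (norm (Fs n \<omega> + Gs n \<omega> - (F \<omega> + G \<omega>)))\<^sup>2 \<partial>M) \<le>
     2 * (\<integral>\<omega>. (norm (Fs n \<omega> - F \<omega>))\<^sup>2 \<partial>M) + 2 * (\<integral>\<omega>. (norm (Gs n \<omega> - G \<omega>))\<^sup>2 \<partial>M)" for n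
  proof -
    have "(\<integral>\<omega>. (norm (Fs n \<omega> + Gs n \<omega> - (F \<omega> + G \<omega>)))\<^sup>2 \<partial>M)
       \<le> (\<integral>\<omega>. 2 * (norm (Fs n \<omega> - F \<omega>))\<^sup>2 + 2 * (norm (Gs n \<omega> - G \<omega>))\<^sup>2 \<partial>M)"
    proof (intro integral_mono)
      show "integrable M (\<lambda>\<omega>. (norm (Fs n \<omega> + Gs n \<omega> - (F \<omega> + G \<omega>)))\<^sup>2)"
        by (intro square_integrableD square_integrable_diff square_integrable_add a b)
      show "integrable M (\<lambda>\<omega>. 2 * (norm (Fs n \<omega> - F \<omega>))\<^sup>2 + 2 * (norm (Gs n \<omega> - G \<omega>))\<^sup>2)"
        by (intro Bochner_Integration.integrable_add integrable_mult_right square_integrableD square_integrable_diff a b)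
      show "(norm (Fs n x + Gs n x - (F x + G x)))\<^sup>2 \<le> 2 * (norm (Fs n x - F x))\<^sup>2 + 2 * (norm (Gs n x - G x))\<^sup>2" for x
        using norm_add_square_le[of "Fs n x - F x" "Gs n x - G x"] by (simp add: algebra_simps)
    qed
    also have "\<dots> = 2 * (\<integral>\<omega>. (norm (Fs n \<omega> - F \<omega>))\<^sup>2 \<partial>M) + 2 * (\<integral>\<omega>. (norm (Gs n \<omega> - G \<omega>))\<^sup>2 \<partial>M)"
      by (subst Bochner_Integration.integral_add)
         (auto intro!: integrable_mult_right square_integrableD square_integrable_diff a b)
    finally show ?thesis .
  qed
  show "(\<lambda>n. 2 * (\<integral>\<omega>. (norm (Fs n \<omega> - F \<omega>))\<^sup>2 \<partial>M) + 2 * (\<integral>\<omega>. (norm (Gs n \<omega> - G \<omega>))\<^sup>2 \<partial>M)) \<longlonglongrightarrow> 0"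
    using tendsto_add[OF tendsto_mult[OF tendsto_const[of 2] a(3)] tendsto_mult[OF tendsto_const[of 2] b(3)]] by simp
qed

lemma L2_converges_scaleR:
  assumes "L2_converges M Fs F"
  shows "L2_converges M (\<lambda>n \<omega>. c *\<^sub>R Fs n \<omega>) (\<lambda>\<omega>. c *\<^sub>R F \<omega>)"
proof -
  have "(\<lambda>n. \<integral>\<omega>. (norm (c *\<^sub>R Fs n \<omega> - c *\<^sub>R F \<omega>))\<^sup>2 \<partial>M) = (\<lambda>n. c\<^sup>2 * (\<integral>\<omega>. (norm (Fs n \<omega> - F \<omega>))\<^sup>2 \<partial>M))"
    by (simp flip: scaleR_diff_right add: power_mult_distrib)
  then show ?thesis
    using L2_convergesD[OF assms] tendsto_mult[OF tendsto_const[of "c\<^sup>2"] L2_convergesD(3)[OF assms]]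
    by (auto simp: L2_converges_def intro!: square_integrable_scaleR)
qed

lemma L2_converges_const:
  assumes "square_integrable M F"
  shows "L2_converges M (\<lambda>n. F) F"
  using assms by (simp add: L2_converges_def)

lemma L2_converges_diff:
  fixes F :: "'a \<Rightarrow> 'b::{second_countable_topology, real_normed_vector}"
  assumes "L2_converges M Fs F" "L2_converges M Gs G"
  shows "L2_converges M (\<lambda>n \<omega>. Fs n \<omega> - Gs n \<omega>) (\<lambda>\<omega>. F \<omega> - G \<omega>)"
  using L2_converges_add[OF assms(1) L2_converges_scaleR[OF assms(2), of "-1"]] by simp

lemma L2_converges_sum:
  fixes F :: "'i \<Rightarrow> 'a \<Rightarrow> 'b::{second_countable_topology, real_normed_vector}"
  assumes "\<And>i. i \<in> I \<Longrightarrow> L2_converges M (\<lambda>n. Fs n i) (F i)"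
  shows "L2_converges M (\<lambda>n \<omega>. \<Sum>i\<in>I. Fs n i \<omega>) (\<lambda>\<omega>. \<Sum>i\<in>I. F i \<omega>)"
proof (cases "finite I")
  case True
  then show ?thesis using assms
    by (induction I) (auto intro!: L2_converges_add, auto simp: square_integrable_def L2_converges_def)
qed (auto simp: square_integrable_def L2_converges_def)

text \<open>Expand around the limits: \<open>\<langle>F\<^sub>n, G\<^sub>n\<rangle>\<close> is \<open>\<langle>F\<^sub>n - F, G\<^sub>n - G\<rangle>\<close> plus terms in which only one
  factor varies, and the Cauchy-Schwarz inequality applies to each of them.\<close>

lemma L2_converges_inner:
  fixes F G :: "'a \<Rightarrow> 'b::{second_countable_topology, real_inner}"
  assumes "L2_converges M Fs F" "L2_converges M Gs G"
  shows "(\<lambda>n. \<integral>\<omega>. inner (Fs n \<omega>) (Gs n \<omega>) \<partial>M) \<longlonglongrightarrow> (\<integral>\<omega>. inner (F \<omega>) (G \<omega>) \<partial>M)"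
proof -
  note a = L2_convergesD[OF assms(1)] and b = L2_convergesD[OF assms(2)]
  have one: "(\<lambda>n. \<integral>\<omega>. inner (Us n \<omega>) (H \<omega>) \<partial>M) \<longlonglongrightarrow> (\<integral>\<omega>. inner (U \<omega>) (H \<omega>) \<partial>M)"
    if u: "L2_converges M Us U" and H: "square_integrable M H" for Us U and H :: "'a \<Rightarrow> 'b"
  proof -
    note u = L2_convergesD[OF u]
    have eq: "(\<integral>\<omega>. inner (Us n \<omega>) (H \<omega>) \<partial>M) - (\<integral>\<omega>. inner (U \<omega>) (H \<omega>) \<partial>M) = (\<integral>\<omega>. inner (Us n \<omega> - U \<omega>) (H \<omega>) \<partial>M)" for n
      by (subst Bochner_Integration.integral_diff[symmetric])
         (auto intro!: integrable_inner_L2 u H simp: inner_diff_left)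
    have "(\<lambda>n. (\<integral>\<omega>. inner (Us n \<omega>) (H \<omega>) \<partial>M) - (\<integral>\<omega>. inner (U \<omega>) (H \<omega>) \<partial>M)) \<longlonglongrightarrow> 0"
      unfolding eq
    proof (rule Lim_null_comparison)
      show "\<forall>\<^sub>F n in sequentially. norm (\<integral>\<omega>. inner (Us n \<omega> - U \<omega>) (H \<omega>) \<partial>M)
         \<le> sqrt (\<integral>\<omega>. (norm (Us n \<omega> - U \<omega>))\<^sup>2 \<partial>M) * sqrt (\<integral>\<omega>. (norm (H \<omega>))\<^sup>2 \<partial>M)"
        unfolding real_norm_def
        by (intro always_eventually allI integral_inner_abs_le square_integrable_diff u H)
      show "(\<lambda>n. sqrt (\<integral>\<omega>. (norm (Us n \<omega> - U \<omega>))\<^sup>2 \<partial>M) * sqrt (\<integral>\<omega>. (norm (H \<omega>))\<^sup>2 \<partial>M)) \<longlonglongrightarrow> 0"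
        using tendsto_mult_left_zero[OF tendsto_real_sqrt[OF u(3), unfolded real_sqrt_zero]] by auto
    qed
    then show ?thesis by (simp add: LIM_zero_iff)
  qed
  have eq: "(\<integral>\<omega>. inner (Fs n \<omega>) (Gs n \<omega>) \<partial>M) =
     (\<integral>\<omega>. inner (Fs n \<omega> - F \<omega>) (Gs n \<omega> - G \<omega>) \<partial>M) + (\<integral>\<omega>. inner (Fs n \<omega>) (G \<omega>) \<partial>M)
     + (\<integral>\<omega>. inner (Gs n \<omega>) (F \<omega>) \<partial>M) - (\<integral>\<omega>. inner (F \<omega>) (G \<omega>) \<partial>M)" for n
  proof -
    have "(\<integral>\<omega>. inner (Fs n \<omega> - F \<omega>) (Gs n \<omega> - G \<omega>) \<partial>M) =
      (\<integral>\<omega>. inner (Fs n \<omega>) (Gs n \<omega>) - inner (Fs n \<omega>) (G \<omega>) - inner (Gs n \<omega>) (F \<omega>) + inner (F \<omega>) (G \<omega>) \<partial>M)"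
      by (intro Bochner_Integration.integral_cong) (auto simp: inner_diff_left inner_diff_right inner_commute algebra_simps)
    also have "\<dots> = (\<integral>\<omega>. inner (Fs n \<omega>) (Gs n \<omega>) \<partial>M) - (\<integral>\<omega>. inner (Fs n \<omega>) (G \<omega>) \<partial>M)
     - (\<integral>\<omega>. inner (Gs n \<omega>) (F \<omega>) \<partial>M) + (\<integral>\<omega>. inner (F \<omega>) (G \<omega>) \<partial>M)"
      by (simp add: integrable_inner_L2 a b)
    finally show ?thesis by simp
  qed
  have "(\<lambda>n. \<integral>\<omega>. inner (Fs n \<omega> - F \<omega>) (Gs n \<omega> - G \<omega>) \<partial>M) \<longlonglongrightarrow> 0"
  proof (rule Lim_null_comparison)
    show "\<forall>\<^sub>F n in sequentially. norm (\<integral>\<omega>. inner (Fs n \<omega> - F \<omega>) (Gs n \<omega> - G \<omega>) \<partial>M)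
       \<le> sqrt (\<integral>\<omega>. (norm (Fs n \<omega> - F \<omega>))\<^sup>2 \<partial>M) * sqrt (\<integral>\<omega>. (norm (Gs n \<omega> - G \<omega>))\<^sup>2 \<partial>M)"
      unfolding real_norm_def
      by (intro always_eventually allI integral_inner_abs_le square_integrable_diff a b)
    show "(\<lambda>n. sqrt (\<integral>\<omega>. (norm (Fs n \<omega> - F \<omega>))\<^sup>2 \<partial>M) * sqrt (\<integral>\<omega>. (norm (Gs n \<omega> - G \<omega>))\<^sup>2 \<partial>M)) \<longlonglongrightarrow> 0"
      using tendsto_mult[OF tendsto_real_sqrt[OF a(3)] tendsto_real_sqrt[OF b(3)]] by simp
  qed
  from tendsto_diff[OF tendsto_add[OF tendsto_add[OF this one[OF assms(1) b(2)]] one[OF assms(2) a(2)]] tendsto_const[of "\<integral>\<omega>. inner (F \<omega>) (G \<omega>) \<partial>M"]]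
  show ?thesis unfolding eq by (simp add: inner_commute)
qed

lemma L2_converges_mult:
  fixes F G :: "'a \<Rightarrow> real"
  assumes "L2_converges M Fs F" "L2_converges M Gs G"
  shows "(\<lambda>n. \<integral>\<omega>. Fs n \<omega> * Gs n \<omega> \<partial>M) \<longlonglongrightarrow> (\<integral>\<omega>. F \<omega> * G \<omega> \<partial>M)"
  using L2_converges_inner[OF assms] by simp

lemma L2_converges_norm_square:
  fixes F :: "'a \<Rightarrow> 'b::{second_countable_topology, real_inner}"
  assumes "L2_converges M Fs F"
  shows "(\<lambda>n. \<integral>\<omega>. (norm (Fs n \<omega>))\<^sup>2 \<partial>M) \<longlonglongrightarrow> (\<integral>\<omega>. (norm (F \<omega>))\<^sup>2 \<partial>M)"
  using L2_converges_inner[OF assms assms] by (simp add: power2_norm_eq_inner)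

lemma square_norm_zero_AE:
  assumes "square_integrable M F" "(\<integral>\<omega>. (norm (F \<omega>))\<^sup>2 \<partial>M) = 0"
  shows "AE \<omega> in M. F \<omega> = 0"
  using integral_nonneg_eq_0_iff_AE[OF square_integrableD(2)[OF assms(1)]] assms(2) by auto

lemma L2_converges_unique:
  fixes F G :: "'a \<Rightarrow> 'b::{second_countable_topology, real_inner}"
  assumes "L2_converges M Fs F" "L2_converges M Fs G"
  shows "AE \<omega> in M. F \<omega> = G \<omega>"
proof -
  have "(\<lambda>n. \<integral>\<omega>. (norm (Fs n \<omega> - Fs n \<omega>))\<^sup>2 \<partial>M) \<longlonglongrightarrow> (\<integral>\<omega>. (norm (F \<omega> - G \<omega>))\<^sup>2 \<partial>M)"
    by (rule L2_converges_norm_square[OF L2_converges_diff[OF assms]])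
  then have "(\<integral>\<omega>. (norm (F \<omega> - G \<omega>))\<^sup>2 \<partial>M) = 0" by (simp add: LIMSEQ_const_iff)
  from square_norm_zero_AE[OF square_integrable_diff this] show ?thesis
    using L2_convergesD[OF assms(1)] L2_convergesD[OF assms(2)] by auto
qed

definition L2_Cauchy :: "'a measure \<Rightarrow> (nat \<Rightarrow> 'a \<Rightarrow> 'b::real_normed_vector) \<Rightarrow> bool" where
  "L2_Cauchy M Fs \<longleftrightarrow> (\<forall>n. square_integrable M (Fs n)) \<and>
     (\<forall>e>0. \<exists>N. \<forall>m\<ge>N. \<forall>n\<ge>N. (\<integral>\<omega>. (norm (Fs m \<omega> - Fs n \<omega>))\<^sup>2 \<partial>M) < e)"

lemma L2_converges_Cauchy:
  fixes F :: "'a \<Rightarrow> 'b::{second_countable_topology, real_normed_vector}"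
  assumes "L2_converges M Fs F"
  shows "L2_Cauchy M Fs"
  unfolding L2_Cauchy_def
proof (intro conjI allI impI)
  note a = L2_convergesD[OF assms]
  show "square_integrable M (Fs n)" for n by fact
  fix e :: real assume "e > 0"
  then have "\<forall>\<^sub>F n in sequentially. (\<integral>\<omega>. (norm (Fs n \<omega> - F \<omega>))\<^sup>2 \<partial>M) < e / 4"
    using order_tendstoD(2)[OF a(3), of "e / 4"] by simp
  then obtain N where N: "\<And>n. n \<ge> N \<Longrightarrow> (\<integral>\<omega>. (norm (Fs n \<omega> - F \<omega>))\<^sup>2 \<partial>M) < e / 4"
    by (auto simp: eventually_sequentially)
  have "(\<integral>\<omega>. (norm (Fs m \<omega> - Fs n \<omega>))\<^sup>2 \<partial>M) < e" if "m \<ge> N" "n \<ge> N" for m n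
  proof -
    have "(\<integral>\<omega>. (norm (Fs m \<omega> - Fs n \<omega>))\<^sup>2 \<partial>M)
       \<le> (\<integral>\<omega>. 2 * (norm (Fs m \<omega> - F \<omega>))\<^sup>2 + 2 * (norm (Fs n \<omega> - F \<omega>))\<^sup>2 \<partial>M)"
    proof (intro integral_mono)
      show "integrable M (\<lambda>\<omega>. (norm (Fs m \<omega> - Fs n \<omega>))\<^sup>2)"
        by (intro square_integrableD square_integrable_diff a)
      show "integrable M (\<lambda>\<omega>. 2 * (norm (Fs m \<omega> - F \<omega>))\<^sup>2 + 2 * (norm (Fs n \<omega> - F \<omega>))\<^sup>2)"
        by (intro Bochner_Integration.integrable_add integrable_mult_right square_integrableD square_integrable_diff a)
      show "(norm (Fs m x - Fs n x))\<^sup>2 \<le> 2 * (norm (Fs m x - F x))\<^sup>2 + 2 * (norm (Fs n x - F x))\<^sup>2" for x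
        using norm_add_square_le[of "Fs m x - F x" "F x - Fs n x"] by (simp add: norm_minus_commute)
    qed
    also have "\<dots> = 2 * (\<integral>\<omega>. (norm (Fs m \<omega> - F \<omega>))\<^sup>2 \<partial>M) + 2 * (\<integral>\<omega>. (norm (Fs n \<omega> - F \<omega>))\<^sup>2 \<partial>M)"
      by (subst Bochner_Integration.integral_add)
         (auto intro!: integrable_mult_right square_integrableD square_integrable_diff a)
    also have "\<dots> < e" using N[OF that(1)] N[OF that(2)] by simp
    finally show ?thesis .
  qed
  then show "\<exists>N. \<forall>m\<ge>N. \<forall>n\<ge>N. (\<integral>\<omega>. (norm (Fs m \<omega> - Fs n \<omega>))\<^sup>2 \<partial>M) < e" by blast
qed

text \<open>An \<open>L\<^sup>2\<close> Cauchy sequence is \<open>L\<^sup>1\<close> Cauchy on a probability space, hence converges almost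
  everywhere along a subsequence; Fatou's lemma turns this into mean square convergence.\<close>

lemma (in prob_space) L2_complete:
  fixes Fs :: "nat \<Rightarrow> 'a \<Rightarrow> 'b::{banach, second_countable_topology}"
  assumes "L2_Cauchy M Fs"
  obtains F where "L2_converges M Fs F"
proof -
  have sq: "\<And>n. square_integrable M (Fs n)"
    and C: "\<And>e. e > 0 \<Longrightarrow> \<exists>N. \<forall>m\<ge>N. \<forall>n\<ge>N. (\<integral>\<omega>. (norm (Fs m \<omega> - Fs n \<omega>))\<^sup>2 \<partial>M) < e"
    using assms by (auto simp: L2_Cauchy_def)
  have one: "square_integrable M (\<lambda>_. 1::real)" by (simp add: square_integrable_def)
  have int: "integrable M (Fs n)" for n
    using integrable_norm_mult[OF sq[of n] one] square_integrableD(1)[OF sq[of n]]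
    by (simp add: integrable_norm_iff)
  have cau1: "\<exists>N. \<forall>i\<ge>N. \<forall>j\<ge>N. (\<integral>\<omega>. norm (Fs i \<omega> - Fs j \<omega>) \<partial>M) < e" if "e > 0" for e
  proof -
    from C[of "e\<^sup>2"] that obtain N where N: "\<And>m n. m \<ge> N \<Longrightarrow> n \<ge> N \<Longrightarrow> (\<integral>\<omega>. (norm (Fs m \<omega> - Fs n \<omega>))\<^sup>2 \<partial>M) < e\<^sup>2"
      by auto
    have "(\<integral>\<omega>. norm (Fs i \<omega> - Fs j \<omega>) \<partial>M) < e" if "i \<ge> N" "j \<ge> N" for i j
    proof -
      have "(\<integral>\<omega>. norm (Fs i \<omega> - Fs j \<omega>) \<partial>M)\<^sup>2 < e\<^sup>2"
        using Cauchy_Schwarz_integral[OF square_integrable_diff[OF sq[of i] sq[of j]] one] N[OF that]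
        by (simp add: prob_space)
      then show ?thesis using \<open>e > 0\<close> by (simp add: power2_less_imp_less)
    qed
    then show ?thesis by blast
  qed
  obtain r where r: "strict_mono r" "AE x in M. Cauchy (\<lambda>i. Fs (r i) x)"
    using cauchy_L1_AE_cauchy_subseq[OF int cau1] by blast
  define F where "F x = lim (\<lambda>i. Fs (r i) x)" for x
  note [measurable] = square_integrableD(1)[OF sq]
  have [measurable]: "F \<in> borel_measurable M"
    unfolding F_def by (rule borel_measurable_lim_metric) measurable
  have lim: "AE x in M. (\<lambda>i. Fs (r i) x) \<longlonglongrightarrow> F x"
    using r(2) by eventually_elim (auto simp: F_def Cauchy_convergent_iff convergent_LIMSEQ_iff)
  have bound: "(\<integral>\<^sup>+\<omega>. ennreal ((norm (Fs m \<omega> - F \<omega>))\<^sup>2) \<partial>M) \<le> ennreal e"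
    if N: "\<And>m n. m \<ge> N \<Longrightarrow> n \<ge> N \<Longrightarrow> (\<integral>\<omega>. (norm (Fs m \<omega> - Fs n \<omega>))\<^sup>2 \<partial>M) < e" and m: "m \<ge> N" for m N e
  proof -
    have "(\<integral>\<^sup>+\<omega>. ennreal ((norm (Fs m \<omega> - F \<omega>))\<^sup>2) \<partial>M)
       = (\<integral>\<^sup>+\<omega>. liminf (\<lambda>i. ennreal ((norm (Fs m \<omega> - Fs (r i) \<omega>))\<^sup>2)) \<partial>M)"
    proof (rule nn_integral_cong_AE)
      show "AE \<omega> in M. ennreal ((norm (Fs m \<omega> - F \<omega>))\<^sup>2) = liminf (\<lambda>i. ennreal ((norm (Fs m \<omega> - Fs (r i) \<omega>))\<^sup>2))"
        using lim
      proof eventually_elim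
        fix \<omega> assume "(\<lambda>i. Fs (r i) \<omega>) \<longlonglongrightarrow> F \<omega>"
        then have "(\<lambda>i. ennreal ((norm (Fs m \<omega> - Fs (r i) \<omega>))\<^sup>2)) \<longlonglongrightarrow> ennreal ((norm (Fs m \<omega> - F \<omega>))\<^sup>2)"
          by (intro tendsto_intros)
        then show "ennreal ((norm (Fs m \<omega> - F \<omega>))\<^sup>2) = liminf (\<lambda>i. ennreal ((norm (Fs m \<omega> - Fs (r i) \<omega>))\<^sup>2))"
          by (intro lim_imp_Liminf[symmetric]) auto
      qed
    qed
    also have "\<dots> \<le> liminf (\<lambda>i. \<integral>\<^sup>+\<omega>. ennreal ((norm (Fs m \<omega> - Fs (r i) \<omega>))\<^sup>2) \<partial>M)"
      by (intro nn_integral_liminf) measurable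
    also have "\<dots> \<le> ennreal e"
    proof -
      have "eventually (\<lambda>i. (\<integral>\<^sup>+\<omega>. ennreal ((norm (Fs m \<omega> - Fs (r i) \<omega>))\<^sup>2) \<partial>M) \<le> ennreal e) sequentially"
      proof (rule eventually_sequentiallyI)
      fix i assume i: "i \<ge> N"
      have "(\<integral>\<^sup>+\<omega>. ennreal ((norm (Fs m \<omega> - Fs (r i) \<omega>))\<^sup>2) \<partial>M) = ennreal (\<integral>\<omega>. (norm (Fs m \<omega> - Fs (r i) \<omega>))\<^sup>2 \<partial>M)"
        by (intro nn_integral_eq_integral square_integrableD square_integrable_diff sq) auto
      also have "\<dots> \<le> ennreal e"
        using N[OF m, of "r i"] i seq_suble[OF r(1), of i] by (intro ennreal_leI) auto
      finally show "(\<integral>\<^sup>+\<omega>. ennreal ((norm (Fs m \<omega> - Fs (r i) \<omega>))\<^sup>2) \<partial>M) \<le> ennreal e" .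
      qed
      from Liminf_mono[OF this] show ?thesis by (simp add: Liminf_const)
    qed
    finally show ?thesis .
  qed
  have sqd: "\<exists>N. \<forall>m\<ge>N. square_integrable M (\<lambda>\<omega>. Fs m \<omega> - F \<omega>) \<and> (\<integral>\<omega>. (norm (Fs m \<omega> - F \<omega>))\<^sup>2 \<partial>M) \<le> e" if "e > 0" for e
  proof -
    from C[OF that] obtain N where N: "\<And>m n. m \<ge> N \<Longrightarrow> n \<ge> N \<Longrightarrow> (\<integral>\<omega>. (norm (Fs m \<omega> - Fs n \<omega>))\<^sup>2 \<partial>M) < e"
      by auto
    have "square_integrable M (\<lambda>\<omega>. Fs m \<omega> - F \<omega>) \<and> (\<integral>\<omega>. (norm (Fs m \<omega> - F \<omega>))\<^sup>2 \<partial>M) \<le> e" if "m \<ge> N" for m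
    proof -
      have b: "(\<integral>\<^sup>+\<omega>. ennreal ((norm (Fs m \<omega> - F \<omega>))\<^sup>2) \<partial>M) \<le> ennreal e"
        by (rule bound[OF N that])
      have i: "integrable M (\<lambda>\<omega>. (norm (Fs m \<omega> - F \<omega>))\<^sup>2)"
        by (rule integrableI_bounded) (auto intro: le_less_trans[OF b])
      moreover have "(\<integral>\<omega>. (norm (Fs m \<omega> - F \<omega>))\<^sup>2 \<partial>M) \<le> e"
        using b \<open>e > 0\<close> by (subst (asm) nn_integral_eq_integral[OF i]) auto
      ultimately show ?thesis by (auto simp: square_integrable_def)
    qed
    then show ?thesis by blast
  qed
  from sqd[of 1] obtain N where "square_integrable M (\<lambda>\<omega>. Fs N \<omega> - F \<omega>)" by auto
  from square_integrable_diff[OF sq[of N] this] have sF: "square_integrable M F" by simp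
  have "(\<lambda>m. \<integral>\<omega>. (norm (Fs m \<omega> - F \<omega>))\<^sup>2 \<partial>M) \<longlonglongrightarrow> 0"
  proof (rule LIMSEQ_I)
    fix e :: real assume "e > 0"
    from sqd[of "e/2"] this obtain N where "\<forall>m\<ge>N. (\<integral>\<omega>. (norm (Fs m \<omega> - F \<omega>))\<^sup>2 \<partial>M) \<le> e/2" by auto
    then show "\<exists>no. \<forall>n\<ge>no. norm ((\<integral>\<omega>. (norm (Fs n \<omega> - F \<omega>))\<^sup>2 \<partial>M) - 0) < e"
      using \<open>e > 0\<close> by (intro exI[of _ N]) (auto intro: le_less_trans)
  qed
  then have "L2_converges M Fs F" using sq sF by (simp add: L2_converges_def)
  then show thesis by (rule that)
qed

text \<open>A quadratic function with minimum at \<open>0\<close> has no linear part. It is the variational step in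
  the projection theorem.\<close>

lemma linear_coeff_zero:
  fixes b c :: real
  assumes q: "\<And>t. 0 \<le> 2 * t * b + t\<^sup>2 * c" and c: "c \<ge> 0"
  shows "b = 0"
proof -
  define k where "k = c + 1"
  have k: "k > 0" using c by (simp add: k_def)
  \<comment> \<open>the minimizer of the quadratic, with denominator \<open>c + 1\<close> so that \<open>c = 0\<close> is covered too\<close>
  have "0 \<le> 2 * (- b / k) * b + (- b / k)\<^sup>2 * (k - 1)" using q[of "- b / k"] by (simp add: k_def)
  also have "\<dots> = - (b\<^sup>2 * (k + 1) / k\<^sup>2)" using k by (simp add: field_simps power2_eq_square)
  finally have "b\<^sup>2 * (k + 1) / k\<^sup>2 \<le> 0" by simp
  then have "b\<^sup>2 * (k + 1) \<le> 0" using k by (simp add: divide_le_0_iff)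
  then show ?thesis using k by (simp add: mult_le_0_iff)
qed

text \<open>Projection theorem for a linear space \<open>V\<close> of functions: by the parallelogram law a sequence
  in \<open>V\<close> that minimizes the distance to \<open>F\<close> is Cauchy, and \<open>F\<close> minus its limit is orthogonal
  to \<open>V\<close>.\<close>

lemma (in prob_space) dense_if_trivial_orthogonal:
  fixes V :: "('a \<Rightarrow> real) set"
  assumes sq: "\<And>P. P \<in> V \<Longrightarrow> square_integrable M P"
    and zero: "(\<lambda>_. 0) \<in> V"
    and lin: "\<And>P Q a b. P \<in> V \<Longrightarrow> Q \<in> V \<Longrightarrow> (\<lambda>\<omega>. a * P \<omega> + b * Q \<omega>) \<in> V"
    and orth: "\<And>Y. square_integrable M Y \<Longrightarrow> (\<And>P. P \<in> V \<Longrightarrow> (\<integral>\<omega>. Y \<omega> * P \<omega> \<partial>M) = 0)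
      \<Longrightarrow> AE \<omega> in M. Y \<omega> = 0"
    and F: "square_integrable M F"
  obtains Ps where "\<And>n. Ps n \<in> V" "L2_converges M Ps F"
proof -
  let ?D = "\<lambda>P. \<integral>\<omega>. (norm (P \<omega> - F \<omega>))\<^sup>2 \<partial>M"
  define d where "d = (INF P\<in>V. ?D P)"
  have bdd: "bdd_below (?D ` V)" by (rule bdd_belowI[of _ 0]) auto
  have d_le: "d \<le> ?D P" if "P \<in> V" for P unfolding d_def by (rule cINF_lower[OF bdd that])
  have "\<exists>P\<in>V. ?D P < d + 1 / Suc n" for n :: nat
    using cINF_less_iff[OF _ bdd, of "d + 1 / Suc n"] zero by (auto simp: d_def)
  then obtain Ps where Ps: "\<And>n. Ps n \<in> V" "\<And>n. ?D (Ps n) < d + 1 / Suc n" by metis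
  have sqP: "square_integrable M (Ps n)" for n using sq Ps by auto
  have par: "(\<integral>\<omega>. (norm (Ps m \<omega> - Ps n \<omega>))\<^sup>2 \<partial>M) \<le> 2 * (1 / Suc m) + 2 * (1 / Suc n)" for m n
  proof -
    let ?Q = "\<lambda>\<omega>. (1/2) * Ps m \<omega> + (1/2) * Ps n \<omega>"
    have Q: "?Q \<in> V" using lin[OF Ps(1)[of m] Ps(1)[of n], of "1/2" "1/2"] .
    have "(\<integral>\<omega>. (norm (Ps m \<omega> - Ps n \<omega>))\<^sup>2 \<partial>M) = (\<integral>\<omega>. 2 * (norm (Ps m \<omega> - F \<omega>))\<^sup>2 + 2 * (norm (Ps n \<omega> - F \<omega>))\<^sup>2 - 4 * (norm (?Q \<omega> - F \<omega>))\<^sup>2 \<partial>M)"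
      by (intro Bochner_Integration.integral_cong) (auto simp: power2_eq_square algebra_simps)
    also have "\<dots> = 2 * ?D (Ps m) + 2 * ?D (Ps n) - 4 * ?D ?Q"
      using square_integrableD(2)[OF square_integrable_diff[OF sqP[of m] F]]
        square_integrableD(2)[OF square_integrable_diff[OF sqP[of n] F]]
        square_integrableD(2)[OF square_integrable_diff[OF sq[OF Q] F]]
      by simp
    also have "\<dots> \<le> 2 * (1 / Suc m) + 2 * (1 / Suc n)"
      using Ps(2)[of m] Ps(2)[of n] d_le[OF Q] by linarith
    finally show ?thesis .
  qed
  have "L2_Cauchy M Ps"
    unfolding L2_Cauchy_def
  proof (intro conjI allI impI sqP)
    fix e :: real assume "e > 0"
    then obtain N :: nat where N: "1 / Suc N < e / 4" using nat_approx_posE[of "e/4"] by auto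
    have "(\<integral>\<omega>. (norm (Ps m \<omega> - Ps n \<omega>))\<^sup>2 \<partial>M) < e" if "m \<ge> N" "n \<ge> N" for m n
    proof -
      have "1 / real (Suc m) \<le> 1 / Suc N" "1 / real (Suc n) \<le> 1 / Suc N"
        using that by (auto intro!: divide_left_mono)
      then show ?thesis using par[of m n] N by linarith
    qed
    then show "\<exists>N. \<forall>m\<ge>N. \<forall>n\<ge>N. (\<integral>\<omega>. (norm (Ps m \<omega> - Ps n \<omega>))\<^sup>2 \<partial>M) < e" by blast
  qed
  then obtain R where R: "L2_converges M Ps R" by (rule L2_complete)
  note sR = L2_convergesD(2)[OF R]
  have DR: "?D R \<le> d"
  proof (rule LIMSEQ_le)
    show "(\<lambda>n. ?D (Ps n)) \<longlonglongrightarrow> ?D R"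
      by (rule L2_converges_norm_square[OF L2_converges_diff[OF R L2_converges_const[OF F]]])
    show "(\<lambda>n. d + 1 / Suc n) \<longlonglongrightarrow> d"
      using tendsto_add[OF tendsto_const[of d] LIMSEQ_inverse_real_of_nat] by (simp add: inverse_eq_divide)
    show "\<exists>N. \<forall>n\<ge>N. ?D (Ps n) \<le> d + 1 / Suc n" using Ps(2) less_imp_le by blast
  qed
  have "(\<integral>\<omega>. (R \<omega> - F \<omega>) * P \<omega> \<partial>M) = 0" if P: "P \<in> V" for P
  proof -
    let ?b = "\<integral>\<omega>. (R \<omega> - F \<omega>) * P \<omega> \<partial>M" and ?c = "\<integral>\<omega>. (norm (P \<omega>))\<^sup>2 \<partial>M"
    have ge: "d \<le> ?D (\<lambda>\<omega>. R \<omega> + t * P \<omega>)" for t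
    proof (rule LIMSEQ_le_const)
      show "(\<lambda>n. ?D (\<lambda>\<omega>. Ps n \<omega> + t * P \<omega>)) \<longlonglongrightarrow> ?D (\<lambda>\<omega>. R \<omega> + t * P \<omega>)"
        by (rule L2_converges_norm_square[OF L2_converges_diff[OF L2_converges_add[OF R
              L2_converges_const[OF square_integrable_cmult[OF sq[OF P]]]] L2_converges_const[OF F]]])
      show "\<exists>N. \<forall>n\<ge>N. d \<le> ?D (\<lambda>\<omega>. Ps n \<omega> + t * P \<omega>)"
        using d_le[OF lin[OF Ps(1) P, of 1 _ t]] by auto
    qed
    have exp: "?D (\<lambda>\<omega>. R \<omega> + t * P \<omega>) = ?D R + 2 * t * ?b + t\<^sup>2 * ?c" for t
    proof -
      have "?D (\<lambda>\<omega>. R \<omega> + t * P \<omega>) = (\<integral>\<omega>. (norm (R \<omega> - F \<omega>))\<^sup>2 + 2 * t * ((R \<omega> - F \<omega>) * P \<omega>) + t\<^sup>2 * (norm (P \<omega>))\<^sup>2 \<partial>M)"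
        by (intro Bochner_Integration.integral_cong) (auto simp: power2_eq_square algebra_simps)
      also have "\<dots> = ?D R + 2 * t * ?b + t\<^sup>2 * ?c"
        using square_integrableD(2)[OF square_integrable_diff[OF sR F]] square_integrableD(2)[OF sq[OF P]]
          integrable_mult_L2[OF square_integrable_diff[OF sR F] sq[OF P]] by simp
      finally show ?thesis .
    qed
    have q: "0 \<le> 2 * t * ?b + t\<^sup>2 * ?c" for t using ge[of t] exp[of t] DR by linarith
    show ?thesis by (rule linear_coeff_zero[OF q]) simp
  qed
  then have "AE \<omega> in M. R \<omega> - F \<omega> = 0"
    by (intro orth square_integrable_diff[OF sR F])
  then have ae: "AE \<omega> in M. R \<omega> = F \<omega>" by eventually_elim simp
  have "?D (Ps n) = (\<integral>\<omega>. (norm (Ps n \<omega> - R \<omega>))\<^sup>2 \<partial>M)" for n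
    using ae square_integrableD(1)[OF sR] square_integrableD(1)[OF F] square_integrableD(1)[OF sqP]
    by (intro integral_cong_AE) (measurable, auto)
  then have "L2_converges M Ps F" using R F by (simp add: L2_converges_def)
  with Ps(1) show thesis by (rule that)
qed

section \<open>Integrals determined by trigonometric test functions\<close>

text \<open>Dynkin's argument: the sets over which the integral of \<open>f\<close> vanishes are closed under
  complements and countable disjoint unions.\<close>

lemma set_integral_zero_sigma_sets:
  fixes f :: "'a \<Rightarrow> real"
  assumes f: "integrable M f" and G: "Int_stable G" "G \<subseteq> sets M"
    and zero: "\<And>A. A \<in> G \<Longrightarrow> (LINT x:A|M. f x) = 0" "(LINT x|M. f x) = 0"
    and B: "B \<in> sigma_sets (space M) G"
  shows "(LINT x:B|M. f x) = 0"
proof -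
  have meas: "A \<in> sets M" if "A \<in> sigma_sets (space M) G" for A
    using sets.sigma_sets_subset[OF G(2)] that by auto
  have int: "set_integrable M A f" if "A \<in> sets M" for A
    using integrable_mult_indicator[OF that f] by (simp add: set_integrable_def)
  have "G \<subseteq> Pow (space M)" using G(2) sets.sets_into_space by blast
  from G(1) this B show ?thesis
  proof (induction rule: sigma_sets_induct_disjoint)
    case (basic A) then show ?case by (rule zero)
  next
    case empty show ?case by (simp add: set_lebesgue_integral_def)
  next
    case (compl A)
    have A: "A \<in> sets M" by (rule meas[OF compl(1)])
    have "(LINT x:space M - A|M. f x) = (LINT x|M. f x - indicator A x *\<^sub>R f x)"
      unfolding set_lebesgue_integral_def
      by (intro Bochner_Integration.integral_cong) (auto simp: indicator_def)
    also have "\<dots> = (LINT x|M. f x) - (LINT x:A|M. f x)"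
      using int[OF A] f unfolding set_lebesgue_integral_def set_integrable_def by simp
    finally show ?case using compl zero(2) by simp
  next
    case (union A)
    have A: "A i \<in> sets M" for i using union meas by blast
    have "(LINT x:(\<Union>i. A i)|M. f x) = (\<Sum>i. (LINT x:(A i)|M. f x))"
      using union(1) A by (intro lebesgue_integral_countable_add int sets.countable_UN)
        (auto simp: disjoint_family_on_def)
    then show ?case using union(3) by simp
  qed
qed

text \<open>Levy's uniqueness theorem for the signed image measure of \<open>f \<cdot> M\<close> under \<open>X\<close>: apply the theorem
  to the normalized positive and negative parts.\<close>

lemma trigonometric_integrals_zero:
  fixes f X :: "'a \<Rightarrow> real"
  assumes f: "integrable M f" and X[measurable]: "X \<in> borel_measurable M"
    and c: "\<And>t. (\<integral>x. f x * cos (t * X x) \<partial>M) = 0" and s: "\<And>t. (\<integral>x. f x * sin (t * X x) \<partial>M) = 0"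
    and A: "A \<in> sets borel"
  shows "(\<integral>x. f x * indicator A (X x) \<partial>M) = 0"
proof -
  define p where "p x = max 0 (f x)" for x
  define n where "n x = max 0 (- f x)" for x
  have fpn: "f x = p x - n x" for x by (auto simp: p_def n_def)
  have [measurable]: "f \<in> borel_measurable M" using f by auto
  have p: "integrable M p" and n: "integrable M n"
    unfolding p_def n_def using f by auto
  have nonneg: "p x \<ge> 0" "n x \<ge> 0" for x by (auto simp: p_def n_def)
  have [measurable]: "p \<in> borel_measurable M" "n \<in> borel_measurable M" using p n by auto
  define a where "a = (\<integral>x. p x \<partial>M)"
  have an: "a = (\<integral>x. n x \<partial>M)"
    using c[of 0] p n by (simp add: a_def fpn)
  have a0: "a \<ge> 0" using nonneg by (simp add: a_def)
  show ?thesis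
  proof (cases "a = 0")
    case True
    have "AE x in M. p x = 0" "AE x in M. n x = 0"
      using integral_nonneg_eq_0_iff_AE[OF p] integral_nonneg_eq_0_iff_AE[OF n] nonneg True an
      by (auto simp: a_def)
    then have "AE x in M. f x = 0" by eventually_elim (simp add: fpn)
    then have "AE x in M. f x * indicator A (X x) = 0" by eventually_elim simp
    then show ?thesis by (rule integral_eq_zero_AE)
  next
    case False
    then have a: "a > 0" using a0 by simp
    have main: "prob_space (density M (\<lambda>x. ennreal (q x / a)))"
      if "integrable M q" "\<And>x. q x \<ge> 0" "(\<integral>x. q x \<partial>M) = a" for q
    proof (rule prob_spaceI)
      have "emeasure (density M (\<lambda>x. ennreal (q x / a))) (space (density M (\<lambda>x. ennreal (q x / a)))) = (\<integral>\<^sup>+x. ennreal (q x / a) \<partial>M)"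
        using that(1) by (subst emeasure_density) (auto cong: nn_integral_cong)
      also have "\<dots> = ennreal (\<integral>x. q x / a \<partial>M)"
        using that a by (intro nn_integral_eq_integral) auto
      also have "\<dots> = 1" using that(3) a by simp
      finally show "emeasure (density M (\<lambda>x. ennreal (q x / a))) (space (density M (\<lambda>x. ennreal (q x / a)))) = 1" .
    qed
    let ?N = "\<lambda>q. distr (density M (\<lambda>x. ennreal (q x / a))) borel X"
    have rd: "real_distribution (?N p)" "real_distribution (?N n)"
      using main[OF p nonneg(1) a_def[symmetric]] main[OF n nonneg(2) an[symmetric]]
      by (auto intro!: prob_space.real_distribution_distr)
    have ch: "char (?N q) t = (\<integral>x. (q x / a) *\<^sub>R iexp (t * X x) \<partial>M)"
      if [measurable]: "q \<in> borel_measurable M" and "\<And>x. q x \<ge> 0" for q t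
      unfolding char_def using that a
      by (subst integral_distr) (auto simp: integral_density)
    have "char (?N p) t = char (?N n) t" for t
    proof -
      have ii: "integrable M (\<lambda>x. (q x / a) *\<^sub>R iexp (t * X x))" if "integrable M q" for q
        using that by (intro Bochner_Integration.integrable_bound[of M "\<lambda>x. q x / a" "\<lambda>x. (q x / a) *\<^sub>R iexp (t * X x)"])
          (auto simp: norm_exp_i_times)
      have If: "integrable M (\<lambda>x. (f x / a) *\<^sub>R iexp (t * X x))" by (rule ii[OF f])
      have "char (?N p) t - char (?N n) t = (\<integral>x. (p x / a) *\<^sub>R iexp (t * X x) \<partial>M) - (\<integral>x. (n x / a) *\<^sub>R iexp (t * X x) \<partial>M)"
        using ch[of p t] ch[of n t] nonneg by simp
      also have "\<dots> = (\<integral>x. (p x / a) *\<^sub>R iexp (t * X x) - (n x / a) *\<^sub>R iexp (t * X x) \<partial>M)"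
        by (rule Bochner_Integration.integral_diff[symmetric, OF ii[OF p] ii[OF n]])
      also have "\<dots> = (\<integral>x. (f x / a) *\<^sub>R iexp (t * X x) \<partial>M)"
        by (intro Bochner_Integration.integral_cong refl)
           (simp only: fpn diff_divide_distrib scaleR_diff_left)
      also have "\<dots> = 0"
      proof (rule complex_eqI)
        have "Re (\<integral>x. (f x / a) *\<^sub>R iexp (t * X x) \<partial>M) = (\<integral>x. Re ((f x / a) *\<^sub>R iexp (t * X x)) \<partial>M)"
          by (rule integral_Re[OF If, symmetric])
        also have "\<dots> = (\<integral>x. f x * cos (t * X x) / a \<partial>M)"
          by (intro Bochner_Integration.integral_cong) (simp_all add: Re_exp)
        finally show "Re (\<integral>x. (f x / a) *\<^sub>R iexp (t * X x) \<partial>M) = Re 0" using c[of t] by simp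
        have "Im (\<integral>x. (f x / a) *\<^sub>R iexp (t * X x) \<partial>M) = (\<integral>x. Im ((f x / a) *\<^sub>R iexp (t * X x)) \<partial>M)"
          by (rule integral_Im[OF If, symmetric])
        also have "\<dots> = (\<integral>x. f x * sin (t * X x) / a \<partial>M)"
          by (intro Bochner_Integration.integral_cong) (simp_all add: Im_exp)
        finally show "Im (\<integral>x. (f x / a) *\<^sub>R iexp (t * X x) \<partial>M) = Im 0" using s[of t] by simp
      qed
      finally show ?thesis by simp
    qed
    then have eq: "?N p = ?N n" using Levy_uniqueness[OF rd] by auto
    have I: "(\<integral>x. indicator A x \<partial>?N q) = (\<integral>x. q x / a * indicator A (X x) \<partial>M)"
      if [measurable]: "q \<in> borel_measurable M" and "\<And>x. q x \<ge> 0" for q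
      using that A a by (subst integral_distr) (auto simp: integral_real_density)
    have ip: "integrable M (\<lambda>x. q x * indicator A (X x))" if "integrable M q" for q :: "'a \<Rightarrow> real"
    proof -
      have [measurable]: "A \<in> sets borel" "q \<in> borel_measurable M" using A that by auto
      show ?thesis
        by (rule Bochner_Integration.integrable_bound[OF that]) (auto simp: indicator_def)
    qed
    have "(\<integral>x. p x / a * indicator A (X x) \<partial>M) = (\<integral>x. n x / a * indicator A (X x) \<partial>M)"
      using I[of p] I[of n] eq nonneg by simp
    then have "(\<integral>x. p x * indicator A (X x) \<partial>M) = (\<integral>x. n x * indicator A (X x) \<partial>M)"
      using a by simp
    then show ?thesis using ip[OF p] ip[OF n] by (simp add: fpn left_diff_distrib)
  qed
qed

section \<open>Random variables with all moments\<close>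

text \<open>Unlike square integrability, this property is preserved by products. It gives the
  integrability of every polynomial expression in the \<open>W h\<close> and their cylindrical functions.\<close>

definition all_moments :: "'a measure \<Rightarrow> ('a \<Rightarrow> real) \<Rightarrow> bool" where
  "all_moments M F \<longleftrightarrow> F \<in> borel_measurable M \<and> (\<forall>k::nat. integrable M (\<lambda>\<omega>. \<bar>F \<omega>\<bar> ^ k))"

lemma all_momentsD:
  assumes "all_moments M F"
  shows "F \<in> borel_measurable M" "integrable M (\<lambda>\<omega>. \<bar>F \<omega>\<bar> ^ k)"
  using assms by (auto simp: all_moments_def)

lemma all_moments_square_integrable: "all_moments M F \<Longrightarrow> square_integrable M F"
  using all_momentsD(2)[of M F 2] by (auto simp: all_moments_def square_integrable_def)

lemma all_moments_integrable:
  assumes "all_moments M F" shows "integrable M F"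
  using all_momentsD(2)[OF assms, of 1] all_momentsD(1)[OF assms]
  by - (rule integrable_abs_cancel, simp_all)

lemma all_moments_bound:
  assumes "all_moments M F" "G \<in> borel_measurable M" "\<And>\<omega>. \<bar>G \<omega>\<bar> \<le> \<bar>F \<omega>\<bar>"
  shows "all_moments M G"
  unfolding all_moments_def
proof (intro conjI allI Bochner_Integration.integrable_bound[OF all_momentsD(2)[OF assms(1)]] AE_I2)
  fix k \<omega>
  show "(\<lambda>x. \<bar>G x\<bar> ^ k) \<in> borel_measurable M" using assms(2) by measurable
  show "norm (\<bar>G \<omega>\<bar> ^ k) \<le> norm (\<bar>F \<omega>\<bar> ^ k)" using power_mono[OF assms(3)[of \<omega>] abs_ge_zero, of k] by simp
qed (rule assms(2))

lemma (in prob_space) all_moments_const: "all_moments M (\<lambda>_. c)"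
  by (simp add: all_moments_def)

lemma all_moments_add:
  assumes "all_moments M F" "all_moments M G"
  shows "all_moments M (\<lambda>\<omega>. F \<omega> + G \<omega>)"
  unfolding all_moments_def
proof (intro conjI allI)
  fix k :: nat
  note [measurable] = all_momentsD(1)[OF assms(1)] all_momentsD(1)[OF assms(2)]
  show "(\<lambda>\<omega>. F \<omega> + G \<omega>) \<in> borel_measurable M" by measurable
  have *: "\<bar>a + b\<bar> ^ k \<le> 2 ^ k * (\<bar>a\<bar> ^ k + \<bar>b\<bar> ^ k)" for a b :: real
  proof -
    have "\<bar>a + b\<bar> ^ k \<le> (2 * max \<bar>a\<bar> \<bar>b\<bar>) ^ k" by (intro power_mono) auto
    also have "\<dots> = 2 ^ k * max \<bar>a\<bar> \<bar>b\<bar> ^ k" by (simp add: power_mult_distrib)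
    also have "max \<bar>a\<bar> \<bar>b\<bar> ^ k \<le> \<bar>a\<bar> ^ k + \<bar>b\<bar> ^ k" by (auto simp: max_def)
    finally show ?thesis by simp
  qed
  have "integrable M (\<lambda>\<omega>. 2 ^ k * (\<bar>F \<omega>\<bar> ^ k + \<bar>G \<omega>\<bar> ^ k))"
    using all_momentsD(2)[OF assms(1), of k] all_momentsD(2)[OF assms(2), of k] by auto
  then show "integrable M (\<lambda>\<omega>. \<bar>F \<omega> + G \<omega>\<bar> ^ k)"
  proof (rule Bochner_Integration.integrable_bound)
    show "AE \<omega> in M. norm (\<bar>F \<omega> + G \<omega>\<bar> ^ k) \<le> norm (2 ^ k * (\<bar>F \<omega>\<bar> ^ k + \<bar>G \<omega>\<bar> ^ k))"
      unfolding real_norm_def power_abs abs_idempotent using * by (intro AE_I2 order_trans[OF _ abs_ge_self]) (simp add: power_abs)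
  qed measurable
qed

lemma all_moments_mult:
  assumes "all_moments M F" "all_moments M G"
  shows "all_moments M (\<lambda>\<omega>. F \<omega> * G \<omega>)"
  unfolding all_moments_def
proof (intro conjI allI)
  fix k :: nat
  note [measurable] = all_momentsD(1)[OF assms(1)] all_momentsD(1)[OF assms(2)]
  show "(\<lambda>\<omega>. F \<omega> * G \<omega>) \<in> borel_measurable M" by measurable
  have *: "\<bar>a * b\<bar> ^ k \<le> \<bar>a\<bar> ^ (2 * k) + \<bar>b\<bar> ^ (2 * k)" for a b :: real
    using norm_mult_le_squares[of "\<bar>a\<bar> ^ k" "\<bar>b\<bar> ^ k"]
    unfolding power_even_eq abs_mult power_mult_distrib by simp
  have "integrable M (\<lambda>\<omega>. \<bar>F \<omega>\<bar> ^ (2 * k) + \<bar>G \<omega>\<bar> ^ (2 * k))"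
    using all_momentsD(2)[OF assms(1)] all_momentsD(2)[OF assms(2)] by auto
  then show "integrable M (\<lambda>\<omega>. \<bar>F \<omega> * G \<omega>\<bar> ^ k)"
  proof (rule Bochner_Integration.integrable_bound)
    show "AE \<omega> in M. norm (\<bar>F \<omega> * G \<omega>\<bar> ^ k) \<le> norm (\<bar>F \<omega>\<bar> ^ (2 * k) + \<bar>G \<omega>\<bar> ^ (2 * k))"
      unfolding real_norm_def power_abs abs_idempotent using * by (intro AE_I2 order_trans[OF _ abs_ge_self]) (simp add: power_abs)
  qed measurable
qed

context prob_space begin

lemma all_moments_cmult: "all_moments M F \<Longrightarrow> all_moments M (\<lambda>\<omega>. c * F \<omega>)"
  by (rule all_moments_mult[OF all_moments_const])

lemma all_moments_diff:
  assumes "all_moments M F" "all_moments M G"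
  shows "all_moments M (\<lambda>\<omega>. F \<omega> - G \<omega>)"
  using all_moments_add[OF assms(1) all_moments_cmult[OF assms(2), of "-1"]] by simp

lemma all_moments_sum:
  assumes "\<And>i. i \<in> I \<Longrightarrow> all_moments M (F i)"
  shows "all_moments M (\<lambda>\<omega>. \<Sum>i\<in>I. F i \<omega>)"
  using assms
proof (induction I rule: infinite_finite_induct)
  case (insert x I)
  have "all_moments M (\<lambda>\<omega>. F x \<omega> + (\<Sum>i\<in>I. F i \<omega>))"
    by (rule all_moments_add) (use insert in auto)
  then show ?case using insert by simp
qed (simp_all add: all_moments_const)

lemma all_moments_power:
  assumes "all_moments M F" shows "all_moments M (\<lambda>\<omega>. F \<omega> ^ k)"
proof (induction k)
  case (Suc k)
  show ?case using all_moments_mult[OF assms Suc.IH] by simp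
qed (simp add: all_moments_const)

lemma all_moments_abs:
  assumes "all_moments M F" shows "all_moments M (\<lambda>\<omega>. \<bar>F \<omega>\<bar>)"
proof (rule all_moments_bound[OF assms])
  have [measurable]: "F \<in> borel_measurable M" by (rule all_momentsD(1)[OF assms])
  show "(\<lambda>\<omega>. \<bar>F \<omega>\<bar>) \<in> borel_measurable M" by measurable
qed simp

end

section \<open>Gaussian random variables\<close>

text \<open>As images of the standard normal law under scaling, the degenerate and the nondegenerate
  Gaussian laws have the same description.\<close>

lemma centered_gaussian_distr:
  assumes "centered_gaussian M X"
  obtains \<sigma> where "\<sigma> \<ge> 0" "distr M borel X = distr std_normal_distribution borel (\<lambda>x. \<sigma> * x)"
proof -
  obtain \<sigma> where s: "\<sigma> \<ge> 0" and d: "distr M borel X =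
        (if \<sigma> = 0 then return borel 0 else density lborel (\<lambda>x. ennreal (normal_density 0 \<sigma> x)))"
    using assms unfolding centered_gaussian_def by blast
  interpret N: real_distribution std_normal_distribution by (rule real_dist_normal_dist)
  show thesis
  proof (cases "\<sigma> = 0")
    case True
    have "distr std_normal_distribution borel (\<lambda>x. 0 * x) = return borel (0::real)"
      using N.distr_const[of "0::real" borel] by simp
    then show thesis using that[OF s] d True by auto
  next
    case False
    have "distributed std_normal_distribution lborel (\<lambda>x. x) std_normal_density"
      by (simp add: distributed_def distr_id2)
    from N.normal_density_affine[OF this, of \<sigma> 0] False s
    have "distributed std_normal_distribution lborel (\<lambda>x. \<sigma> * x) (normal_density 0 \<sigma>)" by simp
    then have "distr std_normal_distribution lborel (\<lambda>x. \<sigma> * x) = density lborel (\<lambda>x. ennreal (normal_density 0 \<sigma> x))"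
      by (simp add: distributed_def)
    then show thesis using that[OF s] d False by (simp cong: distr_cong)
  qed
qed

lemma integrable_std_normal_exp: "integrable std_normal_distribution (\<lambda>x. exp (c * x))"
proof -
  have "std_normal_density x * exp (c * x) = exp (c\<^sup>2 / 2) * normal_density c 1 x" for x
    by (simp add: normal_density_def exp_add[symmetric] power2_eq_square field_simps)
  moreover have "integrable lborel (\<lambda>x. exp (c\<^sup>2 / 2) * normal_density c 1 x)" by simp
  ultimately show ?thesis
    by (subst integrable_real_density) auto
qed

lemma std_normal_cos: "(\<integral>x. cos (t * x) \<partial>std_normal_distribution) = exp (- t\<^sup>2 / 2)"
  and std_normal_sin: "(\<integral>x. sin (t * x) \<partial>std_normal_distribution) = 0"
proof -
  interpret N: real_distribution std_normal_distribution by (rule real_dist_normal_dist)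
  have i: "integrable std_normal_distribution (\<lambda>x. iexp (t * x))"
    by (intro N.integrable_iexp) auto
  have e: "(\<integral>x. iexp (t * x) \<partial>std_normal_distribution) = complex_of_real (exp (- t\<^sup>2 / 2))"
    using char_std_normal_distribution by (simp add: char_def fun_eq_iff)
  have "(\<integral>x. Re (iexp (t * x)) \<partial>std_normal_distribution) = exp (- t\<^sup>2 / 2)"
    using i e by (subst integral_Re) (simp_all del: of_real_mult)
  then show "(\<integral>x. cos (t * x) \<partial>std_normal_distribution) = exp (- t\<^sup>2 / 2)"
    by (simp add: Re_exp)
  have "(\<integral>x. Im (iexp (t * x)) \<partial>std_normal_distribution) = 0"
    using i e by (subst integral_Im) (simp_all del: of_real_mult)
  then show "(\<integral>x. sin (t * x) \<partial>std_normal_distribution) = 0"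
    by (simp add: Im_exp)
qed

context isonormal_gaussian_process begin

lemma W_measurable [measurable]: "W h \<in> borel_measurable M"
  using jointly_gaussian[where N = 1 and a = "\<lambda>_. 1" and h = "\<lambda>_. h"] by (simp add: centered_gaussian_def)

text \<open>The scale is determined by the second moment, which the covariance prescribes.\<close>

lemma W_distr: "distr M borel (W h) = distr std_normal_distribution borel (\<lambda>x. norm h * x)"
proof -
  obtain \<sigma> where s: "\<sigma> \<ge> 0" and d: "distr M borel (W h) = distr std_normal_distribution borel (\<lambda>x. \<sigma> * x)"
    using centered_gaussian_distr[of M "W h"] jointly_gaussian[where N = 1 and a = "\<lambda>_. 1" and h = "\<lambda>_. h"] by auto
  have "inner h h = (\<integral>\<omega>. (W h \<omega>)\<^sup>2 \<partial>M)"
    using covariance[of h h] by (simp add: power2_eq_square)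
  also have "\<dots> = (\<integral>x. x\<^sup>2 \<partial>distr M borel (W h))" by (subst integral_distr) auto
  also have "\<dots> = (\<integral>x. (\<sigma> * x)\<^sup>2 \<partial>std_normal_distribution)"
    unfolding d by (subst integral_distr) auto
  also have "\<dots> = \<sigma>\<^sup>2 * (\<integral>x. x ^ (2 * 1) \<partial>std_normal_distribution)"
    by (simp add: power_mult_distrib)
  also have "\<dots> = \<sigma>\<^sup>2" by (subst std_normal_distribution_even_moments) (simp add: fact_numeral)
  finally have "norm h = \<sigma>" using s by (simp add: norm_eq_sqrt_inner)
  then show ?thesis using d by simp
qed

lemma W_integral:
  assumes [measurable]: "g \<in> borel_measurable borel"
  shows "(\<integral>\<omega>. g (W h \<omega>) \<partial>M) = (\<integral>x. (g (norm h * x) :: real) \<partial>std_normal_distribution)"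
    and "integrable M (\<lambda>\<omega>. g (W h \<omega>)) \<longleftrightarrow> integrable std_normal_distribution (\<lambda>x. g (norm h * x))"
proof -
  have "(\<integral>\<omega>. g (W h \<omega>) \<partial>M) = (\<integral>x. g x \<partial>distr M borel (W h))" by (subst integral_distr) auto
  also have "\<dots> = (\<integral>x. g (norm h * x) \<partial>std_normal_distribution)"
    unfolding W_distr by (subst integral_distr) auto
  finally show "(\<integral>\<omega>. g (W h \<omega>) \<partial>M) = (\<integral>x. g (norm h * x) \<partial>std_normal_distribution)" .
  have "integrable M (\<lambda>\<omega>. g (W h \<omega>)) \<longleftrightarrow> integrable (distr M borel (W h)) g"
    by (subst integrable_distr_eq) auto
  also have "\<dots> \<longleftrightarrow> integrable std_normal_distribution (\<lambda>x. g (norm h * x))"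
    unfolding W_distr by (subst integrable_distr_eq) auto
  finally show "integrable M (\<lambda>\<omega>. g (W h \<omega>)) \<longleftrightarrow> integrable std_normal_distribution (\<lambda>x. g (norm h * x))" .
qed

lemma W_all_moments: "all_moments M (W h)"
  unfolding all_moments_def
proof (intro conjI allI W_measurable)
  fix k :: nat
  have "integrable std_normal_distribution (\<lambda>x. norm h ^ k * \<bar>x ^ k\<bar>)"
    using integrable_std_normal_distribution_moment[of k] by auto
  then show "integrable M (\<lambda>\<omega>. \<bar>W h \<omega>\<bar> ^ k)"
    by (subst W_integral(2)) (auto simp: abs_mult power_mult_distrib power_abs)
qed

lemma W_exp_integrable: "integrable M (\<lambda>\<omega>. exp (c * \<bar>W h \<omega>\<bar>))"
proof -
  have "integrable M (\<lambda>\<omega>. exp (c * W h \<omega>) + exp (- c * W h \<omega>))"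
    using integrable_std_normal_exp[of "c * norm h"] integrable_std_normal_exp[of "- c * norm h"]
    by (intro Bochner_Integration.integrable_add; subst W_integral(2)) (auto simp: mult.assoc)
  then show ?thesis
  proof (rule Bochner_Integration.integrable_bound)
    have "exp (c * \<bar>w\<bar>) \<le> exp (c * w) + exp (- c * w)" for w :: real
      by (cases "w \<ge> 0") (auto intro: add_increasing add_increasing2)
    then show "AE \<omega> in M. norm (exp (c * \<bar>W h \<omega>\<bar>)) \<le> norm (exp (c * W h \<omega>) + exp (- c * W h \<omega>))"
      by (intro AE_I2) (simp add: abs_of_pos add_pos_pos)
  qed measurable
qed

lemma W_cos: "(\<integral>\<omega>. cos (W h \<omega>) \<partial>M) = exp (- (norm h)\<^sup>2 / 2)"
  and W_sin: "(\<integral>\<omega>. sin (W h \<omega>) \<partial>M) = 0"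
  by (simp_all add: W_integral(1)[of cos] W_integral(1)[of sin] std_normal_cos std_normal_sin)

lemma W_mult_integrable: "integrable M (\<lambda>\<omega>. W h \<omega> * W k \<omega>)"
  by (intro integrable_mult_L2 all_moments_square_integrable W_all_moments)

text \<open>The covariance gives variance \<open>0\<close> to the difference of the two sides.\<close>

lemma W_linear: "AE \<omega> in M. W (h + c *\<^sub>R k) \<omega> = W h \<omega> + c * W k \<omega>"
proof -
  let ?X = "\<lambda>\<omega>. W (h + c *\<^sub>R k) \<omega> - (W h \<omega> + c * W k \<omega>)"
  have sq: "square_integrable M ?X"
    by (intro all_moments_square_integrable all_moments_diff all_moments_add all_moments_cmult W_all_moments)
  have "(\<integral>\<omega>. (norm (?X \<omega>))\<^sup>2 \<partial>M) = (\<integral>\<omega>. W (h + c *\<^sub>R k) \<omega> * W (h + c *\<^sub>R k) \<omega> + W h \<omega> * W h \<omega> + c\<^sup>2 * (W k \<omega> * W k \<omega>)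
      - 2 * (W (h + c *\<^sub>R k) \<omega> * W h \<omega>) - 2 * c * (W (h + c *\<^sub>R k) \<omega> * W k \<omega>) + 2 * c * (W h \<omega> * W k \<omega>) \<partial>M)"
    by (intro Bochner_Integration.integral_cong) (auto simp: power2_eq_square algebra_simps)
  also have "\<dots> = inner (h + c *\<^sub>R k) (h + c *\<^sub>R k) + inner h h + c\<^sup>2 * inner k k
     - 2 * inner (h + c *\<^sub>R k) h - 2 * c * inner (h + c *\<^sub>R k) k + 2 * c * inner h k"
    by (simp add: W_mult_integrable covariance)
  also have "\<dots> = 0"
    by (simp add: inner_add_left inner_add_right inner_commute power2_eq_square algebra_simps)
  finally have "AE \<omega> in M. ?X \<omega> = 0" by (rule square_norm_zero_AE[OF sq])
  then show ?thesis by eventually_elim simp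
qed

lemma W_zero: "AE \<omega> in M. W 0 \<omega> = 0"
  using W_linear[of 0 1 0] by eventually_elim simp

lemma W_scaleR: "AE \<omega> in M. W (c *\<^sub>R k) \<omega> = c * W k \<omega>"
  using W_linear[of 0 c k] W_zero by eventually_elim simp

end

section \<open>Independence of orthogonal directions\<close>

context isonormal_gaussian_process begin

definition W_events :: "'h set \<Rightarrow> 'a set set" where
  "W_events S = {W h -` A \<inter> space M | h A. h \<in> S \<and> A \<in> sets borel}"

text \<open>Unlike the events \<open>{W h \<in> A}\<close> themselves, these finite intersections form an
  intersection-stable generator. They are indexed by lists so that conditions can be added one
  at a time.\<close>

definition W_cylinder :: "('h \<times> real set) list \<Rightarrow> 'a set" where
  "W_cylinder xs = {\<omega> \<in> space M. \<forall>(h, A)\<in>set xs. W h \<omega> \<in> A}"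

lemma W_cylinder_append: "W_cylinder (xs @ ys) = W_cylinder xs \<inter> W_cylinder ys"
  by (auto simp: W_cylinder_def)

lemma W_cylinder_Cons: "W_cylinder ((h, A) # xs) = (W h -` A \<inter> space M) \<inter> W_cylinder xs"
  by (auto simp: W_cylinder_def)

lemma W_cylinder_sets: "set xs \<subseteq> UNIV \<times> sets borel \<Longrightarrow> W_cylinder xs \<in> sets M"
proof (induction xs)
  case (Cons x xs)
  then show ?case by (cases x) (auto simp: W_cylinder_Cons intro!: measurable_sets[OF W_measurable] sets.Int)
qed (simp add: W_cylinder_def)

text \<open>Turn the characters \<open>exp (i W k)\<close> into indicators of events \<open>W h \<in> A\<close> one direction at a time:
  once the integrals of \<open>Y \<cdot> 1\<^sub>C \<cdot> exp (i W k)\<close> vanish for all \<open>k\<close> in \<open>S\<close>, those against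
  \<open>exp (i W k) exp (i t W h) = exp (i W (k + t h))\<close> vanish too, so uniqueness of characteristic
  functions in the variable \<open>W h\<close> replaces \<open>exp (i t W h)\<close> by an indicator.\<close>

lemma trigonometric_total:
  assumes S: "subspace S" and Y: "integrable M Y"
    and c: "\<And>k. k \<in> S \<Longrightarrow> (\<integral>\<omega>. Y \<omega> * cos (W k \<omega>) \<partial>M) = 0"
    and s: "\<And>k. k \<in> S \<Longrightarrow> (\<integral>\<omega>. Y \<omega> * sin (W k \<omega>) \<partial>M) = 0"
    and B: "B \<in> sigma_sets (space M) (W_events S)"
  shows "(\<integral>\<omega>. Y \<omega> * indicator B \<omega> \<partial>M) = 0"
proof -
  have [measurable]: "Y \<in> borel_measurable M" using Y by auto
  have bnd: "integrable M (\<lambda>\<omega>. Y \<omega> * g \<omega>)" if [measurable]: "g \<in> borel_measurable M" and "\<And>\<omega>. \<bar>g \<omega>\<bar> \<le> 1" for g :: "'a \<Rightarrow> real"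
    by (rule Bochner_Integration.integrable_bound[OF Y])
       (use that in \<open>auto simp: abs_mult intro!: AE_I2 mult_left_le\<close>)
  have main: "(\<integral>\<omega>. Y \<omega> * indicator (W_cylinder xs) \<omega> * cos (W k \<omega>) \<partial>M) = 0 \<and>
              (\<integral>\<omega>. Y \<omega> * indicator (W_cylinder xs) \<omega> * sin (W k \<omega>) \<partial>M) = 0"
    if "set xs \<subseteq> S \<times> sets borel" "k \<in> S" for xs k
    using that
  proof (induction xs arbitrary: k)
    case Nil
    have "(\<integral>\<omega>. Y \<omega> * indicator (W_cylinder []) \<omega> * g \<omega> \<partial>M) = (\<integral>\<omega>. Y \<omega> * g \<omega> \<partial>M)" for g :: "'a \<Rightarrow> real"
      by (intro Bochner_Integration.integral_cong) (auto simp: W_cylinder_def)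
    then show ?case using c[OF Nil(2)] s[OF Nil(2)] by simp
  next
    case (Cons x xs)
    obtain h A where x: "x = (h, A)" by (cases x)
    have hA: "h \<in> S" "A \<in> sets borel" "set xs \<subseteq> S \<times> sets borel" using Cons.prems x by auto
    have [measurable]: "W_cylinder xs \<in> sets M" using hA(3) by (intro W_cylinder_sets) auto
    define f where "f \<omega> = Y \<omega> * indicator (W_cylinder xs) \<omega>" for \<omega>
    have IHc: "(\<integral>\<omega>. f \<omega> * cos (W k \<omega>) \<partial>M) = 0" and IHs: "(\<integral>\<omega>. f \<omega> * sin (W k \<omega>) \<partial>M) = 0" if "k \<in> S" for k
      using Cons.IH[OF hA(3) that] by (auto simp: f_def)
    have [measurable]: "f \<in> borel_measurable M" unfolding f_def by measurable
    have fi: "integrable M (\<lambda>\<omega>. f \<omega> * g \<omega>)" if [measurable]: "g \<in> borel_measurable M" and "\<And>\<omega>. \<bar>g \<omega>\<bar> \<le> 1" for g :: "'a \<Rightarrow> real"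
      unfolding f_def mult.assoc using that(2)
      by (intro bnd) (auto simp: indicator_def)
    have kt: "k + t *\<^sub>R h \<in> S" for t
      using S hA(1) Cons.prems(2) by (auto intro: subspace_add subspace_scale)
    have plus: "AE \<omega> in M. W k \<omega> + t * W h \<omega> = W (k + t *\<^sub>R h) \<omega>"
     and minus: "AE \<omega> in M. W k \<omega> - t * W h \<omega> = W (k + (- t) *\<^sub>R h) \<omega>" for t
      using W_linear[of k t h] W_linear[of k "-t" h] by (eventually_elim, simp)+
    \<comment> \<open>the functions \<open>cos\<close> and \<open>sin\<close> are real and imaginary part of the character; the addition
      theorems express their products through the values at \<open>k + t h\<close> and \<open>k - t h\<close>\<close>
    have tr: "(\<integral>\<omega>. f \<omega> * g (W k \<omega> + t * W h \<omega>) \<partial>M) = 0 \<and> (\<integral>\<omega>. f \<omega> * g (W k \<omega> - t * W h \<omega>) \<partial>M) = 0"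
      if g: "g = cos \<or> g = sin" for g t
    proof -
      have [measurable]: "g \<in> borel_measurable borel" using g by auto
      have "(\<integral>\<omega>. f \<omega> * g (W k \<omega> + t * W h \<omega>) \<partial>M) = (\<integral>\<omega>. f \<omega> * g (W (k + t *\<^sub>R h) \<omega>) \<partial>M)"
        by (intro integral_cong_AE) (measurable, use plus[of t] in eventually_elim, simp)
      moreover have "(\<integral>\<omega>. f \<omega> * g (W k \<omega> - t * W h \<omega>) \<partial>M) = (\<integral>\<omega>. f \<omega> * g (W (k + (- t) *\<^sub>R h) \<omega>) \<partial>M)"
        by (intro integral_cong_AE) (measurable, use minus[of t] in eventually_elim, simp)
      ultimately show ?thesis using g IHc[OF kt[of t]] IHs[OF kt[of t]] IHc[OF kt[of "-t"]] IHs[OF kt[of "-t"]] by auto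
    qed
    have step: "(\<integral>\<omega>. (f \<omega> * g (W k \<omega>)) * indicator A (W h \<omega>) \<partial>M) = 0" if g: "g = cos \<or> g = sin" for g
    proof (rule trigonometric_integrals_zero)
      have [measurable]: "g \<in> borel_measurable borel" using g by auto
      show "integrable M (\<lambda>\<omega>. f \<omega> * g (W k \<omega>))" by (rule fi) (use g in auto)
      have I: "integrable M (\<lambda>\<omega>. f \<omega> * g' (W k \<omega> + t * W h \<omega>))" "integrable M (\<lambda>\<omega>. f \<omega> * g' (W k \<omega> - t * W h \<omega>))"
        if "g' = cos \<or> g' = sin" for g' t
      proof -
        have [measurable]: "g' \<in> borel_measurable borel" using that by auto
        show "integrable M (\<lambda>\<omega>. f \<omega> * g' (W k \<omega> + t * W h \<omega>))" "integrable M (\<lambda>\<omega>. f \<omega> * g' (W k \<omega> - t * W h \<omega>))"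
          by (intro fi; use that in auto)+
      qed
      show "(\<integral>\<omega>. f \<omega> * g (W k \<omega>) * cos (t * W h \<omega>) \<partial>M) = 0" for t
      proof -
        have "(\<integral>\<omega>. f \<omega> * g (W k \<omega>) * cos (t * W h \<omega>) \<partial>M) =
           (\<integral>\<omega>. (f \<omega> * g (W k \<omega> + t * W h \<omega>) + f \<omega> * g (W k \<omega> - t * W h \<omega>)) / 2 \<partial>M)"
          using g by (intro Bochner_Integration.integral_cong) (auto simp: cos_times_cos sin_times_cos field_simps mult.assoc)
        also have "\<dots> = 0" using I[OF g, of t] tr[OF g, of t] by simp
        finally show ?thesis .
      qed
      show "(\<integral>\<omega>. f \<omega> * g (W k \<omega>) * sin (t * W h \<omega>) \<partial>M) = 0" for t
      proof -
        from g have "(\<exists>g' e. (g' = cos \<or> g' = sin) \<and> (\<forall>a b. g a * sin b = e * (g' (a + b) - g' (a - b)) / 2))"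
        proof
          assume "g = cos" then show ?thesis by (intro exI[of _ sin] exI[of _ 1]) (auto simp: cos_times_sin)
        next
          assume "g = sin" then show ?thesis by (intro exI[of _ cos] exI[of _ "-1"]) (auto simp: sin_times_sin)
        qed
        then obtain g' e where g': "g' = cos \<or> g' = sin" and e: "\<And>a b. g a * sin b = e * (g' (a + b) - g' (a - b)) / 2"
          by blast
        have "(\<integral>\<omega>. f \<omega> * g (W k \<omega>) * sin (t * W h \<omega>) \<partial>M) =
           (\<integral>\<omega>. e * (f \<omega> * g' (W k \<omega> + t * W h \<omega>) - f \<omega> * g' (W k \<omega> - t * W h \<omega>)) / 2 \<partial>M)"
          by (intro Bochner_Integration.integral_cong refl, simp only: mult.assoc e) (simp add: field_simps)
        also have "\<dots> = 0" using I[OF g', of t] tr[OF g', of t] by simp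
        finally show ?thesis .
      qed
    qed (use hA in measurable)
    have "(\<integral>\<omega>. Y \<omega> * indicator (W_cylinder (x # xs)) \<omega> * g (W k \<omega>) \<partial>M) =
      (\<integral>\<omega>. (f \<omega> * g (W k \<omega>)) * indicator A (W h \<omega>) \<partial>M)" for g :: "real \<Rightarrow> real"
      by (intro Bochner_Integration.integral_cong) (auto simp: x W_cylinder_Cons f_def indicator_def)
    then show ?case using step[of cos] step[of sin] by simp
  qed
  let ?G = "{W_cylinder xs | xs. set xs \<subseteq> S \<times> sets borel}"
  have ind: "(LINT \<omega>:W_cylinder xs|M. Y \<omega>) = 0" if xs: "set xs \<subseteq> S \<times> sets borel" for xs
  proof -
    have 0: "(0::'h) \<in> S" using S by (rule subspace_0)
    have [measurable]: "W_cylinder xs \<in> sets M" using xs by (intro W_cylinder_sets) auto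
    have "(LINT \<omega>:W_cylinder xs|M. Y \<omega>) = (\<integral>\<omega>. Y \<omega> * indicator (W_cylinder xs) \<omega> * cos (W 0 \<omega>) \<partial>M)"
      unfolding set_lebesgue_integral_def
      by (intro integral_cong_AE) (measurable, use W_zero in eventually_elim, simp)
    then show ?thesis using main[OF xs 0] by simp
  qed
  have "(LINT \<omega>:B|M. Y \<omega>) = 0"
  proof (rule set_integral_zero_sigma_sets[OF Y])
    show "Int_stable ?G"
    proof (rule Int_stableI)
      fix a b assume "a \<in> ?G" "b \<in> ?G"
      then obtain xs ys where "a = W_cylinder xs" "b = W_cylinder ys" "set xs \<subseteq> S \<times> sets borel" "set ys \<subseteq> S \<times> sets borel"
        by auto
      then show "a \<inter> b \<in> ?G" by (auto simp: W_cylinder_append[symmetric] intro!: exI[of _ "xs @ ys"])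
    qed
    show "?G \<subseteq> sets M" by (auto intro!: W_cylinder_sets)
    show "(LINT \<omega>:A|M. Y \<omega>) = 0" if "A \<in> ?G" for A using that ind by auto
    have "(LINT \<omega>|M. Y \<omega>) = (LINT \<omega>:W_cylinder []|M. Y \<omega>)"
      unfolding set_lebesgue_integral_def by (intro Bochner_Integration.integral_cong) (auto simp: W_cylinder_def)
    then show "(LINT \<omega>|M. Y \<omega>) = 0" using ind[of "[]"] by simp
    have "W_events S \<subseteq> ?G"
    proof
      fix E assume "E \<in> W_events S"
      then obtain h A where "h \<in> S" "A \<in> sets borel" "E = W h -` A \<inter> space M" by (auto simp: W_events_def)
      then show "E \<in> ?G" by (auto simp: W_cylinder_def intro!: exI[of _ "[(h, A)]"])
    qed
    then show "B \<in> sigma_sets (space M) ?G"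
      using B sigma_sets_mono'[of "W_events S" ?G] by blast
  qed
  then show ?thesis by (simp add: set_lebesgue_integral_def mult.commute)
qed

text \<open>The addition theorems reduce the products to values at \<open>W k \<plusminus> t W h = W (k \<plusminus> t h)\<close>, which
  has variance \<open>\<bar>k\<bar>\<^sup>2 + t\<^sup>2\<close> for both signs because \<open>h\<close> and \<open>k\<close> are orthogonal.\<close>

lemma W_trig_product:
  assumes "inner h k = 0" "norm h = 1"
  shows "(\<integral>\<omega>. cos (W k \<omega>) * cos (t * W h \<omega>) \<partial>M) = (\<integral>\<omega>. cos (W k \<omega>) \<partial>M) * (\<integral>\<omega>. cos (t * W h \<omega>) \<partial>M)"
    and "(\<integral>\<omega>. cos (W k \<omega>) * sin (t * W h \<omega>) \<partial>M) = 0"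
    and "(\<integral>\<omega>. sin (W k \<omega>) * cos (t * W h \<omega>) \<partial>M) = 0"
    and "(\<integral>\<omega>. sin (W k \<omega>) * sin (t * W h \<omega>) \<partial>M) = 0"
proof -
  have I: "integrable M (\<lambda>\<omega>. cos (W h \<omega>))" "integrable M (\<lambda>\<omega>. sin (W h \<omega>))" for h
    by (intro integrable_const_bound[where B = 1]; auto)+
  have n: "(norm (k + s *\<^sub>R h))\<^sup>2 = (norm k)\<^sup>2 + s\<^sup>2" for s
    unfolding power2_norm_eq_inner using assms
    by (simp add: inner_add_left inner_add_right inner_commute norm_eq_1 power2_eq_square)
  note n' = n[of "- t", simplified]
  have eq: "(\<integral>\<omega>. a (W k \<omega>) * b (t * W h \<omega>) \<partial>M) = (\<integral>\<omega>. e * f (W (k + t *\<^sub>R h) \<omega>) + e' * f (W (k + (-t) *\<^sub>R h) \<omega>) \<partial>M)"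
    if e: "\<And>x y. a x * b y = e * f (x + y) + e' * f (x - y)"
     and [measurable]: "a \<in> borel_measurable borel" "b \<in> borel_measurable borel" "f \<in> borel_measurable borel"
    for a b f :: "real \<Rightarrow> real" and e e'
  proof (rule integral_cong_AE)
    show "AE \<omega> in M. a (W k \<omega>) * b (t * W h \<omega>) = e * f (W (k + t *\<^sub>R h) \<omega>) + e' * f (W (k + (-t) *\<^sub>R h) \<omega>)"
      using W_linear[of k t h] W_linear[of k "-t" h] by eventually_elim (simp add: e)
  qed measurable
  have tc: "(\<integral>\<omega>. cos (t * W h \<omega>) \<partial>M) = exp (- t\<^sup>2 / 2)"
    using assms(2) std_normal_cos[of t] by (subst W_integral(1)) auto
  show "(\<integral>\<omega>. cos (W k \<omega>) * cos (t * W h \<omega>) \<partial>M) = (\<integral>\<omega>. cos (W k \<omega>) \<partial>M) * (\<integral>\<omega>. cos (t * W h \<omega>) \<partial>M)"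
    by (subst eq[of cos cos "1/2" cos "1/2"], simp add: cos_times_cos add_divide_distrib diff_divide_distrib, simp_all add: I W_cos n n' tc exp_add[symmetric] field_simps)
  show "(\<integral>\<omega>. cos (W k \<omega>) * sin (t * W h \<omega>) \<partial>M) = 0"
    by (subst eq[of cos sin "1/2" sin "-1/2"], simp add: cos_times_sin add_divide_distrib diff_divide_distrib, simp_all add: I W_sin field_simps)
  show "(\<integral>\<omega>. sin (W k \<omega>) * cos (t * W h \<omega>) \<partial>M) = 0"
    by (subst eq[of sin cos "1/2" sin "1/2"], simp add: sin_times_cos add_divide_distrib diff_divide_distrib, simp_all add: I W_sin field_simps)
  show "(\<integral>\<omega>. sin (W k \<omega>) * sin (t * W h \<omega>) \<partial>M) = 0"
    by (subst eq[of sin sin "-1/2" cos "1/2"], simp add: sin_times_sin add_divide_distrib diff_divide_distrib, simp_all add: I W_cos n n' field_simps)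
qed

text \<open>For orthogonal \<open>h\<close> and \<open>k\<close> the characters of \<open>W h\<close> and \<open>W k\<close> are uncorrelated; the two
  uniqueness results upgrade this to independence of \<open>W h\<close> from all of \<open>{W k | k \<bottom> h}\<close>.\<close>

lemma W_independent_orthogonal:
  assumes h: "norm h = 1" and A: "A \<in> sets borel"
    and B: "B \<in> sigma_sets (space M) (W_events {k. inner h k = 0})"
  shows "(\<integral>\<omega>. indicator A (W h \<omega>) * indicator B \<omega> \<partial>M) = (\<integral>\<omega>. indicator A (W h \<omega>) \<partial>M) * (\<integral>\<omega>. indicator B \<omega> \<partial>M :: real)"
proof -
  let ?S = "{k. inner h k = 0}" and ?p = "\<integral>\<omega>. indicator A (W h \<omega>) \<partial>M :: real"
  have S: "subspace ?S" by (auto simp: subspace_def inner_add_right)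
  have [measurable]: "A \<in> sets borel" by fact
  have iA: "integrable M (\<lambda>\<omega>. indicator A (W h \<omega>) * g \<omega> :: real)" if [measurable]: "g \<in> borel_measurable M" and "\<And>\<omega>. \<bar>g \<omega>\<bar> \<le> 1" for g :: "'a \<Rightarrow> real"
    using that(2) by (intro integrable_const_bound[where B = 1]) (auto simp: indicator_def)
  have ig: "integrable M g" if [measurable]: "g \<in> borel_measurable M" and "\<And>\<omega>. \<bar>g \<omega>\<bar> \<le> 1" for g :: "'a \<Rightarrow> real"
    using that(2) by (intro integrable_const_bound[where B = 1]) auto
  have trig: "(\<integral>\<omega>. (g (W k \<omega>) - (\<integral>\<omega>. g (W k \<omega>) \<partial>M)) * indicator A (W h \<omega>) \<partial>M) = 0"
    if g: "g = cos \<or> g = sin" and k: "k \<in> ?S" for g k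
  proof (rule trigonometric_integrals_zero)
    have [measurable]: "g \<in> borel_measurable borel" using g by auto
    have gi: "integrable M (\<lambda>\<omega>. g (W k \<omega>))" by (rule ig) (use g in auto)
    show "integrable M (\<lambda>\<omega>. g (W k \<omega>) - (\<integral>\<omega>. g (W k \<omega>) \<partial>M))" using gi by auto
    have ex: "(\<integral>\<omega>. (g (W k \<omega>) - (\<integral>\<omega>. g (W k \<omega>) \<partial>M)) * f (t * W h \<omega>) \<partial>M)
       = (\<integral>\<omega>. g (W k \<omega>) * f (t * W h \<omega>) \<partial>M) - (\<integral>\<omega>. g (W k \<omega>) \<partial>M) * (\<integral>\<omega>. f (t * W h \<omega>) \<partial>M)"
      if f: "f = cos \<or> f = sin" for f t
    proof -
      have [measurable]: "f \<in> borel_measurable borel" using f by auto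
      have b: "\<bar>g x\<bar> \<le> 1" "\<bar>f x\<bar> \<le> 1" for x using f g by auto
      have 1: "integrable M (\<lambda>\<omega>. f (t * W h \<omega>))" by (rule ig) (use b in auto)
      have 2: "integrable M (\<lambda>\<omega>. g (W k \<omega>) * f (t * W h \<omega>))"
        by (rule ig) (use b in \<open>auto simp: abs_mult intro!: mult_le_one\<close>)
      show ?thesis using 1 2 by (simp add: left_diff_distrib)
    qed
    have k': "inner h k = 0" using k by simp
    have t0: "(\<integral>\<omega>. sin (t * W h \<omega>) \<partial>M) = 0" for t
      using h std_normal_sin[of t] by (subst W_integral(1)) auto
    show "(\<integral>\<omega>. (g (W k \<omega>) - (\<integral>\<omega>. g (W k \<omega>) \<partial>M)) * cos (t * W h \<omega>) \<partial>M) = 0" for t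
      using g by (subst ex) (auto simp: W_trig_product[OF k' h] W_sin)
    show "(\<integral>\<omega>. (g (W k \<omega>) - (\<integral>\<omega>. g (W k \<omega>) \<partial>M)) * sin (t * W h \<omega>) \<partial>M) = 0" for t
      using g by (subst ex) (auto simp: W_trig_product[OF k' h] t0)
  qed measurable
  have z: "(\<integral>\<omega>. (indicator A (W h \<omega>) - ?p) * g (W k \<omega>) \<partial>M) = 0" if g: "g = cos \<or> g = sin" and k: "k \<in> ?S" for g k
  proof -
    have [measurable]: "g \<in> borel_measurable borel" using g by auto
    have b: "\<bar>g x\<bar> \<le> 1" for x using g by auto
    have 1: "integrable M (\<lambda>\<omega>. indicator A (W h \<omega>) * g (W k \<omega>))" by (rule iA) (use b in auto)
    have 2: "integrable M (\<lambda>\<omega>. g (W k \<omega>))" by (rule ig) (use b in auto)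
    have 3: "integrable M (\<lambda>\<omega>. indicator A (W h \<omega>) :: real)" using iA[of "\<lambda>_. 1"] by simp
    show ?thesis using trig[OF g k] 1 2 3 by (simp add: left_diff_distrib right_diff_distrib mult.commute)
  qed
  have int: "integrable M (\<lambda>\<omega>. indicator A (W h \<omega>) - ?p)" using iA[of "\<lambda>_. 1"] by simp
  have "W_events ?S \<subseteq> sets M" by (auto simp: W_events_def)
  then have [measurable]: "B \<in> sets M" using B sets.sigma_sets_subset by blast
  have "(\<integral>\<omega>. (indicator A (W h \<omega>) - ?p) * indicator B \<omega> \<partial>M) = 0"
    by (rule trigonometric_total[OF S int z z B]) auto
  moreover have "integrable M (\<lambda>\<omega>. indicator A (W h \<omega>) * indicator B \<omega> :: real)" by (rule iA) (auto simp: indicator_def)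
  moreover have "integrable M (\<lambda>\<omega>. indicator B \<omega> :: real)" by (rule ig) (auto simp: indicator_def)
  ultimately show ?thesis by (simp add: left_diff_distrib)
qed

end

section \<open>Gaussian integration by parts\<close>

lemma power_std_normal_density_tendsto_0:
  "((\<lambda>x. (1 + \<bar>x\<bar>) ^ k * std_normal_density x) \<longlongrightarrow> 0) at_top"
proof (rule tendsto_sandwich[OF _ _ tendsto_const])
  show "\<forall>\<^sub>F x in at_top. 0 \<le> (1 + \<bar>x\<bar>) ^ k * std_normal_density x" by simp
  have f: "filterlim (\<lambda>x::real. 1 + x) at_top at_top"
    by (rule filterlim_tendsto_add_at_top[OF tendsto_const filterlim_ident])
  have "((\<lambda>x. exp (3/2) * ((1 + x) ^ k / exp (1 + x))) \<longlongrightarrow> exp (3/2) * (0::real)) at_top"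
    by (intro tendsto_mult tendsto_const filterlim_compose[OF tendsto_power_div_exp_0 f])
  then show "((\<lambda>x. exp (3/2) * ((1 + x) ^ k / exp (1 + x))) \<longlongrightarrow> (0::real)) at_top" by simp
  show "\<forall>\<^sub>F x in at_top. (1 + \<bar>x\<bar>) ^ k * std_normal_density x \<le> exp (3/2) * ((1 + x) ^ k / exp (1 + x))"
    using eventually_ge_at_top[of 0]
  proof eventually_elim
    case (elim x)
    have "1 / sqrt (2 * pi) \<le> 1" using pi_gt3 by simp
    then have "std_normal_density x \<le> exp (- x\<^sup>2 / 2)"
      by (simp add: std_normal_density_def divide_le_eq mult_left_le_one_le pi_ge_two)
    \<comment> \<open>the tangent at \<open>x = 1\<close> bounds the exponent by a linear function\<close>
    also have "- x\<^sup>2 / 2 \<le> 3/2 - (1 + x)"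
      using zero_le_power2[of "x - 1"] by (simp add: power2_eq_square field_simps)
    then have "exp (- x\<^sup>2 / 2) \<le> exp (3/2 - (1 + x))" by simp
    also have "\<dots> = exp (3/2) / exp (1 + x)" by (rule exp_diff)
    finally have "std_normal_density x \<le> exp (3/2) / exp (1 + x)" .
    then have "(1 + x) ^ k * std_normal_density x \<le> (1 + x) ^ k * (exp (3/2) / exp (1 + x))"
      using elim by (intro mult_left_mono) auto
    then show ?case using elim by (simp add: mult_ac)
  qed
qed

text \<open>Stein's identity: the derivative of \<open>\<phi>\<close> times the density is the difference of the two
  integrands, and its integral vanishes because of the growth bound on \<open>\<phi>\<close>.\<close>

lemma std_normal_integration_by_parts:
  fixes \<phi> \<phi>' :: "real \<Rightarrow> real"
  assumes d: "\<And>s. (\<phi> has_real_derivative \<phi>' s) (at s)"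
    and c: "continuous_on UNIV \<phi>'"
    and growth: "\<And>s. \<bar>\<phi> s\<bar> \<le> C * (1 + \<bar>s\<bar>) ^ k"
    and i1: "integrable std_normal_distribution (\<lambda>s. s * \<phi> s)"
    and i2: "integrable std_normal_distribution \<phi>'"
  shows "(\<integral>s. s * \<phi> s \<partial>std_normal_distribution) = (\<integral>s. \<phi>' s \<partial>std_normal_distribution)"
proof -
  let ?g = std_normal_density
  have c0: "continuous_on UNIV \<phi>"
    using d by (intro DERIV_continuous_on) (auto intro: DERIV_subset)
  have [measurable]: "\<phi> \<in> borel_measurable borel" "\<phi>' \<in> borel_measurable borel"
    using c c0 by (auto intro: borel_measurable_continuous_onI)
  have j: "integrable lborel (\<lambda>s. ?g s * (s * \<phi> s))" "integrable lborel (\<lambda>s. ?g s * \<phi>' s)"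
    using i1 i2 by (simp_all add: integrable_real_density)
  let ?F = "\<lambda>s. \<phi> s * ?g s" and ?f = "\<lambda>s. ?g s * \<phi>' s - ?g s * (s * \<phi> s)"
  have dg: "(?g has_real_derivative - s * ?g s) (at s)" for s
  proof -
    obtain K where K: "?g = (\<lambda>s. K * exp (- s\<^sup>2 / 2))"
    proof
      show "?g = (\<lambda>s. (1 / sqrt (2 * pi)) * exp (- s\<^sup>2 / 2))" by (simp add: std_normal_density_def fun_eq_iff)
    qed
    show ?thesis unfolding K by (auto intro!: derivative_eq_intros)
  qed
  have dF: "(?F has_real_derivative ?f s) (at s)" for s
    by (auto intro!: derivative_eq_intros d dg simp: algebra_simps)
  have Fb: "norm (?F x) \<le> C * ((1 + \<bar>x\<bar>) ^ k * ?g x)" for x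
    using mult_right_mono[OF growth[of x], of "?g x"] by (simp add: abs_mult mult.assoc)
  have lim: "((\<lambda>x. C * ((1 + \<bar>x\<bar>) ^ k * ?g x)) \<longlongrightarrow> 0) at_top"
    using tendsto_mult[OF tendsto_const[of C] power_std_normal_density_tendsto_0[of k]] by simp
  have top: "(?F \<longlongrightarrow> 0) at_top"
    by (rule Lim_null_comparison[OF _ lim]) (use Fb in \<open>auto intro!: always_eventually\<close>)
  have bot: "(?F \<longlongrightarrow> 0) at_bot"
    unfolding filterlim_at_bot_mirror
  proof (rule Lim_null_comparison[OF _ lim], intro always_eventually allI)
    fix x show "norm (?F (- x)) \<le> C * ((1 + \<bar>x\<bar>) ^ k * ?g x)"
      using Fb[of "-x"] by (simp add: std_normal_density_def)
  qed
  have cf: "isCont ?f x" for x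
    using c c0 by (auto simp: continuous_on_eq_continuous_at std_normal_density_def intro!: continuous_intros)
  have "(LBINT s=-\<infinity>..\<infinity>. ?f s) = 0 - 0"
  proof (rule interval_integral_FTC_integrable)
    show "(?F has_vector_derivative ?f x) (at x)" for x
      using dF[of x] by (simp add: has_real_derivative_iff_has_vector_derivative)
    show "isCont ?f x" for x by (rule cf)
    show "set_integrable lborel (einterval (-\<infinity>) \<infinity>) ?f"
      using j by (simp add: set_integrable_def)
    show "((?F \<circ> real_of_ereal) \<longlongrightarrow> 0) (at_right (-\<infinity>))" using bot by (simp add: ereal_tendsto_simps1)
    show "((?F \<circ> real_of_ereal) \<longlongrightarrow> 0) (at_left \<infinity>)" using top by (simp add: ereal_tendsto_simps1)
  qed simp
  then have "(\<integral>s. ?f s \<partial>lborel) = 0"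
    by (simp add: interval_integral_to_infinity_eq interval_lebesgue_integral_def set_lebesgue_integral_def)
  then show ?thesis using j by (simp add: integral_real_density)
qed

subsection \<open>Continuously differentiable functions of polynomial growth\<close>

text \<open>Integration by parts takes one derivative. Recording no more than the first partial
  derivatives \<open>f'\<close> keeps the class closed under composition with a merely \<open>C\<^sup>1\<close> function of
  bounded derivative.\<close>

definition C1_growth :: "nat \<Rightarrow> ((nat \<Rightarrow> real) \<Rightarrow> real) \<Rightarrow> (nat \<Rightarrow> (nat \<Rightarrow> real) \<Rightarrow> real) \<Rightarrow> bool" where
  "C1_growth n f f' \<longleftrightarrow> (\<forall>x y. (\<forall>i<n. x i = y i) \<longrightarrow> f x = f y) \<and>
     continuous_on UNIV f \<and> (\<exists>C k. \<forall>x. \<bar>f x\<bar> \<le> C * (1 + (\<Sum>i<n. \<bar>x i\<bar>)) ^ k) \<and>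
     (\<forall>i<n. continuous_on UNIV (f' i) \<and> (\<exists>C k. \<forall>x. \<bar>f' i x\<bar> \<le> C * (1 + (\<Sum>i<n. \<bar>x i\<bar>)) ^ k) \<and>
        (\<forall>x. ((\<lambda>t. f (x(i := t))) has_real_derivative f' i x) (at (x i))))"

lemma C1_growthD:
  assumes "C1_growth n f f'"
  shows "\<And>x y. (\<And>i. i < n \<Longrightarrow> x i = y i) \<Longrightarrow> f x = f y"
    "continuous_on UNIV f" "\<exists>C k. \<forall>x. \<bar>f x\<bar> \<le> C * (1 + (\<Sum>i<n. \<bar>x i\<bar>)) ^ k"
    "\<And>i. i < n \<Longrightarrow> continuous_on UNIV (f' i)"
    "\<And>i. i < n \<Longrightarrow> \<exists>C k. \<forall>x. \<bar>f' i x\<bar> \<le> C * (1 + (\<Sum>i<n. \<bar>x i\<bar>)) ^ k"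
    "\<And>i x. i < n \<Longrightarrow> ((\<lambda>t. f (x(i := t))) has_real_derivative f' i x) (at (x i))"
  using assms unfolding C1_growth_def by blast+

lemma MVT_around:
  fixes g g' :: "real \<Rightarrow> real"
  assumes "\<And>r. (g has_real_derivative g' r) (at r)"
  shows "\<exists>\<theta>. \<bar>\<theta> - s0\<bar> \<le> \<bar>s - s0\<bar> \<and> g s - g s0 = (s - s0) * g' \<theta>"
proof (cases s s0 rule: linorder_cases)
  case less
  obtain z where "s < z" "z < s0" "g s0 - g s = (s0 - s) * g' z"
    using MVT2[OF less assms] by auto
  then show ?thesis by (intro exI[of _ z]) (auto simp: algebra_simps)
next
  case greater
  obtain z where "s0 < z" "z < s" "g s - g s0 = (s - s0) * g' z"
    using MVT2[OF greater assms] by auto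
  then show ?thesis by (intro exI[of _ z]) auto
qed auto

lemma tendsto_coordinatewise:
  fixes f :: "'a \<Rightarrow> 'i \<Rightarrow> 'b::topological_space"
  assumes "\<And>i. ((\<lambda>x. f x i) \<longlongrightarrow> l i) F"
  shows "(f \<longlongrightarrow> l) F"
proof -
  have "limitin (product_topology (\<lambda>_. euclidean) UNIV) f l F"
    unfolding limitin_componentwise using assms by (simp add: limitin_canonical_iff)
  then show ?thesis by (simp only: euclidean_product_topology limitin_canonical_iff)
qed

text \<open>The chain rule along a line, from continuous partial derivatives: change the coordinates one
  after the other and apply the mean value theorem to each change.\<close>

lemma C1_growth_line_derivative:
  assumes f: "C1_growth n f f'"
  shows "((\<lambda>s. f (\<lambda>i. c i * s + b i)) has_real_derivative (\<Sum>i<n. c i * f' i (\<lambda>i. c i * s0 + b i))) (at s0)"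
proof -
  note D = C1_growthD[OF f]
  \<comment> \<open>\<open>P m s\<close> runs along the line in the first \<open>m\<close> coordinates and stays at its position for \<open>s0\<close>
    in the others; \<open>y s r\<close> below moves coordinate \<open>m\<close> separately\<close>
  define P where "P m s i = (if i < m then c i * s + b i else c i * s0 + b i)" for m s and i :: nat
  have P0: "P m s0 = (\<lambda>i. c i * s0 + b i)" for m by (auto simp: P_def)
  have "((\<lambda>s. f (P m s)) has_real_derivative (\<Sum>i<m. c i * f' i (\<lambda>i. c i * s0 + b i))) (at s0)" if "m \<le> n" for m
    using that
  proof (induction m)
    case 0
    have "f (P 0 s) = f (P 0 s0)" for s by (intro arg_cong[where f = f] ext) (simp add: P_def)
    then have "(\<lambda>s. f (P 0 s)) = (\<lambda>s. f (P 0 s0))" by (rule ext)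
    then show ?case by simp
  next
    case (Suc m)
    then have m: "m < n" by simp
    define y where "y s r = (P m s)(m := c m * r + b m)" for s r
    have yS: "y s s = P (Suc m) s" for s by (auto simp: y_def P_def)
    have y0: "y s s0 = P m s" for s by (auto simp: y_def P_def)
    have dy: "((\<lambda>r. f (y s r)) has_real_derivative c m * f' m (y s r)) (at r)" for s r
    proof -
      have "((\<lambda>t. f ((y s r)(m := t))) has_real_derivative f' m (y s r)) (at (c m * r + b m))"
        using D(6)[OF m, of "y s r"] by (simp add: y_def)
      then have "((\<lambda>t. f ((P m s)(m := t))) has_real_derivative f' m (y s r)) (at (c m * r + b m))"
        by (simp add: y_def)
      then have "((\<lambda>r. f ((P m s)(m := c m * r + b m))) has_real_derivative f' m (y s r) * c m) (at r)"
        by (rule DERIV_chain2[where f = "\<lambda>t. f ((P m s)(m := t))" and g = "\<lambda>r. c m * r + b m"])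
           (auto intro!: derivative_eq_intros)
      then show ?thesis by (simp add: y_def mult.commute)
    qed
    obtain \<theta> where \<theta>: "\<And>s. \<bar>\<theta> s - s0\<bar> \<le> \<bar>s - s0\<bar>"
      "\<And>s. f (y s s) - f (y s s0) = (s - s0) * (c m * f' m (y s (\<theta> s)))"
    proof -
      have "\<exists>\<theta>. \<bar>\<theta> - s0\<bar> \<le> \<bar>s - s0\<bar> \<and> f (y s s) - f (y s s0) = (s - s0) * (c m * f' m (y s \<theta>))" for s
        by (rule MVT_around[where g = "\<lambda>r. f (y s r)" and g' = "\<lambda>r. c m * f' m (y s r)"]) (rule dy)
      then show ?thesis using that by metis
    qed
    have t\<theta>: "(\<theta> \<longlongrightarrow> s0) (at s0)"
    proof -
      have "((\<lambda>s. \<theta> s - s0) \<longlongrightarrow> 0) (at s0)"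
      proof (rule Lim_null_comparison)
        show "\<forall>\<^sub>F s in at s0. norm (\<theta> s - s0) \<le> \<bar>s - s0\<bar>" using \<theta>(1) by auto
        show "((\<lambda>s. \<bar>s - s0\<bar>) \<longlongrightarrow> 0) (at s0)" by (auto intro!: tendsto_eq_intros)
      qed
      then show ?thesis by (simp add: LIM_zero_iff)
    qed
    have "((\<lambda>s. y s (\<theta> s)) \<longlongrightarrow> (\<lambda>i. c i * s0 + b i)) (at s0)"
    proof (rule tendsto_coordinatewise)
      fix i
      consider "i < m" | "i = m" | "i > m" by linarith
      then show "((\<lambda>s. y s (\<theta> s) i) \<longlongrightarrow> c i * s0 + b i) (at s0)"
        by cases (auto simp: y_def P_def intro!: tendsto_intros t\<theta>)
    qed
    moreover have "isCont (f' m) (\<lambda>i. c i * s0 + b i)"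
      using D(4)[OF m] by (simp add: continuous_on_eq_continuous_at)
    ultimately have "((\<lambda>s. f' m (y s (\<theta> s))) \<longlongrightarrow> f' m (\<lambda>i. c i * s0 + b i)) (at s0)"
      by (rule isCont_tendsto_compose[rotated])
    then have "((\<lambda>s. c m * f' m (y s (\<theta> s))) \<longlongrightarrow> c m * f' m (\<lambda>i. c i * s0 + b i)) (at s0)"
      by (intro tendsto_intros)
    moreover have "\<forall>\<^sub>F s in at s0. c m * f' m (y s (\<theta> s)) = ((f (y s s) - f (y s s0)) - (f (y s0 s0) - f (y s0 s0))) / (s - s0)"
      unfolding eventually_at_filter by (auto simp: \<theta>(2))
    ultimately have "((\<lambda>s. ((f (y s s) - f (y s s0)) - (f (y s0 s0) - f (y s0 s0))) / (s - s0)) \<longlongrightarrow> c m * f' m (\<lambda>i. c i * s0 + b i)) (at s0)"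
      by (rule Lim_transform_eventually)
    then have "((\<lambda>s. f (y s s) - f (y s s0)) has_real_derivative c m * f' m (\<lambda>i. c i * s0 + b i)) (at s0)"
      by (simp add: has_field_derivative_iff)
    from DERIV_add[OF this Suc.IH] m
    show ?case by (simp add: yS y0 add.commute)
  qed
  from this[of n]
  have "((\<lambda>s. f (P n s)) has_real_derivative (\<Sum>i<n. c i * f' i (\<lambda>i. c i * s0 + b i))) (at s0)" by simp
  moreover have "f (P n s) = f (\<lambda>i. c i * s + b i)" for s
    by (rule D(1)) (auto simp: P_def)
  ultimately show ?thesis by simp
qed

lemma growth_mono:
  fixes x :: "nat \<Rightarrow> real"
  assumes "\<bar>a\<bar> \<le> C * (1 + (\<Sum>i<n. \<bar>x i\<bar>)) ^ k" "k \<le> k'" "C \<le> C'"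
  shows "\<bar>a\<bar> \<le> C' * (1 + (\<Sum>i<n. \<bar>x i\<bar>)) ^ k'"
proof -
  have 1: "1 \<le> 1 + (\<Sum>i<n. \<bar>x i\<bar>)" by (simp add: sum_nonneg)
  then have p: "0 < (1 + (\<Sum>i<n. \<bar>x i\<bar>)) ^ k" by (intro zero_less_power) linarith
  have "0 \<le> C * (1 + (\<Sum>i<n. \<bar>x i\<bar>)) ^ k" using assms(1) by (rule order_trans[rotated]) simp
  then have "0 \<le> C" using p by (simp add: zero_le_mult_iff)
  then have "C * (1 + (\<Sum>i<n. \<bar>x i\<bar>)) ^ k \<le> C' * (1 + (\<Sum>i<n. \<bar>x i\<bar>)) ^ k'"
    using assms 1 by (intro mult_mono power_increasing) auto
  then show ?thesis using assms(1) by linarith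
qed

lemma growth_add:
  fixes f g :: "(nat \<Rightarrow> real) \<Rightarrow> real"
  assumes "\<exists>C k. \<forall>x. \<bar>f x\<bar> \<le> C * (1 + (\<Sum>i<n. \<bar>x i\<bar>)) ^ k" "\<exists>C k. \<forall>x. \<bar>g x\<bar> \<le> C * (1 + (\<Sum>i<n. \<bar>x i\<bar>)) ^ k"
  shows "\<exists>C k. \<forall>x. \<bar>f x + g x\<bar> \<le> C * (1 + (\<Sum>i<n. \<bar>x i\<bar>)) ^ k"
proof -
  obtain C k C' k' where b: "\<And>x. \<bar>f x\<bar> \<le> C * (1 + (\<Sum>i<n. \<bar>x i\<bar>)) ^ k" "\<And>x. \<bar>g x\<bar> \<le> C' * (1 + (\<Sum>i<n. \<bar>x i\<bar>)) ^ k'"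
    using assms by blast
  have "\<bar>f x + g x\<bar> \<le> (C + C') * (1 + (\<Sum>i<n. \<bar>x i\<bar>)) ^ (max k k')" for x
    using growth_mono[OF b(1)[of x], of "max k k'" C] growth_mono[OF b(2)[of x], of "max k k'" C']
    by (simp add: distrib_right)
  then show ?thesis by blast
qed

lemma growth_mult:
  fixes f g :: "(nat \<Rightarrow> real) \<Rightarrow> real"
  assumes "\<exists>C k. \<forall>x. \<bar>f x\<bar> \<le> C * (1 + (\<Sum>i<n. \<bar>x i\<bar>)) ^ k" "\<exists>C k. \<forall>x. \<bar>g x\<bar> \<le> C * (1 + (\<Sum>i<n. \<bar>x i\<bar>)) ^ k"
  shows "\<exists>C k. \<forall>x. \<bar>f x * g x\<bar> \<le> C * (1 + (\<Sum>i<n. \<bar>x i\<bar>)) ^ k"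
proof -
  obtain C k C' k' where b: "\<And>x. \<bar>f x\<bar> \<le> C * (1 + (\<Sum>i<n. \<bar>x i\<bar>)) ^ k" "\<And>x. \<bar>g x\<bar> \<le> C' * (1 + (\<Sum>i<n. \<bar>x i\<bar>)) ^ k'"
    using assms by blast
  have "\<bar>f x * g x\<bar> \<le> (C * C') * (1 + (\<Sum>i<n. \<bar>x i\<bar>)) ^ (k + k')" for x
  proof -
    have "\<bar>f x * g x\<bar> \<le> (C * (1 + (\<Sum>i<n. \<bar>x i\<bar>)) ^ k) * (C' * (1 + (\<Sum>i<n. \<bar>x i\<bar>)) ^ k')"
      unfolding abs_mult using b[of x] by (intro mult_mono) (auto intro: order_trans[OF abs_ge_zero])
    then show ?thesis by (simp add: power_add mult_ac)
  qed
  then show ?thesis by blast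
qed

lemma growth_const: "\<exists>C k. \<forall>x::nat \<Rightarrow> real. \<bar>c\<bar> \<le> C * (1 + (\<Sum>i<n. \<bar>x i\<bar>)) ^ k"
  by (intro exI[of _ "\<bar>c\<bar>"] exI[of _ 0]) simp

lemma C1_growth_mult:
  assumes f: "C1_growth n f f'" and g: "C1_growth n g g'"
  shows "C1_growth n (\<lambda>x. f x * g x) (\<lambda>i x. f' i x * g x + f x * g' i x)"
  unfolding C1_growth_def
proof (intro conjI allI impI)
  note F = C1_growthD[OF f] and G = C1_growthD[OF g]
  show "f x * g x = f y * g y" if "\<forall>i<n. x i = y i" for x y
    using F(1)[of x y] G(1)[of x y] that by auto
  show "continuous_on UNIV (\<lambda>x. f x * g x)" by (rule continuous_on_mult[OF F(2) G(2)])
  show "\<exists>C k. \<forall>x. \<bar>f x * g x\<bar> \<le> C * (1 + (\<Sum>i<n. \<bar>x i\<bar>)) ^ k" by (rule growth_mult[OF F(3) G(3)])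
  fix i assume i: "i < n"
  show "continuous_on UNIV (\<lambda>x. f' i x * g x + f x * g' i x)" by (intro continuous_on_add continuous_on_mult F(2,4) G(2,4) i)
  show "\<exists>C k. \<forall>x. \<bar>f' i x * g x + f x * g' i x\<bar> \<le> C * (1 + (\<Sum>i<n. \<bar>x i\<bar>)) ^ k"
    by (rule growth_add[OF growth_mult[OF F(5)[OF i] G(3)] growth_mult[OF F(3) G(5)[OF i]]])
  show "((\<lambda>t. f (x(i := t)) * g (x(i := t))) has_real_derivative f' i x * g x + f x * g' i x) (at (x i))" for x
    using DERIV_mult[OF F(6)[OF i, of x] G(6)[OF i, of x]] by (simp add: add.commute mult.commute)
qed

text \<open>A bounded derivative makes \<open>\<phi>\<close> of linear growth, so that polynomial growth survives the
  composition.\<close>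

lemma C1_growth_compose:
  fixes \<phi> \<phi>' :: "real \<Rightarrow> real"
  assumes f: "C1_growth n f f'" and d: "\<And>y. (\<phi> has_real_derivative \<phi>' y) (at y)"
    and c: "continuous_on UNIV \<phi>'" and b: "\<And>y. \<bar>\<phi>' y\<bar> \<le> K"
  shows "C1_growth n (\<lambda>x. \<phi> (f x)) (\<lambda>i x. \<phi>' (f x) * f' i x)"
  unfolding C1_growth_def
proof (intro conjI allI impI)
  note F = C1_growthD[OF f]
  have c0: "continuous_on UNIV \<phi>"
    using d by (intro DERIV_continuous_on) (auto intro: DERIV_subset)
  show "\<phi> (f x) = \<phi> (f y)" if "\<forall>i<n. x i = y i" for x y
    using F(1)[of x y] that by auto
  show "continuous_on UNIV (\<lambda>x. \<phi> (f x))" by (rule continuous_on_compose2[OF c0 F(2)]) auto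
  have lip: "\<bar>\<phi> y\<bar> \<le> \<bar>\<phi> 0\<bar> + K * \<bar>y\<bar>" for y
  proof -
    obtain \<theta> where "\<phi> y - \<phi> 0 = y * \<phi>' \<theta>" using MVT_around[OF d, of 0 y] by auto
    then have "\<bar>\<phi> y\<bar> \<le> \<bar>\<phi> 0\<bar> + \<bar>y\<bar> * \<bar>\<phi>' \<theta>\<bar>" by (simp add: abs_mult[symmetric])
    also have "\<dots> \<le> \<bar>\<phi> 0\<bar> + \<bar>y\<bar> * K" using b[of \<theta>] by (intro add_left_mono mult_left_mono) auto
    finally show ?thesis by (simp add: mult.commute)
  qed
  have "\<exists>C k. \<forall>x. \<bar>\<bar>f x\<bar>\<bar> \<le> C * (1 + (\<Sum>i<n. \<bar>x i\<bar>)) ^ k" using F(3) by simp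
  from growth_add[OF growth_const growth_mult[OF growth_const this], of "\<bar>\<phi> 0\<bar>" K]
  obtain C k where Ck: "\<And>x. \<bar>\<bar>\<phi> 0\<bar> + K * \<bar>f x\<bar>\<bar> \<le> C * (1 + (\<Sum>i<n. \<bar>x i\<bar>)) ^ k" by blast
  have "\<bar>\<phi> (f x)\<bar> \<le> C * (1 + (\<Sum>i<n. \<bar>x i\<bar>)) ^ k" for x
    using lip[of "f x"] Ck[of x] by linarith
  then show "\<exists>C k. \<forall>x. \<bar>\<phi> (f x)\<bar> \<le> C * (1 + (\<Sum>i<n. \<bar>x i\<bar>)) ^ k" by blast
  fix i assume i: "i < n"
  show "continuous_on UNIV (\<lambda>x. \<phi>' (f x) * f' i x)"
    by (rule continuous_on_mult[OF continuous_on_compose2[OF c F(2)] F(4)[OF i]]) simp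
  show "\<exists>C k. \<forall>x. \<bar>\<phi>' (f x) * f' i x\<bar> \<le> C * (1 + (\<Sum>i<n. \<bar>x i\<bar>)) ^ k"
  proof (rule growth_mult[OF _ F(5)[OF i]])
    show "\<exists>C k. \<forall>x. \<bar>\<phi>' (f x)\<bar> \<le> C * (1 + (\<Sum>i<n. \<bar>x i\<bar>)) ^ k"
      using b by (intro exI[of _ K] exI[of _ 0]) auto
  qed
  show "((\<lambda>t. \<phi> (f (x(i := t)))) has_real_derivative \<phi>' (f x) * f' i x) (at (x i))" for x
  proof -
    have "(\<phi> has_real_derivative \<phi>' (f x)) (at (f (x(i := x i))))" using d[of "f x"] by simp
    then show ?thesis
      by (rule DERIV_chain2[where f = \<phi> and g = "\<lambda>t. f (x(i := t))"]) (rule F(6)[OF i])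
  qed
qed

lemma smooth_poly_growthD:
  assumes "smooth_poly_growth n f"
  shows "\<And>x y. (\<And>i. i < n \<Longrightarrow> x i = y i) \<Longrightarrow> f x = f y"
    and "\<And>js. set js \<subseteq> {..<n} \<Longrightarrow> continuous_on UNIV (iterated_partial js f)"
    and "\<And>js. set js \<subseteq> {..<n} \<Longrightarrow> \<exists>C k. \<forall>x. \<bar>iterated_partial js f x\<bar> \<le> C * (1 + (\<Sum>i<n. \<bar>x i\<bar>)) ^ k"
    and "\<And>js i x. set js \<subseteq> {..<n} \<Longrightarrow> i < n \<Longrightarrow>
      ((\<lambda>t. iterated_partial js f (x(i := t))) has_real_derivative partial_deriv i (iterated_partial js f) x) (at (x i))"
proof -
  note f = assms[unfolded smooth_poly_growth_def]
  have A: "\<forall>x y. (\<forall>i<n. x i = y i) \<longrightarrow> f x = f y" using f by (rule conjunct1)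
  have B: "\<forall>js. set js \<subseteq> {..<n} \<longrightarrow> continuous_on UNIV (iterated_partial js f) \<and>
        (\<forall>i<n. \<forall>x. (\<lambda>t. iterated_partial js f (x(i := t))) differentiable (at (x i))) \<and>
        (\<exists>C k. \<forall>x. \<bar>iterated_partial js f x\<bar> \<le> C * (1 + (\<Sum>i<n. \<bar>x i\<bar>)) ^ k)"
    using f by (rule conjunct2)
  show "f x = f y" if "\<And>i. i < n \<Longrightarrow> x i = y i" for x y using A that by simp
  fix js assume js: "set js \<subseteq> {..<n}"
  note B' = B[rule_format, OF js]
  show "continuous_on UNIV (iterated_partial js f)" using B' by (rule conjunct1)
  show "\<exists>C k. \<forall>x. \<bar>iterated_partial js f x\<bar> \<le> C * (1 + (\<Sum>i<n. \<bar>x i\<bar>)) ^ k"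
    using conjunct2[OF conjunct2[OF B']] .
  fix i x assume "i < n"
  with B' have "(\<lambda>t. iterated_partial js f (x(i := t))) differentiable (at (x i))" by simp
  then show "((\<lambda>t. iterated_partial js f (x(i := t))) has_real_derivative partial_deriv i (iterated_partial js f) x) (at (x i))"
    unfolding partial_deriv_def by (simp add: DERIV_deriv_iff_real_differentiable)
qed

lemma iterated_partial_simps:
  "iterated_partial [] f = f" "iterated_partial (i # js) f = partial_deriv i (iterated_partial js f)"
  by (simp_all add: iterated_partial_def)

lemma partial_deriv_cong_coordinates:
  assumes "smooth_poly_growth n f" "i < n" "\<And>i. i < n \<Longrightarrow> x i = y i"
  shows "partial_deriv i f x = partial_deriv i f y"
proof -
  have eq: "f (x(i := t)) = f (y(i := t))" for t
  proof (rule smooth_poly_growthD(1)[OF assms(1)])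
    fix j assume "j < n"
    from assms(3)[OF this] show "(x(i := t)) j = (y(i := t)) j" by simp
  qed
  show ?thesis unfolding partial_deriv_def eq assms(3)[OF assms(2)] ..
qed

lemma C1_growth_iterated_partial:
  assumes f: "smooth_poly_growth n f" and js: "set js \<subseteq> {..<n}"
    and dep: "\<And>x y. (\<And>i. i < n \<Longrightarrow> x i = y i) \<Longrightarrow> iterated_partial js f x = iterated_partial js f y"
  shows "C1_growth n (iterated_partial js f) (\<lambda>i. partial_deriv i (iterated_partial js f))"
  unfolding C1_growth_def
proof (intro conjI allI impI)
  note S = smooth_poly_growthD[OF f]
  show "iterated_partial js f x = iterated_partial js f y" if "\<forall>i<n. x i = y i" for x y
    by (rule dep) (use that in auto)
  show "continuous_on UNIV (iterated_partial js f)" by (rule S(2)[OF js])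
  show "\<exists>C k. \<forall>x. \<bar>iterated_partial js f x\<bar> \<le> C * (1 + (\<Sum>i<n. \<bar>x i\<bar>)) ^ k" by (rule S(3)[OF js])
  fix i assume i: "i < n"
  then have ijs: "set (i # js) \<subseteq> {..<n}" using js by simp
  show "continuous_on UNIV (partial_deriv i (iterated_partial js f))"
    using S(2)[OF ijs] by (simp only: iterated_partial_simps)
  show "\<exists>C k. \<forall>x. \<bar>partial_deriv i (iterated_partial js f) x\<bar> \<le> C * (1 + (\<Sum>i<n. \<bar>x i\<bar>)) ^ k"
    using S(3)[OF ijs] by (simp only: iterated_partial_simps)
  show "((\<lambda>t. iterated_partial js f (x(i := t))) has_real_derivative partial_deriv i (iterated_partial js f) x) (at (x i))" for x
    by (rule S(4)[OF js i])
qed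

lemma C1_growth_smooth:
  assumes f: "smooth_poly_growth n f"
  shows "C1_growth n f (\<lambda>i. partial_deriv i f)"
  by (rule C1_growth_iterated_partial[OF f, of "[]", unfolded iterated_partial_simps])
     (auto intro: smooth_poly_growthD(1)[OF f])

lemma C1_growth_smooth_partial:
  assumes f: "smooth_poly_growth n f" and i: "i < n"
  shows "C1_growth n (partial_deriv i f) (\<lambda>j. partial_deriv j (partial_deriv i f))"
  by (rule C1_growth_iterated_partial[OF f, of "[i]", unfolded iterated_partial_simps])
     (use i in \<open>auto intro: partial_deriv_cong_coordinates[OF f i]\<close>)

subsection \<open>Cylindrical random variables\<close>

context isonormal_gaussian_process begin

definition orth_algebra :: "'h \<Rightarrow> 'a measure" where
  "orth_algebra e = sigma (space M) (W_events {k. inner e k = 0})"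

lemma sets_orth_algebra: "sets (orth_algebra e) = sigma_sets (space M) (W_events {k. inner e k = 0})"
  unfolding orth_algebra_def by (rule sets_measure_of) (auto simp: W_events_def)

lemma space_orth_algebra: "space (orth_algebra e) = space M"
  unfolding orth_algebra_def by (rule space_measure_of) (auto simp: W_events_def)

lemma subalgebra_orth: "subalgebra M (orth_algebra e)"
proof -
  have "W_events {k. inner e k = 0} \<subseteq> sets M" by (auto simp: W_events_def)
  then show ?thesis
    unfolding subalgebra_def sets_orth_algebra space_orth_algebra by (simp add: sets.sigma_sets_subset)
qed

lemma W_measurable_orth: "inner e k = 0 \<Longrightarrow> W k \<in> borel_measurable (orth_algebra e)"
  by (auto simp: measurable_def space_orth_algebra sets_orth_algebra W_events_def intro!: sigma_sets.Basic)

lemma pair_orth_measurable: "(\<lambda>\<omega>. (W e \<omega>, \<omega>)) \<in> measurable M (borel \<Otimes>\<^sub>M orth_algebra e)"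
proof (rule measurable_Pair)
  show "(\<lambda>\<omega>. \<omega>) \<in> measurable M (orth_algebra e)"
    using subalgebra_orth[of e] by (auto simp: measurable_def subalgebra_def)
qed measurable

text \<open>Independence of \<open>W e\<close> and the orthogonal directions, in the form required by Fubini's
  theorem.\<close>

lemma pair_orth_distr:
  assumes e: "norm e = 1"
  shows "std_normal_distribution \<Otimes>\<^sub>M restr_to_subalg M (orth_algebra e)
    = distr M (borel \<Otimes>\<^sub>M orth_algebra e) (\<lambda>\<omega>. (W e \<omega>, \<omega>))"
proof (rule pair_measure_eqI)
  interpret N: real_distribution std_normal_distribution by (rule real_dist_normal_dist)
  interpret R: prob_space "restr_to_subalg M (orth_algebra e)"
    by (rule prob_space_restr_to_subalg[OF subalgebra_orth]) unfold_locales
  show "sigma_finite_measure std_normal_distribution" "sigma_finite_measure (restr_to_subalg M (orth_algebra e))"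
    by unfold_locales
  note sr = sets_restr_to_subalg[OF subalgebra_orth]
  show "sets (std_normal_distribution \<Otimes>\<^sub>M restr_to_subalg M (orth_algebra e)) =
    sets (distr M (borel \<Otimes>\<^sub>M orth_algebra e) (\<lambda>\<omega>. (W e \<omega>, \<omega>)))"
    unfolding sets_distr by (rule sets_pair_measure_cong) (simp_all add: sr)
  fix A B assume "A \<in> sets std_normal_distribution" and "B \<in> sets (restr_to_subalg M (orth_algebra e))"
  then have A: "A \<in> sets borel" and B: "B \<in> sets (orth_algebra e)" by (simp_all add: sr)
  have BM: "B \<in> sets M" using B subalgebra_orth[of e] by (auto simp: subalgebra_def)
  have [measurable]: "A \<in> sets borel" "B \<in> sets M" by fact+
  have "measure std_normal_distribution A = (\<integral>x. indicator A x \<partial>std_normal_distribution)" using A by simp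
  also have "\<dots> = (\<integral>\<omega>. indicator A (W e \<omega>) \<partial>M)" using e by (subst W_integral(1)) auto
  finally have mA: "measure std_normal_distribution A = (\<integral>\<omega>. indicator A (W e \<omega>) \<partial>M)" .
  have mB: "measure M B = (\<integral>\<omega>. indicator B \<omega> \<partial>M)" by simp
  have "emeasure std_normal_distribution A * emeasure (restr_to_subalg M (orth_algebra e)) B
     = ennreal (measure std_normal_distribution A * measure M B)"
    using B by (simp add: emeasure_restr_to_subalg[OF subalgebra_orth] emeasure_eq_measure N.emeasure_eq_measure ennreal_mult)
  also have "measure std_normal_distribution A * measure M B = (\<integral>\<omega>. indicator A (W e \<omega>) * indicator B \<omega> \<partial>M)"
    unfolding mA mB using B by (intro W_independent_orthogonal[OF e A, symmetric]) (simp add: sets_orth_algebra)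
  also have "\<dots> = (\<integral>\<omega>. indicator ((\<lambda>\<omega>. (W e \<omega>, \<omega>)) -` (A \<times> B) \<inter> space M) \<omega> \<partial>M)"
    by (intro Bochner_Integration.integral_cong) (auto simp: indicator_def)
  also have "\<dots> = measure M ((\<lambda>\<omega>. (W e \<omega>, \<omega>)) -` (A \<times> B) \<inter> space M)"
    by simp
  also have "ennreal \<dots> = emeasure (distr M (borel \<Otimes>\<^sub>M orth_algebra e) (\<lambda>\<omega>. (W e \<omega>, \<omega>))) (A \<times> B)"
    using A B by (subst emeasure_distr[OF pair_orth_measurable]) (auto simp: emeasure_eq_measure)
  finally show "emeasure std_normal_distribution A * emeasure (restr_to_subalg M (orth_algebra e)) B
    = emeasure (distr M (borel \<Otimes>\<^sub>M orth_algebra e) (\<lambda>\<omega>. (W e \<omega>, \<omega>))) (A \<times> B)" .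
qed

text \<open>For a pair in this relation, \<open>\<Phi> (W e \<omega>, \<omega>)\<close> displays a random variable as a differentiable
  function of \<open>W e\<close> with independent random parameters: by measurability \<open>\<omega>\<close> enters the second
  slot only through the variables \<open>W k\<close> with \<open>k \<bottom> e\<close>.\<close>

definition path :: "'h \<Rightarrow> (real \<times> 'a \<Rightarrow> real) \<Rightarrow> (real \<times> 'a \<Rightarrow> real) \<Rightarrow> bool" where
  "path e \<Phi> \<Phi>' \<longleftrightarrow> \<Phi> \<in> borel_measurable (borel \<Otimes>\<^sub>M orth_algebra e) \<and>
     \<Phi>' \<in> borel_measurable (borel \<Otimes>\<^sub>M orth_algebra e) \<and>
     (\<forall>\<omega>. (\<forall>s. ((\<lambda>s. \<Phi> (s, \<omega>)) has_real_derivative \<Phi>' (s, \<omega>)) (at s)) \<and>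
        continuous_on UNIV (\<lambda>s. \<Phi>' (s, \<omega>)) \<and> (\<exists>C k. \<forall>s. \<bar>\<Phi> (s, \<omega>)\<bar> \<le> C * (1 + \<bar>s\<bar>) ^ k))"

lemma pathD:
  assumes "path e \<Phi> \<Phi>'"
  shows "\<Phi> \<in> borel_measurable (borel \<Otimes>\<^sub>M orth_algebra e)" "\<Phi>' \<in> borel_measurable (borel \<Otimes>\<^sub>M orth_algebra e)"
    "\<And>s \<omega>. ((\<lambda>s. \<Phi> (s, \<omega>)) has_real_derivative \<Phi>' (s, \<omega>)) (at s)"
    "\<And>\<omega>. continuous_on UNIV (\<lambda>s. \<Phi>' (s, \<omega>))" "\<And>\<omega>. \<exists>C k. \<forall>s. \<bar>\<Phi> (s, \<omega>)\<bar> \<le> C * (1 + \<bar>s\<bar>) ^ k"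
  using assms unfolding path_def by blast+

lemma path_mult:
  assumes "path e \<Phi> \<Phi>'" "path e \<Psi> \<Psi>'"
  shows "path e (\<lambda>x. \<Phi> x * \<Psi> x) (\<lambda>x. \<Phi>' x * \<Psi> x + \<Phi> x * \<Psi>' x)"
  unfolding path_def
proof (intro conjI allI)
  note P = pathD[OF assms(1)] and Q = pathD[OF assms(2)]
  note [measurable] = P(1,2) Q(1,2)
  show "(\<lambda>x. \<Phi> x * \<Psi> x) \<in> borel_measurable (borel \<Otimes>\<^sub>M orth_algebra e)" by measurable
  show "(\<lambda>x. \<Phi>' x * \<Psi> x + \<Phi> x * \<Psi>' x) \<in> borel_measurable (borel \<Otimes>\<^sub>M orth_algebra e)" by measurable
  fix \<omega>
  show "((\<lambda>s. \<Phi> (s, \<omega>) * \<Psi> (s, \<omega>)) has_real_derivative \<Phi>' (s, \<omega>) * \<Psi> (s, \<omega>) + \<Phi> (s, \<omega>) * \<Psi>' (s, \<omega>)) (at s)" for s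
    using DERIV_mult[OF P(3)[of \<omega> s] Q(3)[of \<omega> s]] by (simp add: add.commute mult.commute)
  have "continuous_on UNIV (\<lambda>s. \<Phi> (s, \<omega>))" "continuous_on UNIV (\<lambda>s. \<Psi> (s, \<omega>))"
    by (auto intro!: DERIV_continuous_on DERIV_subset[OF P(3)] DERIV_subset[OF Q(3)])
  then show "continuous_on UNIV (\<lambda>s. \<Phi>' (s, \<omega>) * \<Psi> (s, \<omega>) + \<Phi> (s, \<omega>) * \<Psi>' (s, \<omega>))"
    using P(4)[of \<omega>] Q(4)[of \<omega>] by (intro continuous_on_add continuous_on_mult)
  obtain C k D l where b: "\<And>s. \<bar>\<Phi> (s, \<omega>)\<bar> \<le> C * (1 + \<bar>s\<bar>) ^ k" "\<And>s. \<bar>\<Psi> (s, \<omega>)\<bar> \<le> D * (1 + \<bar>s\<bar>) ^ l"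
    using P(5)[of \<omega>] Q(5)[of \<omega>] by blast
  have "\<bar>\<Phi> (s, \<omega>) * \<Psi> (s, \<omega>)\<bar> \<le> (C * D) * (1 + \<bar>s\<bar>) ^ (k + l)" for s
  proof -
    have "\<bar>\<Phi> (s, \<omega>) * \<Psi> (s, \<omega>)\<bar> \<le> (C * (1 + \<bar>s\<bar>) ^ k) * (D * (1 + \<bar>s\<bar>) ^ l)"
      unfolding abs_mult using b[of s] by (intro mult_mono) (auto intro: order_trans[OF abs_ge_zero])
    then show ?thesis by (simp add: power_add mult_ac)
  qed
  then show "\<exists>C k. \<forall>s. \<bar>\<Phi> (s, \<omega>) * \<Psi> (s, \<omega>)\<bar> \<le> C * (1 + \<bar>s\<bar>) ^ k" by blast
qed

text \<open>For fixed parameters this is Stein's identity in the first slot; then integrate over the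
  parameters.\<close>

lemma path_integration_by_parts:
  assumes e: "norm e = 1" and p: "path e \<Phi> \<Phi>'"
    and i1: "integrable M (\<lambda>\<omega>. W e \<omega> * \<Phi> (W e \<omega>, \<omega>))" and i2: "integrable M (\<lambda>\<omega>. \<Phi>' (W e \<omega>, \<omega>))"
  shows "(\<integral>\<omega>. W e \<omega> * \<Phi> (W e \<omega>, \<omega>) \<partial>M) = (\<integral>\<omega>. \<Phi>' (W e \<omega>, \<omega>) \<partial>M)"
proof -
  note P = pathD[OF p]
  let ?R = "restr_to_subalg M (orth_algebra e)" and ?N = std_normal_distribution
  let ?D = "distr M (borel \<Otimes>\<^sub>M orth_algebra e) (\<lambda>\<omega>. (W e \<omega>, \<omega>))"
  interpret N: real_distribution ?N by (rule real_dist_normal_dist)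
  interpret R: prob_space ?R
    by (rule prob_space_restr_to_subalg[OF subalgebra_orth]) unfold_locales
  interpret NR: pair_sigma_finite ?N ?R by unfold_locales
  note [measurable] = P(1,2)
  let ?u = "\<lambda>x. fst x * \<Phi> x"
  have m: "?u \<in> borel_measurable (borel \<Otimes>\<^sub>M orth_algebra e)" by measurable
  have int: "integrable (?N \<Otimes>\<^sub>M ?R) ?u" "integrable (?N \<Otimes>\<^sub>M ?R) \<Phi>'"
    unfolding pair_orth_distr[OF e] using i1 i2
    by (simp_all add: integrable_distr_eq[OF pair_orth_measurable] m P(2))
  have int': "integrable (?N \<Otimes>\<^sub>M ?R) (case_prod (\<lambda>s \<omega>. s * \<Phi> (s, \<omega>)))" "integrable (?N \<Otimes>\<^sub>M ?R) (case_prod (\<lambda>s \<omega>. \<Phi>' (s, \<omega>)))"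
    using int by (simp_all add: case_prod_beta')
  have "(\<integral>\<omega>. W e \<omega> * \<Phi> (W e \<omega>, \<omega>) \<partial>M) = (\<integral>x. ?u x \<partial>?D)"
    by (subst integral_distr[OF pair_orth_measurable m]) simp
  also have "\<dots> = (\<integral>\<omega>. (\<integral>s. s * \<Phi> (s, \<omega>) \<partial>?N) \<partial>?R)"
    unfolding pair_orth_distr[OF e, symmetric] NR.integral_snd[OF int'(1)] by (simp add: case_prod_beta')
  also have "\<dots> = (\<integral>\<omega>. (\<integral>s. \<Phi>' (s, \<omega>) \<partial>?N) \<partial>?R)"
  proof (rule integral_cong_AE)
    show "AE \<omega> in ?R. (\<integral>s. s * \<Phi> (s, \<omega>) \<partial>?N) = (\<integral>s. \<Phi>' (s, \<omega>) \<partial>?N)"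
      using NR.AE_integrable_snd[OF int'(1)] NR.AE_integrable_snd[OF int'(2)]
    proof eventually_elim
      case (elim \<omega>)
      obtain C k where "\<And>s. \<bar>\<Phi> (s, \<omega>)\<bar> \<le> C * (1 + \<bar>s\<bar>) ^ k" using P(5)[of \<omega>] by blast
      then show ?case
        using elim by (intro std_normal_integration_by_parts[where \<phi> = "\<lambda>s. \<Phi> (s, \<omega>)" and \<phi>' = "\<lambda>s. \<Phi>' (s, \<omega>)"] P(3,4))
    qed
    show "(\<lambda>\<omega>. \<integral>s. s * \<Phi> (s, \<omega>) \<partial>?N) \<in> borel_measurable ?R" "(\<lambda>\<omega>. \<integral>s. \<Phi>' (s, \<omega>) \<partial>?N) \<in> borel_measurable ?R"
      using NR.integrable_snd[OF int'(1)] NR.integrable_snd[OF int'(2)] by (auto intro: borel_measurable_integrable)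
  qed
  also have "\<dots> = (\<integral>x. \<Phi>' x \<partial>?D)"
    unfolding pair_orth_distr[OF e, symmetric] NR.integral_snd[OF int'(2)] by (simp add: case_prod_beta')
  also have "\<dots> = (\<integral>\<omega>. \<Phi>' (W e \<omega>, \<omega>) \<partial>M)"
    by (subst integral_distr[OF pair_orth_measurable P(2)]) simp
  finally show ?thesis .
qed

lemma W_vector_measurable: "(\<lambda>\<omega> i. W (h (i::nat)) \<omega>) \<in> borel_measurable M"
  by (rule measurable_coordinatewise_then_product) measurable

lemma growth_all_moments:
  fixes h :: "nat \<Rightarrow> 'h"
  assumes c: "continuous_on UNIV f" and g: "\<exists>C k. \<forall>x. \<bar>f x\<bar> \<le> C * (1 + (\<Sum>i<n. \<bar>x i\<bar>)) ^ k"
  shows "all_moments M (\<lambda>\<omega>. f (\<lambda>i. W (h i) \<omega>))"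
proof -
  obtain C k where b: "\<And>x. \<bar>f x\<bar> \<le> C * (1 + (\<Sum>i<n. \<bar>x i\<bar>)) ^ k" using g by blast
  have "all_moments M (\<lambda>\<omega>. C * (1 + (\<Sum>i<n. \<bar>W (h i) \<omega>\<bar>)) ^ k)"
    by (intro all_moments_cmult all_moments_power all_moments_add[OF all_moments_const] all_moments_sum all_moments_abs W_all_moments)
  then show ?thesis
  proof (rule all_moments_bound)
    show "(\<lambda>\<omega>. f (\<lambda>i. W (h i) \<omega>)) \<in> borel_measurable M"
      by (rule measurable_compose[OF W_vector_measurable borel_measurable_continuous_onI[OF c]])
    show "\<bar>f (\<lambda>i. W (h i) \<omega>)\<bar> \<le> \<bar>C * (1 + (\<Sum>i<n. \<bar>W (h i) \<omega>\<bar>)) ^ k\<bar>" for \<omega>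
      by (rule order_trans[OF b abs_ge_self])
  qed
qed

text \<open>Split \<open>h\<^sub>i = c\<^sub>i e + k\<^sub>i\<close> with \<open>k\<^sub>i \<bottom> e\<close>; the path is \<open>f\<close> along the line \<open>s \<mapsto> c s + W k\<close>.\<close>

lemma C1_growth_path:
  assumes f: "C1_growth n f f'" and e: "norm e = 1"
  obtains \<Phi> \<Phi>' where "path e \<Phi> \<Phi>'" "AE \<omega> in M. \<Phi> (W e \<omega>, \<omega>) = f (\<lambda>i. W (h i) \<omega>)"
    "AE \<omega> in M. \<Phi>' (W e \<omega>, \<omega>) = (\<Sum>i<n. f' i (\<lambda>i. W (h i) \<omega>) * inner (h i) e)"
proof -
  note F = C1_growthD[OF f]
  define c where "c i = inner (h i) e" for i
  define k where "k i = h i - c i *\<^sub>R e" for i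
  define \<Phi> where "\<Phi> x = f (\<lambda>i. c i * fst x + W (k i) (snd x))" for x
  define \<Phi>' where "\<Phi>' x = (\<Sum>i<n. c i * f' i (\<lambda>i. c i * fst x + W (k i) (snd x)))" for x
  have [measurable]: "W (k i) \<in> borel_measurable (orth_algebra e)" for i
    by (rule W_measurable_orth) (use e in \<open>simp add: k_def c_def inner_diff_right inner_commute norm_eq_1\<close>)
  have m: "(\<lambda>x i. c i * fst x + W (k i) (snd x)) \<in> borel_measurable (borel \<Otimes>\<^sub>M orth_algebra e)"
    by (rule measurable_coordinatewise_then_product) measurable
  have path: "path e \<Phi> \<Phi>'"
    unfolding path_def
  proof (intro conjI allI)
    show "\<Phi> \<in> borel_measurable (borel \<Otimes>\<^sub>M orth_algebra e)"
      unfolding \<Phi>_def by (rule measurable_compose[OF m borel_measurable_continuous_onI[OF F(2)]])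
    show "\<Phi>' \<in> borel_measurable (borel \<Otimes>\<^sub>M orth_algebra e)"
      unfolding \<Phi>'_def
      by (intro borel_measurable_sum borel_measurable_times borel_measurable_const
          measurable_compose[OF m borel_measurable_continuous_onI[OF F(4)]]) auto
    fix \<omega>
    show "((\<lambda>s. \<Phi> (s, \<omega>)) has_real_derivative \<Phi>' (s, \<omega>)) (at s)" for s
      unfolding \<Phi>_def \<Phi>'_def fst_conv snd_conv by (rule C1_growth_line_derivative[OF f])
    have line: "continuous_on UNIV (\<lambda>s i. c i * s + W (k i) \<omega>)"
      by (rule continuous_on_coordinatewise_then_product) (intro continuous_intros)
    show "continuous_on UNIV (\<lambda>s. \<Phi>' (s, \<omega>))"
      unfolding \<Phi>'_def fst_conv snd_conv
      by (intro continuous_on_sum continuous_on_mult_left continuous_on_compose2[OF F(4) line]) auto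
    obtain C K where b: "\<And>x. \<bar>f x\<bar> \<le> C * (1 + (\<Sum>i<n. \<bar>x i\<bar>)) ^ K" using F(3) by blast
    have C: "C \<ge> 0" using b[of "\<lambda>_. 0"] by simp
    let ?D = "1 + (\<Sum>i<n. \<bar>c i\<bar> + \<bar>W (k i) \<omega>\<bar>)"
    have "\<bar>\<Phi> (s, \<omega>)\<bar> \<le> (C * ?D ^ K) * (1 + \<bar>s\<bar>) ^ K" for s
    proof -
      have "\<bar>c i * s + W (k i) \<omega>\<bar> \<le> (\<bar>c i\<bar> + \<bar>W (k i) \<omega>\<bar>) * (1 + \<bar>s\<bar>)" for i
      proof -
        have "\<bar>c i * s + W (k i) \<omega>\<bar> \<le> \<bar>c i\<bar> * \<bar>s\<bar> + \<bar>W (k i) \<omega>\<bar>" by (simp add: abs_mult[symmetric])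
        also have "\<dots> \<le> \<bar>c i\<bar> * \<bar>s\<bar> + \<bar>W (k i) \<omega>\<bar> + (\<bar>c i\<bar> + \<bar>W (k i) \<omega>\<bar> * \<bar>s\<bar>)" by simp
        finally show ?thesis by (simp add: algebra_simps)
      qed
      then have "1 + (\<Sum>i<n. \<bar>c i * s + W (k i) \<omega>\<bar>) \<le> 1 + (\<Sum>i<n. (\<bar>c i\<bar> + \<bar>W (k i) \<omega>\<bar>) * (1 + \<bar>s\<bar>))"
        by (intro add_left_mono sum_mono)
      also have "\<dots> = 1 + (\<Sum>i<n. \<bar>c i\<bar> + \<bar>W (k i) \<omega>\<bar>) * (1 + \<bar>s\<bar>)" by (simp only: sum_distrib_right)
      also have "\<dots> \<le> ?D * (1 + \<bar>s\<bar>)" unfolding distrib_right[of 1 "\<Sum>i<n. \<bar>c i\<bar> + \<bar>W (k i) \<omega>\<bar>"] by simp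
      finally have "(1 + (\<Sum>i<n. \<bar>c i * s + W (k i) \<omega>\<bar>)) ^ K \<le> (?D * (1 + \<bar>s\<bar>)) ^ K"
        by (rule power_mono) (simp add: sum_nonneg)
      from mult_left_mono[OF this C] b[of "\<lambda>i. c i * s + W (k i) \<omega>"]
      show ?thesis by (simp add: \<Phi>_def power_mult_distrib mult.assoc)
    qed
    then show "\<exists>C k. \<forall>s. \<bar>\<Phi> (s, \<omega>)\<bar> \<le> C * (1 + \<bar>s\<bar>) ^ k" by blast
  qed
  have "AE \<omega> in M. W (h i) \<omega> = c i * W e \<omega> + W (k i) \<omega>" for i
    using W_linear[of "k i" "c i" e] by eventually_elim (simp add: k_def)
  then have ae: "AE \<omega> in M. \<forall>i. W (h i) \<omega> = c i * W e \<omega> + W (k i) \<omega>" by (simp add: AE_all_countable)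
  show thesis
  proof (rule that[OF path])
    show "AE \<omega> in M. \<Phi> (W e \<omega>, \<omega>) = f (\<lambda>i. W (h i) \<omega>)"
      using ae by eventually_elim (simp add: \<Phi>_def)
    show "AE \<omega> in M. \<Phi>' (W e \<omega>, \<omega>) = (\<Sum>i<n. f' i (\<lambda>i. W (h i) \<omega>) * inner (h i) e)"
      using ae by eventually_elim (simp add: \<Phi>'_def c_def mult.commute)
  qed
qed

text \<open>The class on which integration by parts is done. Besides the smooth cylindrical variables
  with their gradients it contains their images under functions with one bounded continuous
  derivative, which are not smooth in general.\<close>

definition cylindrical :: "('a \<Rightarrow> real) \<Rightarrow> ('a \<Rightarrow> 'h) \<Rightarrow> bool" where
  "cylindrical F A \<longleftrightarrow> (\<exists>n f f' h. C1_growth n f f' \<and> F = (\<lambda>\<omega>. f (\<lambda>i. W (h i) \<omega>)) \<and>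
     A = (\<lambda>\<omega>. \<Sum>i<n. f' i (\<lambda>i. W (h i) \<omega>) *\<^sub>R h i))"

lemma cylindricalI:
  "C1_growth n f f' \<Longrightarrow> cylindrical (\<lambda>\<omega>. f (\<lambda>i. W (h i) \<omega>)) (\<lambda>\<omega>. \<Sum>i<n. f' i (\<lambda>i. W (h i) \<omega>) *\<^sub>R h i)"
  unfolding cylindrical_def by blast

lemma smooth_cylindrical_imp_cylindrical:
  assumes "smooth_cylindrical W F A" shows "cylindrical F A"
proof -
  obtain n f h where f: "smooth_poly_growth n f" and F: "F = (\<lambda>\<omega>. f (\<lambda>i. W (h i) \<omega>))"
    and A: "A = (\<lambda>\<omega>. \<Sum>i<n. partial_deriv i f (\<lambda>i. W (h i) \<omega>) *\<^sub>R h i)"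
    using assms unfolding smooth_cylindrical_def by blast
  show ?thesis unfolding F A by (rule cylindricalI[OF C1_growth_smooth[OF f]])
qed

lemma cylindrical_moments:
  assumes "cylindrical F A"
  shows "all_moments M F" "all_moments M (\<lambda>\<omega>. norm (A \<omega>))" "A \<in> borel_measurable M"
    "all_moments M (\<lambda>\<omega>. inner (A \<omega>) e)" "square_integrable M F" "square_integrable M A"
proof -
  obtain n f f' h where f: "C1_growth n f f'" and F: "F = (\<lambda>\<omega>. f (\<lambda>i. W (h i) \<omega>))"
    and A: "A = (\<lambda>\<omega>. \<Sum>i<n. f' i (\<lambda>i. W (h i) \<omega>) *\<^sub>R h i)"
    using assms unfolding cylindrical_def by blast
  note D = C1_growthD[OF f]
  show F': "all_moments M F" unfolding F by (rule growth_all_moments[OF D(2,3)])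
  then show "square_integrable M F" by (rule all_moments_square_integrable)
  have f': "all_moments M (\<lambda>\<omega>. f' i (\<lambda>i. W (h i) \<omega>))" if "i < n" for i
    by (rule growth_all_moments[OF D(4,5)[OF that]])
  show Am: "A \<in> borel_measurable M"
    unfolding A by (intro borel_measurable_sum borel_measurable_scaleR all_momentsD(1)[OF f']) auto
  have "all_moments M (\<lambda>\<omega>. \<Sum>i<n. norm (h i) * \<bar>f' i (\<lambda>i. W (h i) \<omega>)\<bar>)"
    by (intro all_moments_sum all_moments_cmult all_moments_abs f') auto
  then show nA: "all_moments M (\<lambda>\<omega>. norm (A \<omega>))"
  proof (rule all_moments_bound)
    show "(\<lambda>\<omega>. norm (A \<omega>)) \<in> borel_measurable M" using Am by measurable
    fix \<omega>
    have "norm (A \<omega>) \<le> (\<Sum>i<n. norm (f' i (\<lambda>i. W (h i) \<omega>) *\<^sub>R h i))" unfolding A by (rule norm_sum)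
    also have "\<dots> = (\<Sum>i<n. norm (h i) * \<bar>f' i (\<lambda>i. W (h i) \<omega>)\<bar>)" by (simp add: mult.commute)
    also have "\<dots> \<le> \<bar>\<dots>\<bar>" by (rule abs_ge_self)
    finally show "\<bar>norm (A \<omega>)\<bar> \<le> \<bar>\<Sum>i<n. norm (h i) * \<bar>f' i (\<lambda>i. W (h i) \<omega>)\<bar>\<bar>" by simp
  qed
  show "square_integrable M A"
    using all_moments_square_integrable[OF nA] Am by (simp add: square_integrable_def)
  show "all_moments M (\<lambda>\<omega>. inner (A \<omega>) e)"
    unfolding A inner_sum_left inner_scaleR_left
    by (intro all_moments_sum all_moments_mult[OF f' all_moments_const]) auto
qed

text \<open>For a unit vector \<open>e\<close>, condition on \<open>{W k | k \<bottom> e}\<close> and apply Stein's identity to the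
  product of the two paths; the general case follows by scaling.\<close>

theorem gaussian_integration_by_parts:
  assumes "cylindrical F A" "cylindrical G B"
  shows "(\<integral>\<omega>. G \<omega> * inner (A \<omega>) e \<partial>M) + (\<integral>\<omega>. F \<omega> * inner (B \<omega>) e \<partial>M) = (\<integral>\<omega>. F \<omega> * G \<omega> * W e \<omega> \<partial>M)"
proof -
  note mF = cylindrical_moments[OF assms(1)] and mG = cylindrical_moments[OF assms(2)]
  have ints: "integrable M (\<lambda>\<omega>. G \<omega> * inner (A \<omega>) e)" "integrable M (\<lambda>\<omega>. F \<omega> * inner (B \<omega>) e)"
     "integrable M (\<lambda>\<omega>. F \<omega> * G \<omega> * W e \<omega>)" for e
    by (intro all_moments_integrable all_moments_mult mF mG W_all_moments)+
  have unit: "(\<integral>\<omega>. G \<omega> * inner (A \<omega>) e \<partial>M) + (\<integral>\<omega>. F \<omega> * inner (B \<omega>) e \<partial>M) = (\<integral>\<omega>. F \<omega> * G \<omega> * W e \<omega> \<partial>M)"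
    if e: "norm e = 1" for e
  proof -
    obtain n f f' h where f: "C1_growth n f f'" and F: "F = (\<lambda>\<omega>. f (\<lambda>i. W (h i) \<omega>))"
      and A: "A = (\<lambda>\<omega>. \<Sum>i<n. f' i (\<lambda>i. W (h i) \<omega>) *\<^sub>R h i)"
      using assms(1) unfolding cylindrical_def by blast
    obtain m g g' k where g: "C1_growth m g g'" and G: "G = (\<lambda>\<omega>. g (\<lambda>i. W (k i) \<omega>))"
      and B: "B = (\<lambda>\<omega>. \<Sum>i<m. g' i (\<lambda>i. W (k i) \<omega>) *\<^sub>R k i)"
      using assms(2) unfolding cylindrical_def by blast
    obtain \<Phi> \<Phi>' where P: "path e \<Phi> \<Phi>'" and P1: "AE \<omega> in M. \<Phi> (W e \<omega>, \<omega>) = f (\<lambda>i. W (h i) \<omega>)"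
      and P2: "AE \<omega> in M. \<Phi>' (W e \<omega>, \<omega>) = (\<Sum>i<n. f' i (\<lambda>i. W (h i) \<omega>) * inner (h i) e)"
      by (rule C1_growth_path[OF f e, of h])
    obtain \<Psi> \<Psi>' where Q: "path e \<Psi> \<Psi>'" and Q1: "AE \<omega> in M. \<Psi> (W e \<omega>, \<omega>) = g (\<lambda>i. W (k i) \<omega>)"
      and Q2: "AE \<omega> in M. \<Psi>' (W e \<omega>, \<omega>) = (\<Sum>i<m. g' i (\<lambda>i. W (k i) \<omega>) * inner (k i) e)"
      by (rule C1_growth_path[OF g e, of k])
    have [measurable]: "(\<lambda>\<omega>. \<Phi> (W e \<omega>, \<omega>)) \<in> borel_measurable M" "(\<lambda>\<omega>. \<Phi>' (W e \<omega>, \<omega>)) \<in> borel_measurable M"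
       "(\<lambda>\<omega>. \<Psi> (W e \<omega>, \<omega>)) \<in> borel_measurable M" "(\<lambda>\<omega>. \<Psi>' (W e \<omega>, \<omega>)) \<in> borel_measurable M"
      using measurable_compose[OF pair_orth_measurable] pathD(1,2)[OF P] pathD(1,2)[OF Q] by blast+
    have [measurable]: "F \<in> borel_measurable M" "G \<in> borel_measurable M"
      by (rule all_momentsD(1)[OF mF(1)], rule all_momentsD(1)[OF mG(1)])
    have [measurable]: "(\<lambda>\<omega>. inner (A \<omega>) e) \<in> borel_measurable M" "(\<lambda>\<omega>. inner (B \<omega>) e) \<in> borel_measurable M"
      by (rule all_momentsD(1)[OF mF(4)], rule all_momentsD(1)[OF mG(4)])
    have ae: "AE \<omega> in M. \<Phi> (W e \<omega>, \<omega>) = F \<omega> \<and> \<Phi>' (W e \<omega>, \<omega>) = inner (A \<omega>) e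
       \<and> \<Psi> (W e \<omega>, \<omega>) = G \<omega> \<and> \<Psi>' (W e \<omega>, \<omega>) = inner (B \<omega>) e"
      using P1 P2 Q1 Q2 by eventually_elim (simp add: F A G B inner_sum_left)
    let ?X = "\<lambda>x. \<Phi> x * \<Psi> x" and ?X' = "\<lambda>x. \<Phi>' x * \<Psi> x + \<Phi> x * \<Psi>' x"
    have a1: "AE \<omega> in M. F \<omega> * G \<omega> * W e \<omega> = W e \<omega> * ?X (W e \<omega>, \<omega>)"
      using ae by eventually_elim simp
    have a2: "AE \<omega> in M. G \<omega> * inner (A \<omega>) e + F \<omega> * inner (B \<omega>) e = ?X' (W e \<omega>, \<omega>)"
      using ae by eventually_elim simp
    have i1: "integrable M (\<lambda>\<omega>. W e \<omega> * ?X (W e \<omega>, \<omega>))"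
      by (rule integrable_cong_AE_imp[OF ints(3) _ a1]) measurable
    have i2: "integrable M (\<lambda>\<omega>. ?X' (W e \<omega>, \<omega>))"
      by (rule integrable_cong_AE_imp[OF Bochner_Integration.integrable_add[OF ints(1,2)] _ a2]) measurable
    have "(\<integral>\<omega>. F \<omega> * G \<omega> * W e \<omega> \<partial>M) = (\<integral>\<omega>. W e \<omega> * ?X (W e \<omega>, \<omega>) \<partial>M)"
      by (rule integral_cong_AE[OF _ _ a1]) measurable
    also have "\<dots> = (\<integral>\<omega>. ?X' (W e \<omega>, \<omega>) \<partial>M)"
      by (rule path_integration_by_parts[OF e path_mult[OF P Q] i1 i2])
    also have "\<dots> = (\<integral>\<omega>. G \<omega> * inner (A \<omega>) e + F \<omega> * inner (B \<omega>) e \<partial>M)"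
      by (rule integral_cong_AE[OF _ _ a2, symmetric]) measurable
    also have "\<dots> = (\<integral>\<omega>. G \<omega> * inner (A \<omega>) e \<partial>M) + (\<integral>\<omega>. F \<omega> * inner (B \<omega>) e \<partial>M)"
      by (rule Bochner_Integration.integral_add[OF ints(1,2)])
    finally show ?thesis by simp
  qed
  show ?thesis
  proof (cases "e = 0")
    case True
    have [measurable]: "F \<in> borel_measurable M" "G \<in> borel_measurable M"
      by (rule all_momentsD(1)[OF mF(1)], rule all_momentsD(1)[OF mG(1)])
    have "(\<integral>\<omega>. F \<omega> * G \<omega> * W 0 \<omega> \<partial>M) = (\<integral>\<omega>. 0 \<partial>M)"
    proof (rule integral_cong_AE)
      show "AE \<omega> in M. F \<omega> * G \<omega> * W 0 \<omega> = 0" using W_zero by eventually_elim simp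
    qed measurable
    then show ?thesis by (simp add: True)
  next
    case False
    let ?e = "(1 / norm e) *\<^sub>R e"
    have e: "e = norm e *\<^sub>R ?e" "norm ?e = 1" using False by auto
    have [measurable]: "F \<in> borel_measurable M" "G \<in> borel_measurable M"
      by (rule all_momentsD(1)[OF mF(1)], rule all_momentsD(1)[OF mG(1)])
    have "(\<integral>\<omega>. F \<omega> * G \<omega> * W e \<omega> \<partial>M) = (\<integral>\<omega>. norm e * (F \<omega> * G \<omega> * W ?e \<omega>) \<partial>M)"
    proof (rule integral_cong_AE)
      show "AE \<omega> in M. F \<omega> * G \<omega> * W e \<omega> = norm e * (F \<omega> * G \<omega> * W ?e \<omega>)"
        using W_scaleR[of "norm e" ?e] by (eventually_elim) (use e(1) in simp)
    qed measurable
    also have "\<dots> = norm e * ((\<integral>\<omega>. G \<omega> * inner (A \<omega>) ?e \<partial>M) + (\<integral>\<omega>. F \<omega> * inner (B \<omega>) ?e \<partial>M))"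
      using unit[OF e(2)] by simp
    also have "\<dots> = (\<integral>\<omega>. G \<omega> * inner (A \<omega>) e \<partial>M) + (\<integral>\<omega>. F \<omega> * inner (B \<omega>) e \<partial>M)"
      using False by (simp add: distrib_left)
    finally show ?thesis by simp
  qed
qed

end

section \<open>Hermite polynomials and the Wiener chaos\<close>

lemma hermite_Suc: "hermite (Suc q) x = x * hermite q x - real q * hermite (q - 1) x"
  by (cases q) auto

lemma hermite_derivative: "(hermite q has_real_derivative real q * hermite (q - 1) x) (at x)"
proof (induction q rule: less_induct)
  case (less q)
  show ?case
  proof (cases q)
    case 0
    have "hermite 0 = (\<lambda>x. 1)" by (simp add: fun_eq_iff)
    then show ?thesis using 0 by simp
  next
    case (Suc p)
    have e: "hermite q = (\<lambda>x. x * hermite p x - real p * hermite (p - 1) x)"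
      unfolding Suc by (rule ext) (rule hermite_Suc)
    have IH: "(hermite p has_real_derivative real p * hermite (p - 1) x) (at x)"
      "(hermite (p - 1) has_real_derivative real (p - 1) * hermite (p - 1 - 1) x) (at x)"
      using less.IH[of p] less.IH[of "p - 1"] Suc by auto
    have "(hermite q has_real_derivative hermite p x + x * (real p * hermite (p - 1) x)
       - real p * (real (p - 1) * hermite (p - 1 - 1) x)) (at x)"
      unfolding e by (rule derivative_eq_intros IH refl)+ simp
    also have "hermite p x + x * (real p * hermite (p - 1) x) - real p * (real (p - 1) * hermite (p - 1 - 1) x)
       = hermite p x + real p * (x * hermite (p - 1) x - real (p - 1) * hermite (p - 1 - 1) x)"
      by (simp add: algebra_simps)
    also have "\<dots> = hermite p x + real p * hermite p x"
    proof (cases p)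
      case (Suc m)
      show ?thesis unfolding Suc hermite_Suc[of m] by simp
    qed simp
    also have "\<dots> = real q * hermite (q - 1) x" using Suc by (simp add: algebra_simps)
    finally show ?thesis .
  qed
qed

lemma hermite_growth: "\<exists>C. \<forall>x. \<bar>hermite q x\<bar> \<le> C * (1 + \<bar>x\<bar>) ^ q"
proof (induction q rule: less_induct)
  case (less q)
  show ?case
  proof (cases q)
    case 0 then show ?thesis by (intro exI[of _ 1]) simp
  next
    case (Suc p)
    obtain C D where C: "\<And>x. \<bar>hermite p x\<bar> \<le> C * (1 + \<bar>x\<bar>) ^ p" and D: "\<And>x. \<bar>hermite (p - 1) x\<bar> \<le> D * (1 + \<bar>x\<bar>) ^ (p - 1)"
    proof -
      have "p < q" "p - 1 < q" using Suc by auto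
      from less.IH[OF this(1)] less.IH[OF this(2)] that show ?thesis by blast
    qed
    have C0: "C \<ge> 0" and D0: "D \<ge> 0" using C[of 0] D[of 0] by auto
    have "\<bar>hermite q x\<bar> \<le> (C + real p * D) * (1 + \<bar>x\<bar>) ^ q" for x
    proof -
      have "\<bar>hermite q x\<bar> \<le> \<bar>x\<bar> * \<bar>hermite p x\<bar> + real p * \<bar>hermite (p - 1) x\<bar>"
        unfolding Suc hermite_Suc by (rule order_trans[OF abs_triangle_ineq4]) (simp add: abs_mult)
      also have "\<dots> \<le> (1 + \<bar>x\<bar>) * (C * (1 + \<bar>x\<bar>) ^ p) + real p * (D * (1 + \<bar>x\<bar>) ^ q)"
      proof (intro add_mono mult_mono mult_left_mono C)
        have "D * (1 + \<bar>x\<bar>) ^ (p - 1) \<le> D * (1 + \<bar>x\<bar>) ^ q"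
          using Suc D0 by (intro mult_left_mono power_increasing) auto
        then show "\<bar>hermite (p - 1) x\<bar> \<le> D * (1 + \<bar>x\<bar>) ^ q" using D[of x] by linarith
      qed auto
      also have "\<dots> = (C + real p * D) * (1 + \<bar>x\<bar>) ^ q" unfolding Suc by (simp add: algebra_simps)
      finally show ?thesis .
    qed
    then show ?thesis by blast
  qed
qed

text \<open>Sums of Hermite polynomials in separate coordinates are closed under partial derivatives.
  Their smoothness and the growth of all their derivatives therefore follow from the growth of
  the sums themselves.\<close>

definition hermite_sum :: "nat \<Rightarrow> (nat \<Rightarrow> real) \<Rightarrow> (nat \<Rightarrow> nat) \<Rightarrow> (nat \<Rightarrow> real) \<Rightarrow> real" where
  "hermite_sum n a q x = (\<Sum>i<n. a i * hermite (q i) (x i))"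

lemma hermite_sum_partial:
  assumes "j < n"
  shows "((\<lambda>t. hermite_sum n a q (x(j := t))) has_real_derivative a j * (real (q j) * hermite (q j - 1) (x j))) (at (x j))"
proof -
  have eq: "hermite_sum n a q (x(j := t)) = a j * hermite (q j) t + (\<Sum>i\<in>{..<n} - {j}. a i * hermite (q i) (x i))" for t
  proof -
    have "hermite_sum n a q (x(j := t)) = a j * hermite (q j) t + (\<Sum>i\<in>{..<n} - {j}. a i * hermite (q i) ((x(j := t)) i))"
      unfolding hermite_sum_def using assms by (subst sum.remove[of _ j]) auto
    also have "(\<Sum>i\<in>{..<n} - {j}. a i * hermite (q i) ((x(j := t)) i)) = (\<Sum>i\<in>{..<n} - {j}. a i * hermite (q i) (x i))"
      by (intro sum.cong) auto
    finally show ?thesis .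
  qed
  show ?thesis unfolding eq by (rule derivative_eq_intros hermite_derivative refl)+ simp
qed

lemma partial_deriv_hermite_sum:
  assumes "j < n"
  shows "partial_deriv j (hermite_sum n a q) = hermite_sum n (\<lambda>i. if i = j then a j * real (q j) else 0) (\<lambda>i. q i - 1)"
proof
  fix x
  have "partial_deriv j (hermite_sum n a q) x = a j * (real (q j) * hermite (q j - 1) (x j))"
    unfolding partial_deriv_def by (rule DERIV_imp_deriv[OF hermite_sum_partial[OF assms]])
  also have "\<dots> = (\<Sum>i<n. if i = j then a j * (real (q j) * hermite (q j - 1) (x j)) else 0)"
    using assms by simp
  also have "\<dots> = hermite_sum n (\<lambda>i. if i = j then a j * real (q j) else 0) (\<lambda>i. q i - 1) x"
    unfolding hermite_sum_def by (intro sum.cong) auto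
  finally show "partial_deriv j (hermite_sum n a q) x
    = hermite_sum n (\<lambda>i. if i = j then a j * real (q j) else 0) (\<lambda>i. q i - 1) x" .
qed

lemma iterated_partial_hermite_sum:
  "set js \<subseteq> {..<n} \<Longrightarrow> \<exists>b r. iterated_partial js (hermite_sum n a q) = hermite_sum n b r"
proof (induction js)
  case Nil then show ?case unfolding iterated_partial_simps by blast
next
  case (Cons j js)
  then obtain b r where e: "iterated_partial js (hermite_sum n a q) = hermite_sum n b r" by auto
  have "j < n" using Cons.prems by simp
  then show ?case unfolding iterated_partial_simps e by (auto simp only: partial_deriv_hermite_sum)
qed

lemma hermite_sum_growth: "\<exists>C k. \<forall>x. \<bar>hermite_sum n a q x\<bar> \<le> C * (1 + (\<Sum>i<n. \<bar>x i\<bar>)) ^ k"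
proof -
  have "\<exists>C k. \<forall>x::nat \<Rightarrow> real. \<bar>\<Sum>i\<in>I. a i * hermite (q i) (x i)\<bar> \<le> C * (1 + (\<Sum>i<n. \<bar>x i\<bar>)) ^ k" if "finite I" "I \<subseteq> {..<n}" for I
    using that
  proof (induction I)
    case empty show ?case using growth_const[of 0] by simp
  next
    case (insert i I)
    have "\<exists>C k. \<forall>x::nat \<Rightarrow> real. \<bar>hermite (q i) (x i)\<bar> \<le> C * (1 + (\<Sum>i<n. \<bar>x i\<bar>)) ^ k"
    proof -
      obtain C where C: "\<And>x. \<bar>hermite (q i) x\<bar> \<le> C * (1 + \<bar>x\<bar>) ^ q i" using hermite_growth by blast
      have C0: "C \<ge> 0" using C[of 0] by simp
      have "\<bar>hermite (q i) (x i)\<bar> \<le> C * (1 + (\<Sum>i<n. \<bar>x i\<bar>)) ^ q i" for x :: "nat \<Rightarrow> real"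
      proof -
        have "\<bar>x i\<bar> \<le> (\<Sum>i<n. \<bar>x i\<bar>)" using insert.prems by (intro member_le_sum) auto
        then have "C * (1 + \<bar>x i\<bar>) ^ q i \<le> C * (1 + (\<Sum>i<n. \<bar>x i\<bar>)) ^ q i"
          using C0 by (intro mult_left_mono power_mono) auto
        then show ?thesis using C[of "x i"] by linarith
      qed
      then show ?thesis by blast
    qed
    from growth_add[OF growth_mult[OF growth_const this] insert.IH, of "a i"] insert
    show ?case by simp
  qed
  from this[of "{..<n}"] show ?thesis by (simp add: hermite_sum_def)
qed

lemma smooth_hermite_sum: "smooth_poly_growth n (hermite_sum n a q)"
  unfolding smooth_poly_growth_def
proof (intro conjI allI impI)
  show "hermite_sum n a q x = hermite_sum n a q y" if "\<forall>i<n. x i = y i" for x y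
    using that by (simp add: hermite_sum_def)
  fix js assume "set js \<subseteq> {..<n}"
  then obtain b r where e: "iterated_partial js (hermite_sum n a q) = hermite_sum n b r"
    using iterated_partial_hermite_sum by blast
  have ch: "continuous_on UNIV (hermite p)" for p
    by (rule DERIV_continuous_on) (rule DERIV_subset[OF hermite_derivative], simp)
  have "continuous_on UNIV (\<lambda>x::nat \<Rightarrow> real. hermite (r i) (x i))" for i
    by (rule continuous_on_compose2[OF ch]) (auto intro!: continuous_intros)
  then show "continuous_on UNIV (iterated_partial js (hermite_sum n a q))"
    unfolding e hermite_sum_def by (intro continuous_on_sum continuous_on_mult_left)
  show "(\<lambda>t. iterated_partial js (hermite_sum n a q) (x(i := t))) differentiable (at (x i))" if "i < n" for i x
    unfolding e using hermite_sum_partial[OF that] real_differentiable_def by blast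
  show "\<exists>C k. \<forall>x. \<bar>iterated_partial js (hermite_sum n a q) x\<bar> \<le> C * (1 + (\<Sum>i<n. \<bar>x i\<bar>)) ^ k"
    unfolding e by (rule hermite_sum_growth)
qed

text \<open>A list of triples \<open>(a, q, h)\<close> encodes the polynomial \<open>\<Sum> a H\<^sub>q(W h)\<close>. Multiplying each
  coefficient by its order is the number operator \<open>-L\<close>.\<close>

type_synonym 'v hermite_terms = "(real \<times> nat \<times> 'v) list"

abbreviation order_of :: "real \<times> nat \<times> 'v \<Rightarrow> nat" where "order_of t \<equiv> fst (snd t)"

text \<open>For unit vectors \<open>h\<close> the variable \<open>H\<^sub>q(W h)\<close> lies in the chaos of order \<open>q\<close>, for others in
  general not. Terms of order \<open>0\<close> are constants whatever \<open>h\<close> is; exempting them keeps the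
  constants when the Hilbert space is trivial.\<close>

definition normalized :: "'v::real_normed_vector hermite_terms \<Rightarrow> bool" where
  "normalized xs \<longleftrightarrow> (\<forall>(a, q, h)\<in>set xs. q = 0 \<or> norm h = 1)"

definition scale_terms :: "real \<Rightarrow> 'v hermite_terms \<Rightarrow> 'v hermite_terms" where
  "scale_terms c xs = map (\<lambda>(a, q, h). (c * a, q, h)) xs"

definition number_terms :: "'v hermite_terms \<Rightarrow> 'v hermite_terms" where
  "number_terms xs = map (\<lambda>(a, q, h). (real q * a, q, h)) xs"

lemma normalized_simps [simp]:
  "normalized []" "normalized (t # xs) \<longleftrightarrow> (order_of t = 0 \<or> norm (snd (snd t)) = 1) \<and> normalized xs"
  "normalized (xs @ ys) \<longleftrightarrow> normalized xs \<and> normalized ys"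
  "normalized (scale_terms c xs) \<longleftrightarrow> normalized xs"
  "normalized (number_terms xs) \<longleftrightarrow> normalized xs"
  "normalized xs \<Longrightarrow> normalized (filter P xs)"
  by (auto simp: normalized_def scale_terms_def number_terms_def split: prod.splits)

lemma orders_number [simp]: "order_of ` set (number_terms xs) = order_of ` set xs"
  by (force simp: number_terms_def image_image split_beta)

lemma filter_scale: "filter (\<lambda>t. P (order_of t)) (scale_terms c xs) = scale_terms c (filter (\<lambda>t. P (order_of t)) xs)"
  by (induction xs) (auto simp: scale_terms_def)

lemma filter_number: "filter (\<lambda>t. P (order_of t)) (number_terms xs) = number_terms (filter (\<lambda>t. P (order_of t)) xs)"
  by (induction xs) (auto simp: number_terms_def)

context isonormal_gaussian_process begin

definition herm :: "'h hermite_terms \<Rightarrow> 'a \<Rightarrow> real" where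
  "herm xs \<omega> = (\<Sum>(a, q, h)\<leftarrow>xs. a * hermite q (W h \<omega>))"

text \<open>The Malliavin derivative, because of \<open>H\<^sub>q' = q H\<^bsub>q-1\<^esub>\<close>.\<close>

definition hermD :: "'h hermite_terms \<Rightarrow> 'a \<Rightarrow> 'h" where
  "hermD xs \<omega> = (\<Sum>(a, q, h)\<leftarrow>xs. (a * (real q * hermite (q - 1) (W h \<omega>))) *\<^sub>R h)"

lemma herm_simps [simp]:
  "herm [] \<omega> = 0" "herm ((a, q, h) # xs) \<omega> = a * hermite q (W h \<omega>) + herm xs \<omega>"
  "herm (xs @ ys) \<omega> = herm xs \<omega> + herm ys \<omega>"
  by (simp_all add: herm_def)

lemma hermD_simps [simp]:
  "hermD [] \<omega> = 0" "hermD ((a, q, h) # xs) \<omega> = (a * (real q * hermite (q - 1) (W h \<omega>))) *\<^sub>R h + hermD xs \<omega>"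
  "hermD (xs @ ys) \<omega> = hermD xs \<omega> + hermD ys \<omega>"
  by (simp_all add: hermD_def)

lemma herm_scale [simp]: "herm (scale_terms c xs) \<omega> = c * herm xs \<omega>"
  by (induction xs) (auto simp: scale_terms_def algebra_simps)

lemma hermD_scale [simp]: "hermD (scale_terms c xs) \<omega> = c *\<^sub>R hermD xs \<omega>"
  by (induction xs) (auto simp: scale_terms_def algebra_simps)

lemma herm_filter_split: "herm xs \<omega> = herm (filter P xs) \<omega> + herm (filter (\<lambda>t. \<not> P t) xs) \<omega>"
  by (induction xs) auto

lemma herm_smooth_cylindrical: "smooth_cylindrical W (herm xs) (hermD xs)"
proof -
  let ?n = "length xs" and ?a = "\<lambda>i. fst (xs ! i)" and ?q = "\<lambda>i. fst (snd (xs ! i))" and ?h = "\<lambda>i. snd (snd (xs ! i))"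
  have "herm xs = (\<lambda>\<omega>. hermite_sum ?n ?a ?q (\<lambda>i. W (?h i) \<omega>))"
    by (rule ext) (simp add: herm_def hermite_sum_def sum_list_sum_nth split_beta atLeast0LessThan)
  moreover have "hermD xs = (\<lambda>\<omega>. \<Sum>i<?n. partial_deriv i (hermite_sum ?n ?a ?q) (\<lambda>i. W (?h i) \<omega>) *\<^sub>R ?h i)"
  proof
    fix \<omega>
    have "(\<Sum>i<?n. partial_deriv i (hermite_sum ?n ?a ?q) (\<lambda>i. W (?h i) \<omega>) *\<^sub>R ?h i)
       = (\<Sum>i<?n. (?a i * (real (?q i) * hermite (?q i - 1) (W (?h i) \<omega>))) *\<^sub>R ?h i)"
    proof (rule sum.cong)
      fix i assume "i \<in> {..<?n}"
      then have "partial_deriv i (hermite_sum ?n ?a ?q) (\<lambda>i. W (?h i) \<omega>) = ?a i * (real (?q i) * hermite (?q i - 1) (W (?h i) \<omega>))"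
        unfolding partial_deriv_def by (intro DERIV_imp_deriv hermite_sum_partial) simp
      then show "partial_deriv i (hermite_sum ?n ?a ?q) (\<lambda>i. W (?h i) \<omega>) *\<^sub>R ?h i =
         (?a i * (real (?q i) * hermite (?q i - 1) (W (?h i) \<omega>))) *\<^sub>R ?h i" by simp
    qed simp
    then show "hermD xs \<omega> = (\<Sum>i<?n. partial_deriv i (hermite_sum ?n ?a ?q) (\<lambda>i. W (?h i) \<omega>) *\<^sub>R ?h i)"
      by (simp add: hermD_def sum_list_sum_nth split_beta atLeast0LessThan)
  qed
  ultimately show ?thesis
    unfolding smooth_cylindrical_def
    by (intro exI[of _ ?n] exI[of _ "hermite_sum ?n ?a ?q"] exI[of _ ?h] conjI smooth_hermite_sum)
qed

lemmas herm_cylindrical = smooth_cylindrical_imp_cylindrical[OF herm_smooth_cylindrical]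
lemmas herm_moments = cylindrical_moments(1)[OF herm_cylindrical]
lemmas herm_square_integrable = cylindrical_moments(5)[OF herm_cylindrical]
lemmas hermD_square_integrable = cylindrical_moments(6)[OF herm_cylindrical]

lemma hermite_W_moments: "all_moments M (\<lambda>\<omega>. hermite q (W h \<omega>))"
proof -
  have "herm [(1, q, h)] = (\<lambda>\<omega>. hermite q (W h \<omega>))" by (rule ext) simp
  then show ?thesis using herm_moments[of "[(1, q, h)]"] by simp
qed

text \<open>Integration by parts for a Hermite polynomial: the recursion \<open>x H\<^sub>q - H\<^sub>q' = H\<^bsub>q+1\<^esub>\<close> makes the
  number operator appear.\<close>

lemma herm_integration_by_parts:
  assumes "normalized xs" and G: "cylindrical G B"
  shows "(\<integral>\<omega>. inner (hermD xs \<omega>) (B \<omega>) \<partial>M) = (\<integral>\<omega>. herm (number_terms xs) \<omega> * G \<omega> \<partial>M)"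
  using assms(1)
proof (induction xs)
  case Nil then show ?case by (simp add: number_terms_def)
next
  case (Cons t xs)
  obtain a q h where t: "t = (a, q, h)" by (cases t)
  note mG = cylindrical_moments[OF G]
  have one: "(\<integral>\<omega>. real q * hermite (q - 1) (W h \<omega>) * inner h (B \<omega>) \<partial>M) = (\<integral>\<omega>. real q * hermite q (W h \<omega>) * G \<omega> \<partial>M)"
  proof (cases q)
    case (Suc p)
    then have h: "norm h = 1" using Cons.prems t by simp
    have C: "cylindrical (\<lambda>\<omega>. hermite p (W h \<omega>)) (\<lambda>\<omega>. (real p * hermite (p - 1) (W h \<omega>)) *\<^sub>R h)"
    proof -
      have "herm [(1, p, h)] = (\<lambda>\<omega>. hermite p (W h \<omega>))"
        "hermD [(1, p, h)] = (\<lambda>\<omega>. (real p * hermite (p - 1) (W h \<omega>)) *\<^sub>R h)"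
        by (rule ext, simp)+
      then show ?thesis using herm_cylindrical[of "[(1, p, h)]"] by simp
    qed
    have h1: "inner h h = 1" using h by (simp add: norm_eq_1)
    have i: "integrable M (\<lambda>\<omega>. hermite p (W h \<omega>) * G \<omega> * W h \<omega>)" "integrable M (\<lambda>\<omega>. G \<omega> * (real p * hermite (p - 1) (W h \<omega>)))"
      by (intro all_moments_integrable all_moments_mult all_moments_const mG W_all_moments hermite_W_moments)+
    have "(\<integral>\<omega>. hermite p (W h \<omega>) * inner (B \<omega>) h \<partial>M) =
       (\<integral>\<omega>. hermite p (W h \<omega>) * G \<omega> * W h \<omega> \<partial>M) - (\<integral>\<omega>. G \<omega> * (real p * hermite (p - 1) (W h \<omega>)) \<partial>M)"
      using gaussian_integration_by_parts[OF C G, of h] by (simp add: h1)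
    also have "\<dots> = (\<integral>\<omega>. hermite p (W h \<omega>) * G \<omega> * W h \<omega> - G \<omega> * (real p * hermite (p - 1) (W h \<omega>)) \<partial>M)"
      by (rule Bochner_Integration.integral_diff[symmetric, OF i])
    also have "\<dots> = (\<integral>\<omega>. hermite q (W h \<omega>) * G \<omega> \<partial>M)"
      unfolding Suc hermite_Suc[of p] by (intro Bochner_Integration.integral_cong) (auto simp: algebra_simps)
    finally have "real q * (\<integral>\<omega>. hermite p (W h \<omega>) * inner (B \<omega>) h \<partial>M) = real q * (\<integral>\<omega>. hermite q (W h \<omega>) * G \<omega> \<partial>M)"
      by simp
    then show ?thesis using Suc by (simp add: mult.assoc inner_commute[of h])
  qed simp
  have i1: "integrable M (\<lambda>\<omega>. a * (real q * hermite (q - 1) (W h \<omega>) * inner h (B \<omega>)))"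
    unfolding inner_commute[of h "B _"]
    by (intro all_moments_integrable all_moments_mult all_moments_const hermite_W_moments mG(4))
  have i2: "integrable M (\<lambda>\<omega>. inner (hermD xs \<omega>) (B \<omega>))"
    by (rule integrable_inner_L2[OF hermD_square_integrable mG(6)])
  have i3: "integrable M (\<lambda>\<omega>. a * (real q * hermite q (W h \<omega>) * G \<omega>))" "integrable M (\<lambda>\<omega>. herm (number_terms xs) \<omega> * G \<omega>)"
    by (intro all_moments_integrable all_moments_mult all_moments_const hermite_W_moments mG herm_moments)+
  have "(\<integral>\<omega>. inner (hermD (t # xs) \<omega>) (B \<omega>) \<partial>M)
     = (\<integral>\<omega>. a * (real q * hermite (q - 1) (W h \<omega>) * inner h (B \<omega>)) + inner (hermD xs \<omega>) (B \<omega>) \<partial>M)"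
    by (intro Bochner_Integration.integral_cong) (auto simp: t inner_add_left)
  also have "\<dots> = a * (\<integral>\<omega>. real q * hermite (q - 1) (W h \<omega>) * inner h (B \<omega>) \<partial>M) + (\<integral>\<omega>. inner (hermD xs \<omega>) (B \<omega>) \<partial>M)"
    using i1 i2 by (subst Bochner_Integration.integral_add) simp_all
  also have "\<dots> = a * (\<integral>\<omega>. real q * hermite q (W h \<omega>) * G \<omega> \<partial>M) + (\<integral>\<omega>. herm (number_terms xs) \<omega> * G \<omega> \<partial>M)"
    using one Cons by simp
  also have "\<dots> = (\<integral>\<omega>. a * (real q * hermite q (W h \<omega>) * G \<omega>) + herm (number_terms xs) \<omega> * G \<omega> \<partial>M)"
    using i3 by (subst Bochner_Integration.integral_add) simp_all
  also have "\<dots> = (\<integral>\<omega>. herm (number_terms (t # xs)) \<omega> * G \<omega> \<partial>M)"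
    by (intro Bochner_Integration.integral_cong) (auto simp: t number_terms_def algebra_simps)
  finally show ?case .
qed

lemma herm_number_single_order:
  "(\<And>t. t \<in> set xs \<Longrightarrow> order_of t = q) \<Longrightarrow> herm (number_terms xs) \<omega> = real q * herm xs \<omega>"
proof (induction xs)
  case (Cons t xs)
  obtain a p h where t: "t = (a, p, h)" by (cases t)
  have "p = q" using Cons.prems[of t] t by simp
  moreover have "herm (number_terms xs) \<omega> = real q * herm xs \<omega>"
    by (rule Cons.IH, rule Cons.prems) simp
  ultimately show ?case by (simp add: t number_terms_def algebra_simps)
qed (simp add: number_terms_def)

text \<open>Integration by parts on either side gives \<open>p E [F G] = E \<langle>DF, DG\<rangle> = q E [F G]\<close>.\<close>

lemma herm_orthogonal_single_order:
  assumes "normalized xs" "normalized ys" "\<And>t. t \<in> set xs \<Longrightarrow> order_of t = p"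
    "\<And>t. t \<in> set ys \<Longrightarrow> order_of t = q" "p \<noteq> q"
  shows "(\<integral>\<omega>. herm xs \<omega> * herm ys \<omega> \<partial>M) = 0"
proof -
  have n: "herm (number_terms xs) \<omega> = real p * herm xs \<omega>" "herm (number_terms ys) \<omega> = real q * herm ys \<omega>" for \<omega>
    by (rule herm_number_single_order, rule assms, assumption)+
  have "real p * (\<integral>\<omega>. herm xs \<omega> * herm ys \<omega> \<partial>M) = (\<integral>\<omega>. herm (number_terms xs) \<omega> * herm ys \<omega> \<partial>M)"
    by (simp add: n mult.assoc)
  also have "\<dots> = (\<integral>\<omega>. inner (hermD xs \<omega>) (hermD ys \<omega>) \<partial>M)"
    by (rule herm_integration_by_parts[OF assms(1) herm_cylindrical, symmetric])
  also have "\<dots> = (\<integral>\<omega>. inner (hermD ys \<omega>) (hermD xs \<omega>) \<partial>M)" by (simp add: inner_commute)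
  also have "\<dots> = (\<integral>\<omega>. herm (number_terms ys) \<omega> * herm xs \<omega> \<partial>M)"
    by (rule herm_integration_by_parts[OF assms(2) herm_cylindrical])
  also have "\<dots> = real q * (\<integral>\<omega>. herm xs \<omega> * herm ys \<omega> \<partial>M)"
    by (simp add: n mult.assoc mult.commute[of "herm ys _"])
  finally show ?thesis using assms(5) by simp
qed

lemma herm_mult_integrable: "integrable M (\<lambda>\<omega>. herm xs \<omega> * herm ys \<omega>)"
  by (intro all_moments_integrable all_moments_mult herm_moments)

text \<open>By bilinearity the claim reduces to two single terms.\<close>

lemma herm_orthogonal:
  assumes "normalized xs" "normalized ys" "\<And>s t. s \<in> set xs \<Longrightarrow> t \<in> set ys \<Longrightarrow> order_of s \<noteq> order_of t"
  shows "(\<integral>\<omega>. herm xs \<omega> * herm ys \<omega> \<partial>M) = 0"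
proof -
  have cons: "herm (x # xs) \<omega> = herm [x] \<omega> + herm xs \<omega>" for x :: "real \<times> nat \<times> 'h" and xs \<omega>
    by (cases x) simp
  have single: "(\<integral>\<omega>. herm [x] \<omega> * herm ys \<omega> \<partial>M) = 0" if "normalized [x]" "\<And>t. t \<in> set ys \<Longrightarrow> order_of x \<noteq> order_of t" for x
    using assms(2) that(2)
  proof (induction ys)
    case (Cons y ys)
    have "(\<integral>\<omega>. herm [x] \<omega> * herm (y # ys) \<omega> \<partial>M) = (\<integral>\<omega>. herm [x] \<omega> * herm [y] \<omega> + herm [x] \<omega> * herm ys \<omega> \<partial>M)"
      by (subst cons) (simp only: distrib_left)
    also have "\<dots> = (\<integral>\<omega>. herm [x] \<omega> * herm [y] \<omega> \<partial>M) + (\<integral>\<omega>. herm [x] \<omega> * herm ys \<omega> \<partial>M)"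
      by (intro Bochner_Integration.integral_add herm_mult_integrable)
    also have "(\<integral>\<omega>. herm [x] \<omega> * herm [y] \<omega> \<partial>M) = 0"
      by (rule herm_orthogonal_single_order[of _ _ "order_of x" "order_of y"]) (use that(1) Cons.prems in auto)
    finally show ?case using Cons.IH Cons.prems by simp
  qed simp
  show ?thesis using assms(1,3)
  proof (induction xs)
    case (Cons x xs)
    have "(\<integral>\<omega>. herm (x # xs) \<omega> * herm ys \<omega> \<partial>M) = (\<integral>\<omega>. herm [x] \<omega> * herm ys \<omega> + herm xs \<omega> * herm ys \<omega> \<partial>M)"
      by (subst cons) (simp only: distrib_right)
    also have "\<dots> = (\<integral>\<omega>. herm [x] \<omega> * herm ys \<omega> \<partial>M) + (\<integral>\<omega>. herm xs \<omega> * herm ys \<omega> \<partial>M)"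
      by (intro Bochner_Integration.integral_add herm_mult_integrable)
    also have "(\<integral>\<omega>. herm [x] \<omega> * herm ys \<omega> \<partial>M) = 0"
      by (rule single) (use Cons.prems(1) in simp, rule Cons.prems(2), simp_all)
    finally show ?case using Cons by simp
  qed simp
qed

end

lemma integral_orthogonal_sums:
  fixes d :: "'i \<Rightarrow> 'a \<Rightarrow> real"
  assumes "finite Q" "\<And>q. q \<in> Q \<Longrightarrow> square_integrable M (d q)"
    "\<And>p q. p \<in> Q \<Longrightarrow> q \<in> Q \<Longrightarrow> p \<noteq> q \<Longrightarrow> (\<integral>\<omega>. d p \<omega> * d q \<omega> \<partial>M) = 0"
  shows "(\<integral>\<omega>. (\<Sum>q\<in>Q. a q * d q \<omega>) * (\<Sum>q\<in>Q. b q * d q \<omega>) \<partial>M) = (\<Sum>q\<in>Q. a q * b q * (\<integral>\<omega>. (d q \<omega>)\<^sup>2 \<partial>M))"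
proof -
  have i: "integrable M (\<lambda>\<omega>. d p \<omega> * d q \<omega>)" if "p \<in> Q" "q \<in> Q" for p q
    by (rule integrable_mult_L2[OF assms(2)[OF that(1)] assms(2)[OF that(2)]])
  have "(\<integral>\<omega>. (\<Sum>q\<in>Q. a q * d q \<omega>) * (\<Sum>q\<in>Q. b q * d q \<omega>) \<partial>M)
     = (\<integral>\<omega>. (\<Sum>p\<in>Q. \<Sum>q\<in>Q. (a p * b q) * (d p \<omega> * d q \<omega>)) \<partial>M)"
    by (intro Bochner_Integration.integral_cong refl) (simp add: sum_product mult_ac)
  also have "\<dots> = (\<Sum>p\<in>Q. \<Sum>q\<in>Q. (a p * b q) * (\<integral>\<omega>. d p \<omega> * d q \<omega> \<partial>M))"
    using i by (subst Bochner_Integration.integral_sum; (intro Bochner_Integration.integrable_sum integrable_mult_right)?;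
      simp add: Bochner_Integration.integral_sum)
  also have "\<dots> = (\<Sum>p\<in>Q. \<Sum>q\<in>Q. if q = p then a p * b p * (\<integral>\<omega>. (d p \<omega>)\<^sup>2 \<partial>M) else 0)"
  proof (intro sum.cong refl)
    fix p q assume pq: "p \<in> Q" "q \<in> Q"
    show "a p * b q * (\<integral>\<omega>. d p \<omega> * d q \<omega> \<partial>M) = (if q = p then a p * b p * (\<integral>\<omega>. (d p \<omega>)\<^sup>2 \<partial>M) else 0)"
    proof (cases "q = p")
      case True then show ?thesis by (simp add: power2_eq_square)
    next
      case False
      then show ?thesis using assms(3)[OF pq] by simp
    qed
  qed
  also have "\<dots> = (\<Sum>q\<in>Q. a q * b q * (\<integral>\<omega>. (d q \<omega>)\<^sup>2 \<partial>M))"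
    using assms(1) by (intro sum.cong refl) simp
  finally show ?thesis .
qed

context isonormal_gaussian_process begin

subsection \<open>Totality of the Hermite polynomials\<close>

text \<open>The partial sums are dominated by \<open>exp \<bar>t W h\<bar>\<close>, which is square integrable, so the series
  of \<open>g\<close> can be integrated against \<open>Y\<close> term by term.\<close>

lemma power_series_integral_zero:
  fixes c :: "nat \<Rightarrow> real"
  assumes Y: "square_integrable M Y"
    and p: "\<And>n. (\<integral>\<omega>. Y \<omega> * W h \<omega> ^ n \<partial>M) = 0"
    and c: "\<And>n. \<bar>c n\<bar> \<le> inverse (fact n)" "\<And>x. (\<lambda>n. c n * x ^ n) sums g x"
    and g: "g \<in> borel_measurable borel"
  shows "(\<integral>\<omega>. Y \<omega> * g (t * W h \<omega>) \<partial>M) = 0"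
proof -
  note [measurable] = square_integrableD(1)[OF Y] g
  let ?S = "\<lambda>N \<omega>. Y \<omega> * (\<Sum>n<N. c n * (t * W h \<omega>) ^ n)"
  have "(\<lambda>N. \<integral>\<omega>. ?S N \<omega> \<partial>M) \<longlonglongrightarrow> (\<integral>\<omega>. Y \<omega> * g (t * W h \<omega>) \<partial>M)"
  proof (rule integral_dominated_convergence[where w = "\<lambda>\<omega>. norm (Y \<omega>) * norm (exp (\<bar>t\<bar> * \<bar>W h \<omega>\<bar>))"])
    have "square_integrable M (\<lambda>\<omega>. exp (\<bar>t\<bar> * \<bar>W h \<omega>\<bar>))"
      unfolding square_integrable_def
    proof (intro conjI)
      have "integrable M (\<lambda>\<omega>. exp ((2 * \<bar>t\<bar>) * \<bar>W h \<omega>\<bar>))" by (rule W_exp_integrable)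
      then show "integrable M (\<lambda>\<omega>. (norm (exp (\<bar>t\<bar> * \<bar>W h \<omega>\<bar>)))\<^sup>2)"
        by (simp add: exp_double[symmetric] mult.assoc)
    qed measurable
    then show "integrable M (\<lambda>\<omega>. norm (Y \<omega>) * norm (exp (\<bar>t\<bar> * \<bar>W h \<omega>\<bar>)))"
      by (rule integrable_norm_mult[OF Y])
    show "AE \<omega> in M. (\<lambda>N. ?S N \<omega>) \<longlonglongrightarrow> Y \<omega> * g (t * W h \<omega>)"
      using c(2) by (intro AE_I2 tendsto_mult tendsto_const) (simp add: sums_def)
    show "AE \<omega> in M. norm (?S N \<omega>) \<le> norm (Y \<omega>) * norm (exp (\<bar>t\<bar> * \<bar>W h \<omega>\<bar>))" for N
    proof (rule AE_I2)
      fix \<omega>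
      let ?x = "\<bar>t\<bar> * \<bar>W h \<omega>\<bar>"
      have "\<bar>\<Sum>n<N. c n * (t * W h \<omega>) ^ n\<bar> \<le> (\<Sum>n<N. \<bar>c n * (t * W h \<omega>) ^ n\<bar>)" by (rule sum_abs)
      also have "\<dots> \<le> (\<Sum>n<N. inverse (fact n) * ?x ^ n)"
        using c(1) by (intro sum_mono) (auto simp: abs_mult power_abs power_mult_distrib intro!: mult_right_mono)
      also have "\<dots> \<le> exp ?x"
      proof -
        have "(\<lambda>n. inverse (fact n) * ?x ^ n) sums exp ?x" using exp_converges[of ?x] by simp
        from sums_summable[OF this] sums_unique[OF this] show ?thesis
          using sum_le_suminf[of "\<lambda>n. inverse (fact n) * ?x ^ n" "{..<N}"] by simp
      qed
      finally have "\<bar>\<Sum>n<N. c n * (t * W h \<omega>) ^ n\<bar> \<le> exp ?x" .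
      then have "\<bar>Y \<omega>\<bar> * \<bar>\<Sum>n<N. c n * (t * W h \<omega>) ^ n\<bar> \<le> \<bar>Y \<omega>\<bar> * exp ?x" by (intro mult_left_mono) auto
      then show "norm (?S N \<omega>) \<le> norm (Y \<omega>) * norm (exp (\<bar>t\<bar> * \<bar>W h \<omega>\<bar>))" by (simp add: abs_mult)
    qed
  qed measurable
  moreover have "(\<integral>\<omega>. ?S N \<omega> \<partial>M) = 0" for N
  proof -
    have i: "integrable M (\<lambda>\<omega>. Y \<omega> * W h \<omega> ^ n)" for n
      by (rule integrable_mult_L2[OF Y all_moments_square_integrable[OF all_moments_power[OF W_all_moments]]])
    have "(\<integral>\<omega>. ?S N \<omega> \<partial>M) = (\<integral>\<omega>. (\<Sum>n<N. (c n * t ^ n) * (Y \<omega> * W h \<omega> ^ n)) \<partial>M)"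
      by (intro Bochner_Integration.integral_cong refl) (simp add: sum_distrib_left power_mult_distrib mult_ac)
    also have "\<dots> = (\<Sum>n<N. (c n * t ^ n) * (\<integral>\<omega>. Y \<omega> * W h \<omega> ^ n \<partial>M))"
      using i by (subst Bochner_Integration.integral_sum) auto
    finally show ?thesis by (simp add: p)
  qed
  ultimately show ?thesis by (simp add: LIMSEQ_const_iff)
qed

text \<open>By the recursion \<open>x H\<^sub>q = H\<^bsub>q+1\<^esub> + q H\<^bsub>q-1\<^esub>\<close> the variable \<open>Y\<close> is orthogonal to all powers of
  \<open>W h\<close>, hence to \<open>cos (W k)\<close> and \<open>sin (W k)\<close> for all \<open>k\<close>, hence to the indicators of all events
  generated by \<open>W\<close>, and these are all events.\<close>

lemma hermite_total:
  assumes Y: "square_integrable M Y"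
    and orth: "\<And>xs. normalized xs \<Longrightarrow> (\<integral>\<omega>. Y \<omega> * herm xs \<omega> \<partial>M) = 0"
  shows "AE \<omega> in M. Y \<omega> = 0"
proof -
  note [measurable] = square_integrableD(1)[OF Y]
  have one: "square_integrable M (\<lambda>_. 1::real)" by (simp add: square_integrable_def)
  have Yi: "integrable M Y" using integrable_mult_L2[OF Y one] by simp
  have H: "(\<integral>\<omega>. Y \<omega> * hermite q (W h \<omega>) \<partial>M) = 0" if "q = 0 \<or> norm h = 1" for q h
    using orth[of "[(1, q, h)]"] that by simp
  have HW: "(\<integral>\<omega>. Y \<omega> * (W h \<omega> ^ n * hermite q (W h \<omega>)) \<partial>M) = 0" if h: "norm h = 1" for n q h
  proof (induction n arbitrary: q)
    case 0 then show ?case using H h by simp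
  next
    case (Suc n)
    have i: "integrable M (\<lambda>\<omega>. Y \<omega> * (W h \<omega> ^ n * hermite q (W h \<omega>)))" for q
      by (rule integrable_mult_L2[OF Y all_moments_square_integrable[OF all_moments_mult[OF all_moments_power[OF W_all_moments] hermite_W_moments]]])
    have "(\<integral>\<omega>. Y \<omega> * (W h \<omega> ^ Suc n * hermite q (W h \<omega>)) \<partial>M) =
      (\<integral>\<omega>. Y \<omega> * (W h \<omega> ^ n * hermite (Suc q) (W h \<omega>)) + real q * (Y \<omega> * (W h \<omega> ^ n * hermite (q - 1) (W h \<omega>))) \<partial>M)"
      unfolding hermite_Suc by (intro Bochner_Integration.integral_cong refl) (simp add: algebra_simps)
    also have "\<dots> = (\<integral>\<omega>. Y \<omega> * (W h \<omega> ^ n * hermite (Suc q) (W h \<omega>)) \<partial>M) + real q * (\<integral>\<omega>. Y \<omega> * (W h \<omega> ^ n * hermite (q - 1) (W h \<omega>)) \<partial>M)"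
      using i[of "Suc q"] i[of "q - 1"] by (subst Bochner_Integration.integral_add) auto
    finally show ?case by (simp only: Suc.IH)
  qed
  have pw: "(\<integral>\<omega>. Y \<omega> * W h \<omega> ^ n \<partial>M) = 0" if "norm h = 1" for n h
    using HW[OF that, of n 0] by simp
  have unit: "(\<integral>\<omega>. Y \<omega> * cos (t * W h \<omega>) \<partial>M) = 0 \<and> (\<integral>\<omega>. Y \<omega> * sin (t * W h \<omega>) \<partial>M) = 0" if "norm h = 1" for t h
  proof
    show "(\<integral>\<omega>. Y \<omega> * cos (t * W h \<omega>) \<partial>M) = 0"
      by (rule power_series_integral_zero[OF Y pw[OF that], where c = cos_coeff])
         (use cos_converges[where 'a = real] in \<open>auto simp: cos_coeff_def divide_inverse power_abs abs_mult\<close>)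
    show "(\<integral>\<omega>. Y \<omega> * sin (t * W h \<omega>) \<partial>M) = 0"
      by (rule power_series_integral_zero[OF Y pw[OF that], where c = sin_coeff])
         (use sin_converges[where 'a = real] in \<open>auto simp: sin_coeff_def divide_inverse power_abs abs_mult\<close>)
  qed
  have trig: "(\<integral>\<omega>. Y \<omega> * cos (W k \<omega>) \<partial>M) = 0 \<and> (\<integral>\<omega>. Y \<omega> * sin (W k \<omega>) \<partial>M) = 0" for k
  proof (cases "k = 0")
    case True
    have "(\<integral>\<omega>. Y \<omega> * cos (W 0 \<omega>) \<partial>M) = (\<integral>\<omega>. Y \<omega> \<partial>M)"
      by (intro integral_cong_AE) (measurable, use W_zero in eventually_elim, simp)
    moreover have "(\<integral>\<omega>. Y \<omega> * sin (W 0 \<omega>) \<partial>M) = (\<integral>\<omega>. 0 \<partial>M)"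
      by (intro integral_cong_AE) (measurable, use W_zero in eventually_elim, simp)
    moreover have "(\<integral>\<omega>. Y \<omega> \<partial>M) = 0" using H[of 0 0] by simp
    ultimately show ?thesis using True by simp
  next
    case False
    let ?h = "(1 / norm k) *\<^sub>R k"
    have h: "norm ?h = 1" and k: "k = norm k *\<^sub>R ?h" using False by auto
    have ae: "AE \<omega> in M. W k \<omega> = norm k * W ?h \<omega>" using W_scaleR[of "norm k" ?h] k by simp
    have "(\<integral>\<omega>. Y \<omega> * g (W k \<omega>) \<partial>M) = (\<integral>\<omega>. Y \<omega> * g (norm k * W ?h \<omega>) \<partial>M)"
      if [measurable]: "g \<in> borel_measurable borel" for g :: "real \<Rightarrow> real"
    proof (rule integral_cong_AE)
      show "AE \<omega> in M. Y \<omega> * g (W k \<omega>) = Y \<omega> * g (norm k * W ?h \<omega>)" using ae by eventually_elim simp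
    qed measurable
    from this[of cos] this[of sin] show ?thesis using unit[OF h, of "norm k"] by simp
  qed
  have ev: "sets M = sigma_sets (space M) (W_events UNIV)"
    unfolding generated W_events_def by (rule arg_cong[where f = "sigma_sets (space M)"]) auto
  have Z: "(\<integral>\<omega>. Y \<omega> * indicator B \<omega> \<partial>M) = 0" if "B \<in> sets M" for B
    by (rule trigonometric_total[OF subspace_UNIV Yi]) (use trig that ev in auto)
  \<comment> \<open>test with the events \<open>Y > 0\<close> and \<open>Y < 0\<close>\<close>
  have half: "AE \<omega> in M. s * Y \<omega> \<le> 0" if s: "s = 1 \<or> s = -1" for s :: real
  proof -
    let ?B = "{\<omega> \<in> space M. s * Y \<omega> > 0}"
    have B: "?B \<in> sets M" by measurable
    have i: "integrable M (\<lambda>\<omega>. s * (Y \<omega> * indicator ?B \<omega>))"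
      using integrable_mult_indicator[OF B Yi] by (simp add: mult.commute)
    have "(\<integral>\<omega>. s * (Y \<omega> * indicator ?B \<omega>) \<partial>M) = 0" using Z[OF B] by simp
    then have "AE \<omega> in M. s * (Y \<omega> * indicator ?B \<omega>) = 0"
      by (subst (asm) integral_nonneg_eq_0_iff_AE[OF i]) (auto simp: indicator_def)
    then show ?thesis
      using AE_space by eventually_elim (auto simp: indicator_def split: if_splits)
  qed
  show ?thesis using half[of 1] half[of "-1"] by (auto elim!: eventually_elim2)
qed

lemma hermite_dense:
  assumes F: "square_integrable M F"
  obtains xss where "\<And>n::nat. normalized (xss n)" "L2_converges M (\<lambda>n. herm (xss n)) F"
proof -
  let ?V = "{herm xs | xs. normalized xs}"
  obtain Ps where Ps: "\<And>n::nat. Ps n \<in> ?V" "L2_converges M Ps F"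
  proof (rule dense_if_trivial_orthogonal[of ?V, OF _ _ _ _ F])
    show "square_integrable M P" if "P \<in> ?V" for P using that herm_square_integrable by blast
    have "herm [] = (\<lambda>_. 0)" by (rule ext) simp
    then show "(\<lambda>_. 0) \<in> ?V" by (metis (mono_tags, lifting) mem_Collect_eq normalized_simps(1))
    show "(\<lambda>\<omega>. a * P \<omega> + b * Q \<omega>) \<in> ?V" if PQ: "P \<in> ?V" "Q \<in> ?V" for P Q a b
    proof -
      obtain xs ys where "P = herm xs" "Q = herm ys" "normalized xs" "normalized ys" using PQ by blast
      then have "(\<lambda>\<omega>. a * P \<omega> + b * Q \<omega>) = herm (scale_terms a xs @ scale_terms b ys)"
        "normalized (scale_terms a xs @ scale_terms b ys)"
        by (auto simp: fun_eq_iff)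
      then show ?thesis by blast
    qed
    show "AE \<omega> in M. Y \<omega> = 0" if "square_integrable M Y" "\<And>P. P \<in> ?V \<Longrightarrow> (\<integral>\<omega>. Y \<omega> * P \<omega> \<partial>M) = 0" for Y
      by (rule hermite_total[OF that(1)]) (rule that(2), blast)
  qed blast
  from Ps(1) have "\<forall>n. \<exists>xs. normalized xs \<and> Ps n = herm xs" by auto
  then obtain xss where x: "\<And>n. normalized (xss n)" "\<And>n. Ps n = herm (xss n)" by metis
  have "Ps = (\<lambda>n. herm (xss n))" by (rule ext) (rule x(2))
  with that[OF x(1)] Ps(2) show thesis by simp
qed

subsection \<open>Energy inequalities\<close>

text \<open>Pythagoras: terms of different order are orthogonal.\<close>

lemma herm_filter_energy:
  assumes "normalized xs"
  shows "(\<integral>\<omega>. (herm (filter (\<lambda>t. P (order_of t)) xs) \<omega>)\<^sup>2 \<partial>M) \<le> (\<integral>\<omega>. (herm xs \<omega>)\<^sup>2 \<partial>M)"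
proof -
  let ?a = "filter (\<lambda>t. P (order_of t)) xs" and ?b = "filter (\<lambda>t. \<not> P (order_of t)) xs"
  have o: "(\<integral>\<omega>. herm ?a \<omega> * herm ?b \<omega> \<partial>M) = 0"
    by (rule herm_orthogonal) (use assms in auto)
  have e: "herm xs \<omega> = herm ?a \<omega> + herm ?b \<omega>" for \<omega> by (rule herm_filter_split)
  have "(\<integral>\<omega>. (herm xs \<omega>)\<^sup>2 \<partial>M) = (\<integral>\<omega>. herm ?a \<omega> * herm ?a \<omega> + 2 * (herm ?a \<omega> * herm ?b \<omega>) + herm ?b \<omega> * herm ?b \<omega> \<partial>M)"
    by (intro Bochner_Integration.integral_cong refl, subst e) (simp add: power2_eq_square algebra_simps)
  also have "\<dots> = (\<integral>\<omega>. herm ?a \<omega> * herm ?a \<omega> \<partial>M) + 2 * (\<integral>\<omega>. herm ?a \<omega> * herm ?b \<omega> \<partial>M) + (\<integral>\<omega>. herm ?b \<omega> * herm ?b \<omega> \<partial>M)"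
    using herm_mult_integrable[of ?a ?a] herm_mult_integrable[of ?a ?b] herm_mult_integrable[of ?b ?b] by simp
  finally have "(\<integral>\<omega>. (herm xs \<omega>)\<^sup>2 \<partial>M) = (\<integral>\<omega>. (herm ?a \<omega>)\<^sup>2 \<partial>M) + (\<integral>\<omega>. (herm ?b \<omega>)\<^sup>2 \<partial>M)"
    using o by (simp add: power2_eq_square)
  then show ?thesis by simp
qed

lemma herm_by_order:
  assumes "\<And>t. t \<in> set xs \<Longrightarrow> order_of t \<le> m"
  shows "herm xs \<omega> = (\<Sum>q\<le>m. herm (filter (\<lambda>t. order_of t = q) xs) \<omega>)"
  using assms
proof (induction xs)
  case (Cons t xs)
  obtain a p h where t: "t = (a, p, h)" by (cases t)
  have p: "p \<le> m" using Cons.prems[of t] t by simp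
  have IH: "herm xs \<omega> = (\<Sum>q\<le>m. herm (filter (\<lambda>t. order_of t = q) xs) \<omega>)"
    by (rule Cons.IH, rule Cons.prems) simp
  have "(\<Sum>q\<le>m. herm (filter (\<lambda>t. order_of t = q) (t # xs)) \<omega>)
     = (\<Sum>q\<le>m. (if q = p then a * hermite p (W h \<omega>) else 0) + herm (filter (\<lambda>t. order_of t = q) xs) \<omega>)"
    by (intro sum.cong refl) (simp add: t)
  also have "\<dots> = a * hermite p (W h \<omega>) + herm xs \<omega>"
    unfolding sum.distrib IH using p by simp
  finally show ?case by (simp add: t)
qed simp

text \<open>In terms of the energies \<open>c\<^sub>q\<close> of the components, the left-hand side
  \<open>E \<bar>D F\<bar>\<^sup>2 = E [(-L F) F]\<close> is \<open>\<Sum> q c\<^sub>q\<close>, the right-hand side \<open>E (L F)\<^sup>2\<close> is \<open>\<Sum> q\<^sup>2 c\<^sub>q\<close>, and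
  \<open>q \<le> q\<^sup>2\<close>.\<close>

lemma hermD_energy:
  assumes n: "normalized xs"
  shows "(\<integral>\<omega>. (norm (hermD xs \<omega>))\<^sup>2 \<partial>M) \<le> (\<integral>\<omega>. (herm (number_terms xs) \<omega>)\<^sup>2 \<partial>M)"
proof -
  define m where "m = Max (insert 0 (order_of ` set xs))"
  have m: "order_of t \<le> m" if "t \<in> set xs" for t using that by (auto simp: m_def intro!: Max_ge)
  define d where "d q = herm (filter (\<lambda>t. order_of t = q) xs)" for q
  have x: "herm xs \<omega> = (\<Sum>q\<le>m. 1 * d q \<omega>)" for \<omega> unfolding d_def by (simp only: mult_1_left) (rule herm_by_order[OF m])
  have Nx: "herm (number_terms xs) \<omega> = (\<Sum>q\<le>m. real q * d q \<omega>)" for \<omega>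
  proof -
    have "order_of t \<le> m" if "t \<in> set (number_terms xs)" for t
    proof -
      have "order_of t \<in> order_of ` set (number_terms xs)" using that by (rule imageI)
      then show ?thesis using m by auto
    qed
    then have "herm (number_terms xs) \<omega> = (\<Sum>q\<le>m. herm (filter (\<lambda>t. order_of t = q) (number_terms xs)) \<omega>)"
      by (rule herm_by_order)
    also have "\<dots> = (\<Sum>q\<le>m. real q * d q \<omega>)"
    proof (intro sum.cong refl)
      fix q show "herm (filter (\<lambda>t. order_of t = q) (number_terms xs)) \<omega> = real q * d q \<omega>"
        unfolding d_def filter_number[of "\<lambda>r. r = q"] by (rule herm_number_single_order) simp
    qed
    finally show ?thesis .
  qed
  have sq: "square_integrable M (d q)" for q unfolding d_def by (rule herm_square_integrable)
  have o: "(\<integral>\<omega>. d p \<omega> * d q \<omega> \<partial>M) = 0" if "p \<noteq> q" for p q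
    unfolding d_def by (rule herm_orthogonal) (use n that in auto)
  have S: "(\<integral>\<omega>. (\<Sum>q\<le>m. a q * d q \<omega>) * (\<Sum>q\<le>m. b q * d q \<omega>) \<partial>M) = (\<Sum>q\<le>m. a q * b q * (\<integral>\<omega>. (d q \<omega>)\<^sup>2 \<partial>M))" for a b
    by (rule integral_orthogonal_sums) (auto intro: sq o)
  have "(\<integral>\<omega>. (norm (hermD xs \<omega>))\<^sup>2 \<partial>M) = (\<integral>\<omega>. herm (number_terms xs) \<omega> * herm xs \<omega> \<partial>M)"
    unfolding power2_norm_eq_inner by (rule herm_integration_by_parts[OF n herm_cylindrical])
  also have "\<dots> = (\<Sum>q\<le>m. real q * 1 * (\<integral>\<omega>. (d q \<omega>)\<^sup>2 \<partial>M))" unfolding x Nx by (rule S)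
  also have "\<dots> \<le> (\<Sum>q\<le>m. real q * real q * (\<integral>\<omega>. (d q \<omega>)\<^sup>2 \<partial>M))"
  proof (intro sum_mono mult_right_mono)
    fix q show "real q * 1 \<le> real q * real q" by (cases q) auto
  qed auto
  also have "\<dots> = (\<integral>\<omega>. (herm (number_terms xs) \<omega>)\<^sup>2 \<partial>M)" unfolding Nx power2_eq_square by (rule S[symmetric, unfolded power2_eq_square])
  finally show ?thesis .
qed

end

subsection \<open>The chaos decomposition\<close>

context isonormal_gaussian_process begin

definition order_terms :: "nat \<Rightarrow> 'h hermite_terms set" where
  "order_terms q = {xs. normalized xs \<and> (\<forall>t\<in>set xs. order_of t = q)}"

lemma order_termsD:
  assumes "xs \<in> order_terms q"
  shows "normalized xs" "\<And>t. t \<in> set xs \<Longrightarrow> order_of t = q"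
  using assms by (auto simp: order_terms_def)

lemma order_terms_filter: "normalized xs \<Longrightarrow> filter (\<lambda>t. order_of t = q) xs \<in> order_terms q"
  by (simp add: order_terms_def)

lemma order_terms_orthogonal:
  assumes "xs \<in> order_terms p" "ys \<in> order_terms q" "p \<noteq> q"
  shows "(\<integral>\<omega>. herm xs \<omega> * herm ys \<omega> \<partial>M) = 0"
  by (rule herm_orthogonal_single_order[OF order_termsD(1)[OF assms(1)] order_termsD(1)[OF assms(2)]
        order_termsD(2)[OF assms(1)] order_termsD(2)[OF assms(2)] assms(3)])

lemma herm_order_0:
  assumes "xs \<in> order_terms 0"
  shows "\<exists>c. herm xs = (\<lambda>_. c)"
  using order_termsD(2)[OF assms]
proof (induction xs)
  case Nil then show ?case by (intro exI[of _ 0] ext) simp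
next
  case (Cons t xs)
  obtain a q h where t: "t = (a, q, h)" by (cases t)
  have "q = 0" using Cons.prems[of t] t by simp
  moreover obtain c where "herm xs = (\<lambda>_. c)" using Cons.IH Cons.prems by (metis list.set_intros(2))
  ultimately show ?case by (intro exI[of _ "a + c"] ext) (simp add: t)
qed

text \<open>A description of the chaos that does not distinguish order \<open>0\<close> from the others.\<close>

lemma wiener_chaos_approx:
  assumes "Y \<in> wiener_chaos M W q"
  obtains xss where "\<And>n::nat. xss n \<in> order_terms q" "L2_converges M (\<lambda>n. herm (xss n)) Y"
proof (cases "q = 0")
  case True
  then obtain c where Y: "Y \<in> borel_measurable M" "AE \<omega> in M. Y \<omega> = c"
    using assms by (auto simp: wiener_chaos_def)
  let ?xs = "[(c, 0, 0)] :: 'h hermite_terms"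
  have h: "herm ?xs \<omega> = c" for \<omega> by simp
  have z: "AE \<omega> in M. (norm (herm ?xs \<omega> - Y \<omega>))\<^sup>2 = 0" using Y(2) by eventually_elim simp
  have sY: "square_integrable M Y"
    unfolding square_integrable_def
  proof (intro conjI Y(1))
    have "integrable M (\<lambda>\<omega>. (norm c)\<^sup>2)" by simp
    then show "integrable M (\<lambda>\<omega>. (norm (Y \<omega>))\<^sup>2)"
    proof (rule integrable_cong_AE_imp)
      show "(\<lambda>\<omega>. (norm (Y \<omega>))\<^sup>2) \<in> borel_measurable M" using Y(1) by measurable
      show "AE \<omega> in M. (norm c)\<^sup>2 = (norm (Y \<omega>))\<^sup>2" using Y(2) by eventually_elim simp
    qed
  qed
  have "L2_converges M (\<lambda>n. herm ?xs) Y"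
    unfolding L2_converges_def using integral_eq_zero_AE[OF z] sY herm_square_integrable by simp
  then show thesis using True by (intro that[of "\<lambda>n. ?xs"]) (auto simp: order_terms_def)
next
  case False
  then obtain Ys where Ys: "L2_converges M Ys Y"
    "\<forall>n. \<exists>(N::nat) a h. (\<forall>i<N. norm (h i) = 1) \<and> Ys n = (\<lambda>\<omega>. \<Sum>i<N. a i * hermite q (W (h i) \<omega>))"
    using assms by (auto simp: wiener_chaos_def)
  have "\<exists>xs\<in>order_terms q. Ys n = herm xs" for n
  proof -
    obtain N :: nat and a h where h: "\<forall>i<N. norm (h i) = 1" and y: "Ys n = (\<lambda>\<omega>. \<Sum>i<N. a i * hermite q (W (h i) \<omega>))"
      using Ys(2) by blast
    let ?xs = "map (\<lambda>i. (a i, q, h i)) [0..<N]"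
    have "herm ?xs \<omega> = Ys n \<omega>" for \<omega>
      unfolding y herm_def by (simp add: o_def interv_sum_list_conv_sum_set_nat atLeast0LessThan)
    moreover have "?xs \<in> order_terms q" using h by (auto simp: order_terms_def normalized_def)
    ultimately show ?thesis by (intro bexI[of _ ?xs] ext) simp
  qed
  then obtain xss where x: "\<And>n. xss n \<in> order_terms q" "\<And>n. Ys n = herm (xss n)" by metis
  have "Ys = (\<lambda>n. herm (xss n))" by (rule ext) (rule x(2))
  with that[OF x(1)] Ys(1) show thesis by simp
qed

text \<open>For order \<open>0\<close> the approximants are constants, and the mean of the limit is the constant
  they tend to.\<close>

lemma wiener_chaos_limit:
  assumes x: "\<And>n::nat. xss n \<in> order_terms q" and lim: "L2_converges M (\<lambda>n. herm (xss n)) Y"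
  shows "Y \<in> wiener_chaos M W q"
proof (cases "q = 0")
  case True
  have "\<exists>c. herm (xss n) = (\<lambda>_. c)" for n using herm_order_0 x True by auto
  then obtain c where c: "\<And>n. herm (xss n) = (\<lambda>_. c n)" by metis
  have one: "square_integrable M (\<lambda>_. a)" for a :: real by (simp add: square_integrable_def)
  let ?m = "\<integral>\<omega>. Y \<omega> \<partial>M"
  have "(\<lambda>n. \<integral>\<omega>. herm (xss n) \<omega> * 1 \<partial>M) \<longlonglongrightarrow> (\<integral>\<omega>. Y \<omega> * 1 \<partial>M)"
    by (rule L2_converges_mult[OF lim L2_converges_const[OF one]])
  then have cl: "c \<longlonglongrightarrow> ?m" by (simp add: c prob_space)
  have "L2_converges M (\<lambda>n. herm (xss n)) (\<lambda>_. ?m)"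
  proof -
    have "(\<lambda>n. (norm (c n - ?m))\<^sup>2) \<longlonglongrightarrow> (norm (?m - ?m))\<^sup>2" by (intro tendsto_intros cl)
    then show ?thesis unfolding L2_converges_def c using one by (simp add: prob_space)
  qed
  from L2_converges_unique[OF lim this] have "AE \<omega> in M. Y \<omega> = ?m" .
  then show ?thesis using True square_integrableD(1)[OF L2_convergesD(2)[OF lim]]
    by (auto simp: wiener_chaos_def)
next
  case False
  have "\<exists>(N::nat) a h. (\<forall>i<N. norm (h i) = 1) \<and> herm (xss n) = (\<lambda>\<omega>. \<Sum>i<N. a i * hermite q (W (h i) \<omega>))" for n
  proof (intro exI conjI allI impI ext)
    let ?xs = "xss n"
    have o: "order_of (?xs ! i) = q" if "i < length ?xs" for i
      by (rule order_termsD(2)[OF x nth_mem[OF that]])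
    fix i assume i: "i < length ?xs"
    have "?xs ! i \<in> set ?xs" using i by simp
    then have "order_of (?xs ! i) = 0 \<or> norm (snd (snd (?xs ! i))) = 1"
      using order_termsD(1)[OF x[of n]] unfolding normalized_def by (auto simp: split_beta)
    then show "norm (snd (snd (?xs ! i))) = 1" using o[OF i] False by simp
  next
    fix \<omega>
    let ?xs = "xss n"
    have "herm ?xs \<omega> = (\<Sum>i<length ?xs. fst (?xs ! i) * hermite (order_of (?xs ! i)) (W (snd (snd (?xs ! i))) \<omega>))"
      by (simp add: herm_def sum_list_sum_nth split_beta atLeast0LessThan)
    also have "\<dots> = (\<Sum>i<length ?xs. fst (?xs ! i) * hermite q (W (snd (snd (?xs ! i))) \<omega>))"
    proof (intro sum.cong refl)
      fix i assume "i \<in> {..<length ?xs}"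
      then have "order_of (?xs ! i) = q" by (intro order_termsD(2)[OF x nth_mem]) simp
      then show "fst (?xs ! i) * hermite (order_of (?xs ! i)) (W (snd (snd (?xs ! i))) \<omega>) = fst (?xs ! i) * hermite q (W (snd (snd (?xs ! i))) \<omega>)" by simp
    qed
    finally show "herm ?xs \<omega> = (\<Sum>i<length ?xs. fst (?xs ! i) * hermite q (W (snd (snd (?xs ! i))) \<omega>))" .
  qed
  then show ?thesis using lim False unfolding wiener_chaos_def by auto
qed

lemma wiener_chaos_square_integrable: "Y \<in> wiener_chaos M W q \<Longrightarrow> square_integrable M Y"
  using wiener_chaos_approx L2_convergesD(2) by metis

lemma wiener_chaos_orthogonal:
  assumes "Y \<in> wiener_chaos M W p" "Y' \<in> wiener_chaos M W q" "p \<noteq> q"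
  shows "(\<integral>\<omega>. Y \<omega> * Y' \<omega> \<partial>M) = 0"
proof -
  obtain xss where x: "\<And>n::nat. xss n \<in> order_terms p" "L2_converges M (\<lambda>n. herm (xss n)) Y"
    using wiener_chaos_approx[OF assms(1)] by blast
  obtain yss where y: "\<And>n::nat. yss n \<in> order_terms q" "L2_converges M (\<lambda>n. herm (yss n)) Y'"
    using wiener_chaos_approx[OF assms(2)] by blast
  have "(\<lambda>n. \<integral>\<omega>. herm (xss n) \<omega> * herm (yss n) \<omega> \<partial>M) \<longlonglongrightarrow> (\<integral>\<omega>. Y \<omega> * Y' \<omega> \<partial>M)"
    by (rule L2_converges_mult[OF x(2) y(2)])
  then show ?thesis by (simp add: order_terms_orthogonal[OF x(1) y(1) assms(3)] LIMSEQ_const_iff)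
qed

text \<open>Take \<open>P\<^sub>n \<rightarrow> F\<close> with \<open>P\<^sub>n\<close> a Hermite polynomial. Projecting to one order, or to all orders up to
  \<open>m\<close>, is a contraction, so the components of order \<open>q\<close> of \<open>P\<^sub>n\<close> converge, and the tail estimate for \<open>P\<^sub>n\<close>
  carries over to the limit.\<close>

lemma chaos_decomposition_exists:
  assumes F: "square_integrable M F"
  obtains J where "chaos_decomposition M W F J"
proof -
  obtain xss where n: "\<And>n::nat. normalized (xss n)" and lim: "L2_converges M (\<lambda>n. herm (xss n)) F"
    using hermite_dense[OF F] by blast
  have Cau: "L2_Cauchy M (\<lambda>n. herm (xss n))" by (rule L2_converges_Cauchy[OF lim])
  have diff: "(\<integral>\<omega>. (norm (herm (filter (\<lambda>t. P (order_of t)) (xss i)) \<omega> - herm (filter (\<lambda>t. P (order_of t)) (xss j)) \<omega>))\<^sup>2 \<partial>M)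
     \<le> (\<integral>\<omega>. (norm (herm (xss i) \<omega> - herm (xss j) \<omega>))\<^sup>2 \<partial>M)" for P i j
  proof -
    let ?d = "xss i @ scale_terms (-1) (xss j)"
    have "(\<integral>\<omega>. (herm (filter (\<lambda>t. P (order_of t)) ?d) \<omega>)\<^sup>2 \<partial>M) \<le> (\<integral>\<omega>. (herm ?d \<omega>)\<^sup>2 \<partial>M)"
      by (rule herm_filter_energy) (simp add: n)
    then show ?thesis by (simp add: filter_scale[of P])
  qed
  have "\<exists>Y. L2_converges M (\<lambda>n. herm (filter (\<lambda>t. order_of t = q) (xss n))) Y" for q
  proof -
    have "L2_Cauchy M (\<lambda>n. herm (filter (\<lambda>t. order_of t = q) (xss n)))"
      unfolding L2_Cauchy_def
    proof (intro conjI allI impI herm_square_integrable)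
      fix e :: real assume "e > 0"
      then obtain N where N: "\<And>i j. i \<ge> N \<Longrightarrow> j \<ge> N \<Longrightarrow> (\<integral>\<omega>. (norm (herm (xss i) \<omega> - herm (xss j) \<omega>))\<^sup>2 \<partial>M) < e"
        using Cau unfolding L2_Cauchy_def by blast
      show "\<exists>N. \<forall>i\<ge>N. \<forall>j\<ge>N. (\<integral>\<omega>. (norm (herm (filter (\<lambda>t. order_of t = q) (xss i)) \<omega> - herm (filter (\<lambda>t. order_of t = q) (xss j)) \<omega>))\<^sup>2 \<partial>M) < e"
        using diff[of "\<lambda>r. r = q"] N by (intro exI[of _ N] allI impI) (rule le_less_trans, assumption, blast)
    qed
    then show ?thesis using L2_complete by blast
  qed
  then obtain J where J: "\<And>q. L2_converges M (\<lambda>n. herm (filter (\<lambda>t. order_of t = q) (xss n))) (J q)" by metis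
  have JW: "J q \<in> wiener_chaos M W q" for q
    by (rule wiener_chaos_limit[OF order_terms_filter[OF n] J])
  have sJ: "square_integrable M (\<lambda>\<omega>. \<Sum>q\<le>m. J q \<omega>)" for m
    by (intro square_integrable_sum wiener_chaos_square_integrable[OF JW])
  have trunc: "herm (filter (\<lambda>t. order_of t \<le> m) xs) \<omega> = (\<Sum>q\<le>m. herm (filter (\<lambda>t. order_of t = q) xs) \<omega>)" for m xs \<omega>
  proof -
    have "herm (filter (\<lambda>t. order_of t \<le> m) xs) \<omega> = (\<Sum>q\<le>m. herm (filter (\<lambda>t. order_of t = q) (filter (\<lambda>t. order_of t \<le> m) xs)) \<omega>)"
      by (rule herm_by_order) simp
    also have "\<dots> = (\<Sum>q\<le>m. herm (filter (\<lambda>t. order_of t = q) xs) \<omega>)"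
    proof (intro sum.cong refl)
      fix q assume "q \<in> {..m}"
      then have "filter (\<lambda>t. order_of t = q) (filter (\<lambda>t. order_of t \<le> m) xs) = filter (\<lambda>t. order_of t = q) xs"
        unfolding filter_filter by (intro filter_cong refl) auto
      then show "herm (filter (\<lambda>t. order_of t = q) (filter (\<lambda>t. order_of t \<le> m) xs)) \<omega> = herm (filter (\<lambda>t. order_of t = q) xs) \<omega>" by simp
    qed
    finally show ?thesis .
  qed
  have SJ: "L2_converges M (\<lambda>n. herm (filter (\<lambda>t. order_of t \<le> m) (xss n))) (\<lambda>\<omega>. \<Sum>q\<le>m. J q \<omega>)" for m
    using L2_converges_sum[of "{..m}" M "\<lambda>n q. herm (filter (\<lambda>t. order_of t = q) (xss n))" J] J
    by (simp add: trunc[abs_def])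
  let ?E = "\<lambda>n. \<integral>\<omega>. (norm (herm (xss n) \<omega> - F \<omega>))\<^sup>2 \<partial>M"
  have tail: "(\<integral>\<omega>. (norm ((\<Sum>q\<le>m. J q \<omega>) - F \<omega>))\<^sup>2 \<partial>M) \<le> 4 * ?E i"
    if m: "\<And>t. t \<in> set (xss i) \<Longrightarrow> order_of t \<le> m" for i m
  proof -
    have f: "filter (\<lambda>t. order_of t \<le> m) (xss i) = xss i" using m by (simp add: filter_id_conv)
    have "(\<integral>\<omega>. (norm (herm (xss i) \<omega> - (\<Sum>q\<le>m. J q \<omega>)))\<^sup>2 \<partial>M) \<le> ?E i"
    proof (rule LIMSEQ_le)
      show "(\<lambda>k. \<integral>\<omega>. (norm (herm (xss i) \<omega> - herm (filter (\<lambda>t. order_of t \<le> m) (xss k)) \<omega>))\<^sup>2 \<partial>M)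
        \<longlonglongrightarrow> (\<integral>\<omega>. (norm (herm (xss i) \<omega> - (\<Sum>q\<le>m. J q \<omega>)))\<^sup>2 \<partial>M)"
        by (rule L2_converges_norm_square[OF L2_converges_diff[OF L2_converges_const[OF herm_square_integrable] SJ]])
      show "(\<lambda>k. \<integral>\<omega>. (norm (herm (xss i) \<omega> - herm (xss k) \<omega>))\<^sup>2 \<partial>M) \<longlonglongrightarrow> ?E i"
        by (rule L2_converges_norm_square[OF L2_converges_diff[OF L2_converges_const[OF herm_square_integrable] lim]])
      show "\<exists>N. \<forall>k\<ge>N. (\<integral>\<omega>. (norm (herm (xss i) \<omega> - herm (filter (\<lambda>t. order_of t \<le> m) (xss k)) \<omega>))\<^sup>2 \<partial>M)
         \<le> (\<integral>\<omega>. (norm (herm (xss i) \<omega> - herm (xss k) \<omega>))\<^sup>2 \<partial>M)"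
        using diff[of "\<lambda>r. r \<le> m" i] by (simp add: f)
    qed
    then have a: "(\<integral>\<omega>. (norm ((\<Sum>q\<le>m. J q \<omega>) - herm (xss i) \<omega>))\<^sup>2 \<partial>M) \<le> ?E i" by (simp add: power2_commute)
    have i1: "integrable M (\<lambda>\<omega>. (norm ((\<Sum>q\<le>m. J q \<omega>) - herm (xss i) \<omega>))\<^sup>2)"
      by (intro square_integrableD square_integrable_diff sJ herm_square_integrable)
    have i2: "integrable M (\<lambda>\<omega>. (norm (herm (xss i) \<omega> - F \<omega>))\<^sup>2)"
      by (intro square_integrableD square_integrable_diff F herm_square_integrable)
    have "(\<integral>\<omega>. (norm ((\<Sum>q\<le>m. J q \<omega>) - F \<omega>))\<^sup>2 \<partial>M)
      \<le> (\<integral>\<omega>. 2 * (norm ((\<Sum>q\<le>m. J q \<omega>) - herm (xss i) \<omega>))\<^sup>2 + 2 * (norm (herm (xss i) \<omega> - F \<omega>))\<^sup>2 \<partial>M)"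
    proof (intro integral_mono)
      show "integrable M (\<lambda>\<omega>. (norm ((\<Sum>q\<le>m. J q \<omega>) - F \<omega>))\<^sup>2)"
        by (intro square_integrableD square_integrable_diff F sJ)
      show "integrable M (\<lambda>\<omega>. 2 * (norm ((\<Sum>q\<le>m. J q \<omega>) - herm (xss i) \<omega>))\<^sup>2 + 2 * (norm (herm (xss i) \<omega> - F \<omega>))\<^sup>2)"
        using i1 i2 by auto
      show "(norm ((\<Sum>q\<le>m. J q \<omega>) - F \<omega>))\<^sup>2 \<le> 2 * (norm ((\<Sum>q\<le>m. J q \<omega>) - herm (xss i) \<omega>))\<^sup>2 + 2 * (norm (herm (xss i) \<omega> - F \<omega>))\<^sup>2" for \<omega>
        using norm_add_square_le[of "(\<Sum>q\<le>m. J q \<omega>) - herm (xss i) \<omega>" "herm (xss i) \<omega> - F \<omega>"] by simp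
    qed
    also have "\<dots> = 2 * (\<integral>\<omega>. (norm ((\<Sum>q\<le>m. J q \<omega>) - herm (xss i) \<omega>))\<^sup>2 \<partial>M) + 2 * ?E i"
      using i1 i2 by (subst Bochner_Integration.integral_add) simp_all
    finally show ?thesis using a by linarith
  qed
  have "(\<lambda>m. \<integral>\<omega>. (norm ((\<Sum>q\<le>m. J q \<omega>) - F \<omega>))\<^sup>2 \<partial>M) \<longlonglongrightarrow> 0"
  proof (rule LIMSEQ_I)
    fix e :: real assume "e > 0"
    then have "\<forall>\<^sub>F i in sequentially. ?E i < e / 4" using order_tendstoD(2)[OF L2_convergesD(3)[OF lim], of "e/4"] by simp
    then obtain i where i: "?E i < e / 4" by (auto simp: eventually_sequentially)
    define m0 where "m0 = Max (insert 0 (order_of ` set (xss i)))"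
    have m0: "order_of t \<le> m0" if "t \<in> set (xss i)" for t using that by (auto simp: m0_def intro!: Max_ge)
    have "norm ((\<integral>\<omega>. (norm ((\<Sum>q\<le>m. J q \<omega>) - F \<omega>))\<^sup>2 \<partial>M) - 0) < e" if "m \<ge> m0" for m
    proof -
      have "(\<integral>\<omega>. (norm ((\<Sum>q\<le>m. J q \<omega>) - F \<omega>))\<^sup>2 \<partial>M) \<le> 4 * ?E i"
        by (rule tail) (rule order_trans[OF m0 that])
      then show ?thesis using i by simp
    qed
    then show "\<exists>no. \<forall>m\<ge>no. norm ((\<integral>\<omega>. (norm ((\<Sum>q\<le>m. J q \<omega>) - F \<omega>))\<^sup>2 \<partial>M) - 0) < e" by blast
  qed
  then have "chaos_decomposition M W F J"
    unfolding chaos_decomposition_def L2_converges_def using JW sJ F by auto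
  then show thesis by (rule that)
qed

end

subsection \<open>The inverse of the Ornstein-Uhlenbeck operator\<close>

context isonormal_gaussian_process begin

lemma chaos_sum_energy_mono:
  assumes J: "\<And>q. J q \<in> wiener_chaos M W q" and Q: "finite Q" and ab: "\<And>q. q \<in> Q \<Longrightarrow> \<bar>a q\<bar> \<le> \<bar>b q\<bar>"
  shows "(\<integral>\<omega>. (\<Sum>q\<in>Q. a q * J q \<omega>)\<^sup>2 \<partial>M) \<le> (\<integral>\<omega>. (\<Sum>q\<in>Q. b q * J q \<omega>)\<^sup>2 \<partial>M)"
proof -
  have S: "(\<integral>\<omega>. (\<Sum>q\<in>Q. c q * J q \<omega>)\<^sup>2 \<partial>M) = (\<Sum>q\<in>Q. c q * c q * (\<integral>\<omega>. (J q \<omega>)\<^sup>2 \<partial>M))" for c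
    unfolding power2_eq_square[of "\<Sum>q\<in>Q. c q * J q _"]
    by (rule integral_orthogonal_sums[OF Q wiener_chaos_square_integrable[OF J] wiener_chaos_orthogonal[OF J J]])
  have "a q * a q \<le> b q * b q" if "q \<in> Q" for q
    using ab[OF that] abs_le_square_iff[of "a q" "b q"] by (simp add: power2_eq_square)
  then show ?thesis unfolding S by (intro sum_mono mult_right_mono) auto
qed

text \<open>Dividing the component of order \<open>q\<close> by \<open>q\<close> does not increase the energy, so the partial
  sums of \<open>L\<^sup>-\<^sup>1 F\<close> inherit the Cauchy property from those of \<open>F\<close>.\<close>

lemma L_inverse_exists:
  assumes J: "chaos_decomposition M W F J"
  shows "\<exists>V. is_L_inverse M W F V"
proof -
  have JW: "J q \<in> wiener_chaos M W q" for q using J by (auto simp: chaos_decomposition_def)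
  have S: "L2_converges M (\<lambda>n \<omega>. \<Sum>q\<le>n. J q \<omega>) F" using J by (simp add: chaos_decomposition_def)
  let ?S = "\<lambda>n \<omega>. \<Sum>q\<le>n. J q \<omega>" and ?V = "\<lambda>n \<omega>. - (\<Sum>q=1..n. J q \<omega> / real q)"
  have sV: "square_integrable M (?V n)" for n
    unfolding divide_inverse mult.commute[of _ "inverse _"]
    by (intro square_integrable_minus square_integrable_sum square_integrable_cmult wiener_chaos_square_integrable[OF JW])
  have le: "(\<integral>\<omega>. (norm (?V m \<omega> - ?V n \<omega>))\<^sup>2 \<partial>M) \<le> (\<integral>\<omega>. (norm (?S m \<omega> - ?S n \<omega>))\<^sup>2 \<partial>M)" for m n
  proof -
    let ?N = "max m n"
    \<comment> \<open>both differences as combinations of the \<open>J q\<close> over one index range, with coefficients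
      \<open>?b\<close> and \<open>?a\<close>\<close>
    let ?b = "\<lambda>q. (if q \<le> m then 1 else 0) - (if q \<le> n then 1 else 0) :: real"
    let ?a = "\<lambda>q. - (if q = 0 then 0 else ?b q / real q)"
    have v: "(\<Sum>q=1..k. J q \<omega> / real q) = (\<Sum>q\<le>?N. if 1 \<le> q \<and> q \<le> k then J q \<omega> / real q else 0)" if "k \<le> ?N" for k \<omega>
      using that by (intro sum.mono_neutral_cong_left) auto
    have s: "(\<Sum>q\<le>k. J q \<omega>) = (\<Sum>q\<le>?N. if q \<le> k then J q \<omega> else 0)" if "k \<le> ?N" for k \<omega>
      using that by (intro sum.mono_neutral_cong_left) auto
    have V: "?V m \<omega> - ?V n \<omega> = (\<Sum>q\<le>?N. ?a q * J q \<omega>)" for \<omega>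
      unfolding v[OF max.cobounded1] v[OF max.cobounded2] sum_negf[symmetric] sum_subtractf[symmetric]
      by (intro sum.cong refl) auto
    have S': "?S m \<omega> - ?S n \<omega> = (\<Sum>q\<le>?N. ?b q * J q \<omega>)" for \<omega>
      unfolding s[OF max.cobounded1] s[OF max.cobounded2] sum_subtractf[symmetric]
      by (intro sum.cong refl) auto
    have "\<bar>?a q\<bar> \<le> \<bar>?b q\<bar>" for q
      by (cases q) (auto simp: divide_le_eq)
    then show ?thesis unfolding V S' real_norm_def power2_abs by (intro chaos_sum_energy_mono[OF JW]) auto
  qed
  have "L2_Cauchy M ?V"
    unfolding L2_Cauchy_def
  proof (intro conjI allI impI sV)
    fix e :: real assume "e > 0"
    then obtain N where "\<And>i j. i \<ge> N \<Longrightarrow> j \<ge> N \<Longrightarrow> (\<integral>\<omega>. (norm (?S i \<omega> - ?S j \<omega>))\<^sup>2 \<partial>M) < e"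
      using L2_converges_Cauchy[OF S] unfolding L2_Cauchy_def by blast
    then show "\<exists>N. \<forall>i\<ge>N. \<forall>j\<ge>N. (\<integral>\<omega>. (norm (?V i \<omega> - ?V j \<omega>))\<^sup>2 \<partial>M) < e"
      by (intro exI[of _ N] allI impI le_less_trans[OF le]) blast
  qed
  then obtain V where "L2_converges M ?V V" by (rule L2_complete)
  then show ?thesis unfolding is_L_inverse_def using J by blast
qed

lemma herm_concat: "herm (concat xss) \<omega> = (\<Sum>xs\<leftarrow>xss. herm xs \<omega>)"
  by (induction xss) auto

lemma number_terms_append: "number_terms (xs @ ys) = number_terms xs @ number_terms ys"
  by (simp add: number_terms_def)

lemma number_terms_scale: "number_terms (scale_terms c xs) = scale_terms c (number_terms xs)"
  by (induction xs) (auto simp: number_terms_def scale_terms_def mult_ac)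

lemma number_terms_concat: "number_terms (concat xss) = concat (map number_terms xss)"
  by (induction xss) (auto simp: number_terms_append, simp add: number_terms_def)

text \<open>If \<open>z\<^sub>q\<close> is a Hermite polynomial close to \<open>J\<^sub>q\<close>, then the \<open>L\<^sup>2\<close> distance between the derivatives of
  two sums \<open>- \<Sum> z\<^sub>q / q\<close> is bounded by that between the sums \<open>\<Sum> z\<^sub>q\<close>, which approximate \<open>F - J\<^sub>0\<close>.\<close>

lemma L_inverse_derivative:
  assumes J: "chaos_decomposition M W F J" and V: "L2_converges M (\<lambda>n \<omega>. - (\<Sum>q=1..n. J q \<omega> / real q)) V"
  shows "\<exists>B. is_malliavin_deriv M W V B"
proof -
  have JW: "J q \<in> wiener_chaos M W q" for q using J by (auto simp: chaos_decomposition_def)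
  note sJ = wiener_chaos_square_integrable[OF JW]
  have S: "L2_converges M (\<lambda>n \<omega>. \<Sum>q\<le>n. J q \<omega>) F" using J by (simp add: chaos_decomposition_def)
  \<comment> \<open>the sum of \<open>m\<close> errors has square at most \<open>m\<close> times the sum of their squares, so the third
    power leaves \<open>1 / (m + 1)\<close>\<close>
  define near where "near m q xs \<longleftrightarrow> xs \<in> order_terms q \<and>
    (\<integral>\<omega>. (norm (herm xs \<omega> - J q \<omega>))\<^sup>2 \<partial>M) \<le> 1 / (real m + 1) ^ 3" for m q xs
  have ex: "\<exists>xs. near m q xs" for m q
  proof -
    obtain xss where x: "\<And>n::nat. xss n \<in> order_terms q" "L2_converges M (\<lambda>n. herm (xss n)) (J q)"
      using wiener_chaos_approx[OF JW] by blast
    have "\<forall>\<^sub>F n in sequentially. (\<integral>\<omega>. (norm (herm (xss n) \<omega> - J q \<omega>))\<^sup>2 \<partial>M) < 1 / (real m + 1) ^ 3"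
      by (rule order_tendstoD(2)[OF L2_convergesD(3)[OF x(2)]]) simp
    then obtain n where "(\<integral>\<omega>. (norm (herm (xss n) \<omega> - J q \<omega>))\<^sup>2 \<partial>M) < 1 / (real m + 1) ^ 3"
      by (auto simp: eventually_sequentially)
    then show ?thesis using x(1)[of n] by (intro exI[of _ "xss n"]) (simp add: near_def)
  qed
  define z where "z m q = (SOME xs. near m q xs)" for m q
  have "near m q (z m q)" for m q unfolding z_def by (rule someI_ex[OF ex])
  then have z: "\<And>m q. z m q \<in> order_terms q"
    "\<And>m q. (\<integral>\<omega>. (norm (herm (z m q) \<omega> - J q \<omega>))\<^sup>2 \<partial>M) \<le> 1 / (real m + 1) ^ 3"
    by (simp_all add: near_def)
  define zs where "zs m = concat (map (\<lambda>q. scale_terms (- 1 / real q) (z m q)) [1..<Suc m])" for m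
  define T where "T m \<omega> = (\<Sum>q=1..m. herm (z m q) \<omega>)" for m \<omega>
  have hz: "herm (zs m) \<omega> = (\<Sum>q=1..m. (- 1 / real q) * herm (z m q) \<omega>)" for m \<omega>
    unfolding zs_def herm_concat map_map o_def herm_scale interv_sum_list_conv_sum_set_nat set_upt atLeastLessThanSuc_atLeastAtMost ..
  have hN: "herm (number_terms (zs m)) \<omega> = - T m \<omega>" for m \<omega>
  proof -
    have "herm (number_terms (zs m)) \<omega> = (\<Sum>q=1..m. (- 1 / real q) * herm (number_terms (z m q)) \<omega>)"
      unfolding zs_def number_terms_concat herm_concat map_map o_def number_terms_scale herm_scale
        interv_sum_list_conv_sum_set_nat set_upt atLeastLessThanSuc_atLeastAtMost ..
    also have "\<dots> = (\<Sum>q=1..m. - herm (z m q) \<omega>)"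
    proof (intro sum.cong refl)
      fix q assume "q \<in> {1..m}"
      moreover have "herm (number_terms (z m q)) \<omega> = real q * herm (z m q) \<omega>"
        by (rule herm_number_single_order) (rule order_termsD(2)[OF z(1)])
      ultimately show "- 1 / real q * herm (number_terms (z m q)) \<omega> = - herm (z m q) \<omega>" by simp
    qed
    finally show ?thesis by (simp add: T_def sum_negf)
  qed
  have nz: "normalized (zs m)" for m
    using order_termsD(1)[OF z(1)] by (auto simp: zs_def normalized_def scale_terms_def split_beta)
  have err: "(\<integral>\<omega>. (norm ((\<Sum>q=1..m. c q * (herm (z m q) \<omega> - J q \<omega>)) - 0))\<^sup>2 \<partial>M) \<le> 1 / (real m + 1)"
    if c: "\<And>q. \<bar>c q\<bar> \<le> 1" for c m
  proof -
    have i: "integrable M (\<lambda>\<omega>. (norm (herm (z m q) \<omega> - J q \<omega>))\<^sup>2)" for q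
      by (intro square_integrableD square_integrable_diff herm_square_integrable sJ)
    have "(\<integral>\<omega>. (norm ((\<Sum>q=1..m. c q * (herm (z m q) \<omega> - J q \<omega>)) - 0))\<^sup>2 \<partial>M)
       \<le> (\<integral>\<omega>. (\<Sum>q=1..m. (norm (herm (z m q) \<omega> - J q \<omega>))\<^sup>2) * real m \<partial>M)"
    proof (rule integral_mono)
      show "integrable M (\<lambda>\<omega>. (norm ((\<Sum>q=1..m. c q * (herm (z m q) \<omega> - J q \<omega>)) - 0))\<^sup>2)"
        unfolding diff_0_right
        by (intro square_integrableD square_integrable_sum square_integrable_cmult square_integrable_diff herm_square_integrable sJ)
      show "integrable M (\<lambda>\<omega>. (\<Sum>q=1..m. (norm (herm (z m q) \<omega> - J q \<omega>))\<^sup>2) * real m)"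
        by (intro integrable_mult_left Bochner_Integration.integrable_sum i)
      fix \<omega>
      have "(norm ((\<Sum>q=1..m. c q * (herm (z m q) \<omega> - J q \<omega>)) - 0))\<^sup>2 \<le> (\<Sum>q=1..m. (c q * (herm (z m q) \<omega> - J q \<omega>))\<^sup>2) * real (card {1..m})"
        using sum_squared_le_sum_of_squares[of "\<lambda>q. c q * (herm (z m q) \<omega> - J q \<omega>)" "{1..m}"] by simp
      also have "\<dots> \<le> (\<Sum>q=1..m. (norm (herm (z m q) \<omega> - J q \<omega>))\<^sup>2) * real (card {1..m})"
      proof (intro mult_right_mono sum_mono)
        fix q
        have "(c q)\<^sup>2 \<le> 1" using c[of q] by (simp add: abs_square_le_1)
        then have "(c q)\<^sup>2 * (herm (z m q) \<omega> - J q \<omega>)\<^sup>2 \<le> 1 * (herm (z m q) \<omega> - J q \<omega>)\<^sup>2" by (intro mult_right_mono) auto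
        then show "(c q * (herm (z m q) \<omega> - J q \<omega>))\<^sup>2 \<le> (norm (herm (z m q) \<omega> - J q \<omega>))\<^sup>2" by (simp add: power_mult_distrib)
      qed simp
      finally show "(norm ((\<Sum>q=1..m. c q * (herm (z m q) \<omega> - J q \<omega>)) - 0))\<^sup>2 \<le> (\<Sum>q=1..m. (norm (herm (z m q) \<omega> - J q \<omega>))\<^sup>2) * real m" by simp
    qed
    also have "\<dots> = (\<Sum>q=1..m. (\<integral>\<omega>. (norm (herm (z m q) \<omega> - J q \<omega>))\<^sup>2 \<partial>M)) * real m"
      using i by (subst Bochner_Integration.integral_mult_left) (auto intro!: Bochner_Integration.integrable_sum simp: Bochner_Integration.integral_sum)
    also have "\<dots> \<le> (\<Sum>q=1..m. 1 / (real m + 1) ^ 3) * real m"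
      by (intro mult_right_mono sum_mono z(2)) auto
    also have "\<dots> = real m * real m / (real m + 1) ^ 3" by simp
    also have "\<dots> \<le> (real m + 1) * (real m + 1) / (real m + 1) ^ 3"
      by (intro divide_right_mono mult_mono) auto
    also have "\<dots> = 1 / (real m + 1)" by (simp add: power3_eq_cube)
    finally show ?thesis .
  qed
  have e0: "(\<lambda>m::nat. 1 / (real m + 1)) \<longlonglongrightarrow> 0"
    using LIMSEQ_inverse_real_of_nat by (simp add: inverse_eq_divide add.commute)
  have small: "L2_converges M (\<lambda>m \<omega>. \<Sum>q=1..m. c q * (herm (z m q) \<omega> - J q \<omega>)) (\<lambda>_. 0)"
    if c: "\<And>q. \<bar>c q\<bar> \<le> 1" for c
  proof (rule L2_converges_bound[OF _ _ err[OF c] e0])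
    show "square_integrable M (\<lambda>\<omega>. \<Sum>q=1..m. c q * (herm (z m q) \<omega> - J q \<omega>))" for m
      by (intro square_integrable_sum square_integrable_cmult square_integrable_diff herm_square_integrable sJ)
  qed (simp add: square_integrable_def)
  have zV: "L2_converges M (\<lambda>m. herm (zs m)) V"
  proof -
    have "L2_converges M (\<lambda>m \<omega>. (\<Sum>q=1..m. (- 1 / real q) * (herm (z m q) \<omega> - J q \<omega>)) + - (\<Sum>q=1..m. J q \<omega> / real q)) (\<lambda>\<omega>. 0 + V \<omega>)"
      by (rule L2_converges_add[OF small V]) (auto simp: divide_le_eq)
    moreover have "(\<lambda>m \<omega>. (\<Sum>q=1..m. (- 1 / real q) * (herm (z m q) \<omega> - J q \<omega>)) + - (\<Sum>q=1..m. J q \<omega> / real q)) = (\<lambda>m. herm (zs m))"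
      unfolding hz fun_eq_iff sum_negf[symmetric] sum.distrib[symmetric]
      by (intro allI sum.cong refl) (simp add: field_simps)
    ultimately show ?thesis by simp
  qed
  have zF: "L2_converges M T (\<lambda>\<omega>. F \<omega> - J 0 \<omega>)"
  proof -
    have S1: "L2_converges M (\<lambda>m \<omega>. (\<Sum>q\<le>m. J q \<omega>) - J 0 \<omega>) (\<lambda>\<omega>. F \<omega> - J 0 \<omega>)"
      by (rule L2_converges_diff[OF S L2_converges_const[OF sJ]])
    have "L2_converges M (\<lambda>m \<omega>. (\<Sum>q=1..m. 1 * (herm (z m q) \<omega> - J q \<omega>)) + ((\<Sum>q\<le>m. J q \<omega>) - J 0 \<omega>)) (\<lambda>\<omega>. 0 + (F \<omega> - J 0 \<omega>))"
      by (rule L2_converges_add[OF small S1]) auto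
    moreover have "(\<Sum>q\<le>m. J q \<omega>) - J 0 \<omega> = (\<Sum>q=1..m. J q \<omega>)" for m \<omega>
      by (simp add: atMost_atLeast0 sum.atLeast_Suc_atMost)
    then have "(\<lambda>m \<omega>. (\<Sum>q=1..m. 1 * (herm (z m q) \<omega> - J q \<omega>)) + ((\<Sum>q\<le>m. J q \<omega>) - J 0 \<omega>)) = T"
      by (simp add: fun_eq_iff T_def sum_subtractf)
    ultimately show ?thesis by simp
  qed
  have le: "(\<integral>\<omega>. (norm (hermD (zs i) \<omega> - hermD (zs j) \<omega>))\<^sup>2 \<partial>M) \<le> (\<integral>\<omega>. (norm (T i \<omega> - T j \<omega>))\<^sup>2 \<partial>M)" for i j
  proof -
    let ?d = "zs i @ scale_terms (-1) (zs j)"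
    have "(\<integral>\<omega>. (norm (hermD ?d \<omega>))\<^sup>2 \<partial>M) \<le> (\<integral>\<omega>. (herm (number_terms ?d) \<omega>)\<^sup>2 \<partial>M)"
      by (rule hermD_energy) (simp add: nz)
    then show ?thesis by (simp add: number_terms_append number_terms_scale hN power2_commute)
  qed
  have "L2_Cauchy M (\<lambda>m. hermD (zs m))"
    unfolding L2_Cauchy_def
  proof (intro conjI allI impI hermD_square_integrable)
    fix e :: real assume "e > 0"
    then obtain N where "\<And>i j. i \<ge> N \<Longrightarrow> j \<ge> N \<Longrightarrow> (\<integral>\<omega>. (norm (T i \<omega> - T j \<omega>))\<^sup>2 \<partial>M) < e"
      using L2_converges_Cauchy[OF zF] unfolding L2_Cauchy_def by blast
    then show "\<exists>N. \<forall>i\<ge>N. \<forall>j\<ge>N. (\<integral>\<omega>. (norm (hermD (zs i) \<omega> - hermD (zs j) \<omega>))\<^sup>2 \<partial>M) < e"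
      by (intro exI[of _ N] allI impI le_less_trans[OF le]) blast
  qed
  then obtain B where "L2_converges M (\<lambda>m. hermD (zs m)) B" by (rule L2_complete)
  with zV have "is_malliavin_deriv M W V B"
    unfolding is_malliavin_deriv_def using herm_smooth_cylindrical
    by (intro exI[of _ "\<lambda>m. herm (zs m)"] exI[of _ "\<lambda>m. hermD (zs m)"]) blast
  then show ?thesis by blast
qed

end

section \<open>The Malliavin integration by parts formula\<close>

lemma L2_converges_AE_subseq:
  fixes F :: "'a \<Rightarrow> real"
  assumes "L2_converges M Fs F"
  obtains r :: "nat \<Rightarrow> nat" where "strict_mono r" "AE \<omega> in M. (\<lambda>n. Fs (r n) \<omega>) \<longlonglongrightarrow> F \<omega>"
proof -
  note L = L2_convergesD[OF assms]
  have i: "integrable M (\<lambda>\<omega>. (norm (Fs n \<omega> - F \<omega>))\<^sup>2)" for n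
    by (intro square_integrableD square_integrable_diff L)
  have "(\<lambda>n. \<integral>\<omega>. norm ((norm (Fs n \<omega> - F \<omega>))\<^sup>2) \<partial>M) \<longlonglongrightarrow> 0" using L(3) by simp
  from tendsto_L1_AE_subseq[OF i this] obtain r :: "nat \<Rightarrow> nat" where
    r: "strict_mono r" "AE \<omega> in M. (\<lambda>n. (norm (Fs (r n) \<omega> - F \<omega>))\<^sup>2) \<longlonglongrightarrow> 0" by blast
  show thesis
  proof (rule that[OF r(1)])
    show "AE \<omega> in M. (\<lambda>n. Fs (r n) \<omega>) \<longlonglongrightarrow> F \<omega>"
      using r(2)
    proof eventually_elim
      case (elim \<omega>)
      from tendsto_real_sqrt[OF elim] have "(\<lambda>n. norm (Fs (r n) \<omega> - F \<omega>)) \<longlonglongrightarrow> 0" by simp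
      then show ?case using tendsto_norm_zero_iff LIM_zero_iff by blast
    qed
  qed
qed

lemma bounded_derivative_Lipschitz:
  fixes \<phi> :: "real \<Rightarrow> real"
  assumes d: "\<And>y. (\<phi> has_real_derivative \<phi>' y) (at y)" and b: "\<And>y. \<bar>\<phi>' y\<bar> \<le> K"
  shows "\<bar>\<phi> x - \<phi> y\<bar> \<le> K * \<bar>x - y\<bar>"
proof -
  obtain \<theta> where "\<phi> x - \<phi> y = (x - y) * \<phi>' \<theta>" using MVT_around[OF d, of y x] by auto
  then have "\<bar>\<phi> x - \<phi> y\<bar> = \<bar>x - y\<bar> * \<bar>\<phi>' \<theta>\<bar>" by (simp add: abs_mult)
  also have "\<dots> \<le> \<bar>x - y\<bar> * K" using b[of \<theta>] by (intro mult_left_mono) auto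
  finally show ?thesis by (simp add: mult.commute)
qed

lemma (in prob_space) square_integrable_Lipschitz:
  fixes \<phi> :: "real \<Rightarrow> real"
  assumes F: "square_integrable M F" and l: "\<And>x y. \<bar>\<phi> x - \<phi> y\<bar> \<le> K * \<bar>x - y\<bar>" and [measurable]: "\<phi> \<in> borel_measurable borel"
  shows "square_integrable M (\<lambda>\<omega>. \<phi> (F \<omega>))"
proof (rule square_integrable_bound)
  note [measurable] = square_integrableD(1)[OF F]
  show "square_integrable M (\<lambda>\<omega>. \<bar>\<phi> 0\<bar> + K * \<bar>F \<omega>\<bar>)"
    using square_integrable_add[OF _ square_integrable_cmult[OF square_integrable_norm[OF F], of K], of "\<lambda>_. \<bar>\<phi> 0\<bar>"]
    by (simp add: square_integrable_def)
  show "(\<lambda>\<omega>. \<phi> (F \<omega>)) \<in> borel_measurable M" by measurable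
  show "norm (\<phi> (F \<omega>)) \<le> norm (\<bar>\<phi> 0\<bar> + K * \<bar>F \<omega>\<bar>)" for \<omega>
    using l[of "F \<omega>" 0] by auto
qed

context isonormal_gaussian_process begin

text \<open>For smooth \<open>Y\<close> the functional \<open>B \<mapsto> E \<langle>\<phi>'(Y) DY, B\<rangle>\<close> on gradients is represented by an \<open>L\<^sup>2\<close>
  variable, the divergence of \<open>\<phi>'(Y) DY\<close>. So it is continuous in the \<open>L\<^sup>2\<close> norm of the function
  whose gradient is taken, and its values on \<open>L\<^sup>2\<close> limits of smooth functions are determined.\<close>

lemma smooth_gradient_adjoint:
  fixes \<phi> \<phi>' \<phi>'' :: "real \<Rightarrow> real"
  assumes Y: "smooth_cylindrical W Y A"
    and d1: "\<And>y. (\<phi> has_real_derivative \<phi>' y) (at y)" and d2: "\<And>y. (\<phi>' has_real_derivative \<phi>'' y) (at y)"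
    and c: "continuous_on UNIV \<phi>''" and b: "\<And>y. \<bar>\<phi>' y\<bar> \<le> K" "\<And>y. \<bar>\<phi>'' y\<bar> \<le> K"
  obtains \<Lambda> where "square_integrable M \<Lambda>"
    "\<And>G B. cylindrical G B \<Longrightarrow> (\<integral>\<omega>. \<phi>' (Y \<omega>) * inner (A \<omega>) (B \<omega>) \<partial>M) = (\<integral>\<omega>. \<Lambda> \<omega> * G \<omega> \<partial>M)"
    "cylindrical (\<lambda>\<omega>. \<phi> (Y \<omega>)) (\<lambda>\<omega>. \<phi>' (Y \<omega>) *\<^sub>R A \<omega>)"
proof -
  obtain n f h where f: "smooth_poly_growth n f" and Yf: "Y = (\<lambda>\<omega>. f (\<lambda>i. W (h i) \<omega>))"
    and Af: "A = (\<lambda>\<omega>. \<Sum>i<n. partial_deriv i f (\<lambda>i. W (h i) \<omega>) *\<^sub>R h i)"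
    using Y unfolding smooth_cylindrical_def by blast
  have c1: "continuous_on UNIV \<phi>'" using d2 by (intro DERIV_continuous_on) (auto intro: DERIV_subset)
  note g = C1_growth_compose[OF C1_growth_smooth[OF f] d2 c b(2)]
  define u where "u i = (\<lambda>\<omega>. \<phi>' (Y \<omega>) * partial_deriv i f (\<lambda>i. W (h i) \<omega>))" for i
  have "\<exists>D. cylindrical (u i) D" if "i < n" for i
    using cylindricalI[OF C1_growth_mult[OF g C1_growth_smooth_partial[OF f that]], of h]
    unfolding u_def Yf by blast
  then obtain D where D: "\<And>i. i < n \<Longrightarrow> cylindrical (u i) (D i)" by metis
  note mD = cylindrical_moments[OF D]
  define \<Lambda> where "\<Lambda> \<omega> = (\<Sum>i<n. u i \<omega> * W (h i) \<omega> - inner (D i \<omega>) (h i))" for \<omega>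
  have t: "all_moments M (\<lambda>\<omega>. u i \<omega> * W (h i) \<omega> - inner (D i \<omega>) (h i))" if "i < n" for i
    by (intro all_moments_diff all_moments_mult mD that W_all_moments)
  show thesis
  proof (rule that)
    show "square_integrable M \<Lambda>"
      unfolding \<Lambda>_def by (intro all_moments_square_integrable all_moments_sum t) auto
    have "cylindrical (\<lambda>\<omega>. \<phi> (f (\<lambda>i. W (h i) \<omega>))) (\<lambda>\<omega>. \<Sum>i<n. (\<phi>' (f (\<lambda>i. W (h i) \<omega>)) * partial_deriv i f (\<lambda>i. W (h i) \<omega>)) *\<^sub>R h i)"
      by (rule cylindricalI[OF C1_growth_compose[OF C1_growth_smooth[OF f] d1 c1 b(1)]])
    then show "cylindrical (\<lambda>\<omega>. \<phi> (Y \<omega>)) (\<lambda>\<omega>. \<phi>' (Y \<omega>) *\<^sub>R A \<omega>)"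
      by (simp add: Yf Af scaleR_sum_right)
    fix G B assume G: "cylindrical G B"
    note mG = cylindrical_moments[OF G]
    have i1: "integrable M (\<lambda>\<omega>. u i \<omega> * inner (B \<omega>) (h i))" "integrable M (\<lambda>\<omega>. u i \<omega> * G \<omega> * W (h i) \<omega>)"
       "integrable M (\<lambda>\<omega>. G \<omega> * inner (D i \<omega>) (h i))" if "i < n" for i
      by (intro all_moments_integrable all_moments_mult mD mG that W_all_moments)+
    have "(\<integral>\<omega>. \<phi>' (Y \<omega>) * inner (A \<omega>) (B \<omega>) \<partial>M) = (\<integral>\<omega>. (\<Sum>i<n. u i \<omega> * inner (B \<omega>) (h i)) \<partial>M)"
      by (intro Bochner_Integration.integral_cong refl)
         (simp add: Af u_def inner_sum_left sum_distrib_left mult.assoc, simp add: inner_commute)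
    also have "\<dots> = (\<Sum>i<n. (\<integral>\<omega>. u i \<omega> * inner (B \<omega>) (h i) \<partial>M))"
      by (rule Bochner_Integration.integral_sum) (simp add: i1)
    also have "\<dots> = (\<Sum>i<n. (\<integral>\<omega>. (u i \<omega> * W (h i) \<omega> - inner (D i \<omega>) (h i)) * G \<omega> \<partial>M))"
    proof (intro sum.cong refl)
      fix i assume "i \<in> {..<n}" then have i: "i < n" by simp
      have "(\<integral>\<omega>. u i \<omega> * inner (B \<omega>) (h i) \<partial>M) = (\<integral>\<omega>. u i \<omega> * G \<omega> * W (h i) \<omega> \<partial>M) - (\<integral>\<omega>. G \<omega> * inner (D i \<omega>) (h i) \<partial>M)"
        using gaussian_integration_by_parts[OF D[OF i] G, of "h i"] by linarith
      also have "\<dots> = (\<integral>\<omega>. u i \<omega> * G \<omega> * W (h i) \<omega> - G \<omega> * inner (D i \<omega>) (h i) \<partial>M)"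
        by (rule Bochner_Integration.integral_diff[symmetric, OF i1(2,3)[OF i]])
      also have "\<dots> = (\<integral>\<omega>. (u i \<omega> * W (h i) \<omega> - inner (D i \<omega>) (h i)) * G \<omega> \<partial>M)"
        by (intro Bochner_Integration.integral_cong refl) (simp add: algebra_simps)
      finally show "(\<integral>\<omega>. u i \<omega> * inner (B \<omega>) (h i) \<partial>M) = (\<integral>\<omega>. (u i \<omega> * W (h i) \<omega> - inner (D i \<omega>) (h i)) * G \<omega> \<partial>M)" .
    qed
    also have "\<dots> = (\<integral>\<omega>. (\<Sum>i<n. (u i \<omega> * W (h i) \<omega> - inner (D i \<omega>) (h i)) * G \<omega>) \<partial>M)"
      by (rule Bochner_Integration.integral_sum[symmetric]) (intro all_moments_integrable all_moments_mult t mG, simp)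
    also have "\<dots> = (\<integral>\<omega>. \<Lambda> \<omega> * G \<omega> \<partial>M)" by (simp add: \<Lambda>_def sum_distrib_right)
    finally show "(\<integral>\<omega>. \<phi>' (Y \<omega>) * inner (A \<omega>) (B \<omega>) \<partial>M) = (\<integral>\<omega>. \<Lambda> \<omega> * G \<omega> \<partial>M)" .
  qed
qed

text \<open>The case of smooth \<open>Y\<close>. On the chaos of order \<open>q\<close> the divergence of \<open>\<phi>'(Y) DY\<close> acts as \<open>q\<close> times
  \<open>\<phi>(Y)\<close>, which cancels the factor \<open>1/q\<close> in \<open>L\<^sup>-\<^sup>1\<close>.\<close>

lemma malliavin_integration_by_parts_smooth:
  fixes \<phi> \<phi>' \<phi>'' :: "real \<Rightarrow> real"
  assumes Y: "smooth_cylindrical W Y A"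
    and d1: "\<And>y. (\<phi> has_real_derivative \<phi>' y) (at y)" and d2: "\<And>y. (\<phi>' has_real_derivative \<phi>'' y) (at y)"
    and c: "continuous_on UNIV \<phi>''" and b: "\<And>y. \<bar>\<phi>' y\<bar> \<le> K" "\<And>y. \<bar>\<phi>'' y\<bar> \<le> K"
    and mean: "(\<integral>\<omega>. F \<omega> \<partial>M) = 0" and V: "is_L_inverse M W F V" and B: "is_malliavin_deriv M W V B"
  shows "(\<integral>\<omega>. \<phi>' (Y \<omega>) * inner (A \<omega>) (B \<omega>) \<partial>M) = - (\<integral>\<omega>. \<phi> (Y \<omega>) * F \<omega> \<partial>M)"
proof -
  obtain \<Lambda> where sL: "square_integrable M \<Lambda>"
    and L: "\<And>G B. cylindrical G B \<Longrightarrow> (\<integral>\<omega>. \<phi>' (Y \<omega>) * inner (A \<omega>) (B \<omega>) \<partial>M) = (\<integral>\<omega>. \<Lambda> \<omega> * G \<omega> \<partial>M)"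
    and cY: "cylindrical (\<lambda>\<omega>. \<phi> (Y \<omega>)) (\<lambda>\<omega>. \<phi>' (Y \<omega>) *\<^sub>R A \<omega>)"
    using smooth_gradient_adjoint[OF Y d1 d2 c b] by blast
  note mY = cylindrical_moments[OF cY]
  obtain J where J: "chaos_decomposition M W F J" and Vlim: "L2_converges M (\<lambda>n \<omega>. - (\<Sum>q=1..n. J q \<omega> / real q)) V"
    using V unfolding is_L_inverse_def by blast
  have JW: "J q \<in> wiener_chaos M W q" for q using J by (auto simp: chaos_decomposition_def)
  note sJ = wiener_chaos_square_integrable[OF JW]
  have S: "L2_converges M (\<lambda>n \<omega>. \<Sum>q\<le>n. J q \<omega>) F" using J by (simp add: chaos_decomposition_def)
  have LJ: "(\<integral>\<omega>. \<Lambda> \<omega> * J q \<omega> \<partial>M) = real q * (\<integral>\<omega>. \<phi> (Y \<omega>) * J q \<omega> \<partial>M)" for q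
  proof -
    obtain xss where x: "\<And>n::nat. xss n \<in> order_terms q" "L2_converges M (\<lambda>n. herm (xss n)) (J q)"
      using wiener_chaos_approx[OF JW] by blast
    have eq: "(\<integral>\<omega>. \<Lambda> \<omega> * herm (xss n) \<omega> \<partial>M) = real q * (\<integral>\<omega>. \<phi> (Y \<omega>) * herm (xss n) \<omega> \<partial>M)" for n
    proof -
      have N: "herm (number_terms (xss n)) \<omega> = real q * herm (xss n) \<omega>" for \<omega>
        by (rule herm_number_single_order) (rule order_termsD(2)[OF x(1)])
      have "(\<integral>\<omega>. \<Lambda> \<omega> * herm (xss n) \<omega> \<partial>M) = (\<integral>\<omega>. inner (hermD (xss n) \<omega>) (\<phi>' (Y \<omega>) *\<^sub>R A \<omega>) \<partial>M)"
        by (simp add: L[OF herm_cylindrical, symmetric] inner_commute)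
      also have "\<dots> = (\<integral>\<omega>. herm (number_terms (xss n)) \<omega> * \<phi> (Y \<omega>) \<partial>M)"
        by (rule herm_integration_by_parts[OF order_termsD(1)[OF x(1)] cY])
      also have "\<dots> = (\<integral>\<omega>. real q * (\<phi> (Y \<omega>) * herm (xss n) \<omega>) \<partial>M)"
        by (intro Bochner_Integration.integral_cong refl) (simp add: N)
      finally show ?thesis by simp
    qed
    have "(\<lambda>n. \<integral>\<omega>. \<Lambda> \<omega> * herm (xss n) \<omega> \<partial>M) \<longlonglongrightarrow> (\<integral>\<omega>. \<Lambda> \<omega> * J q \<omega> \<partial>M)"
      by (rule L2_converges_mult[OF L2_converges_const[OF sL] x(2)])
    moreover have "(\<lambda>n. real q * (\<integral>\<omega>. \<phi> (Y \<omega>) * herm (xss n) \<omega> \<partial>M)) \<longlonglongrightarrow> real q * (\<integral>\<omega>. \<phi> (Y \<omega>) * J q \<omega> \<partial>M)"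
      by (intro tendsto_mult tendsto_const L2_converges_mult[OF L2_converges_const[OF mY(5)] x(2)])
    ultimately show ?thesis unfolding eq by (rule LIMSEQ_unique)
  qed
  have one: "square_integrable M (\<lambda>_. 1::real)" by (simp add: square_integrable_def)
  have one_chaos: "(\<lambda>_. 1) \<in> wiener_chaos M W 0" by (auto simp: wiener_chaos_def)
  \<comment> \<open>\<open>L\<^sup>-\<^sup>1\<close> drops the component of order \<open>0\<close>, which is the mean of \<open>F\<close>\<close>
  have J0: "AE \<omega> in M. J 0 \<omega> = 0"
  proof -
    obtain k where k: "AE \<omega> in M. J 0 \<omega> = k" using JW[of 0] by (auto simp: wiener_chaos_def)
    note [measurable] = square_integrableD(1)[OF sJ]
    have "(\<lambda>n. \<integral>\<omega>. (\<Sum>q\<le>n. J q \<omega>) * 1 \<partial>M) \<longlonglongrightarrow> (\<integral>\<omega>. F \<omega> * 1 \<partial>M)"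
      by (rule L2_converges_mult[OF S L2_converges_const[OF one]])
    moreover have "(\<integral>\<omega>. (\<Sum>q\<le>n. J q \<omega>) * 1 \<partial>M) = k" for n
    proof -
      have i: "integrable M (J q)" for q using integrable_mult_L2[OF sJ[of q] one] by simp
      have "(\<integral>\<omega>. (\<Sum>q\<le>n. J q \<omega>) * 1 \<partial>M) = (\<Sum>q\<le>n. \<integral>\<omega>. J q \<omega> \<partial>M)"
        using i by (simp add: Bochner_Integration.integral_sum)
      also have "\<dots> = (\<Sum>q\<le>n. if q = 0 then k else 0)"
      proof (intro sum.cong refl)
        fix q show "(\<integral>\<omega>. J q \<omega> \<partial>M) = (if q = 0 then k else 0)"
        proof (cases "q = 0")
          case True
          have "(\<integral>\<omega>. J 0 \<omega> \<partial>M) = (\<integral>\<omega>. k \<partial>M)" by (rule integral_cong_AE) (measurable, rule k)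
          then show ?thesis using True by (simp add: prob_space)
        next
          case False
          then show ?thesis using wiener_chaos_orthogonal[OF JW one_chaos, of q] by simp
        qed
      qed
      finally show ?thesis by simp
    qed
    ultimately have "k = 0" using mean by (simp add: LIMSEQ_const_iff)
    then show ?thesis using k by simp
  qed
  have LV: "(\<integral>\<omega>. \<Lambda> \<omega> * V \<omega> \<partial>M) = - (\<integral>\<omega>. \<phi> (Y \<omega>) * F \<omega> \<partial>M)"
  proof (rule LIMSEQ_unique)
    show "(\<lambda>n. \<integral>\<omega>. \<Lambda> \<omega> * - (\<Sum>q=1..n. J q \<omega> / real q) \<partial>M) \<longlonglongrightarrow> (\<integral>\<omega>. \<Lambda> \<omega> * V \<omega> \<partial>M)"
      by (rule L2_converges_mult[OF L2_converges_const[OF sL] Vlim])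
    have eq: "(\<integral>\<omega>. \<Lambda> \<omega> * - (\<Sum>q=1..n. J q \<omega> / real q) \<partial>M) = - (\<integral>\<omega>. \<phi> (Y \<omega>) * (\<Sum>q\<le>n. J q \<omega>) \<partial>M)" for n
    proof -
      have i: "integrable M (\<lambda>\<omega>. \<Lambda> \<omega> * J q \<omega>)" "integrable M (\<lambda>\<omega>. \<phi> (Y \<omega>) * J q \<omega>)" for q
        by (rule integrable_mult_L2[OF sL sJ], rule integrable_mult_L2[OF mY(5) sJ])
      note [measurable] = square_integrableD(1)[OF sJ] square_integrableD(1)[OF mY(5)]
      have z: "(\<integral>\<omega>. \<phi> (Y \<omega>) * J 0 \<omega> \<partial>M) = 0"
      proof -
        have "AE \<omega> in M. \<phi> (Y \<omega>) * J 0 \<omega> = 0" using J0 by eventually_elim simp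
        then show ?thesis by (rule integral_eq_zero_AE)
      qed
      have "(\<integral>\<omega>. \<Lambda> \<omega> * - (\<Sum>q=1..n. J q \<omega> / real q) \<partial>M) = (\<integral>\<omega>. (\<Sum>q=1..n. (- 1 / real q) * (\<Lambda> \<omega> * J q \<omega>)) \<partial>M)"
        by (intro Bochner_Integration.integral_cong refl) (simp add: sum_distrib_left sum_negf[symmetric])
      also have "\<dots> = (\<Sum>q=1..n. (- 1 / real q) * (\<integral>\<omega>. \<Lambda> \<omega> * J q \<omega> \<partial>M))"
        using i by (subst Bochner_Integration.integral_sum) (auto intro!: integrable_mult_right)
      also have "\<dots> = (\<Sum>q=1..n. - (\<integral>\<omega>. \<phi> (Y \<omega>) * J q \<omega> \<partial>M))"
        by (intro sum.cong refl) (simp add: LJ)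
      also have "\<dots> = - (\<Sum>q\<le>n. (\<integral>\<omega>. \<phi> (Y \<omega>) * J q \<omega> \<partial>M))"
        by (simp add: atMost_atLeast0 sum.atLeast_Suc_atMost z sum_negf)
      also have "(\<Sum>q\<le>n. (\<integral>\<omega>. \<phi> (Y \<omega>) * J q \<omega> \<partial>M)) = (\<integral>\<omega>. \<phi> (Y \<omega>) * (\<Sum>q\<le>n. J q \<omega>) \<partial>M)"
        using i by (simp add: sum_distrib_left Bochner_Integration.integral_sum)
      finally show ?thesis .
    qed
    show "(\<lambda>n. \<integral>\<omega>. \<Lambda> \<omega> * - (\<Sum>q=1..n. J q \<omega> / real q) \<partial>M) \<longlonglongrightarrow> - (\<integral>\<omega>. \<phi> (Y \<omega>) * F \<omega> \<partial>M)"
      unfolding eq by (intro tendsto_minus L2_converges_mult[OF L2_converges_const[OF mY(5)] S])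
  qed
  obtain Vs Bs where VB: "\<And>m. smooth_cylindrical W (Vs m) (Bs m)" "L2_converges M Vs V" "L2_converges M Bs B"
    using B unfolding is_malliavin_deriv_def by blast
  have "(\<integral>\<omega>. \<phi>' (Y \<omega>) * inner (A \<omega>) (B \<omega>) \<partial>M) = (\<integral>\<omega>. \<Lambda> \<omega> * V \<omega> \<partial>M)"
  proof (rule LIMSEQ_unique)
    show "(\<lambda>m. \<integral>\<omega>. \<Lambda> \<omega> * Vs m \<omega> \<partial>M) \<longlonglongrightarrow> (\<integral>\<omega>. \<Lambda> \<omega> * V \<omega> \<partial>M)"
      by (rule L2_converges_mult[OF L2_converges_const[OF sL] VB(2)])
    have "(\<lambda>m. \<integral>\<omega>. inner (\<phi>' (Y \<omega>) *\<^sub>R A \<omega>) (Bs m \<omega>) \<partial>M) \<longlonglongrightarrow> (\<integral>\<omega>. inner (\<phi>' (Y \<omega>) *\<^sub>R A \<omega>) (B \<omega>) \<partial>M)"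
      by (rule L2_converges_inner[OF L2_converges_const[OF mY(6)] VB(3)])
    then show "(\<lambda>m. \<integral>\<omega>. \<Lambda> \<omega> * Vs m \<omega> \<partial>M) \<longlonglongrightarrow> (\<integral>\<omega>. \<phi>' (Y \<omega>) * inner (A \<omega>) (B \<omega>) \<partial>M)"
      by (simp add: L[OF smooth_cylindrical_imp_cylindrical[OF VB(1)], symmetric])
  qed
  then show ?thesis by (simp only: LV)
qed

text \<open>Replace \<open>F\<close> by smooth approximants in \<open>\<phi>(F)\<close> and \<open>DF\<close> only and keep \<open>L\<^sup>-\<^sup>1 F\<close> fixed. Along
  an almost everywhere convergent subsequence \<open>\<phi>'\<close> of the approximants converges boundedly, and
  the error from the gradients is at most \<open>K\<close> times their \<open>L\<^sup>2\<close> distance.\<close>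

theorem malliavin_integration_by_parts:
  fixes \<phi> \<phi>' \<phi>'' :: "real \<Rightarrow> real"
  assumes A: "is_malliavin_deriv M W F A"
    and d1: "\<And>y. (\<phi> has_real_derivative \<phi>' y) (at y)" and d2: "\<And>y. (\<phi>' has_real_derivative \<phi>'' y) (at y)"
    and c: "continuous_on UNIV \<phi>''" and b: "\<And>y. \<bar>\<phi>' y\<bar> \<le> K" "\<And>y. \<bar>\<phi>'' y\<bar> \<le> K"
    and mean: "(\<integral>\<omega>. F \<omega> \<partial>M) = 0" and V: "is_L_inverse M W F V" and B: "is_malliavin_deriv M W V B"
  shows "(\<integral>\<omega>. \<phi>' (F \<omega>) * inner (A \<omega>) (B \<omega>) \<partial>M) = - (\<integral>\<omega>. \<phi> (F \<omega>) * F \<omega> \<partial>M)"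
proof -
  obtain Fs0 As0 where F0: "\<And>m. smooth_cylindrical W (Fs0 m) (As0 m)" "L2_converges M Fs0 F" "L2_converges M As0 A"
    using A unfolding is_malliavin_deriv_def by blast
  obtain r where r: "strict_mono r" "AE \<omega> in M. (\<lambda>n. Fs0 (r n) \<omega>) \<longlonglongrightarrow> F \<omega>"
    by (rule L2_converges_AE_subseq[OF F0(2)])
  define Fs As where "Fs n = Fs0 (r n)" and "As n = As0 (r n)" for n
  have sm: "smooth_cylindrical W (Fs n) (As n)" for n by (simp add: Fs_def As_def F0(1))
  have FL: "L2_converges M Fs F" and AL: "L2_converges M As A"
    using L2_converges_subseq[OF F0(2) r(1)] L2_converges_subseq[OF F0(3) r(1)]
    by (simp_all add: Fs_def[abs_def] As_def[abs_def])
  have ae: "AE \<omega> in M. (\<lambda>n. Fs n \<omega>) \<longlonglongrightarrow> F \<omega>" using r(2) by (simp add: Fs_def)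
  have sB: "square_integrable M B" using B unfolding is_malliavin_deriv_def L2_converges_def by blast
  note f = L2_convergesD[OF FL] and a = L2_convergesD[OF AL]
  note [measurable] = square_integrableD(1)[OF f(1)] square_integrableD(1)[OF f(2)]
    square_integrableD(1)[OF a(1)] square_integrableD(1)[OF a(2)] square_integrableD(1)[OF sB]
  have c0: "continuous_on UNIV \<phi>" and c1: "continuous_on UNIV \<phi>'"
    by (rule DERIV_continuous_on[OF DERIV_subset[OF d1 subset_UNIV]],
        rule DERIV_continuous_on[OF DERIV_subset[OF d2 subset_UNIV]])
  then have [measurable]: "\<phi> \<in> borel_measurable borel" "\<phi>' \<in> borel_measurable borel"
    by (auto intro: borel_measurable_continuous_onI)
  have K: "K \<ge> 0" using b(1)[of 0] by simp
  note lip = bounded_derivative_Lipschitz[OF d1 b(1)]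
  have s\<phi>: "square_integrable M (\<lambda>\<omega>. \<phi> (Fs n \<omega>))" "square_integrable M (\<lambda>\<omega>. \<phi> (F \<omega>))" for n
    by (rule square_integrable_Lipschitz[OF _ lip]; fact)+
  have \<phi>L: "L2_converges M (\<lambda>n \<omega>. \<phi> (Fs n \<omega>)) (\<lambda>\<omega>. \<phi> (F \<omega>))"
  proof (rule L2_converges_bound[OF s\<phi>])
    show "(\<integral>\<omega>. (norm (\<phi> (Fs n \<omega>) - \<phi> (F \<omega>)))\<^sup>2 \<partial>M) \<le> K\<^sup>2 * (\<integral>\<omega>. (norm (Fs n \<omega> - F \<omega>))\<^sup>2 \<partial>M)" for n
      unfolding Bochner_Integration.integral_mult_right_zero[symmetric]
    proof (rule integral_mono)
      show "integrable M (\<lambda>\<omega>. (norm (\<phi> (Fs n \<omega>) - \<phi> (F \<omega>)))\<^sup>2)"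
        by (rule square_integrableD(2)[OF square_integrable_diff[OF s\<phi>]])
      show "integrable M (\<lambda>\<omega>. K\<^sup>2 * (norm (Fs n \<omega> - F \<omega>))\<^sup>2)"
        by (rule integrable_mult_right) (rule square_integrableD(2)[OF square_integrable_diff[OF f(1,2)]])
      show "(norm (\<phi> (Fs n \<omega>) - \<phi> (F \<omega>)))\<^sup>2 \<le> K\<^sup>2 * (norm (Fs n \<omega> - F \<omega>))\<^sup>2" for \<omega>
        using power_mono[OF lip[of "Fs n \<omega>" "F \<omega>"], of 2] by (simp add: power_mult_distrib)
    qed
    show "(\<lambda>n. K\<^sup>2 * (\<integral>\<omega>. (norm (Fs n \<omega> - F \<omega>))\<^sup>2 \<partial>M)) \<longlonglongrightarrow> 0"
      using tendsto_mult[OF tendsto_const[of "K\<^sup>2"] f(3)] by simp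
  qed
  have bd: "\<bar>\<phi>' y * x\<bar> \<le> K * \<bar>x\<bar>" for x y
    unfolding abs_mult using b(1)[of y] by (intro mult_right_mono) auto
  have iAB: "integrable M (\<lambda>\<omega>. inner (A \<omega>) (B \<omega>))" by (rule integrable_inner_L2[OF a(2) sB])
  have "(\<lambda>n. \<integral>\<omega>. \<phi>' (Fs n \<omega>) * inner (A \<omega>) (B \<omega>) \<partial>M) \<longlonglongrightarrow> (\<integral>\<omega>. \<phi>' (F \<omega>) * inner (A \<omega>) (B \<omega>) \<partial>M)"
  proof (rule integral_dominated_convergence[where w = "\<lambda>\<omega>. K * \<bar>inner (A \<omega>) (B \<omega>)\<bar>"])
    show "integrable M (\<lambda>\<omega>. K * \<bar>inner (A \<omega>) (B \<omega>)\<bar>)" using iAB by auto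
    show "AE \<omega> in M. (\<lambda>n. \<phi>' (Fs n \<omega>) * inner (A \<omega>) (B \<omega>)) \<longlonglongrightarrow> \<phi>' (F \<omega>) * inner (A \<omega>) (B \<omega>)"
      using ae
    proof eventually_elim
      case (elim \<omega>)
      have "isCont \<phi>' (F \<omega>)" using c1 by (simp add: continuous_on_eq_continuous_at)
      from isCont_tendsto_compose[OF this elim] show ?case by (intro tendsto_mult tendsto_const)
    qed
    show "AE \<omega> in M. norm (\<phi>' (Fs n \<omega>) * inner (A \<omega>) (B \<omega>)) \<le> K * \<bar>inner (A \<omega>) (B \<omega>)\<bar>" for n
      unfolding real_norm_def by (rule AE_I2) (rule bd)
  qed measurable
  moreover have "(\<lambda>n. \<integral>\<omega>. inner (\<phi>' (Fs n \<omega>) *\<^sub>R (As n \<omega> - A \<omega>)) (B \<omega>) \<partial>M) \<longlonglongrightarrow> (\<integral>\<omega>. inner 0 (B \<omega>) \<partial>M)"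
  proof (rule L2_converges_inner[OF _ L2_converges_const[OF sB]])
    have sd: "square_integrable M (\<lambda>\<omega>. K *\<^sub>R (As n \<omega> - A \<omega>))" for n
      by (intro square_integrable_scaleR square_integrable_diff a)
    have nb: "norm (\<phi>' (Fs n \<omega>) *\<^sub>R (As n \<omega> - A \<omega>)) \<le> norm (K *\<^sub>R (As n \<omega> - A \<omega>))" for n \<omega>
      using b(1)[of "Fs n \<omega>"] K by (simp add: mult_right_mono)
    have sp: "square_integrable M (\<lambda>\<omega>. \<phi>' (Fs n \<omega>) *\<^sub>R (As n \<omega> - A \<omega>))" for n
      by (rule square_integrable_bound[OF sd _ nb]) measurable
    show "L2_converges M (\<lambda>n \<omega>. \<phi>' (Fs n \<omega>) *\<^sub>R (As n \<omega> - A \<omega>)) (\<lambda>_. 0)"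
    proof (rule L2_converges_bound[OF sp])
      show "square_integrable M (\<lambda>_. 0 :: 'h)" by (simp add: square_integrable_def)
      show "(\<integral>\<omega>. (norm (\<phi>' (Fs n \<omega>) *\<^sub>R (As n \<omega> - A \<omega>) - 0))\<^sup>2 \<partial>M) \<le> K\<^sup>2 * (\<integral>\<omega>. (norm (As n \<omega> - A \<omega>))\<^sup>2 \<partial>M)" for n
        unfolding Bochner_Integration.integral_mult_right_zero[symmetric] diff_0_right
      proof (rule integral_mono)
        show "integrable M (\<lambda>\<omega>. (norm (\<phi>' (Fs n \<omega>) *\<^sub>R (As n \<omega> - A \<omega>)))\<^sup>2)" by (rule square_integrableD(2)[OF sp])
        show "integrable M (\<lambda>\<omega>. K\<^sup>2 * (norm (As n \<omega> - A \<omega>))\<^sup>2)"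
          by (rule integrable_mult_right) (rule square_integrableD(2)[OF square_integrable_diff[OF a(1,2)]])
        show "(norm (\<phi>' (Fs n \<omega>) *\<^sub>R (As n \<omega> - A \<omega>)))\<^sup>2 \<le> K\<^sup>2 * (norm (As n \<omega> - A \<omega>))\<^sup>2" for \<omega>
          using power_mono[OF nb[of n \<omega>], of 2] by (simp add: power_mult_distrib)
      qed
      show "(\<lambda>n. K\<^sup>2 * (\<integral>\<omega>. (norm (As n \<omega> - A \<omega>))\<^sup>2 \<partial>M)) \<longlonglongrightarrow> 0"
        using tendsto_mult[OF tendsto_const[of "K\<^sup>2"] a(3)] by simp
    qed
  qed
  ultimately have "(\<lambda>n. (\<integral>\<omega>. \<phi>' (Fs n \<omega>) * inner (A \<omega>) (B \<omega>) \<partial>M) + (\<integral>\<omega>. inner (\<phi>' (Fs n \<omega>) *\<^sub>R (As n \<omega> - A \<omega>)) (B \<omega>) \<partial>M))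
    \<longlonglongrightarrow> (\<integral>\<omega>. \<phi>' (F \<omega>) * inner (A \<omega>) (B \<omega>) \<partial>M) + (\<integral>\<omega>. inner 0 (B \<omega>) \<partial>M)"
    by (rule tendsto_add)
  moreover have "(\<integral>\<omega>. \<phi>' (Fs n \<omega>) * inner (A \<omega>) (B \<omega>) \<partial>M) + (\<integral>\<omega>. inner (\<phi>' (Fs n \<omega>) *\<^sub>R (As n \<omega> - A \<omega>)) (B \<omega>) \<partial>M)
     = - (\<integral>\<omega>. \<phi> (Fs n \<omega>) * F \<omega> \<partial>M)" for n
  proof -
    have i: "integrable M (\<lambda>\<omega>. \<phi>' (Fs n \<omega>) * x \<omega>)" if "integrable M x" for x
    proof (rule Bochner_Integration.integrable_bound)
      have [measurable]: "x \<in> borel_measurable M" using that by auto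
      show "integrable M (\<lambda>\<omega>. K * \<bar>x \<omega>\<bar>)" using that by auto
      show "(\<lambda>\<omega>. \<phi>' (Fs n \<omega>) * x \<omega>) \<in> borel_measurable M" by measurable
      show "AE \<omega> in M. norm (\<phi>' (Fs n \<omega>) * x \<omega>) \<le> norm (K * \<bar>x \<omega>\<bar>)"
        using K by (intro AE_I2) (simp add: abs_mult[symmetric] bd)
    qed
    have i2: "integrable M (\<lambda>\<omega>. inner (As n \<omega> - A \<omega>) (B \<omega>))"
      by (rule integrable_inner_L2[OF square_integrable_diff[OF a(1,2)] sB])
    have "(\<integral>\<omega>. \<phi>' (Fs n \<omega>) * inner (A \<omega>) (B \<omega>) \<partial>M) + (\<integral>\<omega>. inner (\<phi>' (Fs n \<omega>) *\<^sub>R (As n \<omega> - A \<omega>)) (B \<omega>) \<partial>M)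
      = (\<integral>\<omega>. \<phi>' (Fs n \<omega>) * inner (A \<omega>) (B \<omega>) + \<phi>' (Fs n \<omega>) * inner (As n \<omega> - A \<omega>) (B \<omega>) \<partial>M)"
      using i[OF iAB] i[OF i2] by simp
    also have "\<dots> = (\<integral>\<omega>. \<phi>' (Fs n \<omega>) * inner (As n \<omega>) (B \<omega>) \<partial>M)"
      by (simp add: inner_diff_left algebra_simps)
    also have "\<dots> = - (\<integral>\<omega>. \<phi> (Fs n \<omega>) * F \<omega> \<partial>M)"
      by (rule malliavin_integration_by_parts_smooth[OF sm d1 d2 c b mean V B])
    finally show ?thesis .
  qed
  moreover have "(\<lambda>n. - (\<integral>\<omega>. \<phi> (Fs n \<omega>) * F \<omega> \<partial>M)) \<longlonglongrightarrow> - (\<integral>\<omega>. \<phi> (F \<omega>) * F \<omega> \<partial>M)"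
    by (intro tendsto_minus L2_converges_mult[OF \<phi>L L2_converges_const[OF f(2)]])
  ultimately show ?thesis by (auto dest: LIMSEQ_unique)
qed

text \<open>The versions chosen by \<open>malliavin_D\<close> and \<open>L_inverse\<close> exist, hence the formula for \<open>g\<^sub>F\<close>.\<close>

theorem g_rv_integration_by_parts:
  fixes \<phi> \<phi>' \<phi>'' :: "real \<Rightarrow> real"
  assumes F: "F \<in> D12 M W" and mean: "(\<integral>\<omega>. F \<omega> \<partial>M) = 0"
    and d1: "\<And>y. (\<phi> has_real_derivative \<phi>' y) (at y)" and d2: "\<And>y. (\<phi>' has_real_derivative \<phi>'' y) (at y)"
    and c: "continuous_on UNIV \<phi>''" and b: "\<And>y. \<bar>\<phi>' y\<bar> \<le> K" "\<And>y. \<bar>\<phi>'' y\<bar> \<le> K"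
  shows "(\<integral>\<omega>. \<phi>' (F \<omega>) * g_rv M W F \<omega> \<partial>M) = (\<integral>\<omega>. F \<omega> * \<phi> (F \<omega>) \<partial>M)"
    and "integrable M (g_rv M W F)"
proof -
  let ?V = "L_inverse M W F"
  have A: "is_malliavin_deriv M W F (malliavin_D M W F)"
  proof -
    have "\<exists>A. is_malliavin_deriv M W F A" using F by (simp add: D12_def)
    then show ?thesis unfolding malliavin_D_def by (rule someI_ex)
  qed
  have sF: "square_integrable M F" and sA: "square_integrable M (malliavin_D M W F)"
    using A unfolding is_malliavin_deriv_def L2_converges_def by blast+
  obtain J where J: "chaos_decomposition M W F J" using chaos_decomposition_exists[OF sF] by blast
  have V: "is_L_inverse M W F ?V"
    unfolding L_inverse_def by (rule someI_ex[OF L_inverse_exists[OF J]])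
  then have "\<exists>B. is_malliavin_deriv M W ?V B"
    unfolding is_L_inverse_def using L_inverse_derivative by blast
  then have B: "is_malliavin_deriv M W ?V (malliavin_D M W ?V)"
    unfolding malliavin_D_def by (rule someI_ex)
  have sB: "square_integrable M (malliavin_D M W ?V)"
    using B unfolding is_malliavin_deriv_def L2_converges_def by blast
  let ?G = "\<lambda>\<omega>. inner (malliavin_D M W F \<omega>) (- malliavin_D M W ?V \<omega>)"
  have iG: "integrable M ?G"
    by (rule integrable_inner_L2[OF sA square_integrable_minus[OF sB]])
  note [measurable] = square_integrableD(1)[OF sF]
  let ?S = "vimage_algebra (space M) F borel"
  have sub: "subalgebra M ?S"
    by (auto simp: subalgebra_def sets_vimage_algebra2)
  interpret S: finite_measure_subalgebra M ?S by unfold_locales (rule sub)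
  show "integrable M (g_rv M W F)" unfolding g_rv_def by (rule S.real_cond_exp_int(1)[OF iG])
  have c1: "continuous_on UNIV \<phi>'"
    by (rule DERIV_continuous_on[OF DERIV_subset[OF d2 subset_UNIV]])
  then have [measurable]: "\<phi>' \<in> borel_measurable borel" by (auto intro: borel_measurable_continuous_onI)
  have m: "(\<lambda>\<omega>. \<phi>' (F \<omega>)) \<in> borel_measurable ?S"
    by (rule measurable_compose[OF measurable_vimage_algebra1]) auto
  have mG: "?G \<in> borel_measurable M" using iG by auto
  have K: "K \<ge> 0" using b(1)[of 0] by simp
  have "integrable M (\<lambda>\<omega>. \<phi>' (F \<omega>) * ?G \<omega>)"
  proof (rule Bochner_Integration.integrable_bound)
    show "integrable M (\<lambda>\<omega>. K * \<bar>?G \<omega>\<bar>)" using iG by auto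
    show "(\<lambda>\<omega>. \<phi>' (F \<omega>) * ?G \<omega>) \<in> borel_measurable M" using mG by measurable
    show "AE \<omega> in M. norm (\<phi>' (F \<omega>) * ?G \<omega>) \<le> norm (K * \<bar>?G \<omega>\<bar>)"
      using K b(1) by (intro AE_I2) (simp add: abs_mult mult_right_mono)
  qed
  then have "(\<integral>\<omega>. \<phi>' (F \<omega>) * g_rv M W F \<omega> \<partial>M) = (\<integral>\<omega>. \<phi>' (F \<omega>) * ?G \<omega> \<partial>M)"
    unfolding g_rv_def by (rule S.real_cond_exp_intg(2)[OF _ m mG])
  also have "\<dots> = - (\<integral>\<omega>. \<phi>' (F \<omega>) * inner (malliavin_D M W F \<omega>) (malliavin_D M W ?V \<omega>) \<partial>M)" by simp
  also have "\<dots> = (\<integral>\<omega>. F \<omega> * \<phi> (F \<omega>) \<partial>M)"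
    unfolding malliavin_integration_by_parts[OF A d1 d2 c b mean V B] by (simp add: mult.commute)
  finally show "(\<integral>\<omega>. \<phi>' (F \<omega>) * g_rv M W F \<omega> \<partial>M) = (\<integral>\<omega>. F \<omega> * \<phi> (F \<omega>) \<partial>M)" .
qed

end

section \<open>The law of a variable and its Stein kernel\<close>

context prob_space begin

text \<open>For mean zero \<open>F\<close> this function is nonnegative and
  \<open>E [F \<phi>(F)] = \<integral> \<phi>'(z) tail_mean F z dz\<close>. If \<open>F\<close> has a density, \<open>tail_mean F\<close> is the density
  times the Stein kernel of \<open>F\<close>.\<close>

definition tail_mean :: "('a \<Rightarrow> real) \<Rightarrow> real \<Rightarrow> real" where
  "tail_mean F z = (\<integral>\<omega>. (if z < F \<omega> then F \<omega> else 0) \<partial>M)"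

lemma integrable_tail:
  fixes F :: "'a \<Rightarrow> real"
  assumes "integrable M F" "A \<in> sets borel"
  shows "integrable M (\<lambda>\<omega>. if F \<omega> \<in> A then F \<omega> else 0)"
proof -
  have [measurable]: "F \<in> borel_measurable M" "A \<in> sets borel" using assms by auto
  show ?thesis by (rule Bochner_Integration.integrable_bound[OF assms(1)]) auto
qed

lemma tail_mean_measurable [measurable]:
  assumes [measurable]: "F \<in> borel_measurable M"
  shows "tail_mean F \<in> borel_measurable borel"
  unfolding tail_mean_def[abs_def] by measurable

lemma tail_mean_alt:
  assumes F: "integrable M F" and mean: "(\<integral>\<omega>. F \<omega> \<partial>M) = 0"
  shows "tail_mean F z = (\<integral>\<omega>. (if F \<omega> \<le> z then - F \<omega> else 0) \<partial>M)"
proof -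
  have i: "integrable M (\<lambda>\<omega>. if z < F \<omega> then F \<omega> else 0)" "integrable M (\<lambda>\<omega>. if F \<omega> \<le> z then F \<omega> else 0)"
    using integrable_tail[OF F, of "{z<..}"] integrable_tail[OF F, of "{..z}"] by auto
  have "(\<integral>\<omega>. F \<omega> \<partial>M) = (\<integral>\<omega>. (if z < F \<omega> then F \<omega> else 0) + (if F \<omega> \<le> z then F \<omega> else 0) \<partial>M)"
    by (intro Bochner_Integration.integral_cong) auto
  also have "\<dots> = tail_mean F z + (\<integral>\<omega>. (if F \<omega> \<le> z then F \<omega> else 0) \<partial>M)"
    using i by (simp add: tail_mean_def)
  finally have "tail_mean F z = - (\<integral>\<omega>. (if F \<omega> \<le> z then F \<omega> else 0) \<partial>M)" using mean by simp
  also have "\<dots> = (\<integral>\<omega>. - (if F \<omega> \<le> z then F \<omega> else 0) \<partial>M)" by simp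
  also have "\<dots> = (\<integral>\<omega>. (if F \<omega> \<le> z then - F \<omega> else 0) \<partial>M)"
    by (intro Bochner_Integration.integral_cong) auto
  finally show ?thesis .
qed

lemma tail_mean_nonneg:
  assumes F: "integrable M F" and mean: "(\<integral>\<omega>. F \<omega> \<partial>M) = 0"
  shows "0 \<le> tail_mean F z"
proof (cases "z \<ge> 0")
  case True then show ?thesis unfolding tail_mean_def by (intro Bochner_Integration.integral_nonneg) auto
next
  case False then show ?thesis unfolding tail_mean_alt[OF assms] by (intro Bochner_Integration.integral_nonneg) auto
qed

lemma tail_mean_bounded:
  assumes F: "integrable M F"
  shows "\<bar>tail_mean F z\<bar> \<le> (\<integral>\<omega>. \<bar>F \<omega>\<bar> \<partial>M)"
proof -
  have "\<bar>tail_mean F z\<bar> \<le> (\<integral>\<omega>. \<bar>if z < F \<omega> then F \<omega> else 0\<bar> \<partial>M)"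
    unfolding tail_mean_def by (rule integral_abs_bound)
  also have "\<dots> \<le> (\<integral>\<omega>. \<bar>F \<omega>\<bar> \<partial>M)"
    using integrable_tail[OF F, of "{z<..}"] F by (intro integral_mono) auto
  finally show ?thesis .
qed

lemma tail_mean_diff:
  assumes F: "integrable M F" and ab: "a \<le> b"
  shows "tail_mean F a - tail_mean F b = (\<integral>\<omega>. (if F \<omega> \<in> {a<..b} then F \<omega> else 0) \<partial>M)"
proof -
  have i: "integrable M (\<lambda>\<omega>. if z < F \<omega> then F \<omega> else 0)" for z
    using integrable_tail[OF F, of "{z<..}"] by auto
  have "tail_mean F a - tail_mean F b = (\<integral>\<omega>. (if a < F \<omega> then F \<omega> else 0) - (if b < F \<omega> then F \<omega> else 0) \<partial>M)"
    unfolding tail_mean_def using i by simp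
  also have "\<dots> = (\<integral>\<omega>. (if F \<omega> \<in> {a<..b} then F \<omega> else 0) \<partial>M)"
    using ab by (intro Bochner_Integration.integral_cong) auto
  finally show ?thesis .
qed

text \<open>The inner integral in the application of Fubini's theorem to \<open>tail_mean\<close>; the two ranges
  of \<open>z\<close> belong to \<open>x > 0\<close> and \<open>x < 0\<close>.\<close>

lemma nn_integral_derivative_between:
  fixes \<phi> \<psi> :: "real \<Rightarrow> real"
  assumes d: "\<And>z. (\<phi> has_real_derivative \<psi> z) (at z)" and nn: "\<And>z. 0 \<le> \<psi> z" and [measurable]: "\<psi> \<in> borel_measurable borel"
  shows "(\<integral>\<^sup>+z. (if 0 \<le> z \<and> z < x \<or> x \<le> z \<and> z < 0 then ennreal (\<bar>x\<bar> * \<psi> z) else 0) \<partial>lborel) = ennreal (x * (\<phi> x - \<phi> 0))"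
proof -
  have mono: "\<phi> a \<le> \<phi> b" if "a \<le> b" for a b
    by (rule DERIV_nonneg_imp_nondecreasing[OF that]) (blast intro: d nn)
  have FTC: "(\<integral>\<^sup>+z. ennreal (\<psi> z) * indicator {a..b} z \<partial>lborel) = ennreal (\<phi> b - \<phi> a)" if "a \<le> b" for a b
    by (rule nn_integral_FTC_Icc[OF assms(3) d nn that])
  let ?a = "min 0 x" and ?b = "max 0 x"
  have min_le_max: "?a \<le> ?b" by simp
  have "(\<integral>\<^sup>+z. (if 0 \<le> z \<and> z < x \<or> x \<le> z \<and> z < 0 then ennreal (\<bar>x\<bar> * \<psi> z) else 0) \<partial>lborel)
     = (\<integral>\<^sup>+z. ennreal \<bar>x\<bar> * (ennreal (\<psi> z) * indicator {?a..?b} z) \<partial>lborel)"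
  proof (rule nn_integral_cong_AE)
    show "AE z in lborel. (if 0 \<le> z \<and> z < x \<or> x \<le> z \<and> z < 0 then ennreal (\<bar>x\<bar> * \<psi> z) else 0)
       = ennreal \<bar>x\<bar> * (ennreal (\<psi> z) * indicator {?a..?b} z)"
      using AE_lborel_singleton[of x] AE_lborel_singleton[of 0]
    proof eventually_elim
      case (elim z)
      have "ennreal (\<bar>x\<bar> * \<psi> z) = ennreal \<bar>x\<bar> * ennreal (\<psi> z)" by (rule ennreal_mult) (auto simp: nn)
      then show ?case using elim by (auto simp: indicator_def)
    qed
  qed
  also have "\<dots> = ennreal \<bar>x\<bar> * ennreal (\<phi> ?b - \<phi> ?a)"
    by (subst nn_integral_cmult) (measurable, simp only: FTC[OF min_le_max])
  also have "\<dots> = ennreal (\<bar>x\<bar> * (\<phi> ?b - \<phi> ?a))"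
    using mono[of ?a ?b] by (simp add: ennreal_mult)
  also have "\<bar>x\<bar> * (\<phi> ?b - \<phi> ?a) = x * (\<phi> x - \<phi> 0)"
    by (cases "x \<ge> 0") (auto simp: algebra_simps)
  finally show ?thesis .
qed

text \<open>Represent \<open>tail_mean F z\<close> as \<open>E [F; F > z]\<close> for \<open>z \<ge> 0\<close> and as \<open>E [-F; F \<le> z]\<close> for
  \<open>z < 0\<close>. Both integrands are nonnegative, so the order of integration can be exchanged.\<close>

lemma tail_mean_nn_integral:
  fixes \<phi> \<psi> :: "real \<Rightarrow> real"
  assumes F: "integrable M F" and mean: "(\<integral>\<omega>. F \<omega> \<partial>M) = 0"
    and d: "\<And>z. (\<phi> has_real_derivative \<psi> z) (at z)" and nn: "\<And>z. 0 \<le> \<psi> z" and [measurable]: "\<psi> \<in> borel_measurable borel"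
  shows "(\<integral>\<^sup>+z. ennreal (tail_mean F z * \<psi> z) \<partial>lborel) = (\<integral>\<^sup>+\<omega>. ennreal (F \<omega> * (\<phi> (F \<omega>) - \<phi> 0)) \<partial>M)"
proof -
  have [measurable]: "F \<in> borel_measurable M" using F by auto
  let ?k = "\<lambda>z \<omega>. if 0 \<le> z \<and> z < F \<omega> \<or> F \<omega> \<le> z \<and> z < 0 then ennreal (\<bar>F \<omega>\<bar> * \<psi> z) else 0"
  have R: "ennreal (tail_mean F z * \<psi> z) = (\<integral>\<^sup>+\<omega>. ?k z \<omega> \<partial>M)" for z
  proof (cases "z \<ge> 0")
    case True
    have "ennreal (tail_mean F z * \<psi> z) = ennreal (\<integral>\<omega>. (if z < F \<omega> then F \<omega> else 0) * \<psi> z \<partial>M)"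
      by (simp add: tail_mean_def)
    also have "\<dots> = (\<integral>\<^sup>+\<omega>. ennreal ((if z < F \<omega> then F \<omega> else 0) * \<psi> z) \<partial>M)"
      using integrable_tail[OF F, of "{z<..}"] True nn
      by (intro nn_integral_eq_integral[symmetric] integrable_mult_left AE_I2) auto
    also have "\<dots> = (\<integral>\<^sup>+\<omega>. ?k z \<omega> \<partial>M)" using True by (intro nn_integral_cong) auto
    finally show ?thesis .
  next
    case False
    have i: "integrable M (\<lambda>\<omega>. if F \<omega> \<le> z then - F \<omega> else 0)"
      by (rule Bochner_Integration.integrable_bound[OF F]) auto
    have "ennreal (tail_mean F z * \<psi> z) = ennreal (\<integral>\<omega>. (if F \<omega> \<le> z then - F \<omega> else 0) * \<psi> z \<partial>M)"
      by (simp add: tail_mean_alt[OF F mean])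
    also have "\<dots> = (\<integral>\<^sup>+\<omega>. ennreal ((if F \<omega> \<le> z then - F \<omega> else 0) * \<psi> z) \<partial>M)"
      using i False nn
      by (intro nn_integral_eq_integral[symmetric] integrable_mult_left AE_I2) auto
    also have "\<dots> = (\<integral>\<^sup>+\<omega>. ?k z \<omega> \<partial>M)" using False by (intro nn_integral_cong) auto
    finally show ?thesis .
  qed
  interpret P: pair_sigma_finite lborel M by unfold_locales
  have "(\<integral>\<^sup>+z. ennreal (tail_mean F z * \<psi> z) \<partial>lborel) = (\<integral>\<^sup>+z. (\<integral>\<^sup>+\<omega>. ?k z \<omega> \<partial>M) \<partial>lborel)" by (simp add: R)
  also have "\<dots> = (\<integral>\<^sup>+\<omega>. (\<integral>\<^sup>+z. ?k z \<omega> \<partial>lborel) \<partial>M)"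
    by (rule P.Fubini'[symmetric]) measurable
  also have "\<dots> = (\<integral>\<^sup>+\<omega>. ennreal (F \<omega> * (\<phi> (F \<omega>) - \<phi> 0)) \<partial>M)"
    by (simp add: nn_integral_derivative_between[OF d nn])
  finally show ?thesis .
qed

lemma increasing_mult_nonneg:
  fixes \<phi> \<psi> :: "real \<Rightarrow> real"
  assumes d: "\<And>z. (\<phi> has_real_derivative \<psi> z) (at z)" and nn: "\<And>z. 0 \<le> \<psi> z"
  shows "0 \<le> x * (\<phi> x - \<phi> 0)"
proof -
  have mono: "\<phi> a \<le> \<phi> b" if "a \<le> b" for a b
    by (rule DERIV_nonneg_imp_nondecreasing[OF that]) (blast intro: d nn)
  show ?thesis using mono[of 0 x] mono[of x 0] by (cases "x \<ge> 0") (auto simp: zero_le_mult_iff)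
qed

lemma tail_mean_integral:
  fixes \<phi> \<psi> :: "real \<Rightarrow> real"
  assumes F: "integrable M F" and mean: "(\<integral>\<omega>. F \<omega> \<partial>M) = 0"
    and d: "\<And>z. (\<phi> has_real_derivative \<psi> z) (at z)" and nn: "\<And>z. 0 \<le> \<psi> z" and [measurable]: "\<psi> \<in> borel_measurable borel"
    and i: "integrable M (\<lambda>\<omega>. F \<omega> * \<phi> (F \<omega>))"
  shows "integrable lborel (\<lambda>z. tail_mean F z * \<psi> z)"
    and "(\<integral>z. tail_mean F z * \<psi> z \<partial>lborel) = (\<integral>\<omega>. F \<omega> * \<phi> (F \<omega>) \<partial>M)"
proof -
  have [measurable]: "F \<in> borel_measurable M" using F by auto
  have i': "integrable M (\<lambda>\<omega>. F \<omega> * (\<phi> (F \<omega>) - \<phi> 0))"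
    unfolding right_diff_distrib using i F by auto
  have "(\<integral>\<^sup>+z. ennreal (tail_mean F z * \<psi> z) \<partial>lborel) = (\<integral>\<^sup>+\<omega>. ennreal (F \<omega> * (\<phi> (F \<omega>) - \<phi> 0)) \<partial>M)"
    by (rule tail_mean_nn_integral[OF F mean d nn]) measurable
  also have "\<dots> = ennreal (\<integral>\<omega>. F \<omega> * (\<phi> (F \<omega>) - \<phi> 0) \<partial>M)"
    using increasing_mult_nonneg[OF d nn] by (intro nn_integral_eq_integral i') auto
  also have "(\<integral>\<omega>. F \<omega> * (\<phi> (F \<omega>) - \<phi> 0) \<partial>M) = (\<integral>\<omega>. F \<omega> * \<phi> (F \<omega>) \<partial>M)"
    unfolding right_diff_distrib using i F mean by simp
  finally have e: "(\<integral>\<^sup>+z. ennreal (tail_mean F z * \<psi> z) \<partial>lborel) = ennreal (\<integral>\<omega>. F \<omega> * \<phi> (F \<omega>) \<partial>M)" .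
  have nn': "0 \<le> tail_mean F z * \<psi> z" for z using tail_mean_nonneg[OF F mean] nn by simp
  have pos: "0 \<le> (\<integral>\<omega>. F \<omega> * \<phi> (F \<omega>) \<partial>M)"
  proof -
    have "0 \<le> (\<integral>\<omega>. F \<omega> * (\<phi> (F \<omega>) - \<phi> 0) \<partial>M)"
      using increasing_mult_nonneg[OF d nn] by (intro Bochner_Integration.integral_nonneg) auto
    also have "\<dots> = (\<integral>\<omega>. F \<omega> * \<phi> (F \<omega>) \<partial>M)"
      unfolding right_diff_distrib using i F mean by simp
    finally show ?thesis .
  qed
  show "integrable lborel (\<lambda>z. tail_mean F z * \<psi> z)"
    by (rule integrableI_nonneg) (use nn' e in auto)
  show "(\<integral>z. tail_mean F z * \<psi> z \<partial>lborel) = (\<integral>\<omega>. F \<omega> * \<phi> (F \<omega>) \<partial>M)"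
    using nn' pos by (subst integral_eq_nn_integral) (auto simp: e)
qed

end

text \<open>For \<open>n > 0\<close> these functions decrease from \<open>1\<close> to \<open>0\<close> and converge to the indicator of
  \<open>{..a}\<close>. The shift by \<open>1\<close> inside makes the argument \<open>-n\<close> at \<open>x = a\<close>, so that the limit there
  is \<open>1\<close>.\<close>

definition smooth_step :: "real \<Rightarrow> nat \<Rightarrow> real \<Rightarrow> real" where
  "smooth_step a n x = 1/2 - arctan (real n * (real n * (x - a) - 1)) / pi"

definition smooth_step_deriv :: "real \<Rightarrow> nat \<Rightarrow> real \<Rightarrow> real" where
  "smooth_step_deriv a n x = - (real n * real n) / (pi * (1 + (real n * (real n * (x - a) - 1))\<^sup>2))"

lemma smooth_step_has_derivative: "(smooth_step a n has_real_derivative smooth_step_deriv a n x) (at x)"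
proof -
  let ?u = "\<lambda>x. real n * (real n * (x - a) - 1)"
  have "((\<lambda>x. 1/2 - arctan (?u x) / pi) has_real_derivative 0 - (inverse (1 + (?u x)\<^sup>2) * (real n * real n)) / pi) (at x)"
    by (rule derivative_eq_intros refl | simp)+
  moreover have "0 - (inverse (1 + (?u x)\<^sup>2) * (real n * real n)) / pi = smooth_step_deriv a n x"
    unfolding smooth_step_deriv_def by (simp only: diff_0 inverse_eq_divide times_divide_eq_left divide_divide_eq_left minus_divide_left mult_1_left mult.commute[of pi])
  ultimately show ?thesis unfolding smooth_step_def[abs_def] by simp
qed

lemma smooth_step_deriv_props: "continuous_on UNIV (smooth_step_deriv a n)" "\<bar>smooth_step_deriv a n x\<bar> \<le> 1 + real n * real n"
proof -
  have p: "pi * (1 + y\<^sup>2) \<ge> 1" for y :: real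
  proof -
    have "1 * 1 \<le> pi * (1 + y\<^sup>2)" using pi_gt3 by (intro mult_mono) auto
    then show ?thesis by simp
  qed
  have nz: "pi * (1 + y\<^sup>2) \<noteq> 0" for y :: real using p[of y] by linarith
  show "continuous_on UNIV (smooth_step_deriv a n)"
    unfolding smooth_step_deriv_def[abs_def] by (intro continuous_intros ballI nz)
  let ?d = "pi * (1 + (real n * (real n * (x - a) - 1))\<^sup>2)"
  have "\<bar>smooth_step_deriv a n x\<bar> = real n * real n / ?d"
    using p[of "real n * (real n * (x - a) - 1)"] unfolding smooth_step_deriv_def abs_divide abs_minus_cancel by (simp only: abs_of_nonneg)  simp
  also have "\<dots> \<le> real n * real n / 1"
    using p by (intro divide_left_mono) (auto intro: mult_pos_pos less_le_trans[OF zero_less_one])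
  finally show "\<bar>smooth_step_deriv a n x\<bar> \<le> 1 + real n * real n" by simp
qed

lemma smooth_step_bounds: "0 \<le> smooth_step a n x" "smooth_step a n x \<le> 1"
proof -
  let ?t = "arctan (real n * (real n * (x - a) - 1))"
  have "- (pi / 2) < ?t" "?t < pi / 2" using arctan_bounded by auto
  then show "0 \<le> smooth_step a n x" "smooth_step a n x \<le> 1"
    unfolding smooth_step_def by (simp_all add: field_simps)
qed

lemma smooth_step_tendsto: "(\<lambda>n. smooth_step a n x) \<longlonglongrightarrow> indicator {..a} x"
proof (cases "x \<le> a")
  case True
  have "filterlim (\<lambda>n. real n * (real n * (x - a) - 1)) at_bot sequentially"
  proof (rule filterlim_at_bot_mono)
    show "filterlim (\<lambda>n. - real n) at_bot sequentially"
      using filterlim_real_sequentially by (simp add: filterlim_uminus_at_bot)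
    have "real n * (real n * (x - a) - 1) \<le> - real n" for n
    proof -
      have "real n * (real n * (x - a)) \<le> 0" using True by (simp add: mult_le_0_iff)
      then show ?thesis by (simp add: right_diff_distrib)
    qed
    then show "\<forall>\<^sub>F n in sequentially. real n * (real n * (x - a) - 1) \<le> - real n" by simp
  qed
  from filterlim_compose[OF tendsto_arctan_at_bot this]
  have "(\<lambda>n. arctan (real n * (real n * (x - a) - 1))) \<longlonglongrightarrow> - (pi / 2)" .
  then have "(\<lambda>n. 1/2 - arctan (real n * (real n * (x - a) - 1)) / pi) \<longlonglongrightarrow> 1/2 - (- (pi / 2)) / pi"
    by (intro tendsto_intros) auto
  then show ?thesis using True by (simp add: smooth_step_def)
next
  case False
  have "filterlim (\<lambda>n. real n * (real n * (x - a) - 1)) at_top sequentially"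
  proof (rule filterlim_at_top_mult_at_top[OF filterlim_real_sequentially])
    have "filterlim (\<lambda>n. real n * (x - a)) at_top sequentially"
      using False by (intro filterlim_at_top_mult_tendsto_pos[OF tendsto_const _ filterlim_real_sequentially]) auto
    then show "filterlim (\<lambda>n. real n * (x - a) - 1) at_top sequentially"
      using filterlim_tendsto_add_at_top[OF tendsto_const[of "-1"]] by (simp add: add.commute)
  qed
  from filterlim_compose[OF tendsto_arctan_at_top this]
  have "(\<lambda>n. arctan (real n * (real n * (x - a) - 1))) \<longlonglongrightarrow> pi / 2" .
  then have "(\<lambda>n. 1/2 - arctan (real n * (real n * (x - a) - 1)) / pi) \<longlonglongrightarrow> 1/2 - (pi / 2) / pi"
    by (intro tendsto_intros) auto
  then show ?thesis using False by (simp add: smooth_step_def)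
qed

lemma antiderivative_exists:
  fixes \<psi> :: "real \<Rightarrow> real"
  assumes "continuous_on UNIV \<psi>"
  obtains \<phi> where "\<And>x. (\<phi> has_real_derivative \<psi> x) (at x)"
proof -
  have "\<exists>\<phi>. \<forall>x::real. -\<infinity> < ereal x \<longrightarrow> ereal x < \<infinity> \<longrightarrow> (\<phi> has_vector_derivative \<psi> x) (at x)"
    using assms by (intro einterval_antiderivative) (auto simp: continuous_on_eq_continuous_at)
  then show thesis using that by (auto simp: has_real_derivative_iff_has_vector_derivative)
qed

context isonormal_gaussian_process begin

lemma D12_square_integrable: "F \<in> D12 M W \<Longrightarrow> square_integrable M F"
  unfolding D12_def is_malliavin_deriv_def L2_converges_def by blast

lemma square_integrable_integrable:
  fixes F :: "'a \<Rightarrow> real"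
  assumes "square_integrable M F" shows "integrable M F"
proof -
  have "square_integrable M (\<lambda>_. 1::real)" by (simp add: square_integrable_def)
  from integrable_mult_L2[OF assms this] show ?thesis by simp
qed

lemma tail_mean_integrable:
  assumes sF: "square_integrable M F" and mean: "(\<integral>\<omega>. F \<omega> \<partial>M) = 0"
  shows "integrable lborel (tail_mean F)"
proof -
  have "integrable lborel (\<lambda>z. tail_mean F z * 1)"
    by (rule tail_mean_integral(1)[OF square_integrable_integrable[OF sF] mean, where \<phi> = "\<lambda>x. x"])
       (auto intro: integrable_mult_L2[OF sF sF])
  then show ?thesis by simp
qed

text \<open>Both sides are \<open>E [F \<phi>(F)]\<close> for an antiderivative \<open>\<phi>\<close> of \<open>\<psi>\<close>.\<close>

lemma g_rv_smooth_test:
  fixes \<psi> \<psi>' :: "real \<Rightarrow> real"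
  assumes F: "F \<in> D12 M W" and mean: "(\<integral>\<omega>. F \<omega> \<partial>M) = 0"
    and d: "\<And>x. (\<psi> has_real_derivative \<psi>' x) (at x)" and c: "continuous_on UNIV \<psi>'" and b': "\<And>x. \<bar>\<psi>' x\<bar> \<le> K"
    and b: "\<And>x. 0 \<le> \<psi> x" "\<And>x. \<psi> x \<le> 1"
  shows "(\<integral>\<omega>. \<psi> (F \<omega>) * g_rv M W F \<omega> \<partial>M) = (\<integral>z. tail_mean F z * \<psi> z \<partial>lborel)"
proof -
  note sF = D12_square_integrable[OF F]
  have cont: "continuous_on UNIV \<psi>" by (rule DERIV_continuous_on[OF DERIV_subset[OF d subset_UNIV]])
  obtain \<phi> where \<phi>: "\<And>x. (\<phi> has_real_derivative \<psi> x) (at x)" using antiderivative_exists[OF cont] by blast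
  have K: "K \<ge> 0" using b'[of 0] by simp
  have b1: "\<bar>\<psi> x\<bar> \<le> 1 + K" for x using b[of x] K by simp
  have b2: "\<bar>\<psi>' x\<bar> \<le> 1 + K" for x using b'[of x] by simp
  have c\<phi>: "continuous_on UNIV \<phi>" by (rule DERIV_continuous_on[OF DERIV_subset[OF \<phi> subset_UNIV]])
  have i: "integrable M (\<lambda>\<omega>. F \<omega> * \<phi> (F \<omega>))"
    by (rule integrable_mult_L2[OF sF square_integrable_Lipschitz[OF sF bounded_derivative_Lipschitz[OF \<phi> b1]
          borel_measurable_continuous_onI[OF c\<phi>]]])
  have "(\<integral>\<omega>. \<psi> (F \<omega>) * g_rv M W F \<omega> \<partial>M) = (\<integral>\<omega>. F \<omega> * \<phi> (F \<omega>) \<partial>M)"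
    by (rule g_rv_integration_by_parts(1)[OF F mean \<phi> d c b1 b2])
  also have "\<dots> = (\<integral>z. tail_mean F z * \<psi> z \<partial>lborel)"
    by (rule tail_mean_integral(2)[OF square_integrable_integrable[OF sF] mean \<phi> b(1) borel_measurable_continuous_onI[OF cont] i, symmetric])
  finally show ?thesis .
qed

lemma g_rv_integrable:
  assumes F: "F \<in> D12 M W" and mean: "(\<integral>\<omega>. F \<omega> \<partial>M) = 0"
  shows "integrable M (g_rv M W F)"
  by (rule g_rv_integration_by_parts(2)[OF F mean, where \<phi> = "\<lambda>_. 0" and \<phi>' = "\<lambda>_. 0" and \<phi>'' = "\<lambda>_. 0" and K = 0]) auto

text \<open>Smooth approximations of indicators of half-lines, then Dynkin's argument. The result
  identifies \<open>g\<^sub>F\<close> as the density of the measure \<open>E [F; F > z] dz\<close> with respect to the law of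
  \<open>F\<close>.\<close>

theorem g_rv_tail_mean:
  assumes F: "F \<in> D12 M W" and mean: "(\<integral>\<omega>. F \<omega> \<partial>M) = 0" and B: "B \<in> sets borel"
  shows "(\<integral>\<omega>. indicator B (F \<omega>) * g_rv M W F \<omega> \<partial>M) = (\<integral>z. tail_mean F z * indicator B z \<partial>lborel)"
proof -
  note sF = D12_square_integrable[OF F]
  note [measurable] = square_integrableD(1)[OF sF]
  let ?g = "g_rv M W F" and ?R = "tail_mean F"
  note ig = g_rv_integrable[OF F mean] and iR = tail_mean_integrable[OF sF mean]
  have [measurable]: "?g \<in> borel_measurable M" using ig by auto
  have half: "(\<integral>\<omega>. indicator {..a} (F \<omega>) * ?g \<omega> \<partial>M) = (\<integral>z. ?R z * indicator {..a} z \<partial>lborel)" for a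
  proof (rule LIMSEQ_unique)
    have sm [measurable]: "smooth_step a n \<in> borel_measurable borel" for n
      unfolding smooth_step_def[abs_def] by measurable
    show "(\<lambda>n. \<integral>\<omega>. smooth_step a n (F \<omega>) * ?g \<omega> \<partial>M) \<longlonglongrightarrow> (\<integral>\<omega>. indicator {..a} (F \<omega>) * ?g \<omega> \<partial>M)"
    proof (rule integral_dominated_convergence[where w = "\<lambda>\<omega>. \<bar>?g \<omega>\<bar>"])
      show "integrable M (\<lambda>\<omega>. \<bar>?g \<omega>\<bar>)" using ig by auto
      show "AE \<omega> in M. (\<lambda>n. smooth_step a n (F \<omega>) * ?g \<omega>) \<longlonglongrightarrow> indicator {..a} (F \<omega>) * ?g \<omega>"
        by (intro AE_I2 tendsto_mult tendsto_const smooth_step_tendsto)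
      show "AE \<omega> in M. norm (smooth_step a n (F \<omega>) * ?g \<omega>) \<le> \<bar>?g \<omega>\<bar>" for n
        using smooth_step_bounds[of a n] by (intro AE_I2) (simp add: abs_mult mult_left_le_one_le)
    qed measurable
    have "(\<lambda>n. \<integral>z. ?R z * smooth_step a n z \<partial>lborel) \<longlonglongrightarrow> (\<integral>z. ?R z * indicator {..a} z \<partial>lborel)"
    proof (rule integral_dominated_convergence[where w = "\<lambda>z. \<bar>?R z\<bar>"])
      show "integrable lborel (\<lambda>z. \<bar>?R z\<bar>)" using iR by auto
      show "AE z in lborel. (\<lambda>n. ?R z * smooth_step a n z) \<longlonglongrightarrow> ?R z * indicator {..a} z"
        by (intro AE_I2 tendsto_mult tendsto_const smooth_step_tendsto)
      show "AE z in lborel. norm (?R z * smooth_step a n z) \<le> \<bar>?R z\<bar>" for n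
        using smooth_step_bounds[of a n] by (intro AE_I2) (simp add: abs_mult mult_left_le)
    qed measurable
    moreover have "(\<integral>\<omega>. smooth_step a n (F \<omega>) * ?g \<omega> \<partial>M) = (\<integral>z. ?R z * smooth_step a n z \<partial>lborel)" for n
      by (rule g_rv_smooth_test[OF F mean smooth_step_has_derivative smooth_step_deriv_props smooth_step_bounds])
    ultimately show "(\<lambda>n. \<integral>\<omega>. smooth_step a n (F \<omega>) * ?g \<omega> \<partial>M) \<longlonglongrightarrow> (\<integral>z. ?R z * indicator {..a} z \<partial>lborel)"
      by simp
  qed
  have total: "(\<integral>\<omega>. ?g \<omega> \<partial>M) = (\<integral>z. ?R z \<partial>lborel)"
    using g_rv_smooth_test[OF F mean, where \<psi> = "\<lambda>_. 1" and \<psi>' = "\<lambda>_. 0" and K = 0] by simp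
  have B': "B \<in> sigma_sets UNIV (range (\<lambda>a::real. {..a}))"
    using B unfolding borel_eq_atMost by (simp add: sets_measure_of)
  have bm: "A \<in> sets borel" if "A \<in> sigma_sets UNIV (range (\<lambda>a::real. {..a}))" for A
    using that unfolding borel_eq_atMost by (simp add: sets_measure_of)
  let ?P = "\<lambda>B. (LINT \<omega>:F -` B \<inter> space M|M. ?g \<omega>) = (LINT z:B|lborel. ?R z)"
  have si: "set_integrable M (F -` A \<inter> space M) ?g" "set_integrable lborel A ?R" if "A \<in> sets borel" for A
    using integrable_mult_indicator[OF measurable_sets[OF square_integrableD(1)[OF sF] that] ig]
      integrable_mult_indicator[OF _ iR, of A] that by (simp_all add: set_integrable_def)
  have "Int_stable (range (\<lambda>a::real. {..a}))"
    by (auto intro!: Int_stableI)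
  moreover have "range (\<lambda>a::real. {..a}) \<subseteq> Pow UNIV" by simp
  ultimately have "?P B" using B'
  proof (induction rule: sigma_sets_induct_disjoint)
    case (basic A)
    then obtain a where A: "A = {..a}" by auto
    have "(LINT \<omega>:F -` A \<inter> space M|M. ?g \<omega>) = (\<integral>\<omega>. indicator {..a} (F \<omega>) * ?g \<omega> \<partial>M)"
      unfolding set_lebesgue_integral_def A
      by (intro Bochner_Integration.integral_cong) (auto simp: indicator_def)
    then show ?case unfolding half by (simp add: set_lebesgue_integral_def A mult.commute)
  next
    case empty show ?case by (simp add: set_lebesgue_integral_def)
  next
    case (compl A)
    have A: "A \<in> sets borel" by (rule bm[OF compl(1)])
    have "(LINT \<omega>:F -` (UNIV - A) \<inter> space M|M. ?g \<omega>) = (LINT \<omega>|M. ?g \<omega> - indicator (F -` A \<inter> space M) \<omega> *\<^sub>R ?g \<omega>)"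
      unfolding set_lebesgue_integral_def
      by (intro Bochner_Integration.integral_cong) (auto simp: indicator_def)
    also have "\<dots> = (LINT \<omega>|M. ?g \<omega>) - (LINT \<omega>:F -` A \<inter> space M|M. ?g \<omega>)"
      using si(1)[OF A] ig unfolding set_lebesgue_integral_def set_integrable_def by simp
    also have "\<dots> = (LINT z|lborel. ?R z) - (LINT z:A|lborel. ?R z)" using total compl(2) by simp
    also have "\<dots> = (LINT z|lborel. ?R z - indicator A z *\<^sub>R ?R z)"
      using si(2)[OF A] iR unfolding set_lebesgue_integral_def set_integrable_def by simp
    also have "\<dots> = (LINT z:UNIV - A|lborel. ?R z)"
      unfolding set_lebesgue_integral_def
      by (intro Bochner_Integration.integral_cong) (auto simp: indicator_def)
    finally show ?case .
  next
    case (union A)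
    have A: "A i \<in> sets borel" for i using union(2) bm by blast
    have dj: "A i \<inter> A j = {}" if "i \<noteq> j" for i j using union(1) that by (auto simp: disjoint_family_on_def)
    have UA: "(\<Union>i. A i) \<in> sets borel" using A by (intro sets.countable_UN) auto
    have U: "F -` (\<Union>i. A i) \<inter> space M = (\<Union>i. F -` A i \<inter> space M)" by auto
    have "(LINT \<omega>:F -` (\<Union>i. A i) \<inter> space M|M. ?g \<omega>) = (\<Sum>i. (LINT \<omega>:F -` A i \<inter> space M|M. ?g \<omega>))"
      unfolding U
    proof (rule lebesgue_integral_countable_add)
      show "F -` A i \<inter> space M \<in> sets M" for i by (rule measurable_sets[OF square_integrableD(1)[OF sF] A])
      show "F -` A i \<inter> space M \<inter> (F -` A j \<inter> space M) = {}" if "i \<noteq> j" for i j using dj[OF that] by auto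
      show "set_integrable M (\<Union>i. F -` A i \<inter> space M) ?g" using si(1)[OF UA] unfolding U .
    qed
    also have "\<dots> = (\<Sum>i. (LINT z:A i|lborel. ?R z))" by (simp only: union(3))
    also have "\<dots> = (LINT z:(\<Union>i. A i)|lborel. ?R z)"
      by (rule lebesgue_integral_countable_add[symmetric]) (use A dj si(2)[OF UA] in auto)
    finally show ?case .
  qed
  moreover have "(LINT \<omega>:F -` B \<inter> space M|M. ?g \<omega>) = (\<integral>\<omega>. indicator B (F \<omega>) * ?g \<omega> \<partial>M)"
    unfolding set_lebesgue_integral_def
    by (intro Bochner_Integration.integral_cong) (auto simp: indicator_def)
  ultimately show ?thesis by (simp add: set_lebesgue_integral_def mult.commute)
qed

lemma g_rv_sigma_measurable: "g_rv M W F \<in> borel_measurable (vimage_algebra (space M) F borel)"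
  unfolding g_rv_def by (rule borel_measurable_cond_exp)

text \<open>\<open>g\<^sub>F\<close> is a conditional expectation given \<open>F\<close>, hence determined by its integrals over the
  events \<open>{F \<in> B}\<close>.\<close>

lemma g_rv_eqI:
  assumes F: "F \<in> D12 M W" and mean: "(\<integral>\<omega>. F \<omega> \<partial>M) = 0"
    and \<tau>: "\<tau> \<in> borel_measurable borel" "integrable M (\<lambda>\<omega>. \<tau> (F \<omega>))"
    and eq: "\<And>B. B \<in> sets borel \<Longrightarrow> (\<integral>\<omega>. indicator B (F \<omega>) * \<tau> (F \<omega>) \<partial>M) = (\<integral>z. tail_mean F z * indicator B z \<partial>lborel)"
  shows "AE \<omega> in M. g_rv M W F \<omega> = \<tau> (F \<omega>)"
proof -
  have [measurable]: "F \<in> borel_measurable M" by (rule square_integrableD(1)[OF D12_square_integrable[OF F]])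
  let ?S = "vimage_algebra (space M) F borel"
  have sub: "subalgebra M ?S" by (auto simp: subalgebra_def sets_vimage_algebra2)
  interpret S: finite_measure_subalgebra M ?S by unfold_locales (rule sub)
  note ig = g_rv_integrable[OF F mean]
  have "AE \<omega> in M. real_cond_exp M ?S (g_rv M W F) \<omega> = \<tau> (F \<omega>)"
  proof (rule S.real_cond_exp_charact)
    show "(\<lambda>\<omega>. \<tau> (F \<omega>)) \<in> borel_measurable ?S"
      by (rule measurable_compose[OF measurable_vimage_algebra1 \<tau>(1)]) auto
    show "(LINT \<omega>:A|M. g_rv M W F \<omega>) = (LINT \<omega>:A|M. \<tau> (F \<omega>))" if A: "A \<in> sets ?S" for A
    proof -
      obtain B where B: "B \<in> sets borel" "A = F -` B \<inter> space M" using A by (auto simp: sets_vimage_algebra2)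
      have s: "(LINT \<omega>:A|M. f \<omega>) = (\<integral>\<omega>. indicator B (F \<omega>) * f \<omega> \<partial>M)" for f :: "'a \<Rightarrow> real"
        unfolding set_lebesgue_integral_def B(2)
        by (intro Bochner_Integration.integral_cong) (auto simp: indicator_def)
      show ?thesis unfolding s g_rv_tail_mean[OF F mean B(1)] eq[OF B(1)] ..
    qed
  qed (fact ig \<tau>(2))+
  moreover have "AE \<omega> in M. real_cond_exp M ?S (g_rv M W F) \<omega> = g_rv M W F \<omega>"
    by (rule S.real_cond_exp_F_meas[OF ig g_rv_sigma_measurable])
  ultimately show ?thesis by eventually_elim simp
qed

text \<open>The event \<open>{g\<^sub>F < 0}\<close> has the form \<open>{F \<in> B}\<close>, and the integral of \<open>g\<^sub>F\<close> over it is that of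
  \<open>tail_mean F\<close> over \<open>B\<close>.\<close>

lemma g_rv_nonneg:
  assumes F: "F \<in> D12 M W" and mean: "(\<integral>\<omega>. F \<omega> \<partial>M) = 0"
  shows "AE \<omega> in M. 0 \<le> g_rv M W F \<omega>"
proof -
  note sF = D12_square_integrable[OF F]
  have [measurable]: "F \<in> borel_measurable M" by (rule square_integrableD(1)[OF sF])
  note ig = g_rv_integrable[OF F mean]
  have [measurable]: "g_rv M W F \<in> borel_measurable M" using ig by auto
  have "{\<omega> \<in> space (vimage_algebra (space M) F borel). g_rv M W F \<omega> < 0} \<in> sets (vimage_algebra (space M) F borel)"
    using g_rv_sigma_measurable[of F] by measurable
  then obtain B where B: "B \<in> sets borel" "{\<omega> \<in> space M. g_rv M W F \<omega> < 0} = F -` B \<inter> space M"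
    by (auto simp: sets_vimage_algebra2)
  have [measurable]: "B \<in> sets borel" by fact
  have mem: "F \<omega> \<in> B \<longleftrightarrow> g_rv M W F \<omega> < 0" if "\<omega> \<in> space M" for \<omega> using B(2) that by auto
  have i: "integrable M (\<lambda>\<omega>. - (indicator B (F \<omega>) * g_rv M W F \<omega>))"
    by (rule Bochner_Integration.integrable_bound[OF ig]) (auto simp: indicator_def)
  have nn: "AE \<omega> in M. 0 \<le> - (indicator B (F \<omega>) * g_rv M W F \<omega>)"
    using mem by (intro AE_I2) (auto simp: indicator_def)
  have "0 \<le> (\<integral>z. tail_mean F z * indicator B z \<partial>lborel)"
    using tail_mean_nonneg[OF square_integrable_integrable[OF sF] mean]
    by (intro Bochner_Integration.integral_nonneg) auto
  then have "(\<integral>\<omega>. - (indicator B (F \<omega>) * g_rv M W F \<omega>) \<partial>M) \<le> 0"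
    using g_rv_tail_mean[OF F mean B(1)] by simp
  moreover have "0 \<le> (\<integral>\<omega>. - (indicator B (F \<omega>) * g_rv M W F \<omega>) \<partial>M)" by (rule integral_nonneg_AE[OF nn])
  ultimately have "(\<integral>\<omega>. - (indicator B (F \<omega>) * g_rv M W F \<omega>) \<partial>M) = 0" by linarith
  then have "AE \<omega> in M. - (indicator B (F \<omega>) * g_rv M W F \<omega>) = 0"
    using integral_nonneg_eq_0_iff_AE[OF i nn] by simp
  then show ?thesis using AE_space
  proof eventually_elim
    case (elim \<omega>)
    then show ?case using mem[of \<omega>] by (auto simp: indicator_def split: if_splits)
  qed
qed

end

text \<open>For nonnegative \<open>g\<close> and \<open>R\<close> the integral identity for indicators is one between measures,
  and so extends to all measurable test functions.\<close>

lemma (in prob_space) kernel_measure_eq: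
  fixes F g :: "'a \<Rightarrow> real" and R :: "real \<Rightarrow> real"
  assumes [measurable]: "F \<in> borel_measurable M" and g: "integrable M g" "AE \<omega> in M. 0 \<le> g \<omega>"
    and R: "integrable lborel R" "\<And>z. 0 \<le> R z"
    and eq: "\<And>B. B \<in> sets borel \<Longrightarrow> (\<integral>\<omega>. indicator B (F \<omega>) * g \<omega> \<partial>M) = (\<integral>z. R z * indicator B z \<partial>lborel)"
  shows "distr (density M g) borel F = density lborel R"
proof (rule measure_eqI)
  have [measurable]: "g \<in> borel_measurable M" "R \<in> borel_measurable borel" using g R by auto
  fix B assume "B \<in> sets (distr (density M g) borel F)"
  then have [measurable]: "B \<in> sets borel" by simp
  have ig: "integrable M (\<lambda>\<omega>. indicator B (F \<omega>) * g \<omega>)"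
    by (rule Bochner_Integration.integrable_bound[OF g(1)]) (auto simp: indicator_def)
  have iR: "integrable lborel (\<lambda>z. R z * indicator B z)"
    by (rule Bochner_Integration.integrable_bound[OF R(1)]) (auto simp: indicator_def)
  have "emeasure (distr (density M g) borel F) B = (\<integral>\<^sup>+\<omega>. ennreal (g \<omega>) * indicator (F -` B \<inter> space M) \<omega> \<partial>M)"
    by (subst emeasure_distr) (auto simp: emeasure_density)
  also have "\<dots> = (\<integral>\<^sup>+\<omega>. ennreal (indicator B (F \<omega>) * g \<omega>) \<partial>M)"
    by (intro nn_integral_cong) (auto simp: indicator_def)
  also have "\<dots> = ennreal (\<integral>\<omega>. indicator B (F \<omega>) * g \<omega> \<partial>M)"
    using g(2) by (intro nn_integral_eq_integral ig) (auto simp: indicator_def)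
  also have "\<dots> = ennreal (\<integral>z. R z * indicator B z \<partial>lborel)" by (simp add: eq)
  also have "\<dots> = (\<integral>\<^sup>+z. ennreal (R z * indicator B z) \<partial>lborel)"
    using R(2) by (intro nn_integral_eq_integral[symmetric] iR) (auto simp: indicator_def)
  also have "\<dots> = (\<integral>\<^sup>+z. ennreal (R z) * indicator B z \<partial>lborel)"
    by (intro nn_integral_cong) (auto simp: indicator_def)
  also have "\<dots> = emeasure (density lborel R) B" by (subst emeasure_density) auto
  finally show "emeasure (distr (density M g) borel F) B = emeasure (density lborel R) B" .
qed simp

lemma (in prob_space) kernel_integral_eq:
  fixes F g :: "'a \<Rightarrow> real" and R :: "real \<Rightarrow> real"
  assumes [measurable]: "F \<in> borel_measurable M" and g: "integrable M g" "AE \<omega> in M. 0 \<le> g \<omega>"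
    and R: "integrable lborel R" "\<And>z. 0 \<le> R z"
    and eq: "\<And>B. B \<in> sets borel \<Longrightarrow> (\<integral>\<omega>. indicator B (F \<omega>) * g \<omega> \<partial>M) = (\<integral>z. R z * indicator B z \<partial>lborel)"
    and [measurable]: "\<psi> \<in> borel_measurable borel"
  shows "(\<integral>\<omega>. g \<omega> * \<psi> (F \<omega>) \<partial>M) = (\<integral>z. R z * \<psi> z \<partial>lborel)"
proof -
  have [measurable]: "g \<in> borel_measurable M" "R \<in> borel_measurable borel" using g R by auto
  have m: "distr (density M g) borel F = density lborel R"
    by (rule kernel_measure_eq[OF assms(1) g R]) (rule eq)
  have "(\<integral>\<omega>. g \<omega> * \<psi> (F \<omega>) \<partial>M) = (\<integral>\<omega>. \<psi> (F \<omega>) \<partial>density M g)"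
    using g(2) by (subst integral_real_density) auto
  also have "\<dots> = (\<integral>z. \<psi> z \<partial>distr (density M g) borel F)" by (subst integral_distr) auto
  also have "\<dots> = (\<integral>z. R z * \<psi> z \<partial>lborel)"
    unfolding m using R(2) by (subst integral_real_density) auto
  finally show ?thesis .
qed

section \<open>Uniqueness of the law with a given Stein kernel\<close>

text \<open>The fundamental theorem of calculus, for increments given by Lebesgue integrals over
  half-open intervals.\<close>

lemma derivative_of_increments:
  fixes R h :: "real \<Rightarrow> real"
  assumes I: "open I" and h: "continuous_on I h" and x: "x \<in> I"
    and inc: "\<And>a b. {a..b} \<subseteq> I \<Longrightarrow> a \<le> b \<Longrightarrow> R a - R b = (\<integral>y. indicator {a<..b} y * h y \<partial>lborel)"
  shows "(R has_real_derivative - h x) (at x)"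
proof -
  obtain e where e: "e > 0" "cball x e \<subseteq> I" using open_contains_cball_eq[OF I] x by auto
  define c d where "c = x - e" and "d = x + e"
  have cd: "c < x" "x < d" and sub: "{c..d} \<subseteq> I"
    using e by (auto simp: c_def d_def cball_eq_atLeastAtMost)
  have hc: "continuous_on {c..d} h" by (rule continuous_on_subset[OF h sub])
  have R: "R y = R c - integral {c..y} h" if y: "y \<in> {c..d}" for y
  proof -
    have s: "{c..y} \<subseteq> {c..d}" using y by auto
    have hy: "continuous_on {c..y} h" by (rule continuous_on_subset[OF hc s])
    have "R c - R y = (\<integral>y'. indicator {c<..y} y' * h y' \<partial>lborel)"
      by (rule inc) (use s sub y in auto)
    also have "\<dots> = (LINT y':{c..y}|lborel. h y')"
      unfolding set_lebesgue_integral_def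
    proof (rule integral_cong_AE)
      show "AE y' in lborel. indicator {c<..y} y' * h y' = indicator {c..y} y' *\<^sub>R h y'"
        using AE_lborel_singleton[of c] by eventually_elim (auto simp: indicator_def)
      have m: "(\<lambda>y'. indicator {c..y} y' *\<^sub>R h y') \<in> borel_measurable borel"
        using borel_measurable_continuous_on_indicator[OF _ hy] by simp
      then show "(\<lambda>y'. indicator {c..y} y' *\<^sub>R h y') \<in> borel_measurable lborel" by simp
      have "(\<lambda>y'. indicator {c<..y} y' * (indicator {c..y} y' *\<^sub>R h y')) \<in> borel_measurable borel"
        using m by measurable
      also have "(\<lambda>y'. indicator {c<..y} y' * (indicator {c..y} y' *\<^sub>R h y')) = (\<lambda>y'. indicator {c<..y} y' * h y')"
        by (auto simp: indicator_def fun_eq_iff)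
      finally show "(\<lambda>y'. indicator {c<..y} y' * h y') \<in> borel_measurable lborel" by simp
    qed
    also have "\<dots> = integral {c..y} h"
      by (rule set_borel_integral_eq_integral(2)[OF borel_integrable_atLeastAtMost'[OF hy]])
    finally show ?thesis by simp
  qed
  have "((\<lambda>y. integral {c..y} h) has_real_derivative h x) (at x within {c..d})"
    by (rule integral_has_real_derivative[OF hc]) (use cd in auto)
  then have "((\<lambda>y. integral {c..y} h) has_real_derivative h x) (at x)"
    using at_within_Icc_at[OF cd] by simp
  from DERIV_diff[OF DERIV_const[of "R c"] this]
  have "((\<lambda>y. R c - integral {c..y} h) has_real_derivative - h x) (at x)" by simp
  then show ?thesis
  proof (rule has_field_derivative_transform_within_open)
    show "open {c<..<d}" by simp
    show "x \<in> {c<..<d}" using cd by simp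
    show "R c - integral {c..y} h = R y" if "y \<in> {c<..<d}" for y
      by (rule R[symmetric]) (use that in simp)
  qed
qed

text \<open>Supplies the continuity of the integrand that the fundamental theorem asks for: a bounded
  \<open>R\<close> with these increments is locally Lipschitz.\<close>

lemma continuous_of_increments:
  fixes R q :: "real \<Rightarrow> real"
  assumes I: "open I" and q: "continuous_on I q" and bd: "\<And>y. \<bar>R y\<bar> \<le> m"
    and inc: "\<And>a b. {a..b} \<subseteq> I \<Longrightarrow> a \<le> b \<Longrightarrow> R a - R b = (\<integral>y. indicator {a<..b} y * (R y * q y) \<partial>lborel)"
  shows "continuous_on I R"
  unfolding continuous_on_eq_continuous_at[OF I]
proof
  fix x assume x: "x \<in> I"
  obtain e where e: "e > 0" "cball x e \<subseteq> I" using open_contains_cball_eq[OF I] x by auto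
  have qc: "continuous_on (cball x e) q" by (rule continuous_on_subset[OF q e(2)])
  obtain K where K: "\<And>y. y \<in> cball x e \<Longrightarrow> \<bar>q y\<bar> \<le> K"
  proof -
    have "bounded (q ` cball x e)" by (rule compact_imp_bounded[OF compact_continuous_image[OF qc compact_cball]])
    then obtain K where "\<And>z. z \<in> q ` cball x e \<Longrightarrow> norm z \<le> K" unfolding bounded_iff by blast
    then have "\<bar>q y\<bar> \<le> K" if "y \<in> cball x e" for y using that by auto
    then show ?thesis by (rule that)
  qed
  have m0: "m \<ge> 0" using bd[of 0] by simp
  have K0: "K \<ge> 0" using K[of x] e(1) by simp
  have inc_le: "\<bar>R a - R b\<bar> \<le> m * K * (b - a)" if ab: "a \<in> cball x e" "b \<in> cball x e" "a \<le> b" for a b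
  proof -
    have sub: "{a..b} \<subseteq> cball x e" using ab by (auto simp: cball_eq_atLeastAtMost)
    have "\<bar>R a - R b\<bar> = \<bar>\<integral>y. indicator {a<..b} y * (R y * q y) \<partial>lborel\<bar>"
      using inc[OF order_trans[OF sub e(2)] ab(3)] by simp
    also have "\<dots> \<le> (\<integral>y. \<bar>indicator {a<..b} y * (R y * q y)\<bar> \<partial>lborel)" by (rule integral_abs_bound)
    also have "\<dots> \<le> (\<integral>y. (m * K) * indicator {a<..b} y \<partial>lborel)"
    proof (rule integral_mono')
      have "integrable lborel (indicator {a<..b} :: real \<Rightarrow> real)"
        by (rule integrable_real_indicator) (use ab(3) in auto)
      then show "integrable lborel (\<lambda>y. (m * K) * indicator {a<..b} y)" by (rule integrable_mult_right)
      show "0 \<le> (m * K) * indicator {a<..b} y" for y using m0 K0 by (auto simp: indicator_def)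
      show "\<bar>indicator {a<..b} y * (R y * q y)\<bar> \<le> (m * K) * indicator {a<..b} y" for y
      proof (cases "y \<in> {a<..b}")
        case True
        then have "y \<in> {a..b}" by auto
        then have "y \<in> cball x e" using sub by blast
        then have "\<bar>R y\<bar> * \<bar>q y\<bar> \<le> m * K" using bd[of y] K[of y] m0 by (intro mult_mono) auto
        then show ?thesis using True by (simp add: abs_mult)
      qed simp
    qed
    also have "\<dots> = m * K * (b - a)" using ab(3) by simp
    finally show ?thesis .
  qed
  have "(m * K)-lipschitz_on (cball x e) R"
  proof (rule lipschitz_onI)
    fix a b assume ab: "a \<in> cball x e" "b \<in> cball x e"
    show "dist (R a) (R b) \<le> m * K * dist a b"
      using inc_le[OF ab] inc_le[OF ab(2,1)] by (cases "a \<le> b") (auto simp: dist_real_def abs_minus_commute)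
  qed (use m0 K0 in simp)
  then have "continuous_on (cball x e) R" by (rule lipschitz_on_continuous_on)
  then show "isCont R x" by (rule continuous_on_interior) (use e(1) in \<open>simp add: interior_cball\<close>)
qed

text \<open>The quotient \<open>R / S\<close> has derivative zero.\<close>

lemma linear_ODE_unique:
  fixes R S q :: "real \<Rightarrow> real"
  assumes I: "open I" "convex I"
    and R: "\<And>x. x \<in> I \<Longrightarrow> (R has_real_derivative - (R x * q x)) (at x)"
    and S: "\<And>x. x \<in> I \<Longrightarrow> (S has_real_derivative - (S x * q x)) (at x)" "\<And>x. x \<in> I \<Longrightarrow> S x > 0"
  obtains C where "\<And>x. x \<in> I \<Longrightarrow> R x = C * S x"
proof -
  have "((\<lambda>x. R x / S x) has_real_derivative 0) (at x within I)" if x: "x \<in> I" for x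
  proof -
    have "((\<lambda>x. R x / S x) has_real_derivative (- (R x * q x) * S x - R x * - (S x * q x)) / (S x * S x)) (at x)"
      by (rule DERIV_divide[OF R[OF x] S(1)[OF x]]) (use S(2)[OF x] in simp)
    moreover have "(- (R x * q x) * S x - R x * - (S x * q x)) / (S x * S x) = 0" by (simp add: algebra_simps)
    ultimately have "((\<lambda>x. R x / S x) has_real_derivative 0) (at x)" by simp
    then show ?thesis by (rule DERIV_subset) simp
  qed
  then have "\<exists>C. \<forall>x\<in>I. R x / S x = C"
    by (rule has_field_derivative_zero_constant[OF I(2)])
  then obtain C where C: "\<And>x. x \<in> I \<Longrightarrow> R x / S x = C" by blast
  show thesis
  proof (rule that)
    fix x assume x: "x \<in> I"
    show "R x = C * S x" unfolding C[OF x, symmetric] using S(2)[OF x] by simp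
  qed
qed

lemma convex_einterval: "convex (einterval l u)"
  unfolding is_interval_convex_1[symmetric] is_interval_1
  by (auto simp: einterval_iff) (meson ereal_less_eq(3) le_less_trans less_le_trans)+

context prob_space begin

text \<open>\<open>tail_mean X\<close> is right continuous and may jump at an atom. At an upper endpoint \<open>c > 0\<close>
  the limit from the left therefore includes the atom, while at a lower endpoint \<open>c < 0\<close> the
  limit from the right is the value at \<open>c\<close>. The sequence \<open>c - c / (n + 2)\<close> approaches \<open>c\<close>
  strictly from the side of \<open>0\<close> in both cases.\<close>

lemma tail_mean_tendsto_upper:
  fixes c :: real
  assumes X: "integrable M X" and c: "c > 0"
  shows "(\<lambda>n. tail_mean X (c - c / (real n + 2))) \<longlonglongrightarrow> (\<integral>\<omega>. (if c \<le> X \<omega> then X \<omega> else 0) \<partial>M)"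
  unfolding tail_mean_def
proof (rule integral_dominated_convergence[where w = "\<lambda>\<omega>. \<bar>X \<omega>\<bar>"])
  have [measurable]: "X \<in> borel_measurable M" using X by auto
  show "integrable M (\<lambda>\<omega>. \<bar>X \<omega>\<bar>)" using X by auto
  show "(\<lambda>\<omega>. if c \<le> X \<omega> then X \<omega> else 0) \<in> borel_measurable M" by measurable
  show "(\<lambda>\<omega>. if c - c / (real n + 2) < X \<omega> then X \<omega> else 0) \<in> borel_measurable M" for n by measurable
  have lim: "(\<lambda>n. c - c / (real n + 2)) \<longlonglongrightarrow> c" by real_asymp
  show "AE \<omega> in M. (\<lambda>n. if c - c / (real n + 2) < X \<omega> then X \<omega> else 0) \<longlonglongrightarrow> (if c \<le> X \<omega> then X \<omega> else 0)"
  proof (rule AE_I2)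
    fix \<omega>
    show "(\<lambda>n. if c - c / (real n + 2) < X \<omega> then X \<omega> else 0) \<longlonglongrightarrow> (if c \<le> X \<omega> then X \<omega> else 0)"
    proof (cases "c \<le> X \<omega>")
      case True
      have "c - c / (real n + 2) < X \<omega>" for n
      proof -
        have "c / (real n + 2) > 0" using c by simp
        then show ?thesis using True by linarith
      qed
      then show ?thesis using True by simp
    next
      case False
      then have "\<forall>\<^sub>F n in sequentially. c - c / (real n + 2) > X \<omega>" using order_tendstoD(1)[OF lim] by simp
      then have "\<forall>\<^sub>F n in sequentially. (if c - c / (real n + 2) < X \<omega> then X \<omega> else 0) = (if c \<le> X \<omega> then X \<omega> else 0)"
        by eventually_elim (use False in auto)
      then show ?thesis by (rule tendsto_eventually)
    qed
  qed
qed auto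

lemma tail_mean_tendsto_lower:
  fixes c :: real
  assumes X: "integrable M X" and c: "c < 0"
  shows "(\<lambda>n. tail_mean X (c - c / (real n + 2))) \<longlonglongrightarrow> tail_mean X c"
  unfolding tail_mean_def
proof (rule integral_dominated_convergence[where w = "\<lambda>\<omega>. \<bar>X \<omega>\<bar>"])
  have [measurable]: "X \<in> borel_measurable M" using X by auto
  show "integrable M (\<lambda>\<omega>. \<bar>X \<omega>\<bar>)" using X by auto
  show "(\<lambda>\<omega>. if c < X \<omega> then X \<omega> else 0) \<in> borel_measurable M" by measurable
  show "(\<lambda>\<omega>. if c - c / (real n + 2) < X \<omega> then X \<omega> else 0) \<in> borel_measurable M" for n by measurable
  have lim: "(\<lambda>n. c - c / (real n + 2)) \<longlonglongrightarrow> c" by real_asymp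
  show "AE \<omega> in M. (\<lambda>n. if c - c / (real n + 2) < X \<omega> then X \<omega> else 0) \<longlonglongrightarrow> (if c < X \<omega> then X \<omega> else 0)"
  proof (rule AE_I2)
    fix \<omega>
    show "(\<lambda>n. if c - c / (real n + 2) < X \<omega> then X \<omega> else 0) \<longlonglongrightarrow> (if c < X \<omega> then X \<omega> else 0)"
    proof (cases "c < X \<omega>")
      case False
      have "\<not> c - c / (real n + 2) < X \<omega>" for n
      proof -
        have "c / (real n + 2) < 0" using c by (simp add: divide_neg_pos)
        then show ?thesis using False by linarith
      qed
      then show ?thesis using False by simp
    next
      case True
      then have "\<forall>\<^sub>F n in sequentially. c - c / (real n + 2) < X \<omega>" using order_tendstoD(2)[OF lim] by simp
      then have "\<forall>\<^sub>F n in sequentially. (if c - c / (real n + 2) < X \<omega> then X \<omega> else 0) = (if c < X \<omega> then X \<omega> else 0)"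
        by eventually_elim (use True in auto)
      then show ?thesis by (rule tendsto_eventually)
    qed
  qed
qed auto

text \<open>With \<open>R = tail_mean X\<close> the hypothesis says that the law of \<open>X\<close> has density \<open>R / g\<close> on
  \<open>(l, u)\<close>, so the increments of \<open>R\<close> are those of a solution of \<open>R' = - y R / g\<close>.\<close>

lemma tail_mean_ODE:
  assumes X: "square_integrable M X" and mean: "(\<integral>\<omega>. X \<omega> \<partial>M) = 0"
    and g: "g \<in> borel_measurable borel" "\<And>z. z \<in> einterval l u \<Longrightarrow> 0 < g z" "\<And>z. 0 \<le> g z" "continuous_on (einterval l u) g"
    and gi: "integrable M (\<lambda>\<omega>. g (X \<omega>))" and Ri: "integrable lborel (tail_mean X)"
    and eq: "\<And>B. B \<in> sets borel \<Longrightarrow> (\<integral>\<omega>. indicator B (X \<omega>) * g (X \<omega>) \<partial>M) = (\<integral>z. tail_mean X z * indicator B z \<partial>lborel)"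
    and x: "x \<in> einterval l u"
  shows "(tail_mean X has_real_derivative - (tail_mean X x * (x / g x))) (at x)"
proof -
  have [measurable]: "X \<in> borel_measurable M" by (rule square_integrableD(1)[OF X])
  note [measurable] = g(1)
  have one: "square_integrable M (\<lambda>_. 1::real)" by (simp add: square_integrable_def)
  have Xi: "integrable M X" using integrable_mult_L2[OF X one] by simp
  have ke: "(\<integral>\<omega>. g (X \<omega>) * \<psi> (X \<omega>) \<partial>M) = (\<integral>z. tail_mean X z * \<psi> z \<partial>lborel)" if "\<psi> \<in> borel_measurable borel" for \<psi>
    by (rule kernel_integral_eq[OF _ gi _ Ri tail_mean_nonneg[OF Xi mean] eq that]) (use g(3) in auto)
  let ?q = "\<lambda>y. y / g y"
  have inc: "tail_mean X a - tail_mean X b = (\<integral>y. indicator {a<..b} y * (tail_mean X y * ?q y) \<partial>lborel)"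
    if ab: "{a..b} \<subseteq> einterval l u" "a \<le> b" for a b
  proof -
    have "tail_mean X a - tail_mean X b = (\<integral>\<omega>. (if X \<omega> \<in> {a<..b} then X \<omega> else 0) \<partial>M)"
      by (rule tail_mean_diff[OF Xi ab(2)])
    also have "\<dots> = (\<integral>\<omega>. g (X \<omega>) * (indicator {a<..b} (X \<omega>) * ?q (X \<omega>)) \<partial>M)"
    proof (intro Bochner_Integration.integral_cong refl)
      fix \<omega>
      show "(if X \<omega> \<in> {a<..b} then X \<omega> else 0) = g (X \<omega>) * (indicator {a<..b} (X \<omega>) * ?q (X \<omega>))"
      proof (cases "X \<omega> \<in> {a<..b}")
        case True
        then have "X \<omega> \<in> einterval l u" using ab(1) by auto
        from g(2)[OF this] True show ?thesis by simp
      qed (auto simp: indicator_def)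
    qed
    also have "\<dots> = (\<integral>y. tail_mean X y * (indicator {a<..b} y * ?q y) \<partial>lborel)"
      by (rule ke) measurable
    finally show ?thesis by (simp add: mult_ac)
  qed
  have qc: "continuous_on (einterval l u) ?q"
    using g(2,4) by (intro continuous_on_divide continuous_on_id) (auto simp: less_imp_neq[THEN not_sym])
  have Rc: "continuous_on (einterval l u) (tail_mean X)"
    by (rule continuous_of_increments[OF _ qc tail_mean_bounded[OF Xi] inc]) auto
  have "continuous_on (einterval l u) (\<lambda>y. tail_mean X y * ?q y)" by (intro continuous_on_mult Rc qc)
  from derivative_of_increments[OF _ this x inc] show ?thesis by simp
qed

text \<open>Both tail means solve the same linear equation on \<open>(l, u)\<close>, hence are proportional. Their
  limits at a finite endpoint vanish for \<open>Z\<close>, hence for \<open>X\<close>, so \<open>X\<close> has no mass outside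
  \<open>(l, u)\<close>. The laws are recovered by dividing by \<open>g\<close>, so they are proportional as well, and the
  factor is 1.\<close>

lemma law_unique_of_kernel:
  assumes X: "square_integrable M X" "(\<integral>\<omega>. X \<omega> \<partial>M) = 0" and Z: "square_integrable M Z" "(\<integral>\<omega>. Z \<omega> \<partial>M) = 0"
    and lu: "l < 0" "0 < u"
    and g: "g \<in> borel_measurable borel" "\<And>z. z \<in> einterval l u \<Longrightarrow> 0 < g z" "\<And>z. 0 \<le> g z" "continuous_on (einterval l u) g"
    and gX: "integrable M (\<lambda>\<omega>. g (X \<omega>))" and RX: "integrable lborel (tail_mean X)"
    and eqX: "\<And>B. B \<in> sets borel \<Longrightarrow> (\<integral>\<omega>. indicator B (X \<omega>) * g (X \<omega>) \<partial>M) = (\<integral>z. tail_mean X z * indicator B z \<partial>lborel)"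
    and gZ: "integrable M (\<lambda>\<omega>. g (Z \<omega>))" and RZ: "integrable lborel (tail_mean Z)"
    and eqZ: "\<And>B. B \<in> sets borel \<Longrightarrow> (\<integral>\<omega>. indicator B (Z \<omega>) * g (Z \<omega>) \<partial>M) = (\<integral>z. tail_mean Z z * indicator B z \<partial>lborel)"
    and Zpos: "\<And>z. z \<in> einterval l u \<Longrightarrow> 0 < tail_mean Z z" and ZI: "AE \<omega> in M. Z \<omega> \<in> einterval l u"
  shows "distr M borel X = distr M borel Z"
proof -
  let ?I = "einterval l u"
  have [measurable]: "X \<in> borel_measurable M" "Z \<in> borel_measurable M"
    by (rule square_integrableD(1)[OF X(1)], rule square_integrableD(1)[OF Z(1)])
  note [measurable] = g(1)
  have one: "square_integrable M (\<lambda>_. 1::real)" by (simp add: square_integrable_def)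
  have Xi: "integrable M X" and Zi: "integrable M Z"
    using integrable_mult_L2[OF X(1) one] integrable_mult_L2[OF Z(1) one] by simp_all
  have dX: "(tail_mean X has_real_derivative - (tail_mean X x * (x / g x))) (at x)" if "x \<in> ?I" for x
    by (rule tail_mean_ODE[OF X g gX RX eqX that])
  have dZ: "(tail_mean Z has_real_derivative - (tail_mean Z x * (x / g x))) (at x)" if "x \<in> ?I" for x
    by (rule tail_mean_ODE[OF Z g gZ RZ eqZ that])
  obtain C where C: "\<And>x. x \<in> ?I \<Longrightarrow> tail_mean X x = C * tail_mean Z x"
    using linear_ODE_unique[OF open_einterval convex_einterval dX dZ Zpos] by blast
  have upper: "AE \<omega> in M. ereal (X \<omega>) < u"
  proof (cases u)
    case (real c)
    then have c: "c > 0" using lu by simp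
    have inI: "c - c / (real n + 2) \<in> ?I" for n
    proof -
      have "c / (real n + 2) \<le> c / 2" using c by (intro divide_left_mono) auto
      moreover have "0 < c / (real n + 2)" using c by simp
      ultimately have "0 < c - c / (real n + 2)" "c - c / (real n + 2) < c" using c by linarith+
      moreover have "l < ereal (c - c / (real n + 2))"
        using lu(1) calculation(1) by (intro less_trans[OF lu(1)]) (simp add: zero_ereal_def)
      ultimately show ?thesis using real by (simp add: einterval_iff)
    qed
    have "(\<lambda>n. tail_mean X (c - c / (real n + 2))) \<longlonglongrightarrow> C * (\<integral>\<omega>. (if c \<le> Z \<omega> then Z \<omega> else 0) \<partial>M)"
      unfolding C[OF inI] by (intro tendsto_mult tendsto_const tail_mean_tendsto_upper[OF Zi c])
    moreover have "(\<integral>\<omega>. (if c \<le> Z \<omega> then Z \<omega> else 0) \<partial>M) = 0"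
    proof (rule integral_eq_zero_AE)
      show "AE \<omega> in M. (if c \<le> Z \<omega> then Z \<omega> else 0) = 0"
        using ZI by eventually_elim (auto simp: einterval_iff real)
    qed
    ultimately have z: "(\<integral>\<omega>. (if c \<le> X \<omega> then X \<omega> else 0) \<partial>M) = 0"
      using LIMSEQ_unique[OF tail_mean_tendsto_upper[OF Xi c]] by simp
    have i: "integrable M (\<lambda>\<omega>. if c \<le> X \<omega> then X \<omega> else 0)" using integrable_tail[OF Xi, of "{c..}"] by simp
    have "AE \<omega> in M. (if c \<le> X \<omega> then X \<omega> else 0) = 0"
      using integral_nonneg_eq_0_iff_AE[OF i] z c by auto
    then show ?thesis by eventually_elim (use c in \<open>auto simp: real split: if_splits\<close>)
  qed (use lu in auto)
  have lower: "AE \<omega> in M. l < ereal (X \<omega>)"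
  proof (cases l)
    case (real c)
    then have c: "c < 0" using lu by simp
    have inI: "c - c / (real n + 2) \<in> ?I" for n
    proof -
      have "c / 2 \<le> c / (real n + 2)" using c by (intro divide_left_mono_neg) auto
      moreover have "c / (real n + 2) < 0" using c by (simp add: divide_neg_pos)
      ultimately have "c < c - c / (real n + 2)" "c - c / (real n + 2) < 0" using c by linarith+
      moreover have "ereal (c - c / (real n + 2)) < u"
        using lu(2) calculation(2) by (intro less_trans[OF _ lu(2)]) (simp add: zero_ereal_def)
      ultimately show ?thesis using real by (simp add: einterval_iff)
    qed
    have "(\<lambda>n. tail_mean X (c - c / (real n + 2))) \<longlonglongrightarrow> C * tail_mean Z c"
      unfolding C[OF inI] by (intro tendsto_mult tendsto_const tail_mean_tendsto_lower[OF Zi c])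
    moreover have "tail_mean Z c = 0"
      unfolding tail_mean_alt[OF Zi Z(2)]
    proof (rule integral_eq_zero_AE)
      show "AE \<omega> in M. (if Z \<omega> \<le> c then - Z \<omega> else 0) = 0"
        using ZI by eventually_elim (auto simp: einterval_iff real)
    qed
    ultimately have "tail_mean X c = 0"
      using LIMSEQ_unique[OF tail_mean_tendsto_lower[OF Xi c]] by simp
    then have z: "(\<integral>\<omega>. (if X \<omega> \<le> c then - X \<omega> else 0) \<partial>M) = 0" by (simp only: tail_mean_alt[OF Xi X(2)])
    have i: "integrable M (\<lambda>\<omega>. if X \<omega> \<le> c then - X \<omega> else 0)"
      by (rule Bochner_Integration.integrable_bound[OF Xi]) auto
    have "AE \<omega> in M. (if X \<omega> \<le> c then - X \<omega> else 0) = 0"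
      using integral_nonneg_eq_0_iff_AE[OF i] z c by auto
    then show ?thesis by eventually_elim (use c in \<open>auto simp: real split: if_splits\<close>)
  qed (use lu in auto)
  have XI: "AE \<omega> in M. X \<omega> \<in> ?I" using upper lower by eventually_elim (simp add: einterval_iff)
  have keX: "(\<integral>\<omega>. g (X \<omega>) * \<psi> (X \<omega>) \<partial>M) = (\<integral>z. tail_mean X z * \<psi> z \<partial>lborel)" if "\<psi> \<in> borel_measurable borel" for \<psi>
    by (rule kernel_integral_eq[OF _ gX _ RX tail_mean_nonneg[OF Xi X(2)] eqX that]) (use g(3) in auto)
  have keZ: "(\<integral>\<omega>. g (Z \<omega>) * \<psi> (Z \<omega>) \<partial>M) = (\<integral>z. tail_mean Z z * \<psi> z \<partial>lborel)" if "\<psi> \<in> borel_measurable borel" for \<psi>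
    by (rule kernel_integral_eq[OF _ gZ _ RZ tail_mean_nonneg[OF Zi Z(2)] eqZ that]) (use g(3) in auto)
  have I: "?I \<in> sets borel" by (intro borel_open open_einterval)
  have law: "(\<integral>\<omega>. indicator B (X \<omega>) \<partial>M) = C * (\<integral>\<omega>. indicator B (Z \<omega>) \<partial>M)" if B: "B \<in> sets borel" for B
  proof -
    have [measurable]: "B \<in> sets borel" "?I \<in> sets borel" by fact+
    let ?\<psi> = "\<lambda>z. indicator B z * indicator ?I z / g z :: real"
    have "(\<integral>\<omega>. indicator B (X \<omega>) \<partial>M) = (\<integral>\<omega>. g (X \<omega>) * ?\<psi> (X \<omega>) \<partial>M)"
    proof (rule integral_cong_AE)
      show "AE \<omega> in M. indicator B (X \<omega>) = g (X \<omega>) * ?\<psi> (X \<omega>)"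
        using XI by eventually_elim (use g(2) in \<open>auto simp: indicator_def less_imp_neq[THEN not_sym]\<close>)
    qed measurable
    also have "\<dots> = (\<integral>z. tail_mean X z * ?\<psi> z \<partial>lborel)" by (rule keX) measurable
    also have "\<dots> = (\<integral>z. C * (tail_mean Z z * ?\<psi> z) \<partial>lborel)"
      by (intro Bochner_Integration.integral_cong refl) (auto simp: indicator_def C)
    also have "\<dots> = C * (\<integral>z. tail_mean Z z * ?\<psi> z \<partial>lborel)"
      by (rule Bochner_Integration.integral_mult_right_zero)
    also have "(\<integral>z. tail_mean Z z * ?\<psi> z \<partial>lborel) = (\<integral>\<omega>. g (Z \<omega>) * ?\<psi> (Z \<omega>) \<partial>M)"
      by (rule keZ[symmetric]) measurable
    also have "(\<integral>\<omega>. g (Z \<omega>) * ?\<psi> (Z \<omega>) \<partial>M) = (\<integral>\<omega>. indicator B (Z \<omega>) \<partial>M)"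
    proof (rule integral_cong_AE)
      show "AE \<omega> in M. g (Z \<omega>) * ?\<psi> (Z \<omega>) = indicator B (Z \<omega>)"
        using ZI by eventually_elim (use g(2) in \<open>auto simp: indicator_def less_imp_neq[THEN not_sym]\<close>)
    qed measurable
    finally show ?thesis .
  qed
  have C1: "C = 1" using law[of UNIV] by (simp add: prob_space)
  show ?thesis
  proof (rule measure_eqI)
    fix B assume "B \<in> sets (distr M borel X)"
    then have B [measurable]: "B \<in> sets borel" by simp
    have m: "measure (distr M borel Y) B = (\<integral>\<omega>. indicator B (Y \<omega>) \<partial>M)" if [measurable]: "Y \<in> borel_measurable M" for Y
    proof -
      have "measure (distr M borel Y) B = (\<integral>x. indicator B x \<partial>distr M borel Y)" by simp
      also have "\<dots> = (\<integral>\<omega>. indicator B (Y \<omega>) \<partial>M)" by (subst integral_distr) auto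
      finally show ?thesis .
    qed
    interpret DX: prob_space "distr M borel X" by (rule prob_space_distr) measurable
    interpret DZ: prob_space "distr M borel Z" by (rule prob_space_distr) measurable
    show "emeasure (distr M borel X) B = emeasure (distr M borel Z) B"
      unfolding DX.emeasure_eq_measure DZ.emeasure_eq_measure using law[OF B] C1 by (simp add: m)
  qed simp
qed

end

section \<open>The function \<open>g\<^sub>*\<close>\<close>

text \<open>The complement of the support is a union of open null sets, hence of countably many of
  them.\<close>

lemma AE_in_measure_support:
  fixes N :: "real measure"
  assumes s: "sets N = sets borel"
  shows "AE x in N. x \<in> measure_support N"
proof -
  let ?F = "{U. open U \<and> emeasure N U = 0}"
  have "\<And>S. S \<in> ?F \<Longrightarrow> open S" by simp
  then obtain F' where F': "F' \<subseteq> ?F" "countable F'" "\<Union>F' = \<Union>?F" by (rule Lindelof)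
  have "U \<in> null_sets N" if "U \<in> F'" for U using F'(1) that s by (auto simp: null_sets_def)
  then have "\<Union>F' \<in> null_sets N" using F'(2) by (intro null_sets_UN'[where N = "\<lambda>U. U", simplified]) auto
  then have "\<Union>?F \<in> null_sets N" unfolding F'(3) .
  then have "AE x in N. x \<notin> \<Union>?F" by (rule AE_not_in)
  then show ?thesis
    by eventually_elim (auto simp: measure_support_def zero_less_iff_neq_zero)
qed

text \<open>The defining integral of \<open>\<rho> g\<^sub>*\<close> is the tail mean of \<open>Z\<close>: inside \<open>(l, u)\<close> because \<open>Z\<close> has
  no mass above \<open>u\<close>, and outside because both sides vanish. The last claim says that \<open>g\<^sub>*\<close> is the
  Stein kernel of \<open>Z\<close>.\<close>

lemma (in prob_space) g_star_facts:
  fixes Z :: "'a \<Rightarrow> real" and l u :: ereal and \<rho> :: "real \<Rightarrow> real"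
  assumes Z: "integrable M Z" and mean: "(\<integral>\<omega>. Z \<omega> \<partial>M) = 0"
    and support: "measure_support (distr M borel Z) = closure (einterval l u)"
    and density: "distributed M lborel Z (\<lambda>x. ennreal (\<rho> x))" "\<And>x. 0 \<le> \<rho> x"
    and cont: "continuous_on (einterval l u) \<rho>"
    and pos: "\<forall>z\<in>einterval l u. 0 < g_star l u \<rho> z"
  shows "AE \<omega> in M. Z \<omega> \<in> einterval l u"
    and "\<And>z. tail_mean Z z = \<rho> z * g_star l u \<rho> z"
    and "\<And>z. z \<in> einterval l u \<Longrightarrow> 0 < tail_mean Z z"
    and "g_star l u \<rho> \<in> borel_measurable borel"
    and "continuous_on (einterval l u) (g_star l u \<rho>)"
    and "\<And>B. B \<in> sets borel \<Longrightarrow>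
      (\<integral>\<omega>. indicator B (Z \<omega>) * g_star l u \<rho> (Z \<omega>) \<partial>M) = (\<integral>z. tail_mean Z z * indicator B z \<partial>lborel)"
proof -
  let ?I = "einterval l u" and ?g = "g_star l u \<rho>"
  have [measurable]: "Z \<in> borel_measurable M" using Z by auto
  have "(\<lambda>x. enn2real (ennreal (\<rho> x))) \<in> borel_measurable borel"
    using distributed_borel_measurable[OF density(1)] by measurable
  then have rm [measurable]: "\<rho> \<in> borel_measurable borel" using density(2) by simp
  have dens: "(\<integral>\<omega>. \<psi> (Z \<omega>) \<partial>M) = (\<integral>x. \<rho> x * \<psi> x \<partial>lborel)" if "\<psi> \<in> borel_measurable borel" for \<psi> :: "real \<Rightarrow> real"
    using distributed_integral[OF density(1), of \<psi>] that density(2) by simp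
  have cl: "closure ?I \<subseteq> {x. l \<le> ereal x \<and> ereal x \<le> u}"
  proof (rule closure_minimal)
    show "?I \<subseteq> {x. l \<le> ereal x \<and> ereal x \<le> u}" by (auto simp: einterval_iff)
    show "closed {x. l \<le> ereal x \<and> ereal x \<le> u}"
      by (intro closed_Collect_conj closed_Collect_le continuous_intros)
  qed
  have "AE x in distr M borel Z. x \<in> closure ?I"
    using AE_in_measure_support[of "distr M borel Z"] by (simp add: support)
  then have a1: "AE \<omega> in M. Z \<omega> \<in> closure ?I" by (rule AE_distrD[rotated]) measurable
  \<comment> \<open>the support contains the finite endpoints, to which a law with a density gives no mass\<close>
  have a2: "AE \<omega> in M. Z \<omega> \<noteq> c" for c
  proof -
    have "AE x in lborel. 0 < ennreal (\<rho> x) \<longrightarrow> x \<noteq> c" using AE_lborel_singleton[of c] by eventually_elim simp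
    then have "AE x in density lborel (\<lambda>x. ennreal (\<rho> x)). x \<noteq> c" by (subst AE_density) auto
    then have "AE x in distr M lborel Z. x \<noteq> c"
      unfolding distributed_distr_eq_density[OF density(1)] .
    then show ?thesis by (rule AE_distrD[rotated]) measurable
  qed
  show ZI: "AE \<omega> in M. Z \<omega> \<in> ?I"
    using a1 a2[of "real_of_ereal l"] a2[of "real_of_ereal u"]
  proof eventually_elim
    case (elim \<omega>)
    then have "l \<le> ereal (Z \<omega>)" "ereal (Z \<omega>) \<le> u" using cl by auto
    moreover have "l \<noteq> ereal (Z \<omega>)" "u \<noteq> ereal (Z \<omega>)" using elim(2,3) by auto
    ultimately show ?case by (auto simp: einterval_iff less_le)
  qed
  have rpos: "0 < \<rho> z" if "z \<in> ?I" for z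
  proof -
    have "\<rho> z \<noteq> 0" using bspec[OF pos that] by (auto simp: g_star_def that)
    then show ?thesis using density(2)[of z] by simp
  qed
  show R: "tail_mean Z z = \<rho> z * ?g z" for z
  proof (cases "z \<in> ?I")
    case True
    then have zu: "ereal z < u" by (simp add: einterval_iff)
    have "tail_mean Z z = (\<integral>\<omega>. (if Z \<omega> \<in> einterval (ereal z) u then Z \<omega> else 0) \<partial>M)"
      unfolding tail_mean_def
    proof (rule integral_cong_AE)
      show "AE \<omega> in M. (if z < Z \<omega> then Z \<omega> else 0) = (if Z \<omega> \<in> einterval (ereal z) u then Z \<omega> else 0)"
        using ZI by eventually_elim (auto simp: einterval_iff)
    qed measurable
    also have "\<dots> = (\<integral>x. \<rho> x * (if x \<in> einterval (ereal z) u then x else 0) \<partial>lborel)"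
      by (rule dens) measurable
    also have "\<dots> = (LBINT y=ereal z..u. y * \<rho> y)"
      using zu unfolding interval_lebesgue_integral_def set_lebesgue_integral_def
      by (auto intro!: Bochner_Integration.integral_cong simp: indicator_def)
    finally show ?thesis using rpos[OF True] True by (simp add: g_star_def)
  next
    case False
    \<comment> \<open>above \<open>u\<close> the event \<open>Z > z\<close> is null; below \<open>l\<close> its complement is, and \<open>Z\<close> has mean zero\<close>
    then consider "u \<le> ereal z" | "ereal z \<le> l" by (auto simp: einterval_iff not_less)
    then have "tail_mean Z z = 0"
    proof cases
      case 1
      have "AE \<omega> in M. (if z < Z \<omega> then Z \<omega> else 0) = 0"
        using ZI
      proof eventually_elim
        case (elim \<omega>)
        then have "ereal (Z \<omega>) < u" by (simp add: einterval_iff)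
        then have "ereal (Z \<omega>) < ereal z" using 1 by (rule less_le_trans)
        then show ?case by simp
      qed
      then show ?thesis unfolding tail_mean_def by (rule integral_eq_zero_AE)
    next
      case 2
      have "AE \<omega> in M. (if Z \<omega> \<le> z then - Z \<omega> else 0) = 0"
        using ZI
      proof eventually_elim
        case (elim \<omega>)
        then have "l < ereal (Z \<omega>)" by (simp add: einterval_iff)
        with 2 have "ereal z < ereal (Z \<omega>)" by (rule le_less_trans)
        then show ?case by simp
      qed
      then show ?thesis unfolding tail_mean_alt[OF Z mean] by (rule integral_eq_zero_AE)
    qed
    then show ?thesis using False by (simp add: g_star_def)
  qed
  show "0 < tail_mean Z z" if "z \<in> ?I" for z
    unfolding R using rpos[OF that] bspec[OF pos that] by simp
  have gz: "?g z = (if z \<in> ?I then tail_mean Z z / \<rho> z else 0)" for z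
  proof (cases "z \<in> ?I")
    case True
    then show ?thesis using R[of z] rpos[OF True] by simp
  qed (simp add: g_star_def)
  show gm: "?g \<in> borel_measurable borel"
    unfolding gz[abs_def] by measurable
  have "(tail_mean Z has_real_derivative - (x * \<rho> x)) (at x)" if x: "x \<in> ?I" for x
  proof (rule derivative_of_increments[OF open_einterval _ x])
    show "continuous_on ?I (\<lambda>x. x * \<rho> x)" by (intro continuous_on_mult continuous_on_id cont)
    fix a b assume ab: "{a..b} \<subseteq> ?I" "a \<le> b"
    have "tail_mean Z a - tail_mean Z b = (\<integral>\<omega>. (if Z \<omega> \<in> {a<..b} then Z \<omega> else 0) \<partial>M)"
      by (rule tail_mean_diff[OF Z ab(2)])
    also have "\<dots> = (\<integral>x. \<rho> x * (if x \<in> {a<..b} then x else 0) \<partial>lborel)" by (rule dens) measurable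
    also have "\<dots> = (\<integral>y. indicator {a<..b} y * (y * \<rho> y) \<partial>lborel)"
      by (intro Bochner_Integration.integral_cong) (auto simp: indicator_def)
    finally show "tail_mean Z a - tail_mean Z b = (\<integral>y. indicator {a<..b} y * (y * \<rho> y) \<partial>lborel)" .
  qed
  then have "continuous_on ?I (tail_mean Z)"
    by (intro continuous_at_imp_continuous_on ballI) (rule DERIV_isCont)
  then have "continuous_on ?I (\<lambda>z. tail_mean Z z / \<rho> z)"
    using rpos by (intro continuous_on_divide cont) (auto dest: rpos)
  then show "continuous_on ?I ?g"
    by (rule continuous_on_eq) (simp add: gz)
  fix B :: "real set" assume [measurable]: "B \<in> sets borel"
  have "(\<integral>\<omega>. indicator B (Z \<omega>) * ?g (Z \<omega>) \<partial>M) = (\<integral>x. \<rho> x * (indicator B x * ?g x) \<partial>lborel)"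
    by (rule dens) (use gm in measurable)
  also have "\<dots> = (\<integral>z. tail_mean Z z * indicator B z \<partial>lborel)"
    by (intro Bochner_Integration.integral_cong refl) (simp add: R mult_ac)
  finally show "(\<integral>\<omega>. indicator B (Z \<omega>) * ?g (Z \<omega>) \<partial>M) = (\<integral>z. tail_mean Z z * indicator B z \<partial>lborel)" .
qed

section \<open>Characterization of the law\<close>

theorem theorem13:
  fixes M :: "'a measure"
    and W :: "'h::{real_inner, banach, second_countable_topology} \<Rightarrow> 'a \<Rightarrow> real"
    and X Z :: "'a \<Rightarrow> real"
    and l u :: ereal
    and \<rho> gt G :: "real \<Rightarrow> real"
  assumes W: "isonormal_gaussian_process M W"
    and Z_dom: "Z \<in> D12 M W" and Z_mean: "integral\<^sup>L M Z = 0"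
    and X_dom: "X \<in> D12 M W" and X_mean: "integral\<^sup>L M X = 0"
    and lu: "l < 0" "0 < u"
    and support: "measure_support (distr M borel Z) = closure (einterval l u)"
    and density: "distributed M lborel Z (\<lambda>x. ennreal (\<rho> x))" "\<And>x. 0 \<le> \<rho> x"
    and \<rho>_cont: "continuous_on (einterval l u) \<rho>"
    and g_star_pos: "\<And>z. z \<in> einterval l u \<Longrightarrow> 0 < g_star l u \<rho> z"
    and bounded_or_density:
      "bounded (range (g_star l u \<rho>)) \<or> (\<exists>f. distributed M lborel X f)"
    and gt_pos: "\<And>x. x \<in> einterval l u \<Longrightarrow> 0 < gt x"
    and gt_C1: "gt C1_differentiable_on (einterval l u)"
    and ratio_u:
      "0 < Liminf (at_left u) (\<lambda>x. ereal (g_star l u \<rho> (real_of_ereal x) / gt (real_of_ereal x)))"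
      "Limsup (at_left u) (\<lambda>x. ereal (g_star l u \<rho> (real_of_ereal x) / gt (real_of_ereal x))) < \<infinity>"
    and ratio_l:
      "0 < Liminf (at_right l) (\<lambda>x. ereal (g_star l u \<rho> (real_of_ereal x) / gt (real_of_ereal x)))"
      "Limsup (at_right l) (\<lambda>x. ereal (g_star l u \<rho> (real_of_ereal x) / gt (real_of_ereal x))) < \<infinity>"
    and gt_deriv_l: "\<exists>d::ereal. ((\<lambda>x. ereal (deriv gt (real_of_ereal x))) \<longlongrightarrow> d) (at_right l)"
    and gt_deriv_u: "\<exists>d::ereal. ((\<lambda>x. ereal (deriv gt (real_of_ereal x))) \<longlongrightarrow> d) (at_left u)"
    and u_infinite:
      "u = \<infinity> \<Longrightarrow> 0 < Liminf (at_left u) (\<lambda>x. ereal (g_star l u \<rho> (real_of_ereal x)))"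
    and l_infinite:
      "l = -\<infinity> \<Longrightarrow> 0 < Liminf (at_right l) (\<lambda>x. ereal (g_star l u \<rho> (real_of_ereal x)))"
    and G: "\<And>x. (G has_real_derivative g_star l u \<rho> x) (at x)"
    and finite_1: "integrable M (\<lambda>\<omega>. (g_star l u \<rho> (X \<omega>))\<^sup>2)"
                  "integrable M (\<lambda>\<omega>. (g_star l u \<rho> (Z \<omega>))\<^sup>2)"
    and finite_2: "integrable M (\<lambda>\<omega>. X \<omega> * G (X \<omega>))"
                  "integrable M (\<lambda>\<omega>. Z \<omega> * G (Z \<omega>))"
    and finite_3: "integrable M (\<lambda>\<omega>. (g_rv M W X \<omega>)\<^sup>2)"
                  "integrable M (\<lambda>\<omega>. (g_rv M W Z \<omega>)\<^sup>2)"
  shows "distr M borel X = distr M borel Z \<longleftrightarrow>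
      (\<integral>\<omega>. (g_star l u \<rho> (X \<omega>))\<^sup>2 \<partial>M) = (\<integral>\<omega>. (g_star l u \<rho> (Z \<omega>))\<^sup>2 \<partial>M) \<and>
      (\<integral>\<omega>. X \<omega> * G (X \<omega>) \<partial>M) = (\<integral>\<omega>. Z \<omega> * G (Z \<omega>) \<partial>M) \<and>
      (\<integral>\<omega>. (g_rv M W X \<omega>)\<^sup>2 \<partial>M) = (\<integral>\<omega>. (g_rv M W Z \<omega>)\<^sup>2 \<partial>M)"
proof -
  interpret isonormal_gaussian_process M W by (rule W)
  let ?g = "g_star l u \<rho>"
  let ?gX = "g_rv M W X" and ?gZ = "g_rv M W Z"
  note sX = D12_square_integrable[OF X_dom] and sZ = D12_square_integrable[OF Z_dom]
  note [measurable] = square_integrableD(1)[OF sX] square_integrableD(1)[OF sZ]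
  have Xi: "integrable M X" and Zi: "integrable M Z"
    by (rule square_integrable_integrable[OF sX], rule square_integrable_integrable[OF sZ])
  have "\<forall>z\<in>einterval l u. 0 < ?g z" using g_star_pos by blast
  note gs = g_star_facts[OF Zi Z_mean support density \<rho>_cont this]
  note [measurable] = gs(4)
  have g0: "0 \<le> ?g z" for z
    using g_star_pos[of z] by (cases "z \<in> einterval l u") (auto simp: g_star_def intro: less_imp_le)
  have sgX: "square_integrable M (\<lambda>\<omega>. ?g (X \<omega>))" and sgZ: "square_integrable M (\<lambda>\<omega>. ?g (Z \<omega>))"
    using finite_1 by (simp_all add: square_integrable_def)
  have igX: "integrable M (\<lambda>\<omega>. ?g (X \<omega>))" and igZ: "integrable M (\<lambda>\<omega>. ?g (Z \<omega>))"
    by (rule square_integrable_integrable[OF sgX], rule square_integrable_integrable[OF sgZ])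
  have [measurable]: "?gX \<in> borel_measurable M" "?gZ \<in> borel_measurable M"
    using g_rv_integrable[OF X_dom X_mean] g_rv_integrable[OF Z_dom Z_mean] by auto
  have aeZ: "AE \<omega> in M. ?gZ \<omega> = ?g (Z \<omega>)"
    by (rule g_rv_eqI[OF Z_dom Z_mean gs(4) igZ gs(6)])
  have eZ: "(\<integral>\<omega>. (?gZ \<omega>)\<^sup>2 \<partial>M) = (\<integral>\<omega>. (?g (Z \<omega>))\<^sup>2 \<partial>M)"
    by (rule integral_cong_AE) (measurable, use aeZ in eventually_elim, simp)
  show ?thesis
  proof
    assume law: "distr M borel X = distr M borel Z"
    have same: "(\<integral>\<omega>. \<psi> (X \<omega>) \<partial>M) = (\<integral>\<omega>. \<psi> (Z \<omega>) \<partial>M)" if [measurable]: "\<psi> \<in> borel_measurable borel" for \<psi> :: "real \<Rightarrow> real"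
    proof -
      have "(\<integral>\<omega>. \<psi> (X \<omega>) \<partial>M) = (\<integral>x. \<psi> x \<partial>distr M borel X)" by (subst integral_distr) auto
      also have "\<dots> = (\<integral>\<omega>. \<psi> (Z \<omega>) \<partial>M)" unfolding law by (subst integral_distr) auto
      finally show ?thesis .
    qed
    have [measurable]: "G \<in> borel_measurable borel"
      by (rule borel_measurable_continuous_onI[OF DERIV_continuous_on[OF DERIV_subset[OF G subset_UNIV]]])
    have R: "tail_mean X = tail_mean Z"
    proof
      fix z show "tail_mean X z = tail_mean Z z"
        unfolding tail_mean_def by (rule same[of "\<lambda>x. if z < x then x else 0"]) measurable
    qed
    have aeX: "AE \<omega> in M. ?gX \<omega> = ?g (X \<omega>)"
    proof (rule g_rv_eqI[OF X_dom X_mean gs(4) igX])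
      fix B :: "real set" assume B [measurable]: "B \<in> sets borel"
      have "(\<integral>\<omega>. indicator B (X \<omega>) * ?g (X \<omega>) \<partial>M) = (\<integral>\<omega>. indicator B (Z \<omega>) * ?g (Z \<omega>) \<partial>M)"
        by (rule same[of "\<lambda>x. indicator B x * ?g x"]) measurable
      then show "(\<integral>\<omega>. indicator B (X \<omega>) * ?g (X \<omega>) \<partial>M) = (\<integral>z. tail_mean X z * indicator B z \<partial>lborel)"
        unfolding R gs(6)[OF B] .
    qed
    have 1: "(\<integral>\<omega>. (?g (X \<omega>))\<^sup>2 \<partial>M) = (\<integral>\<omega>. (?g (Z \<omega>))\<^sup>2 \<partial>M)"
      by (rule same[of "\<lambda>x. (?g x)\<^sup>2"]) measurable
    have 2: "(\<integral>\<omega>. X \<omega> * G (X \<omega>) \<partial>M) = (\<integral>\<omega>. Z \<omega> * G (Z \<omega>) \<partial>M)"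
      by (rule same[of "\<lambda>x. x * G x"]) measurable
    have "(\<integral>\<omega>. (?gX \<omega>)\<^sup>2 \<partial>M) = (\<integral>\<omega>. (?g (X \<omega>))\<^sup>2 \<partial>M)"
      by (rule integral_cong_AE) (measurable, use aeX in eventually_elim, simp)
    then show "(\<integral>\<omega>. (?g (X \<omega>))\<^sup>2 \<partial>M) = (\<integral>\<omega>. (?g (Z \<omega>))\<^sup>2 \<partial>M) \<and>
      (\<integral>\<omega>. X \<omega> * G (X \<omega>) \<partial>M) = (\<integral>\<omega>. Z \<omega> * G (Z \<omega>) \<partial>M) \<and>
      (\<integral>\<omega>. (?gX \<omega>)\<^sup>2 \<partial>M) = (\<integral>\<omega>. (?gZ \<omega>)\<^sup>2 \<partial>M)"
      using 1 2 eZ by simp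
  next
    assume cond: "(\<integral>\<omega>. (?g (X \<omega>))\<^sup>2 \<partial>M) = (\<integral>\<omega>. (?g (Z \<omega>))\<^sup>2 \<partial>M) \<and>
      (\<integral>\<omega>. X \<omega> * G (X \<omega>) \<partial>M) = (\<integral>\<omega>. Z \<omega> * G (Z \<omega>) \<partial>M) \<and>
      (\<integral>\<omega>. (?gX \<omega>)\<^sup>2 \<partial>M) = (\<integral>\<omega>. (?gZ \<omega>)\<^sup>2 \<partial>M)"
    \<comment> \<open>integration by parts with the test function \<open>G\<close>\<close>
    have cross: "(\<integral>\<omega>. g_rv M W F \<omega> * ?g (F \<omega>) \<partial>M) = (\<integral>\<omega>. F \<omega> * G (F \<omega>) \<partial>M)"
      if F: "F \<in> D12 M W" "(\<integral>\<omega>. F \<omega> \<partial>M) = 0" and i: "integrable M (\<lambda>\<omega>. F \<omega> * G (F \<omega>))" for F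
    proof -
      note sF = D12_square_integrable[OF F(1)]
      have "(\<integral>\<omega>. g_rv M W F \<omega> * ?g (F \<omega>) \<partial>M) = (\<integral>z. tail_mean F z * ?g z \<partial>lborel)"
        by (rule kernel_integral_eq[OF square_integrableD(1)[OF sF] g_rv_integrable[OF F] g_rv_nonneg[OF F]
              tail_mean_integrable[OF sF F(2)] tail_mean_nonneg[OF square_integrable_integrable[OF sF] F(2)]
              g_rv_tail_mean[OF F] gs(4)])
      also have "\<dots> = (\<integral>\<omega>. F \<omega> * G (F \<omega>) \<partial>M)"
        by (rule tail_mean_integral(2)[OF square_integrable_integrable[OF sF] F(2) G g0 gs(4) i])
      finally show ?thesis .
    qed
    \<comment> \<open>the square of \<open>g\<^sub>X - g\<^sub>*(X)\<close> expands into three expectations, each of which is \<open>s\<close>\<close>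
    define s where "s = (\<integral>\<omega>. (?g (Z \<omega>))\<^sup>2 \<partial>M)"
    have "(\<integral>\<omega>. ?gZ \<omega> * ?g (Z \<omega>) \<partial>M) = s"
      unfolding s_def by (rule integral_cong_AE) (measurable, use aeZ in eventually_elim, simp add: power2_eq_square)
    then have c: "(\<integral>\<omega>. ?gX \<omega> * ?g (X \<omega>) \<partial>M) = s"
      using cross[OF X_dom X_mean finite_2(1)] cross[OF Z_dom Z_mean finite_2(2)] cond by simp
    have sg: "square_integrable M ?gX"
      using finite_3(1) by (simp add: square_integrable_def)
    have "(\<integral>\<omega>. (norm (?gX \<omega> - ?g (X \<omega>)))\<^sup>2 \<partial>M) = (\<integral>\<omega>. (?gX \<omega>)\<^sup>2 - 2 * (?gX \<omega> * ?g (X \<omega>)) + (?g (X \<omega>))\<^sup>2 \<partial>M)"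
      by (intro Bochner_Integration.integral_cong) (auto simp: power2_eq_square algebra_simps)
    also have "\<dots> = (\<integral>\<omega>. (?gX \<omega>)\<^sup>2 \<partial>M) - 2 * (\<integral>\<omega>. ?gX \<omega> * ?g (X \<omega>) \<partial>M) + (\<integral>\<omega>. (?g (X \<omega>))\<^sup>2 \<partial>M)"
      using finite_3(1) finite_1(1) integrable_mult_L2[OF sg sgX] by simp
    also have "\<dots> = 0" using cond c eZ by (simp add: s_def)
    finally have "AE \<omega> in M. ?gX \<omega> - ?g (X \<omega>) = 0"
      by (rule square_norm_zero_AE[OF square_integrable_diff[OF sg sgX]])
    then have aeX: "AE \<omega> in M. ?gX \<omega> = ?g (X \<omega>)" by eventually_elim simp
    have eqX: "(\<integral>\<omega>. indicator B (X \<omega>) * ?g (X \<omega>) \<partial>M) = (\<integral>z. tail_mean X z * indicator B z \<partial>lborel)"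
      if B [measurable]: "B \<in> sets borel" for B
    proof -
      have "(\<integral>\<omega>. indicator B (X \<omega>) * ?g (X \<omega>) \<partial>M) = (\<integral>\<omega>. indicator B (X \<omega>) * ?gX \<omega> \<partial>M)"
        by (rule integral_cong_AE) (measurable, use aeX in eventually_elim, simp)
      then show ?thesis unfolding g_rv_tail_mean[OF X_dom X_mean B] .
    qed
    show "distr M borel X = distr M borel Z"
      by (rule law_unique_of_kernel[OF sX X_mean sZ Z_mean lu gs(4) g_star_pos g0 gs(5) igX
            tail_mean_integrable[OF sX X_mean] eqX igZ tail_mean_integrable[OF sZ Z_mean] gs(6) gs(3) gs(1)])
  qed
qed

end
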